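(* Let $\{P_\vartheta:\vartheta\in\Theta\}$, $\Theta\subseteq\mathbb{R}^d$ with nonempty interior, be a family of probability measures on $(\mathcal{X},\mathcal{A})$, each absolutely continuous with respect to a common $\sigma$-finite measure $\mu$, let $\Pi$ be a prior on $\Theta$, and let $\vartheta_0\in\Theta^\circ$. Assume: (a) the family is differentiable in quadratic mean at $\vartheta_0$ with nonsingular Fisher information matrix $I_{\vartheta_0}$; (b) for every $\varepsilon>0$ there is a sequence of tests $\phi_n:\mathcal{X}^n\to[0,1]$ with $\mathbb{E}_{P^n_{\vartheta_0}}[\phi_n(\boldsymbol X)]\to0$ and $\sup_{\vartheta\in\Theta:\|\vartheta-\vartheta_0\|\ge\varepsilon}\mathbb{E}_{P^n_\vartheta}[1-\phi_n(\boldsymbol X)]\to0$ as $n\to\infty$; (c) $\Pi$ has a Lebesgue density $\pi$ that is continuous in a neighborhood of $\vartheta_0$ with $\pi(\vartheta_0)>0$. Let $K\subset\mathbb{R}^d$ be compact, let $p>0$, and let $\ell:\Theta\times\Theta\to[0,\infty)$ and $\ell_0:\mathbb{R}^d\times\mathbb{R}^d\to[0,\infty)$ be loss functions satisfying: (i) there are $\varepsilon>0$ and $c_1>0$ such that $\ell(t,\vartheta)\le c_1\|t-\vartheta\|^p$ for all $t,\vartheta\in B_\varepsilon(\vartheta_0)$; (ii) for some $\delta>0$, $\int_\Theta\sup_{t\in B_\delta(\vartheta_0)}\ell(t,\vartheta)\,\mathrm{d}\Pi(\vartheta)<\infty$; (iii) for all $h\in\mathbb{R}^d$, $\sup_{t\in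 K}\bigl|r^{-p}\ell(\vartheta_0+rt,\vartheta_0+rh)-\ell_0(t,h)\bigr|\to0$ as $r\to0$, $r>0$; (iv) there exist $c_2,c_3>0$, $0<c_4<2$ and $\delta>0$ such that $\ell(t,\vartheta)\le c_2\exp(c_3\|t\|^{c_4}+c_3\|\vartheta\|^{c_4})$ for all $t\in B_\delta(\vartheta_0)$, $\vartheta\in\Theta$, and $\ell_0(t,h)\le c_2\exp(c_3\|t\|^{c_4}+c_3\|h\|^{c_4})$ for all $t,h\in\mathbb{R}^d$. Define $$Z_n(t)=\int_{H_n}n^{p/2}\,\ell\Bigl(\tfrac{t}{n^{1/2}}+\vartheta_0,\tfrac{h}{n^{1/2}}+\vartheta_0\Bigr)\,\mathrm{d}P_{h_n\mid\boldsymbol X}(h),\qquad Z(t)=\int_{\mathbb{R}^d}\ell_0(t,h)\,\mathrm{d}\mathcal{N}_d(Y,I_{\vartheta_0}^{-1})(h),$$ where $Y\sim\mathcal{N}_d(0,I_{\vartheta_0}^{-1})$. Then $Z_n\stackrel{D}{\to}_{P^n_{\vartheta_0}}Z$ in $\ell^\infty(K)$ as $n\to\infty$.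
   Context: Bayes model: $\theta\sim\Pi$, a probability measure on $(\Theta,\mathcal{B}(\Theta))$, and conditionally on $\theta=\vartheta$, $X_1,\dots,X_n$ are i.i.d. with law $P_\vartheta$ (so implicitly $\vartheta\mapsto P_\vartheta(A)$ is measurable for $A\in\mathcal{A}$). Write $\boldsymbol X=(X_1,\dots,X_n)$, $P^{\boldsymbol X}$ for the marginal law of $\boldsymbol X$ in this model, $P_{\theta\mid\boldsymbol X}$ for the posterior, $P^n_\vartheta=\bigotimes_{i=1}^nP_\vartheta$. Standing assumption: $P^n_{\vartheta_0}\ll P^{\boldsymbol X}$ for all $n$. Local parameter: $h_n=n^{1/2}(\theta-\vartheta_0)$, $H_n=n^{1/2}(\Theta-\vartheta_0)$; $P_{h_n\mid\boldsymbol X}$ is the posterior law of $h_n$. $B_\delta(\vartheta_0)=\{\vartheta\in\Theta:\|\vartheta-\vartheta_0\|\le\delta\}$ (Euclidean norm). $\mathcal{N}_d(m,\Sigma)$ is the $d$-variate Gaussian law. Differentiability in quadratic mean at $\vartheta_0$: with $p_\vartheta=\mathrm{d}P_\vartheta/\mathrm{d}\mu$, there is $\ell'_{\vartheta_0}:\mathcal{X}\to\mathbb{R}^d$ with $\int_{\mathcal X}[p^{1/2}_{\vartheta_0+h}-p^{1/2}_{\vartheta_0}-\frac12\langle h,\ell'_{\vartheta_0}\rangle p^{1/2}_{\vartheta_0}]^2\,\mathrm{d}\mu=o(\|h\|^2)$ as $h\to0$. Fisher information: $I_{\vartheta_0}=\int\ell'_{\vartheta_0}(\ell'_{\vartheta_0})^\top\,\mathrm{d}P_{\vartheta_0}$.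 A loss function on $A\times A$, $A\subseteq\mathbb{R}^d$, is a jointly measurable function $A\times A\to[0,\infty)$ vanishing exactly on the diagonal. Standing assumption on $\ell$: $\int_\Theta\ell(t,\vartheta)\,\mathrm{d}\Pi(\vartheta)<\infty$ for every $t\in\Theta$. $\ell^\infty(K)$ is the space of bounded functions $K\to\mathbb{R}$ with the sup norm. $g_n(\boldsymbol X)\stackrel{D}{\to}_{P_n}Z$ means $\int f(g_n)\,\mathrm{d}P_n\to\mathbb{E}f(Z)$ for all bounded continuous $f$ (in $\ell^\infty(K)$: with the usual outer-integral convention if measurability fails). Since $\vartheta_0\in\Theta^\circ$, $Z_n$ is defined on $K$, and the expression in (iii) makes sense, for all large $n$ and all small $r$. *)

theory Defs
  imports "HOL-Probability.Probability" "HOL-Library.Landau_Symbols"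
begin

definition sample_law :: "nat \<Rightarrow> 'x measure \<Rightarrow> (nat \<Rightarrow> 'x) measure" where
  "sample_law n M = Pi\<^sub>M {..<n} (\<lambda>_. M)"

definition marginal_law ::
  "'t measure \<Rightarrow> ('t \<Rightarrow> 'x measure) \<Rightarrow> nat \<Rightarrow> (nat \<Rightarrow> 'x) measure" where
  "marginal_law prior P n = prior \<bind> (\<lambda>\<theta>. sample_law n (P \<theta>))"

text \<open>
  The posterior is a regular conditional distribution of the parameter given the sample. It is only
  determined up to null sets of the marginal law, so it is a predicate on kernels.
\<close>

definition is_posterior ::
  "'t measure \<Rightarrow> ('t \<Rightarrow> 'x measure) \<Rightarrow> nat \<Rightarrow> ((nat \<Rightarrow> 'x) \<Rightarrow> 't measure) \<Rightarrow> bool" where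
  "is_posterior prior P n Q \<longleftrightarrow>
     Q \<in> marginal_law prior P n \<rightarrow>\<^sub>M prob_algebra prior \<and>
     (\<forall>A\<in>sets (marginal_law prior P n). \<forall>C\<in>sets prior.
        (\<integral>\<^sup>+x\<in>A. emeasure (Q x) C \<partial>marginal_law prior P n)
          = (\<integral>\<^sup>+\<theta>\<in>C. emeasure (sample_law n (P \<theta>)) A \<partial>prior))"

definition local_set :: "nat \<Rightarrow> (real^'d) set \<Rightarrow> real^'d \<Rightarrow> (real^'d) set" where
  "local_set n \<Theta> \<theta>\<^sub>0 = (\<lambda>\<theta>. sqrt n *\<^sub>R (\<theta> - \<theta>\<^sub>0)) ` \<Theta>"

definition local_law ::
  "nat \<Rightarrow> (real^'d) set \<Rightarrow> real^'d \<Rightarrow> (real^'d) measure \<Rightarrow> (real^'d) measure" where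
  "local_law n \<Theta> \<theta>\<^sub>0 N =
     distr N (restrict_space borel (local_set n \<Theta> \<theta>\<^sub>0)) (\<lambda>\<theta>. sqrt n *\<^sub>R (\<theta> - \<theta>\<^sub>0))"

text \<open>
  For \<open>\<theta>\<^sub>0\<close> in the interior of the parameter set, the filter \<open>at 0\<close> only sees admissible
  increments \<open>h\<close>. The eventual integrability excludes the default value \<open>0\<close> of the integral
  of a non-integrable function.
\<close>

definition differentiable_in_quadratic_mean ::
  "'x measure \<Rightarrow> (real^'d \<Rightarrow> 'x measure) \<Rightarrow> real^'d \<Rightarrow> ('x \<Rightarrow> real^'d) \<Rightarrow> bool" where
  "differentiable_in_quadratic_mean \<mu> P \<theta>\<^sub>0 s \<longleftrightarrow>
     (let p = (\<lambda>\<theta> x. enn2real (RN_deriv \<mu> (P \<theta>) x));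
          R = (\<lambda>h x. (sqrt (p (\<theta>\<^sub>0 + h) x) - sqrt (p \<theta>\<^sub>0 x)
                       - 1/2 * (h \<bullet> s x) * sqrt (p \<theta>\<^sub>0 x))\<^sup>2)
      in s \<in> borel_measurable \<mu> \<and>
         (\<forall>\<^sub>F h in at 0. integrable \<mu> (R h)) \<and>
         (\<lambda>h. \<integral>x. R h x \<partial>\<mu>) \<in> o[at 0](\<lambda>h. (norm h)\<^sup>2))"

definition fisher_information :: "'x measure \<Rightarrow> ('x \<Rightarrow> real^'d) \<Rightarrow> real^'d^'d" where
  "fisher_information M s = (\<chi> i j. \<integral>x. s x $ i * s x $ j \<partial>M)"

text \<open>Only meant for symmetric positive definite \<open>\<Sigma>\<close>.\<close>

definition mv_normal :: "real^'d \<Rightarrow> real^'d^'d \<Rightarrow> (real^'d) measure" where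
  "mv_normal m \<Sigma> = density lborel (\<lambda>x. ennreal
     (exp (- ((x - m) \<bullet> (matrix_inv \<Sigma> *v (x - m))) / 2) / sqrt ((2 * pi) ^ CARD('d) * det \<Sigma>)))"

definition loss_function :: "(real^'d) set \<Rightarrow> (real^'d \<Rightarrow> real^'d \<Rightarrow> real) \<Rightarrow> bool" where
  "loss_function A L \<longleftrightarrow>
     (\<lambda>(t, \<theta>). L t \<theta>) \<in> borel_measurable (restrict_space borel A \<Otimes>\<^sub>M restrict_space borel A) \<and>
     (\<forall>t\<in>A. \<forall>\<theta>\<in>A. 0 \<le> L t \<theta> \<and> (L t \<theta> = 0 \<longleftrightarrow> t = \<theta>))"

text \<open>
  For a function that is not measurable, \<open>nn_integral\<close> is a lower integral. A supremum over
  uncountably many parameters need not be Borel measurable, so its integral is taken to be the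
  upper one; the two agree if it is measurable for the completed measure.
\<close>

definition outer_nn_integral :: "'a measure \<Rightarrow> ('a \<Rightarrow> ennreal) \<Rightarrow> ennreal" where
  "outer_nn_integral M f =
     (INF g\<in>{g \<in> borel_measurable M. \<forall>x\<in>space M. f x \<le> g x}. \<integral>\<^sup>+x. g x \<partial>M)"

text \<open>
  Intended for functions that are bounded almost everywhere. Majorants are real-valued here, so
  \<open>f x \<le> U x\<close> may fail on a null set, where an extended real majorant could be infinite.
\<close>

definition outer_expectation :: "'a measure \<Rightarrow> ('a \<Rightarrow> real) \<Rightarrow> real" where
  "outer_expectation M f =
     Inf {\<integral>x. U x \<partial>M | U. integrable M U \<and> (AE x in M. f x \<le> U x)}"

text \<open>Functions on \<open>K\<close> are represented by their extensional versions.\<close>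

definition linfty :: "'a set \<Rightarrow> ('a \<Rightarrow> real) set" where
  "linfty K = {g \<in> extensional K. bounded (g ` K)}"

text \<open>
  The sup metric. Taking the supremum in \<open>ennreal\<close> makes it \<open>0\<close> for empty \<open>K\<close>, and the distance
  nonnegative also outside of \<open>linfty K\<close>, as the locale \<open>Metric_space\<close> requires.
\<close>

definition linfty_dist :: "'a set \<Rightarrow> ('a \<Rightarrow> real) \<Rightarrow> ('a \<Rightarrow> real) \<Rightarrow> real" where
  "linfty_dist K g h = enn2real (SUP t\<in>K. ennreal \<bar>g t - h t\<bar>)"

lemma linfty_dist_finite:
  assumes "g \<in> linfty K" "h \<in> linfty K"
  shows "(SUP t\<in>K. ennreal \<bar>g t - h t\<bar>) = ennreal (linfty_dist K g h)"
proof -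
  obtain a where a: "\<And>t. t \<in> K \<Longrightarrow> \<bar>g t\<bar> \<le> a"
    using assms(1) by (auto simp: linfty_def bounded_iff)
  obtain b where b: "\<And>t. t \<in> K \<Longrightarrow> \<bar>h t\<bar> \<le> b"
    using assms(2) by (auto simp: linfty_def bounded_iff)
  have "(SUP t\<in>K. ennreal \<bar>g t - h t\<bar>) \<le> ennreal (a + b)"
  proof (rule SUP_least, rule ennreal_leI)
    fix t assume "t \<in> K"
    then show "\<bar>g t - h t\<bar> \<le> a + b"
      using a[of t] b[of t] by linarith
  qed
  then have "(SUP t\<in>K. ennreal \<bar>g t - h t\<bar>) < top"
    using ennreal_less_top le_less_trans by blast
  then show ?thesis
    by (simp add: linfty_dist_def)
qed

lemma linfty_dist_upper:
  assumes "g \<in> linfty K" "h \<in> linfty K" "t \<in> K"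
  shows "\<bar>g t - h t\<bar> \<le> linfty_dist K g h"
proof -
  have "ennreal \<bar>g t - h t\<bar> \<le> ennreal (linfty_dist K g h)"
    unfolding linfty_dist_finite[OF assms(1,2), symmetric] by (rule SUP_upper[OF assms(3)])
  then show ?thesis
    by (simp add: linfty_dist_def)
qed

lemma linfty_dist_least:
  assumes "\<And>t. t \<in> K \<Longrightarrow> \<bar>g t - h t\<bar> \<le> c" "0 \<le> c"
  shows "linfty_dist K g h \<le> c"
  unfolding linfty_dist_def using assms
  by (intro enn2real_leI SUP_least ennreal_leI) auto

lemma Metric_space_linfty: "Metric_space (linfty K) (linfty_dist K)"
proof
  show "0 \<le> linfty_dist K g h" for g h
    by (simp add: linfty_dist_def)
  show "linfty_dist K g h = linfty_dist K h g" for g h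
    by (simp add: linfty_dist_def abs_minus_commute)
  show "linfty_dist K g h = 0 \<longleftrightarrow> g = h" if "g \<in> linfty K" "h \<in> linfty K" for g h
  proof
    assume 0: "linfty_dist K g h = 0"
    show "g = h"
    proof (rule extensionalityI)
      show "g \<in> extensional K" "h \<in> extensional K"
        using that by (auto simp: linfty_def)
      show "g t = h t" if "t \<in> K" for t
        using linfty_dist_upper[OF \<open>g \<in> linfty K\<close> \<open>h \<in> linfty K\<close> that] 0 by simp
    qed
  next
    assume "g = h"
    moreover have "linfty_dist K h h \<le> 0"
      by (rule linfty_dist_least) auto
    ultimately show "linfty_dist K g h = 0"
      by (simp add: linfty_dist_def order_antisym)
  qed
  show "linfty_dist K f h \<le> linfty_dist K f g + linfty_dist K g h"
    if "f \<in> linfty K" "g \<in> linfty K" "h \<in> linfty K" for f g h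
  proof (rule linfty_dist_least)
    show "\<bar>f t - h t\<bar> \<le> linfty_dist K f g + linfty_dist K g h" if "t \<in> K" for t
      using linfty_dist_upper[OF \<open>f \<in> linfty K\<close> \<open>g \<in> linfty K\<close> that]
        linfty_dist_upper[OF \<open>g \<in> linfty K\<close> \<open>h \<in> linfty K\<close> that] by linarith
    show "0 \<le> linfty_dist K f g + linfty_dist K g h"
      by (simp add: linfty_dist_def)
  qed
qed

definition linfty_topology :: "'a set \<Rightarrow> ('a \<Rightarrow> real) topology" where
  "linfty_topology K = Metric_space.mtopology (linfty K) (linfty_dist K)"

text \<open>
  \<open>G n\<close> is a map on the probability space \<open>M n\<close>, not necessarily measurable, which for large \<open>n\<close>
  almost surely takes values in \<open>linfty K\<close>; the limit \<open>Z\<close> is a random element of \<open>linfty K\<close>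
  defined on \<open>\<Omega>\<close>.
\<close>

definition converges_in_distribution_linfty ::
  "'a set \<Rightarrow> (nat \<Rightarrow> 'x measure) \<Rightarrow> (nat \<Rightarrow> 'x \<Rightarrow> 'a \<Rightarrow> real) \<Rightarrow>
     'w measure \<Rightarrow> ('w \<Rightarrow> 'a \<Rightarrow> real) \<Rightarrow> bool" where
  "converges_in_distribution_linfty K M G \<Omega> Z \<longleftrightarrow>
     (\<forall>\<^sub>F n in sequentially. AE x in M n. restrict (G n x) K \<in> linfty K) \<and>
     (\<forall>\<omega>\<in>space \<Omega>. restrict (Z \<omega>) K \<in> linfty K) \<and>
     (\<forall>f. continuous_map (linfty_topology K) euclideanreal f \<and> bounded (f ` linfty K) \<longrightarrow>
        (\<lambda>\<omega>. f (restrict (Z \<omega>) K)) \<in> borel_measurable \<Omega> \<and>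
        (\<lambda>n. outer_expectation (M n) (\<lambda>x. f (restrict (G n x) K)))
          \<longlonglongrightarrow> (\<integral>\<omega>. f (restrict (Z \<omega>) K) \<partial>\<Omega>))"

end

theory Submission
  imports Defs "HOL-Real_Asymp.Real_Asymp" "HOL-Probability.Hoeffding" "HOL-Complex_Analysis.Conformal_Mappings"
begin

text \<open>
  The log likelihood ratio at distance \<open>h / sqrt n\<close> is approximated in mean by that of a Gaussian shift, with the
  score truncated at \<open>n powr (1/8)\<close> so that exponential moments exist (\<open>lan_L1\<close>). Hence the posterior of the
  local parameter, up to normalization, is close in total variation on balls to the Gaussian density with
  mean \<open>B Del\<close> and covariance \<open>B\<close>, the inverse Fisher information. Outside of a large ball it is
  controlled by tests: Hoeffding bounds for a truncated score inside a fixed neighbourhood of the true parameter, and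
  the consistent tests of the hypothesis, boosted to exponential power on blocks of observations, far away.
  Therefore the posterior risk is, uniformly on \<open>K\<close> and up to an event of small probability, equal to the
  Gaussian risk \<open>Zt (B Del)\<close>. Since \<open>B Del\<close> converges in law to \<open>Y\<close> and
  \<open>y \<mapsto> Zt y\<close> is continuous into the space of bounded functions, the claim follows from the continuous mapping
  theorem, without any measurability of the posterior risk process.
\<close>

section \<open>Product laws\<close>

text \<open>The posterior risk is a quotient, and its numerator and normalizer are both integrals
  over \<open>h\<close> of weights times \<open>u n h x / p0 n x\<close>. Integrating a ratio
  \<open>g / p0\<close> against \<open>P0 n\<close> gives at most the integral of \<open>g\<close>
  against the dominating measure, so bounds under the laws at \<open>loc n h\<close> become bounds
  in \<open>P0 n\<close> probability by Markov's inequality, with no contiguity argument. This is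
  why local asymptotic normality is wanted as L1 convergence of densities for each fixed
  \<open>h\<close>: it can be integrated over \<open>h\<close>, and a Hellinger computation for
  product densities yields it directly. The truncation exponent 1/8 lies below 1/6, so that the
  cubic Taylor errors of \<open>n\<close> factors, of total size
  \<open>n * (n powr (1/8) / sqrt n) ^ 3\<close>, vanish while the truncation level still tends to
  infinity. Measurability shapes the rest: densities of the model need not be jointly measurable in
  parameter and observation, and suprema over \<open>K\<close> need not be measurable. Hence the
  joint density \<open>q\<close>, identities integrated over the parameter, and error terms free of
  \<open>t\<close> that bound the risk for all \<open>t\<close> in \<open>K\<close> outside one
  measurable bad set.\<close>

lemma sets_sample_law: "sets M = sets N \<Longrightarrow> sets (sample_law n M) = sets (sample_law n N)"
  unfolding sample_law_def by (intro sets_PiM_cong) auto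

lemma space_sample_law: "sets M = sets N \<Longrightarrow> space (sample_law n M) = space (sample_law n N)"
  by (intro sets_eq_imp_space_eq sets_sample_law)

lemma prob_space_sample_law: "prob_space M \<Longrightarrow> prob_space (sample_law n M)"
  unfolding sample_law_def by (intro prob_space_PiM)

lemma product_sigma_finite_const: "sigma_finite_measure M \<Longrightarrow> product_sigma_finite (\<lambda>_. M)"
  by (simp add: product_sigma_finite_def)

lemma sigma_finite_sample_law:
  assumes "sigma_finite_measure M" shows "sigma_finite_measure (sample_law n M)"
proof -
  interpret product_sigma_finite "\<lambda>_::nat. M" by (rule product_sigma_finite_const[OF assms])
  show ?thesis unfolding sample_law_def by (rule sigma_finite) simp
qed

lemma measurable_sample_law_component:
  "i < n \<Longrightarrow> (\<lambda>x. x i) \<in> sample_law n M \<rightarrow>\<^sub>M M"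
  unfolding sample_law_def by measurable

text \<open>Boxes form an intersection-stable generator of the product sigma-algebra, and on a box
  the probability is a finite product of functions measurable in the parameter.\<close>

lemma measurable_sample_law:
  assumes P: "P \<in> M \<rightarrow>\<^sub>M prob_algebra \<mu>"
  shows "(\<lambda>\<theta>. sample_law n (P \<theta>)) \<in> M \<rightarrow>\<^sub>M prob_algebra (sample_law n \<mu>)"
proof (rule measurable_prob_algebra_generated)
  show "sets (sample_law n \<mu>) = sigma_sets (\<Pi>\<^sub>E i\<in>{..<n}. space \<mu>) (prod_algebra {..<n} (\<lambda>_. \<mu>))"
    unfolding sample_law_def by (rule sets_PiM)
  show "Int_stable (prod_algebra {..<n} (\<lambda>_. \<mu>))" by (rule Int_stable_prod_algebra)
  show "prod_algebra {..<n} (\<lambda>_. \<mu>) \<subseteq> Pow (\<Pi>\<^sub>E i\<in>{..<n}. space \<mu>)"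
    by (rule prod_algebra_sets_into_space)
  have PS: "prob_space (P \<theta>)" "sets (P \<theta>) = sets \<mu>" if "\<theta> \<in> space M" for \<theta>
    using measurable_space[OF P that] by (auto simp: space_prob_algebra)
  then show "prob_space (sample_law n (P \<theta>))" if "\<theta> \<in> space M" for \<theta>
    using that by (intro prob_space_sample_law)
  show "sets (sample_law n (P \<theta>)) = sets (sample_law n \<mu>)" if "\<theta> \<in> space M" for \<theta>
    using PS that by (intro sets_sample_law)
  fix A assume "A \<in> prod_algebra {..<n} (\<lambda>_. \<mu>)"
  then obtain X where X: "A = Pi\<^sub>E {..<n} X" "\<And>i. i < n \<Longrightarrow> X i \<in> sets \<mu>"
    by (auto simp: prod_algebra_eq_finite Pi_iff)
  have *: "emeasure (sample_law n (P \<theta>)) A = (\<Prod>i<n. emeasure (P \<theta>) (X i))" if "\<theta> \<in> space M" for \<theta>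
  proof -
    interpret product_sigma_finite "\<lambda>_::nat. P \<theta>"
      using PS(1)[OF that] by (intro product_sigma_finite_const prob_space_imp_sigma_finite)
    show ?thesis unfolding X(1) sample_law_def using X(2) PS(2)[OF that]
      by (subst emeasure_PiM) auto
  qed
  have "(\<lambda>\<theta>. \<Prod>i<n. emeasure (P \<theta>) (X i)) \<in> borel_measurable M"
    by (intro borel_measurable_prod_ennreal measurable_emeasure_kernel[OF measurable_prob_algebraD[OF P]])
       (use X(2) in auto)
  then show "(\<lambda>\<theta>. emeasure (sample_law n (P \<theta>)) A) \<in> borel_measurable M"
    by (rule measurable_cong[THEN iffD2, rotated]) (rule *)
qed

text \<open>A product measure is determined by its values on boxes, where the indicator factorizes
  and the integral splits. The hypothesis \<open>pr\<close> supplies the sigma-finiteness of the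
  factor that this uniqueness requires.\<close>

lemma sample_law_density:
  assumes \<mu>: "sigma_finite_measure \<mu>" and f [measurable]: "f \<in> borel_measurable \<mu>"
    and pr: "prob_space (density \<mu> f)"
  shows "sample_law n (density \<mu> f) = density (sample_law n \<mu>) (\<lambda>x. \<Prod>i<n. f (x i))"
proof -
  interpret m: product_sigma_finite "\<lambda>_::nat. \<mu>" by (rule product_sigma_finite_const[OF \<mu>])
  interpret d: product_sigma_finite "\<lambda>_::nat. density \<mu> f"
    using pr by (intro product_sigma_finite_const prob_space_imp_sigma_finite)
  show ?thesis unfolding sample_law_def
  proof (rule d.PiM_eqI[symmetric])
    show "sets (density (Pi\<^sub>M {..<n} (\<lambda>_. \<mu>)) (\<lambda>x. \<Prod>i<n. f (x i))) = sets (Pi\<^sub>M {..<n} (\<lambda>_. density \<mu> f))"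
      by (simp cong: sets_PiM_cong)
    fix A assume A: "\<And>i. i \<in> {..<n} \<Longrightarrow> A i \<in> sets (density \<mu> f)"
    have fm: "(\<lambda>x. \<Prod>i<n. f (x i)) \<in> borel_measurable (Pi\<^sub>M {..<n} (\<lambda>_. \<mu>))"
      by (intro borel_measurable_prod_ennreal measurable_compose[OF _ f] measurable_component_singleton)
    have AS: "Pi\<^sub>E {..<n} A \<in> sets (Pi\<^sub>M {..<n} (\<lambda>_. \<mu>))"
      by (intro sets_PiM_I_finite) (use A in auto)
    have "emeasure (density (Pi\<^sub>M {..<n} (\<lambda>_. \<mu>)) (\<lambda>x. \<Prod>i<n. f (x i))) (Pi\<^sub>E {..<n} A)
       = (\<integral>\<^sup>+x. (\<Prod>i<n. f (x i)) * indicator (Pi\<^sub>E {..<n} A) x \<partial>Pi\<^sub>M {..<n} (\<lambda>_. \<mu>))"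
      by (rule emeasure_density[OF fm AS])
    also have "\<dots> = (\<integral>\<^sup>+x. (\<Prod>i<n. f (x i) * indicator (A i) (x i)) \<partial>Pi\<^sub>M {..<n} (\<lambda>_. \<mu>))"
    proof (rule nn_integral_cong)
      fix x assume "x \<in> space (Pi\<^sub>M {..<n} (\<lambda>_. \<mu>))"
      then have x: "x \<in> Pi\<^sub>E {..<n} A \<longleftrightarrow> (\<forall>i<n. x i \<in> A i)" by (auto simp: space_PiM PiE_iff)
      have "indicator (Pi\<^sub>E {..<n} A) x = (\<Prod>i<n. indicator (A i) (x i) :: ennreal)"
      proof (cases "x \<in> Pi\<^sub>E {..<n} A")
        case True
        then show ?thesis using x by (simp add: prod.neutral)
      next
        case False
        then obtain i where "i < n" "x i \<notin> A i" using x by auto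
        then have "(\<Prod>i<n. indicator (A i) (x i) :: ennreal) = 0"
          by (intro prod_zero) (auto intro!: bexI[of _ i])
        then show ?thesis using False by simp
      qed
      then show "(\<Prod>i<n. f (x i)) * indicator (Pi\<^sub>E {..<n} A) x = (\<Prod>i<n. f (x i) * indicator (A i) (x i))"
        by (simp add: prod.distrib)
    qed
    also have "\<dots> = (\<Prod>i<n. \<integral>\<^sup>+y. f y * indicator (A i) y \<partial>\<mu>)"
    proof (rule m.product_nn_integral_prod[where f = "\<lambda>i y. f y * indicator (A i) y"])
      fix i assume "i \<in> {..<n}"
      then have "A i \<in> sets \<mu>" using A by simp
      then show "(\<lambda>y. f y * indicator (A i) y) \<in> borel_measurable \<mu>"
        by (intro borel_measurable_times_ennreal f borel_measurable_indicator)
    qed simp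
    also have "\<dots> = (\<Prod>i<n. emeasure (density \<mu> f) (A i))"
    proof (rule prod.cong[OF refl])
      fix i assume "i \<in> {..<n}"
      then have "A i \<in> sets \<mu>" using A by simp
      then show "(\<integral>\<^sup>+y. f y * indicator (A i) y \<partial>\<mu>) = emeasure (density \<mu> f) (A i)"
        by (simp add: emeasure_density)
    qed
    finally show "emeasure (density (Pi\<^sub>M {..<n} (\<lambda>_. \<mu>)) (\<lambda>x. \<Prod>i<n. f (x i))) (Pi\<^sub>E {..<n} A)
       = (\<Prod>i<n. emeasure (density \<mu> f) (A i))" .
  qed auto
qed

section \<open>L1 distance of product densities through the Hellinger affinity\<close>

lemma sqrt_prod: "sqrt (\<Prod>i\<in>A. f i) = (\<Prod>i\<in>A. sqrt (f i))"
  by (induction A rule: infinite_finite_induct) (auto simp: real_sqrt_mult)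

text \<open>Write \<open>c n ^ n\<close> as \<open>exp (n * Ln (c n))\<close> and use that
  \<open>Ln (1 + w) / w\<close> tends to 1 at 0. The base is complex because the lemma also has to
  give the limit of characteristic functions.\<close>

lemma power_tendsto_exp:
  fixes c :: "nat \<Rightarrow> complex"
  assumes c: "(\<lambda>n. of_nat n * (c n - 1)) \<longlonglongrightarrow> z"
  shows "(\<lambda>n. c n ^ n) \<longlonglongrightarrow> exp z"
proof -
  \<comment> \<open>The value 1 at 0 makes the quotient continuous, so indices with
    \<open>c n = 1\<close> need no separate treatment.\<close>
  define G where "G w = (if w = 0 then 1 else Ln (1 + w) / w)" for w :: complex
  have "((\<lambda>w. Ln (1 + w)) has_field_derivative 1) (at 0)"
    by (auto intro!: derivative_eq_intros)
  then have "((\<lambda>w. (Ln (1 + w) - Ln (1 + 0)) / (w - 0)) \<longlongrightarrow> 1) (at 0)"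
    by (simp add: has_field_derivative_iff)
  then have "(G \<longlongrightarrow> 1) (at 0)"
    by (rule Lim_transform_eventually) (auto simp: G_def eventually_at_filter)
  then have G: "isCont G 0" by (simp add: isCont_def G_def)
  have "(\<lambda>n. inverse (of_nat n) * (of_nat n * (c n - 1))) \<longlonglongrightarrow> 0 * z"
    using lim_inverse_n by (intro tendsto_mult c) auto
  then have d: "(\<lambda>n. c n - 1) \<longlonglongrightarrow> 0"
    by (subst (asm) tendsto_cong[where g = "\<lambda>n. c n - 1"])
       (auto intro!: eventually_mono[OF eventually_gt_at_top[of 0]])
  have "(\<lambda>n. G (c n - 1)) \<longlonglongrightarrow> G 0"
    using isCont_tendsto_compose[OF G d] .
  then have "(\<lambda>n. of_nat n * (c n - 1) * G (c n - 1)) \<longlonglongrightarrow> z * 1"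
    by (intro tendsto_mult c) (simp add: G_def)
  then have "(\<lambda>n. exp (of_nat n * (c n - 1) * G (c n - 1))) \<longlonglongrightarrow> exp (z * 1)"
    by (rule tendsto_exp)
  moreover have "\<forall>\<^sub>F n in sequentially. norm (c n - 1) < 1"
    using d by (auto simp: tendsto_iff dist_norm)
  then have "\<forall>\<^sub>F n in sequentially. exp (of_nat n * (c n - 1) * G (c n - 1)) = c n ^ n"
  proof eventually_elim
    case (elim n)
    then have "c n \<noteq> 0" by (auto simp: norm_minus_commute)
    then show ?case by (auto simp: G_def exp_of_nat_mult)
  qed
  ultimately show ?thesis by (auto intro: Lim_transform_eventually)
qed

lemma power_tendsto_exp_real:
  fixes c :: "nat \<Rightarrow> real"
  assumes c: "(\<lambda>n. real n * (c n - 1)) \<longlonglongrightarrow> z"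
  shows "(\<lambda>n. c n ^ n) \<longlonglongrightarrow> exp z"
proof -
  have "(\<lambda>n. complex_of_real (real n * (c n - 1))) \<longlonglongrightarrow> of_real z"
    using c by (rule tendsto_of_real)
  then have "(\<lambda>n. of_nat n * (complex_of_real (c n) - 1)) \<longlonglongrightarrow> of_real z" by simp
  from power_tendsto_exp[OF this] have "(\<lambda>n. complex_of_real (c n ^ n)) \<longlonglongrightarrow> of_real (exp z)"
    by (simp add: exp_of_real)
  then show ?thesis by (rule tendsto_of_real_iff[THEN iffD1])
qed

text \<open>By polarization \<open>C\<close> is the affinity, the integral of
  \<open>sqrt f * sqrt g\<close>, and affinities multiply over products. Pointwise, the difference
  of squares \<open>\<bar>a\<^sup>2 - b\<^sup>2\<bar>\<close> is
  \<open>\<bar>a - b\<bar> * (a + b)\<close>, to which the weighted arithmetic-geometric mean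
  inequality with weight \<open>k\<close> applies; leaving \<open>k\<close> free replaces the
  Cauchy-Schwarz inequality for integrals. The functions need not have mass one, which matters for
  the Gaussian approximation of the likelihood.\<close>

lemma prod_L1_le:
  fixes f g :: "'x \<Rightarrow> real"
  assumes \<mu>: "sigma_finite_measure \<mu>"
    and f: "integrable \<mu> f" "\<And>x. 0 \<le> f x" and g: "integrable \<mu> g" "\<And>x. 0 \<le> g x"
    and k: "0 < (k::real)"
  defines "C \<equiv> (integral\<^sup>L \<mu> f + integral\<^sup>L \<mu> g - (\<integral>x. (sqrt (f x) - sqrt (g x))\<^sup>2 \<partial>\<mu>)) / 2"
  shows "integrable (sample_law n \<mu>) (\<lambda>x. \<Prod>i<n. f (x i))" "integrable (sample_law n \<mu>) (\<lambda>x. \<Prod>i<n. g (x i))"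
    "(\<integral>x. \<bar>(\<Prod>i<n. f (x i)) - (\<Prod>i<n. g (x i))\<bar> \<partial>sample_law n \<mu>)
      \<le> ((integral\<^sup>L \<mu> f ^ n + integral\<^sup>L \<mu> g ^ n - 2 * C ^ n) / k
          + k * (integral\<^sup>L \<mu> f ^ n + integral\<^sup>L \<mu> g ^ n + 2 * C ^ n)) / 2"
proof -
  interpret m: product_sigma_finite "\<lambda>_::nat. \<mu>" by (rule product_sigma_finite_const[OF \<mu>])
  let ?N = "sample_law n \<mu>"
  have [measurable]: "f \<in> borel_measurable \<mu>" "g \<in> borel_measurable \<mu>"
    using f g by auto
  have fg: "integrable \<mu> (\<lambda>x. sqrt (f x) * sqrt (g x))"
  proof (rule Bochner_Integration.integrable_bound)
    show "integrable \<mu> (\<lambda>x. f x + g x)" using f g by simp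
    show "AE x in \<mu>. norm (sqrt (f x) * sqrt (g x)) \<le> norm (f x + g x)"
    proof (rule AE_I2)
      fix x
      have "2 * (sqrt (f x) * sqrt (g x)) \<le> (sqrt (f x))\<^sup>2 + (sqrt (g x))\<^sup>2"
        using sum_squares_bound[of "sqrt (f x)" "sqrt (g x)"] by simp
      then show "norm (sqrt (f x) * sqrt (g x)) \<le> norm (f x + g x)"
        using f(2)[of x] g(2)[of x] by (simp add: abs_mult)
    qed
  qed measurable
  have C: "C = (\<integral>x. sqrt (f x) * sqrt (g x) \<partial>\<mu>)"
  proof -
    have "(\<integral>x. (sqrt (f x) - sqrt (g x))\<^sup>2 \<partial>\<mu>) = (\<integral>x. f x + g x - 2 * (sqrt (f x) * sqrt (g x)) \<partial>\<mu>)"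
      using f g by (intro Bochner_Integration.integral_cong) (auto simp: power2_diff)
    also have "\<dots> = integral\<^sup>L \<mu> f + integral\<^sup>L \<mu> g - 2 * (\<integral>x. sqrt (f x) * sqrt (g x) \<partial>\<mu>)"
      using f g fg by simp
    finally show ?thesis unfolding C_def by simp
  qed
  let ?F = "\<lambda>x. \<Prod>i<n. f (x i)" and ?G = "\<lambda>x. \<Prod>i<n. g (x i)"
  let ?H = "\<lambda>x. \<Prod>i<n. sqrt (f (x i)) * sqrt (g (x i))"
  show F: "integrable ?N ?F" unfolding sample_law_def using f by (intro m.product_integrable_prod[where f = "\<lambda>_. f"]) auto
  show G: "integrable ?N ?G" unfolding sample_law_def using g by (intro m.product_integrable_prod[where f = "\<lambda>_. g"]) auto
  have H: "integrable ?N ?H" unfolding sample_law_def using fg by (intro m.product_integrable_prod[where f = "\<lambda>_ x. sqrt (f x) * sqrt (g x)"]) auto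
  have iF: "integral\<^sup>L ?N ?F = integral\<^sup>L \<mu> f ^ n"
    unfolding sample_law_def using f by (subst m.product_integral_prod[where f = "\<lambda>_. f"]) auto
  have iG: "integral\<^sup>L ?N ?G = integral\<^sup>L \<mu> g ^ n"
    unfolding sample_law_def using g by (subst m.product_integral_prod[where f = "\<lambda>_. g"]) auto
  have iH: "integral\<^sup>L ?N ?H = C ^ n"
    unfolding sample_law_def C using fg by (subst m.product_integral_prod[where f = "\<lambda>_ x. sqrt (f x) * sqrt (g x)"]) auto
  have "(\<integral>x. \<bar>?F x - ?G x\<bar> \<partial>?N) \<le> (\<integral>x. ((?F x + ?G x - 2 * ?H x) / k + k * (?F x + ?G x + 2 * ?H x)) / 2 \<partial>?N)"
  proof (rule integral_mono)
    show "integrable ?N (\<lambda>x. \<bar>?F x - ?G x\<bar>)" using F G by simp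
    show "integrable ?N (\<lambda>x. ((?F x + ?G x - 2 * ?H x) / k + k * (?F x + ?G x + 2 * ?H x)) / 2)"
      using F G H by simp
    fix x
    define a b where "a = sqrt (?F x)" and "b = sqrt (?G x)"
    have nn: "0 \<le> ?F x" "0 \<le> ?G x" using f g by (auto intro: prod_nonneg)
    have ab: "?F x = a\<^sup>2" "?G x = b\<^sup>2" "0 \<le> a" "0 \<le> b" unfolding a_def b_def using nn by auto
    have "?H x = a * b"
      unfolding a_def b_def prod.distrib by (simp add: sqrt_prod)
    moreover have "\<bar>a\<^sup>2 - b\<^sup>2\<bar> \<le> ((a\<^sup>2 + b\<^sup>2 - 2 * (a * b)) / k + k * (a\<^sup>2 + b\<^sup>2 + 2 * (a * b))) / 2"
    proof -
      have "\<bar>a\<^sup>2 - b\<^sup>2\<bar> = \<bar>a - b\<bar> * (a + b)"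
        using ab(3,4) unfolding square_diff_square_factored power2_eq_square abs_mult by (simp add: mult.commute)
      also have "\<dots> = (2 * (\<bar>a - b\<bar> / sqrt k) * (sqrt k * (a + b))) / 2" using k by simp
      also have "\<dots> \<le> ((\<bar>a - b\<bar> / sqrt k)\<^sup>2 + (sqrt k * (a + b))\<^sup>2) / 2"
        using sum_squares_bound[of "\<bar>a - b\<bar> / sqrt k" "sqrt k * (a + b)"] by simp
      also have "\<dots> = ((a\<^sup>2 + b\<^sup>2 - 2 * (a * b)) / k + k * (a\<^sup>2 + b\<^sup>2 + 2 * (a * b))) / 2"
        using k by (simp add: power_divide power_mult_distrib power2_diff power2_sum)
      finally show ?thesis .
    qed
    ultimately show "\<bar>?F x - ?G x\<bar> \<le> ((?F x + ?G x - 2 * ?H x) / k + k * (?F x + ?G x + 2 * ?H x)) / 2"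
      using ab by simp
  qed
  also have "\<dots> = ((integral\<^sup>L \<mu> f ^ n + integral\<^sup>L \<mu> g ^ n - 2 * C ^ n) / k
          + k * (integral\<^sup>L \<mu> f ^ n + integral\<^sup>L \<mu> g ^ n + 2 * C ^ n)) / 2"
    using F G H iF iG iH by simp
  finally show "(\<integral>x. \<bar>?F x - ?G x\<bar> \<partial>?N) \<le> \<dots>" .
qed

text \<open>The mass defect of \<open>g n\<close> and the squared Hellinger distance are both of
  smaller order than \<open>1 / n\<close>, so the \<open>n\<close>-th powers of mass and affinity
  tend to 1. For fixed \<open>k\<close> only the second part of the bound in
  \<open>prod_L1_le\<close> then survives.\<close>

lemma prod_L1_tendsto:
  fixes f g :: "nat \<Rightarrow> 'x \<Rightarrow> real"
  assumes \<mu>: "sigma_finite_measure \<mu>"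
    and f: "\<forall>\<^sub>F n in sequentially. integrable \<mu> (f n) \<and> (\<forall>x. 0 \<le> f n x) \<and> integral\<^sup>L \<mu> (f n) = 1"
    and g: "\<forall>\<^sub>F n in sequentially. integrable \<mu> (g n) \<and> (\<forall>x. 0 \<le> g n x)"
    and g1: "(\<lambda>n. real n * (integral\<^sup>L \<mu> (g n) - 1)) \<longlonglongrightarrow> 0"
    and h: "(\<lambda>n. real n * (\<integral>x. (sqrt (f n x) - sqrt (g n x))\<^sup>2 \<partial>\<mu>)) \<longlonglongrightarrow> 0"
  shows "(\<lambda>n. \<integral>x. \<bar>(\<Prod>i<n. f n (x i)) - (\<Prod>i<n. g n (x i))\<bar> \<partial>sample_law n \<mu>) \<longlonglongrightarrow> 0"
proof (rule LIMSEQ_I)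
  fix r :: real assume r: "0 < r"
  \<comment> \<open>The bound tends to \<open>2 * k\<close>, so any \<open>k\<close> below
    \<open>r / 2\<close> would do.\<close>
  define k where "k = r / 8"
  have k: "k > 0" using r by (simp add: k_def)
  define C where "C n = (1 + integral\<^sup>L \<mu> (g n) - (\<integral>x. (sqrt (f n x) - sqrt (g n x))\<^sup>2 \<partial>\<mu>)) / 2" for n
  have "(\<lambda>n. (real n * (integral\<^sup>L \<mu> (g n) - 1) - real n * (\<integral>x. (sqrt (f n x) - sqrt (g n x))\<^sup>2 \<partial>\<mu>)) / 2) \<longlonglongrightarrow> (0 - 0) / 2"
    by (intro tendsto_intros g1 h) auto
  then have "(\<lambda>n. real n * (C n - 1)) \<longlonglongrightarrow> 0"
    by (simp add: C_def algebra_simps diff_divide_distrib add_divide_distrib)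
  from power_tendsto_exp_real[OF this] have Cn: "(\<lambda>n. C n ^ n) \<longlonglongrightarrow> 1" by simp
  from power_tendsto_exp_real[OF g1] have Gn: "(\<lambda>n. integral\<^sup>L \<mu> (g n) ^ n) \<longlonglongrightarrow> 1" by simp
  have "(\<lambda>n. ((1 + integral\<^sup>L \<mu> (g n) ^ n - 2 * C n ^ n) / k + k * (1 + integral\<^sup>L \<mu> (g n) ^ n + 2 * C n ^ n)) / 2)
      \<longlonglongrightarrow> ((1 + 1 - 2 * 1) / k + k * (1 + 1 + 2 * 1)) / 2"
    using k by (intro tendsto_intros Cn Gn) auto
  then have "\<forall>\<^sub>F n in sequentially. ((1 + integral\<^sup>L \<mu> (g n) ^ n - 2 * C n ^ n) / k + k * (1 + integral\<^sup>L \<mu> (g n) ^ n + 2 * C n ^ n)) / 2 < r"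
    by (rule order_tendstoD) (use r in \<open>simp add: k_def\<close>)
  then have "\<forall>\<^sub>F n in sequentially. norm ((\<integral>x. \<bar>(\<Prod>i<n. f n (x i)) - (\<Prod>i<n. g n (x i))\<bar> \<partial>sample_law n \<mu>) - 0) < r"
    using f g
  proof eventually_elim
    case (elim n)
    have "(\<integral>x. \<bar>(\<Prod>i<n. f n (x i)) - (\<Prod>i<n. g n (x i))\<bar> \<partial>sample_law n \<mu>)
      \<le> ((1 + integral\<^sup>L \<mu> (g n) ^ n - 2 * C n ^ n) / k + k * (1 + integral\<^sup>L \<mu> (g n) ^ n + 2 * C n ^ n)) / 2"
      using prod_L1_le(3)[OF \<mu> _ _ _ _ k, of "f n" "g n" n] elim unfolding C_def by simp
    moreover have "0 \<le> (\<integral>x. \<bar>(\<Prod>i<n. f n (x i)) - (\<Prod>i<n. g n (x i))\<bar> \<partial>sample_law n \<mu>)"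
      by (intro integral_nonneg_AE) auto
    ultimately show ?case using elim(1) by simp
  qed
  then show "\<exists>no. \<forall>n\<ge>no. norm ((\<integral>x. \<bar>(\<Prod>i<n. f n (x i)) - (\<Prod>i<n. g n (x i))\<bar> \<partial>sample_law n \<mu>) - 0) < r"
    by (simp add: eventually_sequentially)
qed

section \<open>Posterior distributions\<close>

text \<open>The joint law \<open>J\<close> of parameter and observation is dominated by the product
  of \<open>\<nu>\<close> and \<open>N\<close>: almost every section of a product null set is null
  for \<open>N\<close>, hence for the kernel. Its Radon-Nikodym derivative is jointly measurable.
  The conclusion is integrated over \<open>\<theta>\<close>, the only form in which it is
  used.\<close>

lemma kernel_density:
  fixes \<nu> :: "'t measure" and N :: "'y measure"
  assumes \<nu>: "prob_space \<nu>" and N: "sigma_finite_measure N"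
    and \<kappa>: "\<kappa> \<in> \<nu> \<rightarrow>\<^sub>M prob_algebra N"
    and ac: "\<And>\<theta>. \<theta> \<in> space \<nu> \<Longrightarrow> absolutely_continuous N (\<kappa> \<theta>)"
  obtains q :: "'t \<Rightarrow> 'y \<Rightarrow> real" where "case_prod q \<in> borel_measurable (\<nu> \<Otimes>\<^sub>M N)" "\<And>\<theta> x. 0 \<le> q \<theta> x"
    "\<And>G. case_prod G \<in> borel_measurable (\<nu> \<Otimes>\<^sub>M N) \<Longrightarrow>
       (\<integral>\<^sup>+\<theta>. \<integral>\<^sup>+x. G \<theta> x * ennreal (q \<theta> x) \<partial>N \<partial>\<nu>) = (\<integral>\<^sup>+\<theta>. \<integral>\<^sup>+x. G \<theta> x \<partial>\<kappa> \<theta> \<partial>\<nu>)"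
proof -
  interpret \<nu>: prob_space \<nu> by fact
  interpret N: sigma_finite_measure N by fact
  interpret pair_sigma_finite \<nu> N ..
  note \<kappa>' [measurable] = measurable_prob_algebraD[OF \<kappa>]
  let ?K = "\<lambda>\<theta>. \<kappa> \<theta> \<bind> (\<lambda>x. return (\<nu> \<Otimes>\<^sub>M N) (\<theta>, x))"
  define J where "J = \<nu> \<bind> ?K"
  have K [measurable]: "?K \<in> \<nu> \<rightarrow>\<^sub>M subprob_algebra (\<nu> \<Otimes>\<^sub>M N)"
    by (rule measurable_bind[OF \<kappa>']) (auto intro!: measurable_compose[OF _ return_measurable])
  have PS: "prob_space (\<kappa> \<theta>)" "sets (\<kappa> \<theta>) = sets N" if "\<theta> \<in> space \<nu>" for \<theta>
    using measurable_space[OF \<kappa> that] by (auto simp: space_prob_algebra)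
  have setsJ: "sets J = sets (\<nu> \<Otimes>\<^sub>M N)"
    unfolding J_def by (rule sets_bind) (use measurable_space[OF K] \<nu>.not_empty in \<open>auto simp: space_subprob_algebra\<close>)
  have intJ: "(\<integral>\<^sup>+z. G z \<partial>J) = (\<integral>\<^sup>+\<theta>. \<integral>\<^sup>+x. G (\<theta>, x) \<partial>\<kappa> \<theta> \<partial>\<nu>)"
    if G [measurable]: "G \<in> borel_measurable (\<nu> \<Otimes>\<^sub>M N)" for G :: "_ \<Rightarrow> ennreal"
  proof -
    have "(\<integral>\<^sup>+z. G z \<partial>J) = (\<integral>\<^sup>+\<theta>. \<integral>\<^sup>+z. G z \<partial>?K \<theta> \<partial>\<nu>)"
      unfolding J_def by (rule nn_integral_bind[OF G K])
    also have "\<dots> = (\<integral>\<^sup>+\<theta>. \<integral>\<^sup>+x. G (\<theta>, x) \<partial>\<kappa> \<theta> \<partial>\<nu>)"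
    proof (rule nn_integral_cong)
      fix \<theta> assume \<theta>: "\<theta> \<in> space \<nu>"
      have R: "(\<lambda>x. return (\<nu> \<Otimes>\<^sub>M N) (\<theta>, x)) \<in> \<kappa> \<theta> \<rightarrow>\<^sub>M subprob_algebra (\<nu> \<Otimes>\<^sub>M N)"
        unfolding measurable_cong_sets[OF PS(2)[OF \<theta>] refl] using \<theta> by measurable
      have "(\<integral>\<^sup>+z. G z \<partial>?K \<theta>) = (\<integral>\<^sup>+x. \<integral>\<^sup>+z. G z \<partial>return (\<nu> \<Otimes>\<^sub>M N) (\<theta>, x) \<partial>\<kappa> \<theta>)"
        by (rule nn_integral_bind[OF G R])
      also have "\<dots> = (\<integral>\<^sup>+x. G (\<theta>, x) \<partial>\<kappa> \<theta>)"
        using \<theta> sets_eq_imp_space_eq[OF PS(2)[OF \<theta>]]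
        by (intro nn_integral_cong nn_integral_return) (auto simp: space_pair_measure)
      finally show "(\<integral>\<^sup>+z. G z \<partial>?K \<theta>) = (\<integral>\<^sup>+x. G (\<theta>, x) \<partial>\<kappa> \<theta>)" .
    qed
    finally show ?thesis .
  qed
  have emJ: "emeasure J E = (\<integral>\<^sup>+\<theta>. emeasure (\<kappa> \<theta>) (Pair \<theta> -` E) \<partial>\<nu>)"
    if E: "E \<in> sets (\<nu> \<Otimes>\<^sub>M N)" for E
  proof -
    have "emeasure J E = (\<integral>\<^sup>+z. indicator E z \<partial>J)" using E setsJ by simp
    also have "\<dots> = (\<integral>\<^sup>+\<theta>. \<integral>\<^sup>+x. indicator E (\<theta>, x) \<partial>\<kappa> \<theta> \<partial>\<nu>)"
      by (rule intJ) (use E in measurable)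
    also have "\<dots> = (\<integral>\<^sup>+\<theta>. emeasure (\<kappa> \<theta>) (Pair \<theta> -` E) \<partial>\<nu>)"
    proof (rule nn_integral_cong)
      fix \<theta> assume \<theta>: "\<theta> \<in> space \<nu>"
      have "Pair \<theta> -` E \<in> sets (\<kappa> \<theta>)" using sets_Pair1[OF E] PS(2)[OF \<theta>] by auto
      moreover have "(\<integral>\<^sup>+x. indicator E (\<theta>, x) \<partial>\<kappa> \<theta>) = (\<integral>\<^sup>+x. indicator (Pair \<theta> -` E) x \<partial>\<kappa> \<theta>)"
        by (intro nn_integral_cong) (simp add: indicator_def)
      ultimately show "(\<integral>\<^sup>+x. indicator E (\<theta>, x) \<partial>\<kappa> \<theta>) = emeasure (\<kappa> \<theta>) (Pair \<theta> -` E)"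
        by simp
    qed
    finally show ?thesis .
  qed
  have "emeasure J (space J) = (\<integral>\<^sup>+\<theta>. 1 \<partial>\<nu>)"
    unfolding sets_eq_imp_space_eq[OF setsJ]
  proof (subst emJ, simp, rule nn_integral_cong)
    fix \<theta> assume \<theta>: "\<theta> \<in> space \<nu>"
    then have "Pair \<theta> -` space (\<nu> \<Otimes>\<^sub>M N) = space (\<kappa> \<theta>)"
      using sets_eq_imp_space_eq[OF PS(2)[OF \<theta>]] by (auto simp: space_pair_measure)
    then show "emeasure (\<kappa> \<theta>) (Pair \<theta> -` space (\<nu> \<Otimes>\<^sub>M N)) = 1"
      using prob_space.emeasure_space_1[OF PS(1)[OF \<theta>]] by simp
  qed
  then interpret J: prob_space J by (intro prob_spaceI) (simp add: \<nu>.emeasure_space_1)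
  have acJ: "absolutely_continuous (\<nu> \<Otimes>\<^sub>M N) J"
    unfolding absolutely_continuous_def
  proof
    fix E assume E: "E \<in> null_sets (\<nu> \<Otimes>\<^sub>M N)"
    then have Es: "E \<in> sets (\<nu> \<Otimes>\<^sub>M N)" by auto
    have "(\<integral>\<^sup>+\<theta>. emeasure N (Pair \<theta> -` E) \<partial>\<nu>) = 0"
      using E N.emeasure_pair_measure_alt[OF Es] by auto
    then have "AE \<theta> in \<nu>. emeasure N (Pair \<theta> -` E) = 0"
      by (subst (asm) nn_integral_0_iff_AE) (auto intro: N.measurable_emeasure_Pair Es)
    then have "AE \<theta> in \<nu>. emeasure (\<kappa> \<theta>) (Pair \<theta> -` E) = 0"
      using AE_space
    proof eventually_elim
      case (elim \<theta>)
      then have "Pair \<theta> -` E \<in> null_sets N" using sets_Pair1[OF Es] by auto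
      then show ?case using ac[OF elim(2)] unfolding absolutely_continuous_def by auto
    qed
    then have "emeasure J E = 0" unfolding emJ[OF Es] by (simp add: nn_integral_cong_AE)
    then show "E \<in> null_sets J" using Es setsJ by auto
  qed
  define r where "r = RN_deriv (\<nu> \<Otimes>\<^sub>M N) J"
  have r: "r \<in> borel_measurable (\<nu> \<Otimes>\<^sub>M N)" unfolding r_def by simp
  have dJ: "density (\<nu> \<Otimes>\<^sub>M N) r = J" unfolding r_def by (rule density_RN_deriv[OF acJ setsJ])
  have fin: "AE z in \<nu> \<Otimes>\<^sub>M N. r z \<noteq> \<infinity>"
    unfolding r_def by (rule RN_deriv_finite[OF _ acJ setsJ]) (rule J.sigma_finite_measure_axioms)
  \<comment> \<open>The derivative is finite almost everywhere because \<open>J\<close> is a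
    probability measure, so \<open>enn2real\<close> changes it on a null set only.\<close>
  define q where "q \<theta> x = enn2real (r (\<theta>, x))" for \<theta> x
  have q [measurable]: "case_prod q \<in> borel_measurable (\<nu> \<Otimes>\<^sub>M N)"
    unfolding q_def using r by (auto simp: case_prod_beta)
  show ?thesis
  proof (rule that[of q])
    show "case_prod q \<in> borel_measurable (\<nu> \<Otimes>\<^sub>M N)" by fact
    show "0 \<le> q \<theta> x" for \<theta> x by (simp add: q_def)
    fix G :: "'t \<Rightarrow> 'y \<Rightarrow> ennreal" assume G [measurable]: "case_prod G \<in> borel_measurable (\<nu> \<Otimes>\<^sub>M N)"
    have "(\<integral>\<^sup>+\<theta>. \<integral>\<^sup>+x. G \<theta> x * ennreal (q \<theta> x) \<partial>N \<partial>\<nu>) = (\<integral>\<^sup>+z. case_prod G z * ennreal (case_prod q z) \<partial>(\<nu> \<Otimes>\<^sub>M N))"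
      by (subst N.nn_integral_fst[symmetric]) auto
    also have "\<dots> = (\<integral>\<^sup>+z. r z * case_prod G z \<partial>(\<nu> \<Otimes>\<^sub>M N))"
      using fin by (intro nn_integral_cong_AE, elim eventually_mono) (auto simp: q_def mult.commute less_top)
    also have "\<dots> = (\<integral>\<^sup>+z. case_prod G z \<partial>J)"
      unfolding dJ[symmetric] by (rule nn_integral_density[symmetric]) (use r G in auto)
    also have "\<dots> = (\<integral>\<^sup>+\<theta>. \<integral>\<^sup>+x. G \<theta> x \<partial>\<kappa> \<theta> \<partial>\<nu>)" by (subst intJ[OF G]) simp
    finally show "(\<integral>\<^sup>+\<theta>. \<integral>\<^sup>+x. G \<theta> x * ennreal (q \<theta> x) \<partial>N \<partial>\<nu>) = (\<integral>\<^sup>+\<theta>. \<integral>\<^sup>+x. G \<theta> x \<partial>\<kappa> \<theta> \<partial>\<nu>)" .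
  qed
qed

text \<open>The definition of the posterior yields, for each set \<open>C\<close>, an identity
  outside a null set depending on \<open>C\<close>. Countability of the generator
  \<open>\<C>\<close> makes the exceptional set common to all its members, and intersection
  stability extends the identity to a whole measure, hence to all integrands \<open>F\<close> at
  once. The law \<open>R\<close> stands for the distribution of the sample under the true
  parameter.\<close>

lemma bayes_formula:
  fixes \<nu> :: "'t measure" and N :: "'y measure" and q :: "'t \<Rightarrow> 'y \<Rightarrow> real"
  assumes \<nu>: "prob_space \<nu>" and N: "sigma_finite_measure N"
    and \<kappa>: "\<kappa> \<in> \<nu> \<rightarrow>\<^sub>M prob_algebra N"
    and q [measurable]: "case_prod q \<in> borel_measurable (\<nu> \<Otimes>\<^sub>M N)"
    and qG: "\<And>G. case_prod G \<in> borel_measurable (\<nu> \<Otimes>\<^sub>M N) \<Longrightarrow>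
       (\<integral>\<^sup>+\<theta>. \<integral>\<^sup>+x. G \<theta> x * ennreal (q \<theta> x) \<partial>N \<partial>\<nu>) = (\<integral>\<^sup>+\<theta>. \<integral>\<^sup>+x. G \<theta> x \<partial>\<kappa> \<theta> \<partial>\<nu>)"
    and Q: "Q \<in> (\<nu> \<bind> \<kappa>) \<rightarrow>\<^sub>M prob_algebra \<nu>"
    and Qq: "\<And>A C. A \<in> sets (\<nu> \<bind> \<kappa>) \<Longrightarrow> C \<in> sets \<nu> \<Longrightarrow>
        (\<integral>\<^sup>+x\<in>A. emeasure (Q x) C \<partial>(\<nu> \<bind> \<kappa>)) = (\<integral>\<^sup>+\<theta>\<in>C. emeasure (\<kappa> \<theta>) A \<partial>\<nu>)"
    and gen: "countable \<C>" "Int_stable \<C>" "\<C> \<subseteq> Pow (space \<nu>)" "space \<nu> \<in> \<C>" "sets \<nu> = sigma_sets (space \<nu>) \<C>"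
    and R: "sets R = sets N" "absolutely_continuous (\<nu> \<bind> \<kappa>) R"
  defines "m \<equiv> \<lambda>x. \<integral>\<^sup>+\<theta>. ennreal (q \<theta> x) \<partial>\<nu>"
  shows "AE x in R. 0 < m x \<and> m x < \<infinity> \<and> sets (Q x) = sets \<nu> \<and> prob_space (Q x) \<and>
    (\<forall>F\<in>borel_measurable \<nu>. m x * (\<integral>\<^sup>+\<theta>. F \<theta> \<partial>Q x) = (\<integral>\<^sup>+\<theta>. F \<theta> * ennreal (q \<theta> x) \<partial>\<nu>))"
proof -
  interpret \<nu>: prob_space \<nu> by fact
  interpret N: sigma_finite_measure N by fact
  interpret pair_sigma_finite \<nu> N ..
  note \<kappa>' [measurable] = measurable_prob_algebraD[OF \<kappa>]
  have PS: "prob_space (\<kappa> \<theta>)" "sets (\<kappa> \<theta>) = sets N" if "\<theta> \<in> space \<nu>" for \<theta>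
    using measurable_space[OF \<kappa> that] by (auto simp: space_prob_algebra)
  have setsm: "sets (\<nu> \<bind> \<kappa>) = sets N"
    by (rule sets_bind) (use PS(2) \<nu>.not_empty in auto)
  have m [measurable]: "m \<in> borel_measurable N"
    unfolding m_def by measurable
  have qC: "(\<integral>\<^sup>+x. (\<integral>\<^sup>+\<theta>. indicator C \<theta> * ennreal (q \<theta> x) \<partial>\<nu>) * indicator A x \<partial>N) = (\<integral>\<^sup>+\<theta>\<in>C. emeasure (\<kappa> \<theta>) A \<partial>\<nu>)"
    if [measurable]: "A \<in> sets N" "C \<in> sets \<nu>" for A C
  proof -
    have "(\<integral>\<^sup>+x. (\<integral>\<^sup>+\<theta>. indicator C \<theta> * ennreal (q \<theta> x) \<partial>\<nu>) * indicator A x \<partial>N)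
        = (\<integral>\<^sup>+x. \<integral>\<^sup>+\<theta>. (indicator C \<theta> * indicator A x) * ennreal (q \<theta> x) \<partial>\<nu> \<partial>N)"
      by (intro nn_integral_cong, subst nn_integral_multc[symmetric]) (auto simp: ac_simps)
    also have "\<dots> = (\<integral>\<^sup>+\<theta>. \<integral>\<^sup>+x. (indicator C \<theta> * indicator A x) * ennreal (q \<theta> x) \<partial>N \<partial>\<nu>)"
      by (rule Fubini') measurable
    also have "\<dots> = (\<integral>\<^sup>+\<theta>. \<integral>\<^sup>+x. indicator C \<theta> * indicator A x \<partial>\<kappa> \<theta> \<partial>\<nu>)"
      by (rule qG) measurable
    also have "\<dots> = (\<integral>\<^sup>+\<theta>\<in>C. emeasure (\<kappa> \<theta>) A \<partial>\<nu>)"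
      by (intro nn_integral_cong, subst nn_integral_cmult) (auto simp: PS(2) mult.commute cong: measurable_cong_sets)
    finally show ?thesis .
  qed
  have dens: "\<nu> \<bind> \<kappa> = density N m"
  proof (rule measure_eqI)
    fix A assume "A \<in> sets (\<nu> \<bind> \<kappa>)"
    then have A [measurable]: "A \<in> sets N" using setsm by simp
    have "emeasure (\<nu> \<bind> \<kappa>) A = (\<integral>\<^sup>+\<theta>. emeasure (\<kappa> \<theta>) A \<partial>\<nu>)"
      by (rule emeasure_bind[OF \<nu>.not_empty \<kappa>' A])
    also have "\<dots> = (\<integral>\<^sup>+x. m x * indicator A x \<partial>N)"
      using qC[OF A sets.top] unfolding m_def
      by (simp cong: nn_integral_cong add: nn_integral_cong[of \<nu> "\<lambda>\<theta>. indicator (space \<nu>) \<theta> * _ \<theta>"])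
    finally show "emeasure (\<nu> \<bind> \<kappa>) A = emeasure (density N m) A" by (simp add: emeasure_density)
  qed (simp add: setsm)
  have Q' [measurable]: "Q \<in> N \<rightarrow>\<^sub>M subprob_algebra \<nu>"
    using measurable_prob_algebraD[OF Q] unfolding measurable_cong_sets[OF setsm refl] .
  have spQ: "prob_space (Q x)" "sets (Q x) = sets \<nu>" if "x \<in> space N" for x
    using measurable_space[OF Q] that sets_eq_imp_space_eq[OF setsm] by (auto simp: space_prob_algebra)
  \<comment> \<open>Both functions are densities of the same measure with respect to
    \<open>N\<close>; equality almost everywhere is the uniqueness of densities.\<close>
  have AEC: "AE x in N. m x * emeasure (Q x) C = (\<integral>\<^sup>+\<theta>. indicator C \<theta> * ennreal (q \<theta> x) \<partial>\<nu>)" if "C \<in> sets \<nu>" for C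
  proof (rule N.density_unique)
    note that [measurable]
    show "(\<lambda>x. m x * emeasure (Q x) C) \<in> borel_measurable N" by measurable
    show "(\<lambda>x. \<integral>\<^sup>+\<theta>. indicator C \<theta> * ennreal (q \<theta> x) \<partial>\<nu>) \<in> borel_measurable N" by measurable
    show "density N (\<lambda>x. m x * emeasure (Q x) C) = density N (\<lambda>x. \<integral>\<^sup>+\<theta>. indicator C \<theta> * ennreal (q \<theta> x) \<partial>\<nu>)"
    proof (rule measure_eqI)
      fix A assume "A \<in> sets (density N (\<lambda>x. m x * emeasure (Q x) C))"
      then have A [measurable]: "A \<in> sets N" by simp
      have "emeasure (density N (\<lambda>x. m x * emeasure (Q x) C)) A = (\<integral>\<^sup>+x. m x * (emeasure (Q x) C * indicator A x) \<partial>N)"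
        by (simp add: emeasure_density mult.assoc)
      also have "\<dots> = (\<integral>\<^sup>+x\<in>A. emeasure (Q x) C \<partial>(\<nu> \<bind> \<kappa>))"
        unfolding dens by (rule nn_integral_density[symmetric]) measurable
      also have "\<dots> = (\<integral>\<^sup>+\<theta>\<in>C. emeasure (\<kappa> \<theta>) A \<partial>\<nu>)" using A that setsm by (intro Qq) auto
      also have "\<dots> = emeasure (density N (\<lambda>x. \<integral>\<^sup>+\<theta>. indicator C \<theta> * ennreal (q \<theta> x) \<partial>\<nu>)) A"
        unfolding qC[OF A that, symmetric] by (simp add: emeasure_density)
      finally show "emeasure (density N (\<lambda>x. m x * emeasure (Q x) C)) A = \<dots>" .
    qed simp
  qed
  have genS: "C \<in> sets \<nu>" if "C \<in> \<C>" for C using gen(5) that by auto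
  have 1: "AE x in N. \<forall>C\<in>\<C>. m x * emeasure (Q x) C = (\<integral>\<^sup>+\<theta>. indicator C \<theta> * ennreal (q \<theta> x) \<partial>\<nu>)"
    by (subst AE_ball_countable[OF gen(1)]) (auto intro: AEC genS)
  have "(\<integral>\<^sup>+x. m x \<partial>N) = emeasure (\<nu> \<bind> \<kappa>) (space N)"
    unfolding dens by (simp add: emeasure_density cong: nn_integral_cong)
  also have "\<dots> = (\<integral>\<^sup>+\<theta>. emeasure (\<kappa> \<theta>) (space N) \<partial>\<nu>)"
    by (rule emeasure_bind[OF \<nu>.not_empty \<kappa>']) simp
  also have "\<dots> = (\<integral>\<^sup>+\<theta>. 1 \<partial>\<nu>)"
    using prob_space.emeasure_space_1[OF PS(1)] sets_eq_imp_space_eq[OF PS(2)] by (intro nn_integral_cong) auto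
  finally have "(\<integral>\<^sup>+x. m x \<partial>N) \<noteq> \<infinity>" by (simp add: \<nu>.emeasure_space_1)
  then have 2: "AE x in N. m x \<noteq> \<infinity>" by (intro nn_integral_noteq_infinite) auto
  have "AE x in N. m x < \<infinity> \<and> sets (Q x) = sets \<nu> \<and> prob_space (Q x) \<and>
    (\<forall>F\<in>borel_measurable \<nu>. m x * (\<integral>\<^sup>+\<theta>. F \<theta> \<partial>Q x) = (\<integral>\<^sup>+\<theta>. F \<theta> * ennreal (q \<theta> x) \<partial>\<nu>))"
    using 1 2 AE_space
  proof eventually_elim
    case (elim x)
    have qx [measurable]: "(\<lambda>\<theta>. ennreal (q \<theta> x)) \<in> borel_measurable \<nu>" using elim(3) by measurable
    have eq: "scale_measure (m x) (Q x) = density \<nu> (\<lambda>\<theta>. ennreal (q \<theta> x))"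
    proof (rule measure_eqI_generator_eq[OF gen(2,3)])
      show "emeasure (scale_measure (m x) (Q x)) X = emeasure (density \<nu> (\<lambda>\<theta>. ennreal (q \<theta> x))) X" if "X \<in> \<C>" for X
        using elim(1) that genS[OF that] by (simp add: emeasure_density mult.commute)
      show "sets (scale_measure (m x) (Q x)) = sigma_sets (space \<nu>) \<C>" using spQ(2)[OF elim(3)] gen(5) by simp
      show "sets (density \<nu> (\<lambda>\<theta>. ennreal (q \<theta> x))) = sigma_sets (space \<nu>) \<C>" using gen(5) by simp
      show "range (\<lambda>_::nat. space \<nu>) \<subseteq> \<C>" using gen(4) by auto
      show "(\<Union>i::nat. space \<nu>) = space \<nu>" by simp
      show "emeasure (scale_measure (m x) (Q x)) (space \<nu>) \<noteq> \<infinity>"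
        using elim(2) prob_space.emeasure_space_1[OF spQ(1)[OF elim(3)]] sets_eq_imp_space_eq[OF spQ(2)[OF elim(3)]] by simp
    qed
    show ?case
    proof (intro conjI ballI)
      show "m x < \<infinity>" using elim(2) by (simp add: less_top)
      show "sets (Q x) = sets \<nu>" "prob_space (Q x)" using spQ elim(3) by auto
      fix F :: "'t \<Rightarrow> ennreal" assume F: "F \<in> borel_measurable \<nu>"
      then have "F \<in> borel_measurable (Q x)" using spQ(2)[OF elim(3)] by (simp cong: measurable_cong_sets)
      then have "m x * (\<integral>\<^sup>+\<theta>. F \<theta> \<partial>Q x) = (\<integral>\<^sup>+\<theta>. F \<theta> \<partial>scale_measure (m x) (Q x))"
        by (simp add: nn_integral_scale_measure)
      also have "\<dots> = (\<integral>\<^sup>+\<theta>. F \<theta> * ennreal (q \<theta> x) \<partial>\<nu>)"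
        unfolding eq using F by (subst nn_integral_density) (auto simp: mult.commute)
      finally show "m x * (\<integral>\<^sup>+\<theta>. F \<theta> \<partial>Q x) = (\<integral>\<^sup>+\<theta>. F \<theta> * ennreal (q \<theta> x) \<partial>\<nu>)" .
    qed
  qed
  \<comment> \<open>Positivity of \<open>m\<close> fails on a set that the marginal law, having
    density \<open>m\<close>, does not charge; domination by the marginal law then carries
    everything over to \<open>R\<close>.\<close>
  then have "AE x in \<nu> \<bind> \<kappa>. 0 < m x \<and> m x < \<infinity> \<and> sets (Q x) = sets \<nu> \<and> prob_space (Q x) \<and>
    (\<forall>F\<in>borel_measurable \<nu>. m x * (\<integral>\<^sup>+\<theta>. F \<theta> \<partial>Q x) = (\<integral>\<^sup>+\<theta>. F \<theta> * ennreal (q \<theta> x) \<partial>\<nu>))"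
    unfolding dens AE_density[OF m] by (auto elim: eventually_mono)
  then show ?thesis using R setsm by (intro absolutely_continuous_AE[OF _ R(2)]) auto
qed

text \<open>Closing a countable basis under finite intersections keeps it countable and makes it
  intersection-stable. The empty intersection contributes the whole space, and so
  \<open>\<Theta>\<close> after restriction.\<close>

lemma restrict_borel_generator:
  fixes \<Theta> :: "'a::second_countable_topology set"
  obtains \<C> where "countable \<C>" "Int_stable \<C>" "\<C> \<subseteq> Pow \<Theta>" "\<Theta> \<in> \<C>"
    "sets (restrict_space borel \<Theta>) = sigma_sets \<Theta> \<C>"
proof -
  obtain B :: "'a set set" where B: "countable B" "topological_basis B"
    using ex_countable_basis by auto
  define D where "D = {\<Inter>F |F. finite F \<and> F \<subseteq> B}"
  have D: "countable D"
  proof -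
    have "D = Inter ` {F. finite F \<and> F \<subseteq> B}" by (auto simp: D_def)
    then show ?thesis using countable_Collect_finite_subset[OF B(1)] by simp
  qed
  have DI: "X \<inter> Y \<in> D" if XY: "X \<in> D" "Y \<in> D" for X Y
  proof -
    obtain F G where "X = \<Inter>F" "Y = \<Inter>G" "finite F" "finite G" "F \<subseteq> B" "G \<subseteq> B"
      using XY by (auto simp: D_def)
    then have "X \<inter> Y = \<Inter>(F \<union> G)" "finite (F \<union> G)" "F \<union> G \<subseteq> B" by auto
    then show ?thesis unfolding D_def by blast
  qed
  have oB: "open b" if "b \<in> B" for b using B(2) that by (rule topological_basis_open)
  have oD: "open X" if "X \<in> D" for X using that oB by (auto simp: D_def)
  have BD: "B \<subseteq> D" unfolding D_def by (auto intro!: exI[of _ "{_}"])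
  have bor: "sets (borel :: 'a measure) = sigma_sets UNIV D"
  proof
    have "sets (borel :: 'a measure) = sigma_sets UNIV B"
      unfolding borel_eq_countable_basis[OF B] by simp
    then show "sets (borel :: 'a measure) \<subseteq> sigma_sets UNIV D"
      using sigma_sets_mono'[OF BD, of UNIV] by simp
    show "sigma_sets UNIV D \<subseteq> sets (borel :: 'a measure)"
      using sets.sigma_sets_subset[of D "borel :: 'a measure"] oD by (auto intro: borel_open)
  qed
  let ?C = "(\<lambda>X. \<Theta> \<inter> X) ` D"
  show ?thesis
  proof (rule that[of ?C])
    show "countable ?C" using D by simp
    show "Int_stable ?C"
    proof (rule Int_stableI)
      fix a b assume "a \<in> ?C" "b \<in> ?C"
      then obtain X Y where "a = \<Theta> \<inter> X" "b = \<Theta> \<inter> Y" "X \<in> D" "Y \<in> D" by auto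
      then show "a \<inter> b \<in> ?C" using DI[of X Y] by (auto intro!: image_eqI[of _ _ "X \<inter> Y"])
    qed
    show "?C \<subseteq> Pow \<Theta>" by auto
    have "UNIV \<in> D" unfolding D_def by (auto intro!: exI[of _ "{}"])
    then show "\<Theta> \<in> ?C" by force
    have "sets (restrict_space borel \<Theta>) = (\<inter>) \<Theta> ` sigma_sets UNIV D"
      unfolding sets_restrict_space bor ..
    also have "\<dots> = sigma_sets \<Theta> ((\<inter>) \<Theta> ` D)"
      using sigma_sets_vimage_commute[of "\<lambda>x. x" \<Theta> UNIV D]
      by (simp add: image_def Int_commute Setcompr_eq_image vimage_def)
    finally show "sets (restrict_space borel \<Theta>) = sigma_sets \<Theta> ?C" .
  qed
qed

section \<open>Differentiability in quadratic mean\<close>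

locale dqm_model =
  fixes \<mu> :: "'x measure" and \<Theta> :: "(real^'d) set" and \<theta>\<^sub>0 :: "real^'d"
    and P :: "real^'d \<Rightarrow> 'x measure" and s :: "'x \<Rightarrow> real^'d"
  assumes sigma_finite_\<mu>: "sigma_finite_measure \<mu>"
    and P_in_space: "\<And>\<theta>. \<theta> \<in> \<Theta> \<Longrightarrow> P \<theta> \<in> space (prob_algebra \<mu>)"
    and P_dominated: "\<And>\<theta>. \<theta> \<in> \<Theta> \<Longrightarrow> absolutely_continuous \<mu> (P \<theta>)"
    and \<theta>0_interior: "\<theta>\<^sub>0 \<in> interior \<Theta>"
    and dqm: "differentiable_in_quadratic_mean \<mu> P \<theta>\<^sub>0 s"
begin

definition dens :: "real^'d \<Rightarrow> 'x \<Rightarrow> real" where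
  "dens \<theta> x = enn2real (RN_deriv \<mu> (P \<theta>) x)"

definition rem :: "real^'d \<Rightarrow> 'x \<Rightarrow> real" where
  "rem u x = sqrt (dens (\<theta>\<^sub>0 + u) x) - sqrt (dens \<theta>\<^sub>0 x) - 1/2 * (u \<bullet> s x) * sqrt (dens \<theta>\<^sub>0 x)"

abbreviation "M\<^sub>0 \<equiv> P \<theta>\<^sub>0"

lemma \<theta>0_in: "\<theta>\<^sub>0 \<in> \<Theta>" using \<theta>0_interior interior_subset by auto

lemma prob_P: "\<theta> \<in> \<Theta> \<Longrightarrow> prob_space (P \<theta>)" and sets_P: "\<theta> \<in> \<Theta> \<Longrightarrow> sets (P \<theta>) = sets \<mu>"
  using P_in_space by (auto simp: space_prob_algebra)

lemma sets_M0 [measurable_cong, simp]: "sets M\<^sub>0 = sets \<mu>" by (rule sets_P[OF \<theta>0_in])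

lemma space_M0 [simp]: "space M\<^sub>0 = space \<mu>" by (rule sets_eq_imp_space_eq) simp

sublocale M0: prob_space "M\<^sub>0" by (rule prob_P[OF \<theta>0_in])

lemma dens_measurable [measurable]: "dens \<theta> \<in> borel_measurable \<mu>"
  unfolding dens_def by measurable

lemma dens_nonneg [simp]: "0 \<le> dens \<theta> x" by (simp add: dens_def)

lemma s_measurable [measurable]: "s \<in> borel_measurable \<mu>"
  using dqm by (auto simp: differentiable_in_quadratic_mean_def Let_def)

lemma P_eq_density:
  assumes "\<theta> \<in> \<Theta>" shows "P \<theta> = density \<mu> (\<lambda>x. ennreal (dens \<theta> x))"
proof -
  interpret sigma_finite_measure \<mu> by (rule sigma_finite_\<mu>)
  interpret T: prob_space "P \<theta>" by (rule prob_P[OF assms])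
  have "AE x in \<mu>. RN_deriv \<mu> (P \<theta>) x \<noteq> \<infinity>"
    by (rule RN_deriv_finite[OF _ P_dominated[OF assms] sets_P[OF assms]]) (rule T.sigma_finite_measure_axioms)
  then have "AE x in \<mu>. RN_deriv \<mu> (P \<theta>) x = ennreal (dens \<theta> x)"
    by eventually_elim (auto simp: dens_def less_top)
  then have "density \<mu> (RN_deriv \<mu> (P \<theta>)) = density \<mu> (\<lambda>x. ennreal (dens \<theta> x))"
    by (intro density_cong) auto
  then show ?thesis using density_RN_deriv[OF P_dominated[OF assms] sets_P[OF assms]] by simp
qed

lemma integrable_P_iff:
  fixes g :: "'x \<Rightarrow> 'b::{banach,second_countable_topology}"
  assumes "\<theta> \<in> \<Theta>" "g \<in> borel_measurable \<mu>"
  shows "integrable (P \<theta>) g \<longleftrightarrow> integrable \<mu> (\<lambda>x. dens \<theta> x *\<^sub>R g x)"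
  unfolding P_eq_density[OF assms(1)] using assms(2) by (subst integrable_density) auto

lemma integral_P:
  fixes g :: "'x \<Rightarrow> 'b::{banach,second_countable_topology}"
  assumes "\<theta> \<in> \<Theta>" "g \<in> borel_measurable \<mu>"
  shows "integral\<^sup>L (P \<theta>) g = (\<integral>x. dens \<theta> x *\<^sub>R g x \<partial>\<mu>)"
  unfolding P_eq_density[OF assms(1)] using assms(2) by (subst integral_density) auto

lemma integrable_dens: "\<theta> \<in> \<Theta> \<Longrightarrow> integrable \<mu> (dens \<theta>)"
  using integrable_P_iff[of \<theta> "\<lambda>_. 1::real"] prob_space.finite_measure[OF prob_P, of \<theta>]
  by (auto intro: finite_measure.integrable_const)

lemma integral_dens: "\<theta> \<in> \<Theta> \<Longrightarrow> integral\<^sup>L \<mu> (dens \<theta>) = 1"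
  using integral_P[of \<theta> "\<lambda>_. 1::real"] prob_space.prob_space[OF prob_P, of \<theta>] by simp

lemma s_nth_measurable [measurable]: "(\<lambda>x. s x $ i) \<in> borel_measurable \<mu>"
proof -
  have "(\<lambda>x. s x $ i) = (\<lambda>x. s x \<bullet> axis i 1)" by (simp add: inner_axis)
  then show ?thesis by simp
qed

text \<open>Turns the little-o condition, which speaks of nonzero increments only, into a bound on a
  full ball: at \<open>u = 0\<close> the remainder vanishes identically. The radius is also small
  enough to stay inside \<open>\<Theta>\<close>.\<close>

lemma rem_small:
  assumes "\<eta> > 0"
  obtains \<delta> where "\<delta> > 0" "\<And>u. norm u < \<delta> \<Longrightarrow> \<theta>\<^sub>0 + u \<in> \<Theta>"
    "\<And>u. norm u < \<delta> \<Longrightarrow> integrable \<mu> (\<lambda>x. (rem u x)\<^sup>2)"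
    "\<And>u. norm u < \<delta> \<Longrightarrow> (\<integral>x. (rem u x)\<^sup>2 \<partial>\<mu>) \<le> \<eta> * (norm u)\<^sup>2"
proof -
  have 1: "\<forall>\<^sub>F h in at 0. integrable \<mu> (\<lambda>x. (rem h x)\<^sup>2)"
    and 2: "(\<lambda>h. \<integral>x. (rem h x)\<^sup>2 \<partial>\<mu>) \<in> o[at 0](\<lambda>h. (norm h)\<^sup>2)"
    using dqm unfolding differentiable_in_quadratic_mean_def Let_def rem_def dens_def by auto
  from landau_o.smallD[OF 2 assms]
  have "\<forall>\<^sub>F h in at 0. integrable \<mu> (\<lambda>x. (rem h x)\<^sup>2) \<and> (\<integral>x. (rem h x)\<^sup>2 \<partial>\<mu>) \<le> \<eta> * (norm h)\<^sup>2"
    using 1 by eventually_elim auto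
  then obtain d where d: "d > 0" "\<And>h. h \<noteq> 0 \<Longrightarrow> norm h < d \<Longrightarrow> integrable \<mu> (\<lambda>x. (rem h x)\<^sup>2) \<and> (\<integral>x. (rem h x)\<^sup>2 \<partial>\<mu>) \<le> \<eta> * (norm h)\<^sup>2"
    by (auto simp: eventually_at dist_norm)
  obtain e where e: "e > 0" "ball \<theta>\<^sub>0 e \<subseteq> \<Theta>" using \<theta>0_interior by (auto simp: mem_interior)
  have r0: "rem 0 x = 0" for x by (simp add: rem_def)
  show ?thesis
  proof (rule that[of "min d e"])
    show "min d e > 0" using d e by simp
    fix u :: "real^'d" assume u: "norm u < min d e"
    show "\<theta>\<^sub>0 + u \<in> \<Theta>" using u e by (auto simp: subset_eq dist_norm)
    show "integrable \<mu> (\<lambda>x. (rem u x)\<^sup>2)" using d(2)[of u] u r0 by (cases "u = 0") auto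
    show "(\<integral>x. (rem u x)\<^sup>2 \<partial>\<mu>) \<le> \<eta> * (norm u)\<^sup>2" using d(2)[of u] u r0 by (cases "u = 0") auto
  qed
qed

text \<open>Finite Fisher information comes for free: for a small multiple of \<open>u\<close>, half
  the score times the root density is a combination of two root densities and the remainder, all
  three square integrable with respect to \<open>\<mu>\<close>.\<close>

lemma integrable_inner_score_sq: "integrable M\<^sub>0 (\<lambda>x. (u \<bullet> s x)\<^sup>2)"
proof -
  obtain \<delta> where \<delta>: "\<delta> > 0" "\<And>u. norm u < \<delta> \<Longrightarrow> \<theta>\<^sub>0 + u \<in> \<Theta>"
    "\<And>u. norm u < \<delta> \<Longrightarrow> integrable \<mu> (\<lambda>x. (rem u x)\<^sup>2)"
    using rem_small[of 1] by (metis zero_less_one)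
  \<comment> \<open>The added 1 keeps \<open>t\<close> positive also when
    \<open>u = 0\<close>.\<close>
  define t where "t = \<delta> / (2 * (norm u + 1))"
  have n1: "norm u + 1 > 0" by (smt (verit) norm_ge_zero)
  have lt: "norm u / (2 * (norm u + 1)) < 1" 
  proof -
    have "norm u < 2 * (norm u + 1)" using n1 by argo
    moreover have "2 * (norm u + 1) > 0" using n1 by argo
    ultimately show ?thesis by (metis divide_less_eq_1_pos)
  qed
  have t: "t > 0" unfolding t_def using \<delta>(1) n1 by simp
  have "norm (t *\<^sub>R u) < \<delta>"
  proof -
    have "norm (t *\<^sub>R u) = t * norm u" using t by simp
      also have "\<dots> = \<delta> * (norm u / (2 * (norm u + 1)))" by (simp add: t_def)
    also have "\<dots> < \<delta> * 1" using \<delta>(1) lt by (intro mult_strict_left_mono)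
    finally show ?thesis by simp
  qed
  note tu = \<delta>(2,3)[OF this]
  let ?v = "t *\<^sub>R u"
  have "integrable \<mu> (\<lambda>x. 1/4 * (?v \<bullet> s x)\<^sup>2 * dens \<theta>\<^sub>0 x)"
  proof (rule Bochner_Integration.integrable_bound)
    show "integrable \<mu> (\<lambda>x. 3 * (dens (\<theta>\<^sub>0 + ?v) x + dens \<theta>\<^sub>0 x + (rem ?v x)\<^sup>2))"
      using integrable_dens[OF tu(1)] integrable_dens[OF \<theta>0_in] tu(2) by simp
    show "AE x in \<mu>. norm (1/4 * (?v \<bullet> s x)\<^sup>2 * dens \<theta>\<^sub>0 x) \<le> norm (3 * (dens (\<theta>\<^sub>0 + ?v) x + dens \<theta>\<^sub>0 x + (rem ?v x)\<^sup>2))"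
    proof (rule AE_I2)
      fix x
      define a b r where "a = sqrt (dens (\<theta>\<^sub>0 + ?v) x)" and "b = sqrt (dens \<theta>\<^sub>0 x)" and "r = rem ?v x"
      have c: "1/2 * (?v \<bullet> s x) * b = a - b - r" by (simp add: r_def rem_def a_def b_def)
      have "1/4 * (?v \<bullet> s x)\<^sup>2 * dens \<theta>\<^sub>0 x = (1/2 * (?v \<bullet> s x) * b)\<^sup>2"
        by (simp add: b_def power_mult_distrib power2_eq_square)
      also have "\<dots> = (a - b - r)\<^sup>2" unfolding c ..
      also have "\<dots> \<le> 3 * (a\<^sup>2 + b\<^sup>2 + r\<^sup>2)"
      proof -
        have "0 \<le> (a + b)\<^sup>2 + (a + r)\<^sup>2 + (b - r)\<^sup>2" by simp
        then show ?thesis by (simp add: power2_eq_square algebra_simps)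
      qed
      also have "\<dots> = 3 * (dens (\<theta>\<^sub>0 + ?v) x + dens \<theta>\<^sub>0 x + (rem ?v x)\<^sup>2)"
        by (simp add: a_def b_def r_def)
      finally show "norm (1/4 * (?v \<bullet> s x)\<^sup>2 * dens \<theta>\<^sub>0 x) \<le> norm (3 * (dens (\<theta>\<^sub>0 + ?v) x + dens \<theta>\<^sub>0 x + (rem ?v x)\<^sup>2))"
        by simp
    qed
  qed measurable
  then have "integrable \<mu> (\<lambda>x. (4 / t\<^sup>2) * (1/4 * (?v \<bullet> s x)\<^sup>2 * dens \<theta>\<^sub>0 x))" by (rule integrable_mult_right)
  moreover have "(4 / t\<^sup>2) * (1/4 * (?v \<bullet> s x)\<^sup>2 * dens \<theta>\<^sub>0 x) = dens \<theta>\<^sub>0 x *\<^sub>R (u \<bullet> s x)\<^sup>2" for x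
    using t by (simp add: power_mult_distrib field_simps)
  ultimately show ?thesis by (subst integrable_P_iff[OF \<theta>0_in]) auto
qed

lemma integrable_score_sq: "integrable M\<^sub>0 (\<lambda>x. (norm (s x))\<^sup>2)"
proof -
  have "(norm (s x))\<^sup>2 = (\<Sum>b\<in>Basis. (b \<bullet> s x)\<^sup>2)" for x
    unfolding power2_norm_eq_inner by (subst euclidean_inner) (simp add: power2_eq_square inner_commute)
  then show ?thesis using integrable_inner_score_sq by simp
qed

text \<open>The trace of the Fisher information, which bounds the variance of the score in every
  unit direction.\<close>

definition V :: real where "V = (\<integral>x. (norm (s x))\<^sup>2 \<partial>M\<^sub>0)"

lemma V_nonneg: "0 \<le> V" unfolding V_def by simp

lemma inner_score_sq_le: "(\<integral>x. (u \<bullet> s x)\<^sup>2 \<partial>M\<^sub>0) \<le> (norm u)\<^sup>2 * V"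
proof -
  have "(\<integral>x. (u \<bullet> s x)\<^sup>2 \<partial>M\<^sub>0) \<le> (\<integral>x. (norm u)\<^sup>2 * (norm (s x))\<^sup>2 \<partial>M\<^sub>0)"
  proof (rule integral_mono)
    fix x
    have "\<bar>u \<bullet> s x\<bar>\<^sup>2 \<le> (norm u * norm (s x))\<^sup>2" by (intro power_mono Cauchy_Schwarz_ineq2) auto
    then show "(u \<bullet> s x)\<^sup>2 \<le> (norm u)\<^sup>2 * (norm (s x))\<^sup>2" by (simp add: power_mult_distrib)
  qed (use integrable_inner_score_sq integrable_score_sq in auto)
  then show ?thesis by (simp add: V_def)
qed

lemma integrable_score: "integrable M\<^sub>0 s"
proof (rule Bochner_Integration.integrable_bound)
  show "integrable M\<^sub>0 (\<lambda>x. 1 + (norm (s x))\<^sup>2)" using integrable_score_sq by simp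
  show "AE x in M\<^sub>0. norm (s x) \<le> norm (1 + (norm (s x))\<^sup>2)"
  proof (rule AE_I2)
    fix x
    have "0 \<le> (norm (s x) - 1)\<^sup>2" by simp
    then have "norm (s x) * 2 \<le> 1 + (norm (s x))\<^sup>2" by (simp add: power2_eq_square algebra_simps)
    then show "norm (s x) \<le> norm (1 + (norm (s x))\<^sup>2)" using norm_ge_zero[of "s x"] by (simp del: norm_ge_zero)
  qed
qed measurable

lemma integrable_bounded_inner_score:
  assumes [measurable]: "\<zeta> \<in> borel_measurable \<mu>" and "\<And>x. \<bar>\<zeta> x\<bar> \<le> T"
  shows "integrable M\<^sub>0 (\<lambda>x. \<zeta> x * (u \<bullet> s x))"
proof (rule Bochner_Integration.integrable_bound)
  show "integrable M\<^sub>0 (\<lambda>x. T *\<^sub>R (u \<bullet> s x))" using integrable_score by auto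
  show "AE x in M\<^sub>0. norm (\<zeta> x * (u \<bullet> s x)) \<le> norm (T *\<^sub>R (u \<bullet> s x))"
    using order_trans[OF assms(2) abs_ge_self] by (intro AE_I2) (auto simp: abs_mult intro!: mult_right_mono)
qed measurable

text \<open>The expectation of a bounded statistic is differentiable at the true parameter, its
  derivative being the covariance with the score, uniformly over all statistics bounded by
  \<open>T\<close>. With root densities written as \<open>a = b + c + r\<close>, the error
  \<open>a\<^sup>2 - b\<^sup>2 - 2 * c * b\<close> equals
  \<open>2 * b * r + (c + r)\<^sup>2\<close>. The constant statistic shows that the score is
  centred; the truncated score gives the separation needed for the local test.\<close>

lemma mean_shift:
  assumes \<eta>: "\<eta> > 0"
  shows "\<exists>\<delta>>0. \<forall>u. norm u < \<delta> \<longrightarrow> \<theta>\<^sub>0 + u \<in> \<Theta> \<and> (\<forall>\<zeta> T. \<zeta> \<in> borel_measurable \<mu> \<longrightarrow> (\<forall>x. \<bar>\<zeta> x\<bar> \<le> T) \<longrightarrow>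
      \<bar>(\<integral>x. \<zeta> x \<partial>P (\<theta>\<^sub>0 + u)) - (\<integral>x. \<zeta> x \<partial>M\<^sub>0) - (\<integral>x. \<zeta> x * (u \<bullet> s x) \<partial>M\<^sub>0)\<bar> \<le> T * (\<eta> * norm u))"
proof -
  \<comment> \<open>The cross term is split with weight \<open>k = \<eta> * norm u / 4\<close>: it
    costs \<open>k\<close> plus \<open>1 / k\<close> times the squared remainder, and the bound
    \<open>\<eta>\<^sup>2 / 16\<close> makes the latter at most \<open>\<eta> * norm u / 4\<close>
    again. The bound \<open>\<eta> / 16\<close> and the radius \<open>\<epsilon>\<close> below take
    care of the purely quadratic terms.\<close>
  define \<eta>' where "\<eta>' = min (\<eta>\<^sup>2 / 16) (\<eta> / 16)"
  have \<eta>': "\<eta>' > 0" "\<eta>' \<le> \<eta>\<^sup>2 / 16" "\<eta>' \<le> \<eta> / 16" using \<eta> by (auto simp: \<eta>'_def)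
  obtain \<delta> where \<delta>: "\<delta> > 0" "\<And>u. norm u < \<delta> \<Longrightarrow> \<theta>\<^sub>0 + u \<in> \<Theta>"
    "\<And>u. norm u < \<delta> \<Longrightarrow> integrable \<mu> (\<lambda>x. (rem u x)\<^sup>2)"
    "\<And>u. norm u < \<delta> \<Longrightarrow> (\<integral>x. (rem u x)\<^sup>2 \<partial>\<mu>) \<le> \<eta>' * (norm u)\<^sup>2"
    using rem_small[OF \<eta>'(1)] by metis
  define \<epsilon> where "\<epsilon> = Min {\<delta>, 1, \<eta> / (2 * V + 1)}"
  have V1: "2 * V + 1 > 0" using V_nonneg by simp
  have \<epsilon>: "\<epsilon> > 0" "\<epsilon> \<le> \<delta>" "\<epsilon> \<le> 1" "\<epsilon> \<le> \<eta> / (2 * V + 1)" using \<delta>(1) \<eta> V1 by (auto simp: \<epsilon>_def)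
  show ?thesis
  proof (rule exI[of _ \<epsilon>], intro conjI allI impI \<epsilon>(1))
    show "\<theta>\<^sub>0 + u \<in> \<Theta>" if "norm u < \<epsilon>" for u using \<delta>(2)[of u] that \<epsilon>(2) by simp
    fix u :: "real^'d" and \<zeta> :: "'x \<Rightarrow> real" and T
    assume u: "norm u < \<epsilon>" and \<zeta> [measurable]: "\<zeta> \<in> borel_measurable \<mu>" and T': "\<forall>x. \<bar>\<zeta> x\<bar> \<le> T"
    have T: "\<bar>\<zeta> x\<bar> \<le> T" for x using T' by blast
    have T0: "T \<ge> 0" using T[of undefined] by linarith
    have uT: "\<theta>\<^sub>0 + u \<in> \<Theta>" using \<delta>(2)[of u] u \<epsilon>(2) by simp
    have ir: "integrable \<mu> (\<lambda>x. (rem u x)\<^sup>2)" "(\<integral>x. (rem u x)\<^sup>2 \<partial>\<mu>) \<le> \<eta>' * (norm u)\<^sup>2"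
      using \<delta>(3,4)[of u] u \<epsilon>(2) by auto
    have bint: "integrable (P \<theta>) \<zeta>" if "\<theta> \<in> \<Theta>" for \<theta>
    proof -
      interpret T: prob_space "P \<theta>" by (rule prob_P[OF that])
      show ?thesis using T \<zeta> sets_P[OF that] by (intro T.integrable_const_bound[of _ T]) (auto cong: measurable_cong_sets)
    qed
    show "\<bar>(\<integral>x. \<zeta> x \<partial>P (\<theta>\<^sub>0 + u)) - (\<integral>x. \<zeta> x \<partial>M\<^sub>0) - (\<integral>x. \<zeta> x * (u \<bullet> s x) \<partial>M\<^sub>0)\<bar> \<le> T * (\<eta> * norm u)"
    proof (cases "u = 0")
      case True then show ?thesis by simp
    next
      case False
      define k where "k = \<eta> * norm u / 4"
      have k: "k > 0" using \<eta> False by (simp add: k_def)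
      let ?a = "\<lambda>x. dens (\<theta>\<^sub>0 + u) x * \<zeta> x" and ?b = "\<lambda>x. dens \<theta>\<^sub>0 x * \<zeta> x"
      let ?c = "\<lambda>x. dens \<theta>\<^sub>0 x * (\<zeta> x * (u \<bullet> s x))"
      have ia: "integrable \<mu> ?a" using bint[OF uT] by (subst (asm) integrable_P_iff[OF uT]) auto
      have ib: "integrable \<mu> ?b" using bint[OF \<theta>0_in] by (subst (asm) integrable_P_iff[OF \<theta>0_in]) auto
      have ic: "integrable \<mu> ?c"
        using integrable_bounded_inner_score[OF \<zeta> T, of u] by (subst (asm) integrable_P_iff[OF \<theta>0_in]) auto
      have id: "integrable \<mu> (\<lambda>x. dens \<theta>\<^sub>0 x * (u \<bullet> s x)\<^sup>2)"
        using integrable_inner_score_sq[of u] by (subst (asm) integrable_P_iff[OF \<theta>0_in]) auto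
      let ?U = "\<lambda>x. T * (k * dens \<theta>\<^sub>0 x + (1 / k + 2) * (rem u x)\<^sup>2 + 1/2 * (dens \<theta>\<^sub>0 x * (u \<bullet> s x)\<^sup>2))"
      have "\<bar>(\<integral>x. \<zeta> x \<partial>P (\<theta>\<^sub>0 + u)) - (\<integral>x. \<zeta> x \<partial>M\<^sub>0) - (\<integral>x. \<zeta> x * (u \<bullet> s x) \<partial>M\<^sub>0)\<bar>
        = \<bar>\<integral>x. ?a x - ?b x - ?c x \<partial>\<mu>\<bar>"
        using ia ib ic by (simp add: integral_P uT \<theta>0_in)
      also have "\<dots> \<le> (\<integral>x. \<bar>?a x - ?b x - ?c x\<bar> \<partial>\<mu>)" by (rule integral_abs_bound)
      also have "\<dots> \<le> (\<integral>x. ?U x \<partial>\<mu>)"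
      proof (rule integral_mono)
        show "integrable \<mu> (\<lambda>x. \<bar>?a x - ?b x - ?c x\<bar>)" using ia ib ic by simp
        show "integrable \<mu> ?U" using ir(1) id integrable_dens[OF \<theta>0_in] by simp
        fix x
        define a b r c where "a = sqrt (dens (\<theta>\<^sub>0 + u) x)" and "b = sqrt (dens \<theta>\<^sub>0 x)" and "r = rem u x"
          and "c = 1/2 * (u \<bullet> s x) * b"
        have ar: "a = b + c + r" by (simp add: r_def rem_def a_def b_def c_def)
        have sq: "dens (\<theta>\<^sub>0 + u) x = a\<^sup>2" "dens \<theta>\<^sub>0 x = b\<^sup>2" by (auto simp: a_def b_def)
        have "?a x - ?b x - ?c x = \<zeta> x * (a\<^sup>2 - b\<^sup>2 - 2 * c * b)"
          unfolding sq c_def by (simp add: power2_eq_square algebra_simps)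
        also have "a\<^sup>2 - b\<^sup>2 - 2 * c * b = 2 * b * r + (c + r)\<^sup>2"
          unfolding ar by (simp add: power2_eq_square algebra_simps)
        finally have "\<bar>?a x - ?b x - ?c x\<bar> = \<bar>\<zeta> x\<bar> * \<bar>2 * b * r + (c + r)\<^sup>2\<bar>" by (simp add: abs_mult)
        also have "\<dots> \<le> T * (k * b\<^sup>2 + (1 / k + 2) * r\<^sup>2 + 2 * c\<^sup>2)"
        proof (rule mult_mono[OF T _ T0])
          have "\<bar>2 * b * r\<bar> = 2 * (sqrt k * \<bar>b\<bar>) * (\<bar>r\<bar> / sqrt k)" using k by (simp add: abs_mult)
          also have "\<dots> \<le> (sqrt k * \<bar>b\<bar>)\<^sup>2 + (\<bar>r\<bar> / sqrt k)\<^sup>2" by (rule sum_squares_bound)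
          also have "\<dots> = k * b\<^sup>2 + 1 / k * r\<^sup>2" using k by (simp add: power_mult_distrib power_divide)
          finally have 1: "\<bar>2 * b * r\<bar> \<le> k * b\<^sup>2 + 1 / k * r\<^sup>2" .
          have "0 \<le> (c - r)\<^sup>2" by simp
          then have "(c + r)\<^sup>2 \<le> 2 * c\<^sup>2 + 2 * r\<^sup>2" by (simp add: power2_eq_square algebra_simps)
          with 1 have "\<bar>2 * b * r + (c + r)\<^sup>2\<bar> \<le> k * b\<^sup>2 + 1 / k * r\<^sup>2 + (2 * c\<^sup>2 + 2 * r\<^sup>2)"
            using zero_le_power2[of "c + r"] by linarith
          then show "\<bar>2 * b * r + (c + r)\<^sup>2\<bar> \<le> k * b\<^sup>2 + (1 / k + 2) * r\<^sup>2 + 2 * c\<^sup>2"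
            by (simp add: algebra_simps)
        qed simp
        also have "\<dots> = ?U x" unfolding sq r_def c_def by (simp add: power2_eq_square)
        finally show "\<bar>?a x - ?b x - ?c x\<bar> \<le> ?U x" .
      qed
      also have "\<dots> = T * (k + (1 / k + 2) * (\<integral>x. (rem u x)\<^sup>2 \<partial>\<mu>) + 1/2 * (\<integral>x. (u \<bullet> s x)\<^sup>2 \<partial>M\<^sub>0))"
        using ir(1) id integrable_dens[OF \<theta>0_in] integral_dens[OF \<theta>0_in] by (simp add: integral_P \<theta>0_in)
      also have "\<dots> \<le> T * (\<eta> * norm u)"
      proof (rule mult_left_mono[OF _ T0])
        let ?n = "norm u"
        have n: "?n > 0" "?n \<le> 1" "?n * (2 * V + 1) \<le> \<eta>"
        proof -
          show "?n > 0" "?n \<le> 1" using False u \<epsilon>(3) by auto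
          have "?n * (2 * V + 1) \<le> \<epsilon> * (2 * V + 1)" using u V1 by (intro mult_right_mono) auto
          also have "\<dots> \<le> \<eta>" using \<epsilon>(4) V1 by (simp add: pos_le_divide_eq)
          finally show "?n * (2 * V + 1) \<le> \<eta>" .
        qed
        have "1 / k * (\<integral>x. (rem u x)\<^sup>2 \<partial>\<mu>) \<le> 1 / k * (\<eta>\<^sup>2 / 16 * ?n\<^sup>2)"
          using k order_trans[OF ir(2) mult_right_mono[OF \<eta>'(2)]] by (intro mult_left_mono) auto
        also have "\<dots> = \<eta> * ?n / 4" using \<eta> n by (simp add: k_def power2_eq_square field_simps)
        finally have 1: "1 / k * (\<integral>x. (rem u x)\<^sup>2 \<partial>\<mu>) \<le> \<eta> * ?n / 4" .
        have "(\<integral>x. (rem u x)\<^sup>2 \<partial>\<mu>) \<le> \<eta> / 16 * ?n\<^sup>2"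
          using order_trans[OF ir(2) mult_right_mono[OF \<eta>'(3)]] by simp
        also have "\<dots> \<le> \<eta> / 16 * ?n" using n \<eta> by (intro mult_left_mono) (auto simp: power2_eq_square mult_le_cancel_left1)
        finally have 2: "2 * (\<integral>x. (rem u x)\<^sup>2 \<partial>\<mu>) \<le> \<eta> * ?n / 8" by simp
        have "(\<integral>x. (u \<bullet> s x)\<^sup>2 \<partial>M\<^sub>0) \<le> ?n * (?n * V)"
          using inner_score_sq_le[of u] by (simp add: power2_eq_square mult.assoc)
        also have "\<dots> \<le> ?n * (\<eta> / 2)"
        proof (rule mult_left_mono)
          have "?n * (2 * V) + ?n \<le> \<eta>" using n(3) by (simp add: algebra_simps)
          then show "?n * V \<le> \<eta> / 2" using n(1) by linarith
        qed (use n in auto)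
        finally have 3: "1/2 * (\<integral>x. (u \<bullet> s x)\<^sup>2 \<partial>M\<^sub>0) \<le> \<eta> * ?n / 4" by (simp add: mult.commute)
        have "(1 / k + 2) * (\<integral>x. (rem u x)\<^sup>2 \<partial>\<mu>) = 1 / k * (\<integral>x. (rem u x)\<^sup>2 \<partial>\<mu>) + 2 * (\<integral>x. (rem u x)\<^sup>2 \<partial>\<mu>)"
          by (simp add: algebra_simps)
        with 1 2 3 have "k + (1 / k + 2) * (\<integral>x. (rem u x)\<^sup>2 \<partial>\<mu>) + 1/2 * (\<integral>x. (u \<bullet> s x)\<^sup>2 \<partial>M\<^sub>0)
          \<le> \<eta> * ?n / 4 + (\<eta> * ?n / 4 + \<eta> * ?n / 8) + \<eta> * ?n / 4" unfolding k_def by linarith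
        also have "\<dots> \<le> \<eta> * ?n" using \<eta> n(1) by simp
        finally show "k + (1 / k + 2) * (\<integral>x. (rem u x)\<^sup>2 \<partial>\<mu>) + 1/2 * (\<integral>x. (u \<bullet> s x)\<^sup>2 \<partial>M\<^sub>0) \<le> \<eta> * ?n" .
      qed
      finally show ?thesis .
    qed
  qed
qed

text \<open>For the statistic constantly 1 the two probabilities in \<open>mean_shift\<close>
  cancel, so the linear term alone is of smaller order than the increment and must vanish.\<close>

lemma score_mean_zero: "(\<integral>x. u \<bullet> s x \<partial>M\<^sub>0) = 0"
proof -
  have bd: "\<bar>\<integral>x. u \<bullet> s x \<partial>M\<^sub>0\<bar> \<le> e" if e: "e > 0" for e
  proof -
    define \<eta> where "\<eta> = e / (norm u + 1)"
    have n1: "norm u + 1 > 0" by (smt (verit) norm_ge_zero)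
  have lt: "norm u / (2 * (norm u + 1)) < 1" 
  proof -
    have "norm u < 2 * (norm u + 1)" using n1 by argo
    moreover have "2 * (norm u + 1) > 0" using n1 by argo
    ultimately show ?thesis by (metis divide_less_eq_1_pos)
  qed
    have \<eta>: "\<eta> > 0" using e n1 by (simp add: \<eta>_def)
    obtain \<delta> where \<delta>: "\<delta> > 0" "\<And>u. norm u < \<delta> \<Longrightarrow> \<theta>\<^sub>0 + u \<in> \<Theta>"
    "\<And>u \<zeta> T. norm u < \<delta> \<Longrightarrow> \<zeta> \<in> borel_measurable \<mu> \<Longrightarrow> \<forall>x. \<bar>\<zeta> x\<bar> \<le> T \<Longrightarrow>
      \<bar>(\<integral>x. \<zeta> x \<partial>P (\<theta>\<^sub>0 + u)) - (\<integral>x. \<zeta> x \<partial>M\<^sub>0) - (\<integral>x. \<zeta> x * (u \<bullet> s x) \<partial>M\<^sub>0)\<bar> \<le> T * (\<eta> * norm u)"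
      using mean_shift[OF \<eta>] by blast
    define t where "t = \<delta> / (2 * (norm u + 1))"
    have t: "t > 0" unfolding t_def using \<delta>(1) n1 by simp
    have tu: "norm (t *\<^sub>R u) < \<delta>"
    proof -
      have "norm (t *\<^sub>R u) = t * norm u" using t by simp
      also have "\<dots> = \<delta> * (norm u / (2 * (norm u + 1)))" by (simp add: t_def)
      also have "\<dots> < \<delta> * 1" using \<delta>(1) lt by (intro mult_strict_left_mono)
      finally show ?thesis by simp
    qed
    have "\<bar>(\<integral>x. 1 \<partial>P (\<theta>\<^sub>0 + t *\<^sub>R u)) - (\<integral>x. 1 \<partial>M\<^sub>0) - (\<integral>x. 1 * (t *\<^sub>R u \<bullet> s x) \<partial>M\<^sub>0)\<bar> \<le> 1 * (\<eta> * norm (t *\<^sub>R u))"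
      by (rule \<delta>(3)[OF tu]) auto
    then have "t * \<bar>\<integral>x. u \<bullet> s x \<partial>M\<^sub>0\<bar> \<le> t * (\<eta> * norm u)"
      using prob_space.prob_space[OF prob_P[OF \<delta>(2)[OF tu]]] M0.prob_space t by (simp add: abs_mult ac_simps)
    then have "\<bar>\<integral>x. u \<bullet> s x \<partial>M\<^sub>0\<bar> \<le> \<eta> * norm u" using t by simp
    also have "\<dots> \<le> e" using n1 e unfolding \<eta>_def by (simp add: field_simps)
    finally show ?thesis .
  qed
  show ?thesis
  proof (rule ccontr)
    assume "(\<integral>x. u \<bullet> s x \<partial>M\<^sub>0) \<noteq> 0"
    then have "\<bar>\<integral>x. u \<bullet> s x \<partial>M\<^sub>0\<bar> / 2 > 0" by simp
    from bd[OF this] this show False by linarith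
  qed
qed

section \<open>Fisher information as a positive definite form\<close>

abbreviation "FI \<equiv> fisher_information M\<^sub>0 s"

lemma integrable_score_prod: "integrable M\<^sub>0 (\<lambda>x. s x $ i * s x $ j)"
proof (rule Bochner_Integration.integrable_bound[OF integrable_score_sq])
  show "AE x in M\<^sub>0. norm (s x $ i * s x $ j) \<le> norm ((norm (s x))\<^sup>2)"
    by (intro AE_I2) (auto simp: abs_mult power2_eq_square intro!: mult_mono component_le_norm_cart)
qed measurable

lemma fisher_vec: "(FI *v u) $ i = (\<integral>x. s x $ i * (u \<bullet> s x) \<partial>M\<^sub>0)"
proof -
  have "(\<integral>x. s x $ i * (u \<bullet> s x) \<partial>M\<^sub>0) = (\<integral>x. (\<Sum>j\<in>UNIV. s x $ i * s x $ j * u $ j) \<partial>M\<^sub>0)"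
    by (intro Bochner_Integration.integral_cong) (auto simp: inner_vec_def sum_distrib_left ac_simps)
  also have "\<dots> = (\<Sum>j\<in>UNIV. (\<integral>x. s x $ i * s x $ j * u $ j \<partial>M\<^sub>0))"
    by (intro Bochner_Integration.integral_sum integrable_mult_left integrable_score_prod)
  also have "\<dots> = (FI *v u) $ i"
    by (simp add: matrix_vector_mult_def fisher_information_def)
  finally show ?thesis by simp
qed

lemma fisher_quadratic: "u \<bullet> (FI *v u) = (\<integral>x. (u \<bullet> s x)\<^sup>2 \<partial>M\<^sub>0)"
proof -
  have I: "integrable M\<^sub>0 (\<lambda>x. s x $ i * (u \<bullet> s x))" for i
  proof -
    have "(\<lambda>x. s x $ i * (u \<bullet> s x)) = (\<lambda>x. \<Sum>j\<in>UNIV. s x $ i * s x $ j * u $ j)"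
      by (auto simp: inner_vec_def sum_distrib_left ac_simps)
    then show ?thesis by (simp add: integrable_score_prod)
  qed
  have "u \<bullet> (FI *v u) = (\<Sum>i\<in>UNIV. u $ i * (\<integral>x. s x $ i * (u \<bullet> s x) \<partial>M\<^sub>0))"
    by (simp add: inner_vec_def fisher_vec)
  also have "\<dots> = (\<Sum>i\<in>UNIV. (\<integral>x. u $ i * (s x $ i * (u \<bullet> s x)) \<partial>M\<^sub>0))" by simp
  also have "\<dots> = (\<integral>x. (\<Sum>i\<in>UNIV. u $ i * (s x $ i * (u \<bullet> s x))) \<partial>M\<^sub>0)"
    by (intro Bochner_Integration.integral_sum[symmetric] integrable_mult_right I)
  also have "\<dots> = (\<integral>x. (u \<bullet> s x)\<^sup>2 \<partial>M\<^sub>0)"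
    by (intro Bochner_Integration.integral_cong refl) (simp add: power2_eq_square inner_vec_def sum_distrib_right mult.assoc)
  finally show ?thesis .
qed

lemma fisher_symmetric: "transpose FI = FI"
  by (simp add: transpose_def fisher_information_def vec_eq_iff mult.commute)

text \<open>If the quadratic form vanishes at \<open>u\<close>, then \<open>u \<bullet> s x\<close>
  is zero almost surely, hence \<open>FI *v u = 0\<close> and \<open>u = 0\<close> by invertibility.
  Compactness of the unit sphere and homogeneity turn strict positivity into the constant
  \<open>l\<close>.\<close>

lemma fisher_pos_def:
  assumes "invertible FI"
  obtains l where "l > 0" "\<And>u. l * (norm u)\<^sup>2 \<le> u \<bullet> (FI *v u)"
proof -
  obtain N where N: "N ** FI = mat 1" using assms by (auto simp: invertible_def)
  have pos: "u \<bullet> (FI *v u) > 0" if "u \<noteq> 0" for u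
  proof (rule ccontr)
    assume "\<not> u \<bullet> (FI *v u) > 0"
    then have "(\<integral>x. (u \<bullet> s x)\<^sup>2 \<partial>M\<^sub>0) \<le> 0" by (simp add: fisher_quadratic)
    moreover have "(\<integral>x. (u \<bullet> s x)\<^sup>2 \<partial>M\<^sub>0) \<ge> 0" by simp
    ultimately have "AE x in M\<^sub>0. (u \<bullet> s x)\<^sup>2 = 0"
      using integral_nonneg_eq_0_iff_AE[OF integrable_inner_score_sq[of u]] by simp
    then have "(FI *v u) $ i = 0" for i
      unfolding fisher_vec by (intro integral_eq_zero_AE) (auto elim: eventually_mono)
    then have "FI *v u = 0" by (simp add: vec_eq_iff)
    then have "N *v (FI *v u) = 0" by simp
    then have "u = 0" using N by (simp add: matrix_vector_mul_assoc)
    then show False using that by simp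
  qed
  have "compact (sphere (0::real^'d) 1)" by simp
  moreover have "sphere (0::real^'d) 1 \<noteq> {}" by simp
  moreover have "continuous_on (sphere 0 1) (\<lambda>u. u \<bullet> (FI *v u))"
    by (intro continuous_intros linear_continuous_on linear_linear[THEN iffD2]) auto
  ultimately have "\<exists>w\<in>sphere 0 1. \<forall>u\<in>sphere 0 1. w \<bullet> (FI *v w) \<le> u \<bullet> (FI *v u)"
    by (rule continuous_attains_inf)
  then obtain w where w: "w \<in> sphere 0 1" "\<And>u. u \<in> sphere 0 1 \<Longrightarrow> w \<bullet> (FI *v w) \<le> u \<bullet> (FI *v u)"
    by blast
  show ?thesis
  proof (rule that[of "w \<bullet> (FI *v w)"])
    show "w \<bullet> (FI *v w) > 0" using pos[of w] w(1) by (cases "w = 0") auto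
    fix u :: "real^'d"
    show "w \<bullet> (FI *v w) * (norm u)\<^sup>2 \<le> u \<bullet> (FI *v u)"
    proof (cases "u = 0")
      case False
      define v where "v = (1 / norm u) *\<^sub>R u"
      have "v \<in> sphere 0 1" using False by (simp add: v_def)
      from w(2)[OF this] have "(w \<bullet> (FI *v w)) * (norm u)\<^sup>2 \<le> (v \<bullet> (FI *v v)) * (norm u)\<^sup>2"
        by (intro mult_right_mono) auto
      also have "\<dots> = u \<bullet> (FI *v u)"
        using False by (simp add: v_def matrix_vector_mult_scaleR power2_eq_square)
      finally show ?thesis .
    qed simp
  qed
qed

end

section \<open>Local asymptotic normality\<close>

context dqm_model
begin

abbreviation "N n \<equiv> sample_law n \<mu>"
abbreviation "Pn n \<theta> \<equiv> sample_law n (P \<theta>)"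
abbreviation "P0 n \<equiv> sample_law n M\<^sub>0"

text \<open>Large scores are discarded, not rescaled. Therefore
  \<open>(v \<bullet> trunc T x) * (v \<bullet> s x)\<close> is the square of
  \<open>v \<bullet> trunc T x\<close>, so the derivative of the mean of the truncated score in its
  own direction is a second moment and has a sign.\<close>

definition trunc :: "real \<Rightarrow> 'x \<Rightarrow> real^'d" where
  "trunc T x = (if norm (s x) \<le> T then s x else 0)"

text \<open>
  The truncated score is centred, hence \<open>Del n\<close> is bounded for each \<open>n\<close> and has mean zero; it differs from
  the usual normalized score by a term that vanishes in mean square.
\<close>

definition \<psi> :: "nat \<Rightarrow> 'x \<Rightarrow> real^'d" where
  "\<psi> n x = trunc (real n powr (1/8)) x - (\<integral>y. trunc (real n powr (1/8)) y \<partial>M\<^sub>0)"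

definition Del :: "nat \<Rightarrow> (nat \<Rightarrow> 'x) \<Rightarrow> real^'d" where
  "Del n x = (1 / sqrt n) *\<^sub>R (\<Sum>i<n. \<psi> n (x i))"

text \<open>The density of the normal law with mean \<open>FI *v h\<close> and covariance
  \<open>FI\<close> relative to the centred one, evaluated at \<open>Del n x\<close>.\<close>

definition lik :: "nat \<Rightarrow> real^'d \<Rightarrow> (nat \<Rightarrow> 'x) \<Rightarrow> real" where
  "lik n h x = exp (h \<bullet> Del n x - h \<bullet> (FI *v h) / 2)"

lemma trunc_measurable [measurable]: "trunc T \<in> borel_measurable \<mu>"
  unfolding trunc_def by measurable

lemma norm_trunc: "T \<ge> 0 \<Longrightarrow> norm (trunc T x) \<le> T"
  by (simp add: trunc_def)

lemma norm_trunc_le: "norm (trunc T x) \<le> norm (s x)"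
  by (simp add: trunc_def)

lemma integrable_trunc: "integrable M\<^sub>0 (trunc T)"
  by (rule Bochner_Integration.integrable_bound[OF integrable_score]) (auto simp: norm_trunc_le)

lemma trunc_tendsto: "(\<lambda>n. trunc (real n powr (1/8)) x) \<longlonglongrightarrow> s x"
proof -
  have "filterlim (\<lambda>n. real n powr (1/8)) at_top sequentially" by real_asymp
  then have "\<forall>\<^sub>F n in sequentially. norm (s x) \<le> real n powr (1/8)"
    by (simp add: filterlim_at_top)
  then have "\<forall>\<^sub>F n in sequentially. s x = trunc (real n powr (1/8)) x"
    by eventually_elim (simp add: trunc_def)
  then show ?thesis by (rule Lim_transform_eventually[OF tendsto_const])
qed

lemma integral_score_zero: "(\<integral>x. s x \<partial>M\<^sub>0) = 0"
proof -
  have "u \<bullet> (\<integral>x. s x \<partial>M\<^sub>0) = 0" for u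
    using score_mean_zero[of u] integrable_score by simp
  from this[of "\<integral>x. s x \<partial>M\<^sub>0"] show ?thesis by simp
qed

lemma mean_trunc_tendsto: "(\<lambda>n. \<integral>x. trunc (real n powr (1/8)) x \<partial>M\<^sub>0) \<longlonglongrightarrow> 0"
proof -
  have "(\<lambda>n. \<integral>x. trunc (real n powr (1/8)) x \<partial>M\<^sub>0) \<longlonglongrightarrow> (\<integral>x. s x \<partial>M\<^sub>0)"
    by (rule integral_dominated_convergence[where w = "\<lambda>x. norm (s x)"])
       (use integrable_score in \<open>auto simp: norm_trunc_le trunc_tendsto\<close>)
  then show ?thesis by (simp add: integral_score_zero)
qed

lemma \<psi>_measurable [measurable]: "\<psi> n \<in> borel_measurable \<mu>"
  unfolding \<psi>_def by measurable

lemma norm_\<psi>: "norm (\<psi> n x) \<le> 2 * real n powr (1/8)"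
proof -
  have "norm (\<integral>y. trunc (real n powr (1/8)) y \<partial>M\<^sub>0) \<le> (\<integral>y. real n powr (1/8) \<partial>M\<^sub>0)"
    by (rule order_trans[OF integral_norm_bound integral_mono])
       (auto intro!: norm_trunc integrable_trunc integrable_norm)
  then have "norm (\<integral>y. trunc (real n powr (1/8)) y \<partial>M\<^sub>0) \<le> real n powr (1/8)"
    using M0.prob_space by simp
  then show ?thesis
    unfolding \<psi>_def using norm_trunc[of "real n powr (1/8)" x]
    by (intro order_trans[OF norm_triangle_ineq4]) auto
qed

lemma integrable_\<psi>: "integrable M\<^sub>0 (\<psi> n)"
  unfolding \<psi>_def using integrable_trunc by simp

lemma mean_\<psi>: "(\<integral>x. h \<bullet> \<psi> n x \<partial>M\<^sub>0) = 0"
proof -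
  have "(\<integral>x. \<psi> n x \<partial>M\<^sub>0) = 0" unfolding \<psi>_def using integrable_trunc M0.prob_space by simp
  then show ?thesis using integrable_\<psi>[of n] by simp
qed

lemma integrable_inner_trunc_sq: "integrable M\<^sub>0 (\<lambda>x. (h \<bullet> trunc T x)\<^sup>2)"
proof (rule Bochner_Integration.integrable_bound[OF integrable_inner_score_sq[of h]])
  show "AE x in M\<^sub>0. norm ((h \<bullet> trunc T x)\<^sup>2) \<le> norm ((h \<bullet> s x)\<^sup>2)"
    by (auto simp: trunc_def)
qed measurable

lemma variance_\<psi>:
  "integrable M\<^sub>0 (\<lambda>x. (h \<bullet> \<psi> n x)\<^sup>2)"
  "(\<integral>x. (h \<bullet> \<psi> n x)\<^sup>2 \<partial>M\<^sub>0) = (\<integral>x. (h \<bullet> trunc (real n powr (1/8)) x)\<^sup>2 \<partial>M\<^sub>0)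
     - (h \<bullet> (\<integral>x. trunc (real n powr (1/8)) x \<partial>M\<^sub>0))\<^sup>2"
proof -
  let ?m = "\<integral>x. trunc (real n powr (1/8)) x \<partial>M\<^sub>0"
  have *: "(h \<bullet> \<psi> n x)\<^sup>2 = (h \<bullet> trunc (real n powr (1/8)) x)\<^sup>2 - 2 * (h \<bullet> ?m) * (h \<bullet> trunc (real n powr (1/8)) x) + (h \<bullet> ?m)\<^sup>2" for x
    by (simp add: \<psi>_def inner_diff_right power2_eq_square algebra_simps)
  show "integrable M\<^sub>0 (\<lambda>x. (h \<bullet> \<psi> n x)\<^sup>2)"
    unfolding * using integrable_inner_trunc_sq integrable_trunc by auto
  show "(\<integral>x. (h \<bullet> \<psi> n x)\<^sup>2 \<partial>M\<^sub>0) = (\<integral>x. (h \<bullet> trunc (real n powr (1/8)) x)\<^sup>2 \<partial>M\<^sub>0) - (h \<bullet> ?m)\<^sup>2"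
    unfolding * using integrable_inner_trunc_sq integrable_trunc M0.prob_space
    by (simp add: power2_eq_square)
qed

lemma variance_\<psi>_le: "(\<integral>x. (h \<bullet> \<psi> n x)\<^sup>2 \<partial>M\<^sub>0) \<le> (norm h)\<^sup>2 * V"
proof -
  have "(\<integral>x. (h \<bullet> \<psi> n x)\<^sup>2 \<partial>M\<^sub>0) \<le> (\<integral>x. (h \<bullet> trunc (real n powr (1/8)) x)\<^sup>2 \<partial>M\<^sub>0)"
    unfolding variance_\<psi>(2) by simp
  also have "\<dots> \<le> (\<integral>x. (h \<bullet> s x)\<^sup>2 \<partial>M\<^sub>0)"
    by (intro integral_mono integrable_inner_trunc_sq integrable_inner_score_sq) (auto simp: trunc_def)
  also have "\<dots> \<le> (norm h)\<^sup>2 * V" by (rule inner_score_sq_le)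
  finally show ?thesis .
qed

lemma variance_\<psi>_tendsto: "(\<lambda>n. \<integral>x. (h \<bullet> \<psi> n x)\<^sup>2 \<partial>M\<^sub>0) \<longlonglongrightarrow> h \<bullet> (FI *v h)"
proof -
  have "(\<lambda>n. \<integral>x. (h \<bullet> trunc (real n powr (1/8)) x)\<^sup>2 \<partial>M\<^sub>0) \<longlonglongrightarrow> (\<integral>x. (h \<bullet> s x)\<^sup>2 \<partial>M\<^sub>0)"
  proof (rule integral_dominated_convergence[where w = "\<lambda>x. (h \<bullet> s x)\<^sup>2"])
    show "AE x in M\<^sub>0. (\<lambda>n. (h \<bullet> trunc (real n powr (1/8)) x)\<^sup>2) \<longlonglongrightarrow> (h \<bullet> s x)\<^sup>2"
      by (intro AE_I2 tendsto_intros trunc_tendsto)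
    show "AE x in M\<^sub>0. norm ((h \<bullet> trunc (real n powr (1/8)) x)\<^sup>2) \<le> (h \<bullet> s x)\<^sup>2" for n
      by (auto simp: trunc_def)
  qed (use integrable_inner_score_sq in auto)
  moreover have "(\<lambda>n. (h \<bullet> (\<integral>x. trunc (real n powr (1/8)) x \<partial>M\<^sub>0))\<^sup>2) \<longlonglongrightarrow> (h \<bullet> 0)\<^sup>2"
    by (intro tendsto_intros mean_trunc_tendsto)
  ultimately have "(\<lambda>n. \<integral>x. (h \<bullet> \<psi> n x)\<^sup>2 \<partial>M\<^sub>0) \<longlonglongrightarrow> (\<integral>x. (h \<bullet> s x)\<^sup>2 \<partial>M\<^sub>0) - (h \<bullet> 0)\<^sup>2"
    unfolding variance_\<psi>(2) by (rule tendsto_diff)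
  then show ?thesis unfolding fisher_quadratic by simp
qed

lemma \<psi>_approx: "(\<lambda>n. \<integral>x. (h \<bullet> (s x - \<psi> n x))\<^sup>2 \<partial>M\<^sub>0) \<longlonglongrightarrow> 0"
  and integrable_\<psi>_approx: "integrable M\<^sub>0 (\<lambda>x. (h \<bullet> (s x - \<psi> n x))\<^sup>2)"
proof -
  let ?m = "\<lambda>n. \<integral>x. trunc (real n powr (1/8)) x \<partial>M\<^sub>0"
  let ?d = "\<lambda>n x. s x - trunc (real n powr (1/8)) x"
  have id1: "integrable M\<^sub>0 (\<lambda>x. (h \<bullet> ?d n x)\<^sup>2)" for n
    by (rule Bochner_Integration.integrable_bound[OF integrable_inner_score_sq[of h]]) (auto simp: trunc_def)
  have "(\<lambda>n. \<integral>x. (h \<bullet> ?d n x)\<^sup>2 \<partial>M\<^sub>0) \<longlonglongrightarrow> (\<integral>x. 0 \<partial>M\<^sub>0)"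
  proof (rule integral_dominated_convergence[where w = "\<lambda>x. (h \<bullet> s x)\<^sup>2"])
    have "(\<lambda>n. (h \<bullet> ?d n x)\<^sup>2) \<longlonglongrightarrow> (h \<bullet> (s x - s x))\<^sup>2" for x
      by (intro tendsto_intros trunc_tendsto)
    then show "AE x in M\<^sub>0. (\<lambda>n. (h \<bullet> ?d n x)\<^sup>2) \<longlonglongrightarrow> 0" by simp
    show "AE x in M\<^sub>0. norm ((h \<bullet> ?d n x)\<^sup>2) \<le> (h \<bullet> s x)\<^sup>2" for n
      by (auto simp: trunc_def)
  qed (use integrable_inner_score_sq in auto)
  then have 1: "(\<lambda>n. \<integral>x. (h \<bullet> ?d n x)\<^sup>2 \<partial>M\<^sub>0) \<longlonglongrightarrow> 0" by simp
  have 2: "(\<lambda>n. (h \<bullet> ?m n)\<^sup>2) \<longlonglongrightarrow> (h \<bullet> 0)\<^sup>2"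
    by (intro tendsto_intros mean_trunc_tendsto)
  have le: "(h \<bullet> (s x - \<psi> n x))\<^sup>2 \<le> 2 * (h \<bullet> ?d n x)\<^sup>2 + 2 * (h \<bullet> ?m n)\<^sup>2" for x n
  proof -
    have e: "h \<bullet> (s x - \<psi> n x) = h \<bullet> ?d n x + h \<bullet> ?m n" by (simp add: \<psi>_def inner_diff_right)
    have "0 \<le> (h \<bullet> ?d n x - h \<bullet> ?m n)\<^sup>2" by simp
    then show ?thesis unfolding e by (simp add: power2_eq_square algebra_simps)
  qed
  show i: "integrable M\<^sub>0 (\<lambda>x. (h \<bullet> (s x - \<psi> n x))\<^sup>2)" for n
  proof (rule Bochner_Integration.integrable_bound)
    show "integrable M\<^sub>0 (\<lambda>x. 2 * (h \<bullet> ?d n x)\<^sup>2 + 2 * (h \<bullet> ?m n)\<^sup>2)" using id1[of n] by simp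
    show "AE x in M\<^sub>0. norm ((h \<bullet> (s x - \<psi> n x))\<^sup>2) \<le> norm (2 * (h \<bullet> ?d n x)\<^sup>2 + 2 * (h \<bullet> ?m n)\<^sup>2)"
      using le by auto
  qed measurable
  have up: "(\<integral>x. (h \<bullet> (s x - \<psi> n x))\<^sup>2 \<partial>M\<^sub>0) \<le> 2 * (\<integral>x. (h \<bullet> ?d n x)\<^sup>2 \<partial>M\<^sub>0) + 2 * (h \<bullet> ?m n)\<^sup>2" for n
  proof -
    have "(\<integral>x. (h \<bullet> (s x - \<psi> n x))\<^sup>2 \<partial>M\<^sub>0) \<le> (\<integral>x. 2 * (h \<bullet> ?d n x)\<^sup>2 + 2 * (h \<bullet> ?m n)\<^sup>2 \<partial>M\<^sub>0)"
      by (intro integral_mono i le) (use id1[of n] in simp)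
    then show ?thesis using id1[of n] M0.prob_space by simp
  qed
  have "(\<lambda>n. 2 * (\<integral>x. (h \<bullet> ?d n x)\<^sup>2 \<partial>M\<^sub>0) + 2 * (h \<bullet> ?m n)\<^sup>2) \<longlonglongrightarrow> 2 * 0 + 2 * (h \<bullet> 0)\<^sup>2"
    by (intro tendsto_intros 1 2)
  then have up0: "(\<lambda>n. 2 * (\<integral>x. (h \<bullet> ?d n x)\<^sup>2 \<partial>M\<^sub>0) + 2 * (h \<bullet> ?m n)\<^sup>2) \<longlonglongrightarrow> 0" by simp
  show "(\<lambda>n. \<integral>x. (h \<bullet> (s x - \<psi> n x))\<^sup>2 \<partial>M\<^sub>0) \<longlonglongrightarrow> 0"
    by (rule tendsto_sandwich[OF _ _ tendsto_const up0]) (use up in \<open>auto intro!: always_eventually\<close>)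
qed

text \<open>Uniform bound for one increment \<open>h \<bullet> \<psi> n x / sqrt n\<close> with
  \<open>norm h = c\<close>. It is of order \<open>n\<close> to the power -3/8, so \<open>n\<close>
  times its cube still vanishes.\<close>

definition bnd :: "real \<Rightarrow> nat \<Rightarrow> real" where
  "bnd c n = c * (2 * real n powr (1/8)) / sqrt n"

lemma bnd: "\<bar>h \<bullet> \<psi> n x / sqrt n\<bar> \<le> bnd (norm h) n"
proof -
  have "\<bar>h \<bullet> \<psi> n x\<bar> \<le> norm h * (2 * real n powr (1/8))"
    by (rule order_trans[OF Cauchy_Schwarz_ineq2]) (intro mult_left_mono norm_\<psi> norm_ge_zero)
  then show ?thesis unfolding bnd_def by (simp add: divide_right_mono)
qed

lemma bnd_tendsto: "(\<lambda>n. bnd c n) \<longlonglongrightarrow> 0" "(\<lambda>n. real n * bnd c n ^ 3) \<longlonglongrightarrow> 0"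
proof -
  show "(\<lambda>n. bnd c n) \<longlonglongrightarrow> 0" unfolding bnd_def by real_asymp
  have "(\<lambda>n. (8 * c ^ 3) * (real n * (real n powr (1/8) / sqrt n) ^ 3)) \<longlonglongrightarrow> (8 * c ^ 3) * 0"
    by (rule tendsto_mult_left) real_asymp
  then show "(\<lambda>n. real n * bnd c n ^ 3) \<longlonglongrightarrow> 0"
    by (simp add: bnd_def power_mult_distrib power_divide mult_ac)
qed

text \<open>Taylor expansion to second order: the linear term has mean zero because
  \<open>\<psi> n\<close> is centred, and the cubic remainder is absorbed by \<open>bnd\<close>. The
  complex argument serves two purposes: \<open>w = 1\<close> controls the mass of the approximating
  product density, and \<open>w = \<i>\<close> gives the characteristic function of
  \<open>Del n\<close>.\<close>

lemma exp_expansion: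
  fixes w :: complex
  shows "(\<lambda>n. of_nat n * ((\<integral>x. exp (w * of_real (h \<bullet> \<psi> n x / sqrt n)) \<partial>M\<^sub>0) - 1)) \<longlonglongrightarrow> w\<^sup>2 / 2 * of_real (h \<bullet> (FI *v h))"
proof -
  let ?y = "\<lambda>n x. h \<bullet> \<psi> n x / sqrt n"
  let ?b = "\<lambda>n. bnd (norm h) n"
  have g: "(\<lambda>n. w\<^sup>2 / 2 * of_real (\<integral>x. (h \<bullet> \<psi> n x)\<^sup>2 \<partial>M\<^sub>0)) \<longlonglongrightarrow> w\<^sup>2 / 2 * of_real (h \<bullet> (FI *v h))"
    by (intro tendsto_intros tendsto_of_real variance_\<psi>_tendsto)
  have e: "(\<lambda>n. exp 1 * norm w ^ 3 * (real n * ?b n ^ 3)) \<longlonglongrightarrow> exp 1 * norm w ^ 3 * 0"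
    by (intro tendsto_intros bnd_tendsto)
  have "(\<lambda>n. norm w * ?b n) \<longlonglongrightarrow> norm w * 0" by (intro tendsto_intros bnd_tendsto)
  then have "\<forall>\<^sub>F n in sequentially. norm w * ?b n < 1" by (intro order_tendstoD) auto
  then have ev: "\<forall>\<^sub>F n in sequentially. norm (of_nat n * ((\<integral>x. exp (w * of_real (?y n x)) \<partial>M\<^sub>0) - 1)
      - w\<^sup>2 / 2 * of_real (\<integral>x. (h \<bullet> \<psi> n x)\<^sup>2 \<partial>M\<^sub>0)) \<le> exp 1 * norm w ^ 3 * (real n * ?b n ^ 3)"
    using eventually_gt_at_top[of 0]
  proof eventually_elim
    case (elim n)
    have wy: "norm (w * of_real (?y n x)) \<le> norm w * ?b n" for x
    proof -
      have "norm (w * of_real (?y n x)) = norm w * \<bar>?y n x\<bar>" by (simp only: norm_mult norm_of_real)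
      also have "\<dots> \<le> norm w * ?b n" by (intro mult_left_mono bnd norm_ge_zero)
      finally show ?thesis .
    qed
    have ie: "integrable M\<^sub>0 (\<lambda>x. exp (w * complex_of_real (?y n x)))"
    proof (rule M0.integrable_const_bound[of _ "exp 1"])
      show "AE x in M\<^sub>0. norm (exp (w * complex_of_real (?y n x))) \<le> exp 1"
      proof (rule AE_I2)
        fix x
        have "Re (w * complex_of_real (?y n x)) \<le> 1"
          using complex_Re_le_cmod[of "w * complex_of_real (?y n x)"] wy[of x] elim(1) by linarith
        then show "norm (exp (w * complex_of_real (?y n x))) \<le> exp 1" by (simp add: norm_exp_eq_Re)
      qed
    qed measurable
    have iy: "integrable M\<^sub>0 (?y n)" using integrable_\<psi>[of n] by simp
    have iy2: "integrable M\<^sub>0 (\<lambda>x. (?y n x)\<^sup>2)" using variance_\<psi>(1)[of h n] by (simp add: power_divide)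
    let ?p = "\<lambda>x. 1 + w * complex_of_real (?y n x) + w\<^sup>2 / 2 * complex_of_real ((?y n x)\<^sup>2)"
    have ip: "integrable M\<^sub>0 ?p" using iy iy2
      by (intro Bochner_Integration.integrable_add integrable_mult_right integrable_of_real) auto
    have "(\<integral>x. ?p x \<partial>M\<^sub>0) = (\<integral>x. 1 \<partial>M\<^sub>0) + w * (\<integral>x. complex_of_real (?y n x) \<partial>M\<^sub>0) + w\<^sup>2 / 2 * (\<integral>x. complex_of_real ((?y n x)\<^sup>2) \<partial>M\<^sub>0)"
      using iy iy2 by (subst Bochner_Integration.integral_add; (subst Bochner_Integration.integral_add)?)
        (auto intro!: Bochner_Integration.integrable_add integrable_mult_right integrable_of_real simp del: of_real_power of_real_divide)
    also have "\<dots> = 1 + w\<^sup>2 / 2 * complex_of_real ((\<integral>x. (h \<bullet> \<psi> n x)\<^sup>2 \<partial>M\<^sub>0) / n)"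
      unfolding integral_complex_of_real using M0.prob_space mean_\<psi>[of h n] elim(2)
      by (simp add: power_divide)
    finally have pI: "of_nat n * ((\<integral>x. ?p x \<partial>M\<^sub>0) - 1) = w\<^sup>2 / 2 * complex_of_real (\<integral>x. (h \<bullet> \<psi> n x)\<^sup>2 \<partial>M\<^sub>0)"
      using elim(2) by simp
    have "norm ((\<integral>x. exp (w * of_real (?y n x)) \<partial>M\<^sub>0) - (\<integral>x. ?p x \<partial>M\<^sub>0))
        = norm (\<integral>x. exp (w * of_real (?y n x)) - ?p x \<partial>M\<^sub>0)"
      using ie ip by simp
    also have "\<dots> \<le> (\<integral>x. norm (exp (w * of_real (?y n x)) - ?p x) \<partial>M\<^sub>0)" by (rule integral_norm_bound)
    also have "\<dots> \<le> (\<integral>x. exp 1 * norm w ^ 3 * ?b n ^ 3 \<partial>M\<^sub>0)"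
    proof (rule integral_mono)
      show "integrable M\<^sub>0 (\<lambda>x. norm (exp (w * of_real (?y n x)) - ?p x))" using ie ip by simp
      fix x
      let ?z = "w * complex_of_real (?y n x)"
      have "1 + w * complex_of_real r + w\<^sup>2 / 2 * complex_of_real (r\<^sup>2) = (\<Sum>i\<le>2. (w * complex_of_real r) ^ i / fact i)" for r
        by (simp add: numeral_2_eq_2 power_mult_distrib)
      then have "?p x = (\<Sum>i\<le>2. ?z ^ i / fact i)" .
      then have "norm (exp ?z - ?p x) \<le> exp (norm ?z) * (norm ?z ^ Suc 2) / fact 2"
        using Taylor_exp_field[of ?z 2] by simp
      also have "\<dots> \<le> exp (norm ?z) * (norm ?z ^ Suc 2)" by (simp add: field_simps)
      also have "\<dots> \<le> exp 1 * (norm w * ?b n) ^ 3"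
        using wy[of x] elim(1) unfolding eval_nat_numeral(3)[symmetric] by (intro mult_mono power_mono) (auto simp: eval_nat_numeral)
      finally show "norm (exp ?z - ?p x) \<le> exp 1 * norm w ^ 3 * ?b n ^ 3" by (simp add: power_mult_distrib)
    qed simp
    also have "\<dots> = exp 1 * norm w ^ 3 * ?b n ^ 3" using M0.prob_space by simp
    finally have *: "norm ((\<integral>x. exp (w * of_real (?y n x)) \<partial>M\<^sub>0) - (\<integral>x. ?p x \<partial>M\<^sub>0)) \<le> exp 1 * norm w ^ 3 * ?b n ^ 3" .
    have "of_nat n * ((\<integral>x. exp (w * of_real (?y n x)) \<partial>M\<^sub>0) - 1) - w\<^sup>2 / 2 * of_real (\<integral>x. (h \<bullet> \<psi> n x)\<^sup>2 \<partial>M\<^sub>0)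
        = of_nat n * ((\<integral>x. exp (w * of_real (?y n x)) \<partial>M\<^sub>0) - (\<integral>x. ?p x \<partial>M\<^sub>0))"
      unfolding pI[symmetric] by (simp only: right_diff_distrib) simp
    then show ?case using mult_left_mono[OF *, of "real n"] by (simp add: norm_mult ac_simps)
  qed
  have "(\<lambda>n. (of_nat n * ((\<integral>x. exp (w * of_real (?y n x)) \<partial>M\<^sub>0) - 1)) - w\<^sup>2 / 2 * of_real (\<integral>x. (h \<bullet> \<psi> n x)\<^sup>2 \<partial>M\<^sub>0)) \<longlonglongrightarrow> 0"
    by (rule Lim_null_comparison[OF ev]) (use e in simp)
  from tendsto_add[OF this g] show ?thesis by simp
qed

lemma exp_expansion_real:
  "(\<lambda>n. real n * ((\<integral>x. exp (h \<bullet> \<psi> n x / sqrt n) \<partial>M\<^sub>0) - 1)) \<longlonglongrightarrow> h \<bullet> (FI *v h) / 2"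
proof -
  have "(\<lambda>n. complex_of_real (real n * ((\<integral>x. exp (h \<bullet> \<psi> n x / sqrt n) \<partial>M\<^sub>0) - 1))) \<longlonglongrightarrow> complex_of_real (h \<bullet> (FI *v h)) / 2"
    using exp_expansion[where w = 1 and h = h]
    by (simp add: exp_of_real integral_complex_of_real flip: of_real_divide)
  then have "(\<lambda>n. complex_of_real (real n * ((\<integral>x. exp (h \<bullet> \<psi> n x / sqrt n) \<partial>M\<^sub>0) - 1))) \<longlonglongrightarrow> complex_of_real (h \<bullet> (FI *v h) / 2)"
    by simp
  then show ?thesis by (rule tendsto_of_real_iff[THEN iffD1])
qed

lemma inner_Del: "h \<bullet> Del n x = (\<Sum>i<n. h \<bullet> \<psi> n (x i) / sqrt n)"
  by (simp add: Del_def inner_sum_right sum_divide_distrib)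

text \<open>The central limit theorem for a triangular array, since the summands
  \<open>\<psi> n\<close> change with \<open>n\<close>. The characteristic function is an
  \<open>n\<close>-th power, to which \<open>power_tendsto_exp\<close> applies.\<close>

lemma char_Del:
  "(\<lambda>n. \<integral>x. exp (\<i> * of_real (h \<bullet> Del n x)) \<partial>P0 n) \<longlonglongrightarrow> exp (- of_real (h \<bullet> (FI *v h)) / 2)"
proof -
  interpret m: product_sigma_finite "\<lambda>_::nat. M\<^sub>0" by (rule product_sigma_finite_const) (rule M0.sigma_finite_measure_axioms)
  have "(\<integral>x. exp (\<i> * of_real (h \<bullet> Del n x)) \<partial>P0 n) = (\<integral>x. exp (\<i> * of_real (h \<bullet> \<psi> n x / sqrt n)) \<partial>M\<^sub>0) ^ n" for n
  proof -
    let ?f = "\<lambda>x. exp (\<i> * complex_of_real (h \<bullet> \<psi> n x / sqrt n))"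
    have "(\<integral>x. exp (\<i> * of_real (h \<bullet> Del n x)) \<partial>P0 n) = (\<integral>x. (\<Prod>i<n. ?f (x i)) \<partial>P0 n)"
      by (simp only: inner_Del of_real_sum sum_distrib_left exp_sum[OF finite_lessThan])
    also have "\<dots> = (\<Prod>i<n. \<integral>x. ?f x \<partial>M\<^sub>0)"
      unfolding sample_law_def
    proof (rule m.product_integral_prod[where f = "\<lambda>_. ?f"])
      show "integrable M\<^sub>0 ?f" by (rule M0.integrable_const_bound[of _ 1]) auto
    qed simp
    finally show ?thesis by simp
  qed
  with power_tendsto_exp[OF exp_expansion[where w = \<i> and h = h]] show ?thesis by simp
qed

text \<open>Each factor satisfies \<open>exp y \<le> 1 + y + y\<^sup>2\<close> for
  \<open>\<bar>y\<bar> \<le> 1\<close>; the linear part is centred and the variance is of order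
  \<open>1 / n\<close>, so the \<open>n\<close>-th power stays bounded. The bound does not depend on
  \<open>n\<close>, which gives both domination over balls of \<open>h\<close> and tightness of
  \<open>Del n\<close>.\<close>

lemma lik_mean:
  assumes "norm h \<le> C" "bnd C n \<le> 1" "n > 0"
  shows "integrable (P0 n) (\<lambda>x. exp (h \<bullet> Del n x))"
    "(\<integral>x. exp (h \<bullet> Del n x) \<partial>P0 n) \<le> exp (C\<^sup>2 * V)"
proof -
  interpret m: product_sigma_finite "\<lambda>_::nat. M\<^sub>0" by (rule product_sigma_finite_const) (rule M0.sigma_finite_measure_axioms)
  let ?y = "\<lambda>x. h \<bullet> \<psi> n x / sqrt n"
  let ?f = "\<lambda>x. exp (?y x)"
  have y1: "\<bar>?y x\<bar> \<le> 1" for x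
  proof -
    have "bnd (norm h) n \<le> bnd C n" unfolding bnd_def using assms(1)
      by (intro divide_right_mono mult_right_mono) auto
    then show ?thesis using bnd[of h n x] assms(2) by linarith
  qed
  have i1: "integrable M\<^sub>0 ?f"
  proof (rule M0.integrable_const_bound[of _ "exp 1"])
    have "norm (?f x) \<le> exp 1" for x using abs_le_D1[OF y1[of x]] by simp
    then show "AE x in M\<^sub>0. norm (?f x) \<le> exp 1" by blast
  qed measurable
  have iy: "integrable M\<^sub>0 ?y" using integrable_\<psi>[of n] by simp
  have iy2: "integrable M\<^sub>0 (\<lambda>x. (?y x)\<^sup>2)" using variance_\<psi>(1)[of h n] by (simp add: power_divide)
  have eq: "exp (h \<bullet> Del n x) = (\<Prod>i<n. ?f (x i))" for x
    by (simp only: inner_Del exp_sum[OF finite_lessThan])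
  show "integrable (P0 n) (\<lambda>x. exp (h \<bullet> Del n x))"
    unfolding eq sample_law_def using i1 by (intro m.product_integrable_prod[where f = "\<lambda>_. ?f"]) auto
  have "(\<integral>x. ?f x \<partial>M\<^sub>0) \<le> (\<integral>x. 1 + ?y x + (?y x)\<^sup>2 \<partial>M\<^sub>0)"
  proof (rule integral_mono[OF i1])
    show "integrable M\<^sub>0 (\<lambda>x. 1 + ?y x + (?y x)\<^sup>2)" using iy iy2 by simp
    fix x
    show "?f x \<le> 1 + ?y x + (?y x)\<^sup>2"
    proof (cases "0 \<le> ?y x")
      case True then show ?thesis using exp_bound[OF True abs_le_D1[OF y1[of x]]] by simp
    next
      case False
      define z where "z = - ?y x"
      have z: "0 \<le> z" "z \<le> 1" using False abs_le_D2[OF y1[of x]] by (auto simp: z_def)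
      have "1 + z \<le> exp z" by (rule exp_ge_add_one_self)
      have "exp (-z) \<le> 1 / (1 + z)" using \<open>1 + z \<le> exp z\<close> z by (simp add: exp_minus field_simps)
      also have "\<dots> \<le> 1 - z + z\<^sup>2"
      proof -
        have "(1 - z + z\<^sup>2) * (1 + z) = 1 + z^3" by (simp add: power2_eq_square power3_eq_cube algebra_simps)
        then show ?thesis using z by (simp add: pos_divide_le_eq)
      qed
      finally show ?thesis by (simp add: z_def)
    qed
  qed
  also have "\<dots> = 1 + (\<integral>x. (h \<bullet> \<psi> n x)\<^sup>2 \<partial>M\<^sub>0) / n"
    using iy iy2 M0.prob_space mean_\<psi>[of h n] by (simp add: power_divide)
  also have "\<dots> \<le> 1 + (norm h)\<^sup>2 * V / n"
    using variance_\<psi>_le[of h n] by (simp add: divide_right_mono)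
  also have "\<dots> \<le> 1 + C\<^sup>2 * V / n"
    using assms(1) V_nonneg by (intro add_left_mono divide_right_mono mult_right_mono power_mono) auto
  also have "\<dots> \<le> exp (C\<^sup>2 * V / n)" by (rule exp_ge_add_one_self)
  finally have le: "(\<integral>x. ?f x \<partial>M\<^sub>0) \<le> exp (C\<^sup>2 * V / n)" .
  have "(\<integral>x. exp (h \<bullet> Del n x) \<partial>P0 n) = (\<integral>x. ?f x \<partial>M\<^sub>0) ^ n"
    unfolding eq sample_law_def using i1 by (subst m.product_integral_prod[where f = "\<lambda>_. ?f"]) auto
  also have "\<dots> \<le> exp (C\<^sup>2 * V / n) ^ n"
    by (intro power_mono le integral_nonneg_AE) auto
  also have "\<dots> = exp (C\<^sup>2 * V)" using assms(3) by (simp flip: exp_of_nat_mult)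
  finally show "(\<integral>x. exp (h \<bullet> Del n x) \<partial>P0 n) \<le> exp (C\<^sup>2 * V)" .
qed

lemma fisher_nonneg: "0 \<le> h \<bullet> (FI *v h)" unfolding fisher_quadratic by simp

lemma rem_tendsto:
  "(\<lambda>n. real n * (\<integral>x. (rem ((1 / sqrt n) *\<^sub>R h) x)\<^sup>2 \<partial>\<mu>)) \<longlonglongrightarrow> 0" (is "?A \<longlonglongrightarrow> 0")
  "\<forall>\<^sub>F n in sequentially. \<theta>\<^sub>0 + (1 / sqrt n) *\<^sub>R h \<in> \<Theta> \<and> integrable \<mu> (\<lambda>x. (rem ((1 / sqrt n) *\<^sub>R h) x)\<^sup>2)"
proof -
  have lim: "(\<lambda>n. norm ((1 / sqrt n) *\<^sub>R h)) \<longlonglongrightarrow> 0"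
  proof -
    have "(\<lambda>n. 1 / sqrt n * norm h) \<longlonglongrightarrow> 0" by real_asymp
    then show ?thesis by simp
  qed
  show "\<forall>\<^sub>F n in sequentially. \<theta>\<^sub>0 + (1 / sqrt n) *\<^sub>R h \<in> \<Theta> \<and> integrable \<mu> (\<lambda>x. (rem ((1 / sqrt n) *\<^sub>R h) x)\<^sup>2)"
  proof -
    obtain \<delta> where \<delta>: "\<delta> > 0" "\<And>u. norm u < \<delta> \<Longrightarrow> \<theta>\<^sub>0 + u \<in> \<Theta>"
      "\<And>u. norm u < \<delta> \<Longrightarrow> integrable \<mu> (\<lambda>x. (rem u x)\<^sup>2)"
      using rem_small[of 1] by (metis zero_less_one)
    have "\<forall>\<^sub>F n in sequentially. norm ((1 / sqrt n) *\<^sub>R h) < \<delta>" by (rule order_tendstoD(2)[OF lim \<delta>(1)])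
    then show ?thesis by eventually_elim (use \<delta> in blast)
  qed
  show "?A \<longlonglongrightarrow> 0"
  proof (rule LIMSEQ_I)
    fix e :: real assume e: "e > 0"
    define \<eta> where "\<eta> = e / ((norm h)\<^sup>2 + 1)"
    have h1: "(norm h)\<^sup>2 + 1 > 0" by (smt (verit) zero_le_power2)
    have \<eta>: "\<eta> > 0" using e h1 by (simp add: \<eta>_def)
    obtain \<delta> where \<delta>: "\<delta> > 0" "\<And>u. norm u < \<delta> \<Longrightarrow> (\<integral>x. (rem u x)\<^sup>2 \<partial>\<mu>) \<le> \<eta> * (norm u)\<^sup>2"
      using rem_small[OF \<eta>] by metis
    have "\<forall>\<^sub>F n in sequentially. norm ((1 / sqrt n) *\<^sub>R h) < \<delta>" by (rule order_tendstoD(2)[OF lim \<delta>(1)])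
    then have "\<forall>\<^sub>F n in sequentially. norm (?A n - 0) < e" using eventually_gt_at_top[of 0]
    proof eventually_elim
      case (elim n)
      have "?A n \<le> real n * (\<eta> * (norm ((1 / sqrt n) *\<^sub>R h))\<^sup>2)"
        by (intro mult_left_mono \<delta>(2) elim) auto
      also have "\<dots> = \<eta> * (norm h)\<^sup>2" using elim(2) by (simp add: power_mult_distrib power_divide)
      also have "\<dots> < e" using h1 e unfolding \<eta>_def by (simp add: field_simps)
      finally have "?A n < e" .
      moreover have "?A n \<ge> 0" by simp
      ultimately show ?case by simp
    qed
    then show "\<exists>no. \<forall>n\<ge>no. norm (?A n - 0) < e" by (simp add: eventually_sequentially)
  qed
qed

text \<open>Spreading the quadratic term evenly over the observations makes \<open>lik\<close> times
  the null density a product density, so the Hellinger bound for products applies to it.\<close>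

lemma prod_lik:
  assumes "n > 0"
  shows "(\<Prod>i<n. dens \<theta>\<^sub>0 (x i) * exp (h \<bullet> \<psi> n (x i) / sqrt n - h \<bullet> (FI *v h) / (2 * real n))) = (\<Prod>i<n. dens \<theta>\<^sub>0 (x i)) * lik n h x"
proof -
  have "lik n h x = exp (\<Sum>i<n. h \<bullet> \<psi> n (x i) / sqrt n - h \<bullet> (FI *v h) / (2 * real n))"
    unfolding lik_def inner_Del sum_subtractf using assms by simp
  then show ?thesis by (simp only: exp_sum[OF finite_lessThan] prod.distrib)
qed

text \<open>Two conditions of \<open>prod_L1_tendsto\<close> are to be checked. The one-observation
  approximation \<open>?g n\<close> has mass \<open>1 + o(1 / n)\<close> because two second-order
  terms cancel. The difference of root densities decomposes into the quadratic mean remainder, the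
  error of replacing the score by \<open>\<psi> n\<close>, the deterministic term
  \<open>a / (4 * real n)\<close> and the Taylor error of the exponential; each has mean square
  \<open>o(1 / n)\<close>.\<close>

lemma lan_L1:
  "(\<lambda>n. \<integral>x. \<bar>(\<Prod>i<n. dens (\<theta>\<^sub>0 + (1 / sqrt n) *\<^sub>R h) (x i)) - (\<Prod>i<n. dens \<theta>\<^sub>0 (x i)) * lik n h x\<bar> \<partial>N n) \<longlonglongrightarrow> 0"
proof -
  define a where "a = h \<bullet> (FI *v h)"
  have a0: "0 \<le> a" unfolding a_def by (rule fisher_nonneg)
  let ?u = "\<lambda>n::nat. (1 / sqrt n) *\<^sub>R h"
  let ?y = "\<lambda>n x. h \<bullet> \<psi> n x / sqrt n"
  let ?f = "\<lambda>n. dens (\<theta>\<^sub>0 + ?u n)"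
  let ?g = "\<lambda>n x. dens \<theta>\<^sub>0 x * exp (?y n x - a / (2 * real n))"
  have ie: "integrable M\<^sub>0 (\<lambda>x. exp (?y n x))" for n
  proof (rule M0.integrable_const_bound[of _ "exp (bnd (norm h) n)"])
    have "norm (exp (?y n x)) \<le> exp (bnd (norm h) n)" for x using abs_le_D1[OF bnd[of h n x]] by simp
    then show "AE x in M\<^sub>0. norm (exp (?y n x)) \<le> exp (bnd (norm h) n)" by blast
  qed measurable
  have ig: "integrable \<mu> (?g n)" "integral\<^sup>L \<mu> (?g n) = (\<integral>x. exp (?y n x) \<partial>M\<^sub>0) * exp (- a / (2 * real n))" for n
  proof -
    have gx: "?g n x = (dens \<theta>\<^sub>0 x *\<^sub>R exp (?y n x)) * exp (- a / (2 * real n))" for x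
      by (simp add: exp_diff exp_minus field_simps)
    have "integrable \<mu> (\<lambda>x. dens \<theta>\<^sub>0 x *\<^sub>R exp (?y n x))"
      using ie[of n] by (subst (asm) integrable_P_iff[OF \<theta>0_in]) auto
    then show "integrable \<mu> (?g n)" unfolding gx by (rule integrable_mult_left)
    show "integral\<^sup>L \<mu> (?g n) = (\<integral>x. exp (?y n x) \<partial>M\<^sub>0) * exp (- a / (2 * real n))"
      unfolding gx by (subst integral_P[OF \<theta>0_in]) auto
  qed
  \<comment> \<open>The contribution \<open>a / 2\<close> of the exponential moment is cancelled by
    \<open>- a / 2\<close> from the compensating factor.\<close>
  have g1: "(\<lambda>n. real n * (integral\<^sup>L \<mu> (?g n) - 1)) \<longlonglongrightarrow> 0"
  proof -
    have 1: "(\<lambda>n::nat. exp (- a / (2 * real n))) \<longlonglongrightarrow> 1" by real_asymp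
    have 2: "(\<lambda>n::nat. real n * (exp (- a / (2 * real n)) - 1)) \<longlonglongrightarrow> - a / 2" by real_asymp
    have "(\<lambda>n. real n * ((\<integral>x. exp (?y n x) \<partial>M\<^sub>0) - 1) * exp (- a / (2 * real n)) + real n * (exp (- a / (2 * real n)) - 1)) \<longlonglongrightarrow> a / 2 * 1 + - a / 2"
      by (intro tendsto_intros 1 2 exp_expansion_real[of h, folded a_def])
    moreover have "real n * ((\<integral>x. exp (?y n x) \<partial>M\<^sub>0) - 1) * exp (- a / (2 * real n)) + real n * (exp (- a / (2 * real n)) - 1) = real n * (integral\<^sup>L \<mu> (?g n) - 1)" for n
      unfolding ig(2) by (simp add: algebra_simps)
    ultimately show ?thesis by simp
  qed
  \<comment> \<open>Bounds the exponent \<open>z\<close> in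
    \<open>sqrt (?g n x) = b * exp z\<close>, which is half of the exponent in \<open>?g\<close>.
    Its dominant order is again \<open>n\<close> to the power -3/8, so \<open>n\<close> times its
    fourth power vanishes.\<close>
  let ?zb = "\<lambda>n::nat. bnd (norm h) n / 2 + a / (4 * real n)"
  let ?E = "\<lambda>n. \<integral>x. (h \<bullet> (s x - \<psi> n x))\<^sup>2 \<partial>M\<^sub>0"
  let ?R = "\<lambda>n. \<integral>x. (rem (?u n) x)\<^sup>2 \<partial>\<mu>"
  have h0: "(\<lambda>n. real n * (\<integral>x. (sqrt (?f n x) - sqrt (?g n x))\<^sup>2 \<partial>\<mu>)) \<longlonglongrightarrow> 0"
  proof (rule tendsto_sandwich[OF _ _ tendsto_const])
    show "\<forall>\<^sub>F n in sequentially. 0 \<le> real n * (\<integral>x. (sqrt (?f n x) - sqrt (?g n x))\<^sup>2 \<partial>\<mu>)"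
      by simp
    have z1: "(\<lambda>n. real n * ?zb n ^ 4) \<longlonglongrightarrow> 0"
    proof -
      have l1: "(\<lambda>n. real n powr (1/4) * (real n powr (1/8) / sqrt n)) \<longlonglongrightarrow> 0" by real_asymp
      have l2: "(\<lambda>n. real n powr (1/4) / (4 * real n)) \<longlonglongrightarrow> 0" by real_asymp
      have lim4: "(\<lambda>n. (norm h * (real n powr (1/4) * (real n powr (1/8) / sqrt n)) + a * (real n powr (1/4) / (4 * real n))) ^ 4) \<longlonglongrightarrow> (norm h * 0 + a * 0) ^ 4"
        by (intro tendsto_intros l1 l2)
      have eqn: "(norm h * (real n powr (1/4) * (real n powr (1/8) / sqrt n)) + a * (real n powr (1/4) / (4 * real n))) ^ 4
          = real n * ?zb n ^ 4" for n :: nat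
      proof -
        have "norm h * (real n powr (1/4) * (real n powr (1/8) / sqrt n)) + a * (real n powr (1/4) / (4 * real n)) = real n powr (1/4) * ?zb n"
          by (simp add: bnd_def algebra_simps)
        moreover have "(real n powr (1/4)) ^ 4 = real n" by (cases "n = 0") (auto simp: powr_power)
        ultimately show ?thesis by (simp only: power_mult_distrib)
      qed
      show ?thesis using lim4 unfolding eqn by simp
    qed
    have z2: "(\<lambda>n::nat. a\<^sup>2 / (16 * real n)) \<longlonglongrightarrow> 0" by real_asymp
    have "(\<lambda>n. 2 * (real n * ?R n) + 6 * (1/4 * ?E n + a\<^sup>2 / (16 * real n) + 9 * (real n * ?zb n ^ 4))) \<longlonglongrightarrow> 2 * 0 + 6 * (1/4 * 0 + 0 + 9 * 0)"
      by (intro tendsto_intros rem_tendsto(1) \<psi>_approx z1 z2)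
    then show "(\<lambda>n. 2 * (real n * ?R n) + 6 * (1/4 * ?E n + a\<^sup>2 / (16 * real n) + 9 * (real n * ?zb n ^ 4))) \<longlonglongrightarrow> 0"
      by simp
    have z3: "(\<lambda>n. a / (4 * real n)) \<longlonglongrightarrow> 0" by real_asymp
    have "?zb \<longlonglongrightarrow> 0 / 2 + 0" by (intro tendsto_intros bnd_tendsto(1) z3) auto
    then have "?zb \<longlonglongrightarrow> 0" by simp
    then have "\<forall>\<^sub>F n in sequentially. ?zb n < 1" by (rule order_tendstoD) simp
    then show "\<forall>\<^sub>F n in sequentially. real n * (\<integral>x. (sqrt (?f n x) - sqrt (?g n x))\<^sup>2 \<partial>\<mu>)
        \<le> 2 * (real n * ?R n) + 6 * (1/4 * ?E n + a\<^sup>2 / (16 * real n) + 9 * (real n * ?zb n ^ 4))"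
      using rem_tendsto(2)[of h] eventually_gt_at_top[of 0]
    proof eventually_elim
      case (elim n)
      let ?c = "a\<^sup>2 / (16 * (real n)\<^sup>2) + 9 * ?zb n ^ 4"
      let ?U = "\<lambda>x. 2 * (rem (?u n) x)\<^sup>2 + 6 * (1 / (4 * real n) * (dens \<theta>\<^sub>0 x * (h \<bullet> (s x - \<psi> n x))\<^sup>2) + ?c * dens \<theta>\<^sub>0 x)"
      have iE: "integrable \<mu> (\<lambda>x. dens \<theta>\<^sub>0 x * (h \<bullet> (s x - \<psi> n x))\<^sup>2)"
        using integrable_\<psi>_approx[of h n] by (subst (asm) integrable_P_iff[OF \<theta>0_in]) auto
      have iU: "integrable \<mu> ?U" using iE elim(2) integrable_dens[OF \<theta>0_in] by simp
      have le: "(sqrt (?f n x) - sqrt (?g n x))\<^sup>2 \<le> ?U x" for x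
      proof -
        define b r z where "b = sqrt (dens \<theta>\<^sub>0 x)" and "r = rem (?u n) x" and "z = ?y n x / 2 - a / (4 * real n)"
        have f: "sqrt (?f n x) = b + 1/2 * (?u n \<bullet> s x) * b + r" by (simp add: b_def r_def rem_def)
        have g: "sqrt (?g n x) = b * exp z"
        proof -
          have "sqrt (exp (2 * z)) = exp z" by (simp add: exp_double)
          moreover have "2 * z = ?y n x - a / (2 * real n)" by (simp add: z_def)
          ultimately show ?thesis by (simp add: b_def real_sqrt_mult)
        qed
        have zb: "\<bar>z\<bar> \<le> ?zb n"
        proof -
          have "0 \<le> a / (4 * real n)" using a0 by simp
          moreover have "\<bar>p\<bar> \<le> q \<Longrightarrow> 0 \<le> c \<Longrightarrow> \<bar>p / 2 - c\<bar> \<le> q / 2 + c" for p q c :: real by linarith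
          ultimately show ?thesis using bnd[of h n x] unfolding z_def by blast
        qed
        \<comment> \<open>A first-order expansion suffices here: the error is quadratic in
          \<open>z\<close>, and it is its square that is multiplied by \<open>n\<close>.\<close>
        define err where "err = exp z - 1 - z"
        have err: "\<bar>err\<bar> \<le> 3 * ?zb n ^ 2"
        proof -
          have "norm (exp z - (\<Sum>i\<le>1. z ^ i / fact i)) \<le> exp (norm z) * (norm z ^ Suc 1) / fact 1"
            by (rule Taylor_exp_field)
          then have "\<bar>err\<bar> \<le> exp \<bar>z\<bar> * \<bar>z\<bar> ^ 2" by (simp add: err_def algebra_simps numeral_2_eq_2)
          also have "\<dots> \<le> 3 * ?zb n ^ 2"
          proof (intro mult_mono power_mono zb)
            have "exp \<bar>z\<bar> \<le> exp 1" using zb elim(1) by simp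
            also have "\<dots> \<le> 3" by (rule exp_le)
            finally show "exp \<bar>z\<bar> \<le> 3" .
          qed auto
          finally show ?thesis .
        qed
        define d where "d = h \<bullet> (s x - \<psi> n x) / sqrt n"
        have "sqrt (?f n x) - sqrt (?g n x) = r + b * (d / 2 + a / (4 * real n) - err)"
          unfolding f g err_def d_def z_def by (simp add: inner_diff_right diff_divide_distrib algebra_simps)
        also have "(r + b * (d / 2 + a / (4 * real n) - err))\<^sup>2 \<le> 2 * r\<^sup>2 + 2 * (b\<^sup>2 * (d / 2 + a / (4 * real n) - err)\<^sup>2)"
          using sum_squares_bound[of r "b * (d / 2 + a / (4 * real n) - err)"] by (simp add: power2_sum power_mult_distrib)
        also have "\<dots> \<le> 2 * r\<^sup>2 + 2 * (b\<^sup>2 * (3 * ((d / 2)\<^sup>2 + (a / (4 * real n))\<^sup>2 + err\<^sup>2)))"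
        proof -
          have "(p + q - e)\<^sup>2 \<le> 3 * (p\<^sup>2 + q\<^sup>2 + e\<^sup>2)" for p q e :: real
          proof -
            have "0 \<le> (p - q)\<^sup>2 + (p + e)\<^sup>2 + (q + e)\<^sup>2" by simp
            then show ?thesis by (simp add: power2_eq_square algebra_simps)
          qed
          then show ?thesis by (intro add_left_mono mult_left_mono) auto
        qed
        also have "\<dots> \<le> 2 * r\<^sup>2 + 2 * (b\<^sup>2 * (3 * ((d / 2)\<^sup>2 + (a / (4 * real n))\<^sup>2 + 9 * ?zb n ^ 4)))"
        proof -
          have "err\<^sup>2 \<le> (3 * ?zb n ^ 2)\<^sup>2" using power_mono[OF err abs_ge_zero, of 2] by simp
          also have "\<dots> = 9 * ?zb n ^ 4" by (simp only: power_mult_distrib power_mult[symmetric]) simp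
          finally show ?thesis by (intro add_left_mono mult_left_mono) auto
        qed
        also have "\<dots> = ?U x"
        proof -
          have d2: "(d / 2)\<^sup>2 = 1 / (4 * real n) * (h \<bullet> (s x - \<psi> n x))\<^sup>2" by (simp add: d_def power_divide)
          have a2: "(a / (4 * real n))\<^sup>2 = a\<^sup>2 / (16 * (real n)\<^sup>2)" by (simp add: power_divide power_mult_distrib)
          have b2: "b\<^sup>2 = dens \<theta>\<^sub>0 x" by (simp add: b_def)
          have "2 * r\<^sup>2 + 2 * (D * (3 * (p * e + q + w))) = 2 * r\<^sup>2 + 6 * (p * (D * e) + (q + w) * D)" for D p e q w :: real
            by (simp add: algebra_simps)
          then show ?thesis unfolding d2 a2 b2 r_def .
        qed
        finally show ?thesis .
      qed
      have "(\<integral>x. (sqrt (?f n x) - sqrt (?g n x))\<^sup>2 \<partial>\<mu>) \<le> (\<integral>x. ?U x \<partial>\<mu>)"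
      proof (rule integral_mono[OF _ iU])
        show "integrable \<mu> (\<lambda>x. (sqrt (?f n x) - sqrt (?g n x))\<^sup>2)"
          by (rule Bochner_Integration.integrable_bound[OF iU]) (auto intro!: AE_I2 order_trans[OF le])
      qed (rule le)
      also have "(\<integral>x. ?U x \<partial>\<mu>) = 2 * ?R n + 6 * (1 / (4 * real n) * ?E n + ?c)"
        using iE elim(2) integrable_dens[OF \<theta>0_in] integral_dens[OF \<theta>0_in] by (simp add: integral_P[OF \<theta>0_in])
      finally have "real n * (\<integral>x. (sqrt (?f n x) - sqrt (?g n x))\<^sup>2 \<partial>\<mu>) \<le> real n * (2 * ?R n + 6 * (1 / (4 * real n) * ?E n + ?c))"
        by (rule mult_left_mono) simp
      also have "\<dots> = 2 * (real n * ?R n) + 6 * (1/4 * ?E n + a\<^sup>2 / (16 * real n) + 9 * (real n * ?zb n ^ 4))"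
      proof -
        have "real n * (1 / (4 * real n) * ?E n) = 1/4 * ?E n" "real n * (a\<^sup>2 / (16 * (real n)\<^sup>2)) = a\<^sup>2 / (16 * real n)"
          using elim(3) by (auto simp: power2_eq_square)
        moreover have "real n * (2 * R + 6 * (A + (B + 9 * D))) = 2 * (real n * R) + 6 * (real n * A + real n * B + 9 * (real n * D))" for R A B D :: real
          by (simp add: algebra_simps)
        ultimately show ?thesis by (simp only:)
      qed
      finally show ?case .
    qed
  qed
  have "(\<lambda>n. \<integral>x. \<bar>(\<Prod>i<n. ?f n (x i)) - (\<Prod>i<n. ?g n (x i))\<bar> \<partial>N n) \<longlonglongrightarrow> 0"
  proof (rule prod_L1_tendsto[OF sigma_finite_\<mu> _ _ g1 h0])
    show "\<forall>\<^sub>F n in sequentially. integrable \<mu> (?f n) \<and> (\<forall>x. 0 \<le> ?f n x) \<and> integral\<^sup>L \<mu> (?f n) = 1"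
      using rem_tendsto(2)[of h] by eventually_elim (auto simp: integrable_dens integral_dens)
    show "\<forall>\<^sub>F n in sequentially. integrable \<mu> (?g n) \<and> (\<forall>x. 0 \<le> ?g n x)"
      using ig(1) by simp
  qed
  moreover have "\<forall>\<^sub>F n in sequentially. (\<integral>x. \<bar>(\<Prod>i<n. ?f n (x i)) - (\<Prod>i<n. ?g n (x i))\<bar> \<partial>N n)
     = (\<integral>x. \<bar>(\<Prod>i<n. ?f n (x i)) - (\<Prod>i<n. dens \<theta>\<^sub>0 (x i)) * lik n h x\<bar> \<partial>N n)"
    using eventually_gt_at_top[of 0]
    by eventually_elim (simp only: prod_lik a_def)
  ultimately show ?thesis by (rule Lim_transform_eventually)
qed

end

section \<open>Tests\<close>

lemma indep_vars_sample_law: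
  assumes M: "prob_space M" and n: "n > 0"
  shows "prob_space.indep_vars (sample_law n M) (\<lambda>_. M) (\<lambda>i x. x i) {..<n}"
proof -
  interpret S: prob_space "sample_law n M" by (rule prob_space_sample_law[OF M])
  have ne: "{..<n} \<noteq> {}" using n by auto
  have "distr (sample_law n M) (Pi\<^sub>M {..<n} (\<lambda>_. M)) (\<lambda>x. \<lambda>i\<in>{..<n}. x i) = distr (sample_law n M) (Pi\<^sub>M {..<n} (\<lambda>_. M)) (\<lambda>x. x)"
    by (rule distr_cong) (auto simp: sample_law_def space_PiM)
  also have "\<dots> = Pi\<^sub>M {..<n} (\<lambda>_. M)"
    by (simp add: sample_law_def)
  also have "\<dots> = Pi\<^sub>M {..<n} (\<lambda>i. distr (sample_law n M) M (\<lambda>x. x i))"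
    using M by (intro PiM_cong refl) (simp add: sample_law_def distr_PiM_component[where M = "\<lambda>_. M"])
  finally show ?thesis
    by (subst S.indep_vars_iff_distr_eq_PiM'[OF ne]) (auto intro: measurable_sample_law_component)
qed

lemma block_measurable:
  assumes "k * m \<le> n" "j < k"
  shows "(\<lambda>x. \<lambda>i\<in>{..<m}. x (j * m + i)) \<in> sample_law n M \<rightarrow>\<^sub>M sample_law m M"
proof -
  have "j * m + i < n" if "i < m" for i
  proof -
    have "j * m + i < Suc j * m" using that by simp
    also have "\<dots> \<le> k * m" using assms(2) by (intro mult_le_mono1) simp
    finally show ?thesis using assms(1) by simp
  qed
  then show ?thesis unfolding sample_law_def by (intro measurable_restrict measurable_component_singleton) auto
qed

text \<open>Disjoint consecutive blocks of \<open>m\<close> coordinates are independent samples of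
  size \<open>m\<close>, so Hoeffding's inequality applies to the block statistics; observations
  beyond \<open>k * m\<close> are ignored. Blocks of length one serve for averages of the truncated
  score, longer ones for boosting a test.\<close>

lemma block_hoeffding:
  fixes \<phi> :: "(nat \<Rightarrow> 'x) \<Rightarrow> real"
  assumes M: "prob_space M" and \<phi>: "\<phi> \<in> borel_measurable (sample_law m M)"
    and ab: "\<And>x. x \<in> space (sample_law m M) \<Longrightarrow> a \<le> \<phi> x \<and> \<phi> x \<le> b" "a < b"
    and m: "0 < m" and k: "0 < k" "k * m \<le> n" and e: "0 \<le> e"
  defines "S \<equiv> \<lambda>x. \<Sum>j<k. \<phi> (\<lambda>i\<in>{..<m}. x (j * m + i))"
  defines "E \<equiv> \<integral>y. \<phi> y \<partial>sample_law m M"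
  shows "\<P>(x in sample_law n M. S x \<le> real k * E - e) \<le> exp (- 2 * e\<^sup>2 / (real k * (b - a)\<^sup>2))"
    "\<P>(x in sample_law n M. S x \<ge> real k * E + e) \<le> exp (- 2 * e\<^sup>2 / (real k * (b - a)\<^sup>2))"
proof -
  have n: "n > 0" using m k by (metis le_zero_eq mult_eq_0_iff not_gr_zero)
  interpret S: prob_space "sample_law n M" by (rule prob_space_sample_law[OF M])
  let ?K = "\<lambda>j. {j * m ..< Suc j * m}"
  let ?Y = "\<lambda>j (x :: nat \<Rightarrow> 'x). \<phi> (\<lambda>i\<in>{..<m}. x (j * m + i))"
  have rv: "?Y j \<in> borel_measurable (sample_law n M)" if "j < k" for j
    using measurable_compose[OF block_measurable[OF k(2) that] \<phi>] by simp
  have "S.indep_vars (\<lambda>j. Pi\<^sub>M (?K j) (\<lambda>_. M)) (\<lambda>j \<omega>. restrict (\<lambda>i. \<omega> i) (?K j)) {..<k}"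
  proof (rule S.indep_vars_restrict[OF indep_vars_sample_law[OF M n]])
    show "?K j \<subseteq> {..<n}" if "j \<in> {..<k}" for j
    proof -
      have "Suc j * m \<le> k * m" using that by (intro mult_le_mono1) simp
      then show ?thesis using k(2) by auto
    qed
    show "disjoint_family_on ?K {..<k}"
      unfolding disjoint_family_on_def
    proof (intro ballI impI)
      fix i j assume "i \<in> {..<k}" "j \<in> {..<k}" "i \<noteq> j"
      then consider "Suc i \<le> j" | "Suc j \<le> i" by linarith
      then show "?K i \<inter> ?K j = {}"
      proof cases
        case 1 then have "Suc i * m \<le> j * m" by (rule mult_le_mono1) then show ?thesis by auto
      next
        case 2 then have "Suc j * m \<le> i * m" by (rule mult_le_mono1) then show ?thesis by auto
      qed
    qed
  qed
  then have "S.indep_vars (\<lambda>_. borel) (\<lambda>j \<omega>. ?Y j (restrict (\<lambda>i. \<omega> i) (?K j))) {..<k}"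
  proof (rule S.indep_vars_compose2)
    fix j
    have "(\<lambda>x. \<lambda>i\<in>{..<m}. x (j * m + i)) \<in> Pi\<^sub>M (?K j) (\<lambda>_. M) \<rightarrow>\<^sub>M sample_law m M"
      unfolding sample_law_def by (intro measurable_restrict measurable_component_singleton) auto
    from measurable_compose[OF this \<phi>] show "?Y j \<in> borel_measurable (Pi\<^sub>M (?K j) (\<lambda>_. M))" by simp
  qed
  moreover have "?Y j (restrict (\<lambda>i. \<omega> i) (?K j)) = ?Y j \<omega>" for j \<omega>
    by (intro arg_cong[of _ _ \<phi>] restrict_ext) auto
  ultimately have ind: "S.indep_vars (\<lambda>_. borel) ?Y {..<k}" by simp
  have EY: "S.expectation (?Y j) = E" if j: "j < k" for j
  proof -
    have "S.expectation (?Y j) = integral\<^sup>L (distr (sample_law n M) (sample_law m M) (\<lambda>x. \<lambda>i\<in>{..<m}. x (j * m + i))) \<phi>"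
      by (rule integral_distr[symmetric, OF block_measurable[OF k(2) j] \<phi>])
    also have "distr (sample_law n M) (sample_law m M) (\<lambda>x. \<lambda>i\<in>{..<m}. x (j * m + i)) = sample_law m M"
      unfolding sample_law_def
    proof (rule distr_PiM_reindex[where M = "\<lambda>_. M" and f = "\<lambda>i. j * m + i"])
      show "(\<lambda>i. j * m + i) \<in> {..<m} \<rightarrow> {..<n}"
      proof
        fix i assume "i \<in> {..<m}"
        then have "j * m + i < Suc j * m" by simp
        also have "\<dots> \<le> k * m" using j by (intro mult_le_mono1) simp
        finally show "j * m + i \<in> {..<n}" using k(2) by simp
      qed
    qed (use M in \<open>auto simp: inj_on_def\<close>)
    finally show ?thesis unfolding E_def .
  qed
  have HI: "Hoeffding_ineq (sample_law n M) {..<k} ?Y (\<lambda>_. a) (\<lambda>_. b)"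
  proof unfold_locales
    show "AE x in sample_law n M. ?Y j x \<in> {a..b}" if "j \<in> {..<k}" for j
      using ab(1) measurable_space[OF block_measurable[OF k(2), of j M]] that by (intro AE_I2) auto
  qed (use ind in auto)
  have sumE: "(\<Sum>j<k. S.expectation (?Y j)) = real k * E" by (simp add: EY)
  have pos: "0 < (\<Sum>j<k. (b - a)\<^sup>2)" using ab(2) k(1) by simp
  show "\<P>(x in sample_law n M. S x \<le> real k * E - e) \<le> exp (- 2 * e\<^sup>2 / (real k * (b - a)\<^sup>2))"
    using Hoeffding_ineq.Hoeffding_ineq_le[OF HI e pos] unfolding sumE by (simp add: S_def)
  show "\<P>(x in sample_law n M. S x \<ge> real k * E + e) \<le> exp (- 2 * e\<^sup>2 / (real k * (b - a)\<^sup>2))"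
    using Hoeffding_ineq.Hoeffding_ineq_ge[OF HI e pos] unfolding sumE by (simp add: S_def)
qed

text \<open>Blocks of length one, with \<open>\<zeta>\<close> read as a function of a one-element
  sample; its range has length \<open>2 * T\<close>.\<close>

lemma hoeffding_sample_law:
  fixes \<zeta> :: "'x \<Rightarrow> real"
  assumes M: "prob_space M" and \<zeta>: "\<zeta> \<in> borel_measurable M"
    and T: "\<And>x. \<bar>\<zeta> x\<bar> \<le> T" "0 < T" and n: "0 < n" and e: "0 \<le> e"
  shows "\<P>(x in sample_law n M. (\<Sum>i<n. \<zeta> (x i)) \<le> real n * (\<integral>y. \<zeta> y \<partial>M) - real n * e) \<le> exp (- real n * e\<^sup>2 / (2 * T\<^sup>2))"
proof -
  have \<zeta>0: "(\<lambda>y. \<zeta> (y 0)) \<in> borel_measurable (sample_law 1 M)"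
    by (rule measurable_compose[OF measurable_sample_law_component \<zeta>]) simp
  have E: "(\<integral>y. \<zeta> (y 0) \<partial>sample_law 1 M) = (\<integral>y. \<zeta> y \<partial>M)"
  proof -
    have "(\<integral>y. \<zeta> (y 0) \<partial>sample_law 1 M) = integral\<^sup>L (distr (sample_law 1 M) M (\<lambda>y. y 0)) \<zeta>"
      by (rule integral_distr[symmetric, OF measurable_sample_law_component \<zeta>]) simp
    also have "distr (sample_law 1 M) M (\<lambda>y. y 0) = M"
      unfolding sample_law_def using M by (intro distr_PiM_component[where M = "\<lambda>_. M"]) auto
    finally show ?thesis .
  qed
  have "\<P>(x in sample_law n M. (\<Sum>j<n. \<zeta> ((\<lambda>i\<in>{..<1}. x (j * 1 + i)) 0)) \<le> real n * (\<integral>y. \<zeta> (y 0) \<partial>sample_law 1 M) - real n * e)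
      \<le> exp (- 2 * (real n * e)\<^sup>2 / (real n * (T - - T)\<^sup>2))"
  proof (rule block_hoeffding(1)[OF M \<zeta>0])
    show "- T \<le> \<zeta> (x 0) \<and> \<zeta> (x 0) \<le> T" for x using T(1)[of "x 0"] by linarith
  qed (use T n e in auto)
  also have "- 2 * (real n * e)\<^sup>2 / (real n * (T - - T)\<^sup>2) = - real n * e\<^sup>2 / (2 * T\<^sup>2)"
    using n T(2) by (simp add: power2_eq_square field_simps)
  finally show ?thesis unfolding E by simp
qed

context dqm_model
begin

text \<open>In contrast to \<open>Del\<close>, the truncation level is fixed: it enters the
  Hoeffding exponent through \<open>T\<^sup>2\<close>, and a level growing with \<open>n\<close>
  would destroy the Gaussian tail bounds of the local test.\<close>

definition \<Phi> :: "real \<Rightarrow> nat \<Rightarrow> (nat \<Rightarrow> 'x) \<Rightarrow> real^'d" where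
  "\<Phi> T n x = (1 / sqrt n) *\<^sub>R (\<Sum>i<n. trunc T (x i) - (\<integral>y. trunc T y \<partial>M\<^sub>0))"

lemma \<Phi>_measurable: "\<Phi> T n \<in> borel_measurable (N n)"
  unfolding \<Phi>_def
  by (intro borel_measurable_scaleR borel_measurable_const borel_measurable_sum borel_measurable_diff
      measurable_compose[OF measurable_sample_law_component trunc_measurable]) auto

lemma inner_\<Phi>: "v \<bullet> \<Phi> T n x = ((\<Sum>i<n. v \<bullet> trunc T (x i)) - real n * (\<integral>y. v \<bullet> trunc T y \<partial>M\<^sub>0)) / sqrt n"
  using integrable_trunc by (simp add: \<Phi>_def inner_sum_right inner_diff_right sum_subtractf sum_constant_scaleR del: sum_constant)

text \<open>One level works for all directions because the discarded part of the second moment is at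
  most the integral of \<open>(norm (s x - trunc T x))\<^sup>2\<close>, which is free of
  \<open>v\<close> and tends to zero.\<close>

lemma truncation_level:
  assumes l: "l > 0" "\<And>u. l * (norm u)\<^sup>2 \<le> u \<bullet> (FI *v u)"
  obtains T where "T > 0" "\<And>v. norm v = 1 \<Longrightarrow> l / 2 \<le> (\<integral>x. (v \<bullet> trunc T x)\<^sup>2 \<partial>M\<^sub>0)"
proof -
  let ?d = "\<lambda>T x. s x - trunc T x"
  have "(\<lambda>n. \<integral>x. (norm (?d (real n) x))\<^sup>2 \<partial>M\<^sub>0) \<longlonglongrightarrow> (\<integral>x. 0 \<partial>M\<^sub>0)"
  proof (rule integral_dominated_convergence[where w = "\<lambda>x. (norm (s x))\<^sup>2"])
    have "(\<lambda>n. (norm (?d (real n) x))\<^sup>2) \<longlonglongrightarrow> 0" for x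
    proof (rule Lim_transform_eventually[OF tendsto_const])
      have "\<forall>\<^sub>F n in sequentially. norm (s x) \<le> real n"
        by (rule eventually_sequentiallyI[of "nat \<lceil>norm (s x)\<rceil>"]) linarith
      then show "\<forall>\<^sub>F n in sequentially. 0 = (norm (?d (real n) x))\<^sup>2"
        by eventually_elim (simp add: trunc_def)
    qed
    then show "AE x in M\<^sub>0. (\<lambda>n. (norm (?d (real n) x))\<^sup>2) \<longlonglongrightarrow> 0" by blast
    show "AE x in M\<^sub>0. norm ((norm (?d (real n) x))\<^sup>2) \<le> (norm (s x))\<^sup>2" for n
      by (auto simp: trunc_def)
  qed (use integrable_score_sq in auto)
  then have "\<forall>\<^sub>F n in sequentially. (\<integral>x. (norm (?d (real n) x))\<^sup>2 \<partial>M\<^sub>0) < l / 2"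
    using l(1) by (intro order_tendstoD(2)) auto
  then have "\<forall>\<^sub>F n in sequentially. (\<integral>x. (norm (?d (real n) x))\<^sup>2 \<partial>M\<^sub>0) < l / 2 \<and> 0 < n"
    using eventually_gt_at_top[of 0] by eventually_elim auto
  then obtain n :: nat where n: "(\<integral>x. (norm (?d (real n) x))\<^sup>2 \<partial>M\<^sub>0) < l / 2" "0 < n"
    by (auto simp: eventually_sequentially)
  show ?thesis
  proof (rule that[of "real n"])
    show "0 < real n" using n by simp
    fix v :: "real^'d" assume v: "norm v = 1"
    have id: "integrable M\<^sub>0 (\<lambda>x. (norm (?d (real n) x))\<^sup>2)"
      by (rule Bochner_Integration.integrable_bound[OF integrable_score_sq]) (auto simp: trunc_def)
    have le: "(v \<bullet> s x)\<^sup>2 \<le> (v \<bullet> trunc (real n) x)\<^sup>2 + (norm (?d (real n) x))\<^sup>2" for x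
    proof -
      have "\<bar>v \<bullet> s x\<bar> \<le> norm (s x)" using Cauchy_Schwarz_ineq2[of v "s x"] v by simp
      then have "(v \<bullet> s x)\<^sup>2 \<le> (norm (s x))\<^sup>2" by (metis abs_ge_zero power_mono power2_abs)
      then show ?thesis by (simp add: trunc_def)
    qed
    have "l \<le> (\<integral>x. (v \<bullet> s x)\<^sup>2 \<partial>M\<^sub>0)" using l(2)[of v] v by (simp add: fisher_quadratic)
    also have "\<dots> \<le> (\<integral>x. (v \<bullet> trunc (real n) x)\<^sup>2 + (norm (?d (real n) x))\<^sup>2 \<partial>M\<^sub>0)"
      by (intro integral_mono le integrable_inner_score_sq Bochner_Integration.integrable_add integrable_inner_trunc_sq id)
    also have "\<dots> = (\<integral>x. (v \<bullet> trunc (real n) x)\<^sup>2 \<partial>M\<^sub>0) + (\<integral>x. (norm (?d (real n) x))\<^sup>2 \<partial>M\<^sub>0)"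
      by (intro Bochner_Integration.integral_add integrable_inner_trunc_sq id)
    finally show "l / 2 \<le> (\<integral>x. (v \<bullet> trunc (real n) x)\<^sup>2 \<partial>M\<^sub>0)" using n(1) by linarith
  qed
qed

text \<open>In the direction \<open>v\<close> of \<open>h\<close>, the mean of the truncated score
  moves by at least \<open>l / 4\<close> times the length of the increment. The test statistic
  \<open>\<Phi>\<close> does not depend on \<open>h\<close>, so one event per radius
  \<open>C\<close> works against every \<open>h\<close> with \<open>C \<le> norm h\<close>, and the
  error decays with \<open>norm h\<close>, not merely with \<open>C\<close>. The range
  \<open>\<delta> * sqrt n\<close> is a fixed neighbourhood in the original parameter.\<close>

lemma local_test:
  assumes "invertible FI"
  obtains T c c' \<delta> where "T > 0" "c > 0" "c' > 0" "\<delta> > 0" "ball \<theta>\<^sub>0 \<delta> \<subseteq> \<Theta>"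
    "\<And>n h C. 0 < n \<Longrightarrow> norm h < \<delta> * sqrt n \<Longrightarrow> 0 < C \<Longrightarrow> C \<le> norm h \<Longrightarrow>
      measure (Pn n (\<theta>\<^sub>0 + (1 / sqrt n) *\<^sub>R h)) {x\<in>space (N n). norm (\<Phi> T n x) \<le> c * C} \<le> exp (- c' * (norm h)\<^sup>2)"
    "\<And>n C. 0 < n \<Longrightarrow> 0 < C \<Longrightarrow>
      measure (P0 n) {x\<in>space (N n). c * C < norm (\<Phi> T n x)} \<le> 2 * DIM(real^'d) * exp (- c' * C\<^sup>2)"
proof -
  obtain l where l: "l > 0" "\<And>u. l * (norm u)\<^sup>2 \<le> u \<bullet> (FI *v u)" using fisher_pos_def[OF assms] by metis
  obtain T where T: "T > 0" "\<And>v. norm v = 1 \<Longrightarrow> l / 2 \<le> (\<integral>x. (v \<bullet> trunc T x)\<^sup>2 \<partial>M\<^sub>0)"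
    using truncation_level[OF l] by metis
  \<comment> \<open>Then \<open>T * \<eta> = l / 4\<close>, half of the lower bound in
    \<open>T(2)\<close>; the other half remains as the guaranteed shift of the mean.\<close>
  define \<eta> where "\<eta> = l / (4 * T)"
  have \<eta>: "\<eta> > 0" using l T by (simp add: \<eta>_def)
  obtain \<delta> where \<delta>: "\<delta> > 0" "\<And>u. norm u < \<delta> \<Longrightarrow> \<theta>\<^sub>0 + u \<in> \<Theta>"
    "\<And>u \<zeta> T. norm u < \<delta> \<Longrightarrow> \<zeta> \<in> borel_measurable \<mu> \<Longrightarrow> \<forall>x. \<bar>\<zeta> x\<bar> \<le> T \<Longrightarrow>
      \<bar>(\<integral>x. \<zeta> x \<partial>P (\<theta>\<^sub>0 + u)) - (\<integral>x. \<zeta> x \<partial>M\<^sub>0) - (\<integral>x. \<zeta> x * (u \<bullet> s x) \<partial>M\<^sub>0)\<bar> \<le> T * (\<eta> * norm u)"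
    using mean_shift[OF \<eta>] by blast
  define D where "D = real DIM(real^'d)"
  have D: "D \<ge> 1" unfolding D_def by (simp add: Suc_leI)
  \<comment> \<open>\<open>l / 8\<close> divides the shift \<open>l / 4\<close> evenly between the
    threshold of the test and the deviation fed into Hoeffding's inequality. The factor
    \<open>D\<^sup>2\<close> in \<open>c'\<close> pays for replacing the norm by single coordinates
    in the error under the null.\<close>
  define c where "c = l / 8"
  define c' where "c' = c\<^sup>2 / (2 * D\<^sup>2 * T\<^sup>2)"
  have c: "c > 0" using l by (simp add: c_def)
  have c': "c' > 0" "c' \<le> c\<^sup>2 / (2 * T\<^sup>2)"
  proof -
    show "c' > 0" using c D T by (simp add: c'_def)
    have "1 \<le> D\<^sup>2" using D by (simp add: one_le_power)
    then show "c' \<le> c\<^sup>2 / (2 * T\<^sup>2)" unfolding c'_def using T(1) D by (intro divide_left_mono) (auto simp: mult_le_cancel_right1 intro!: mult_pos_pos)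
  qed
  have tb: "\<bar>v \<bullet> trunc T x\<bar> \<le> T" if "norm v = 1" for v x
    using Cauchy_Schwarz_ineq2[of v "trunc T x"] norm_trunc[of T x] T(1) that by simp
  have vm [measurable]: "(\<lambda>x. v \<bullet> trunc T x) \<in> borel_measurable \<mu>" for v by measurable
  show ?thesis
  proof (rule that[OF T(1) c c'(1) \<delta>(1)])
    show "ball \<theta>\<^sub>0 \<delta> \<subseteq> \<Theta>"
    proof
      fix \<theta> assume "\<theta> \<in> ball \<theta>\<^sub>0 \<delta>"
      then have "norm (\<theta> - \<theta>\<^sub>0) < \<delta>" by (simp add: dist_norm norm_minus_commute)
      from \<delta>(2)[OF this] show "\<theta> \<in> \<Theta>" by simp
    qed
    fix n :: nat and C :: real assume n: "0 < n" and C: "0 < C"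
    have sn: "sqrt n > 0" "sqrt n * sqrt n = n" using n by auto
    show "measure (Pn n (\<theta>\<^sub>0 + (1 / sqrt n) *\<^sub>R h)) {x\<in>space (N n). norm (\<Phi> T n x) \<le> c * C} \<le> exp (- c' * (norm h)\<^sup>2)"
      if h: "norm h < \<delta> * sqrt n" "C \<le> norm h" for h
    proof -
      have h0: "norm h > 0" using C h(2) by linarith
      define u where "u = (1 / sqrt n) *\<^sub>R h"
      define v where "v = (1 / norm h) *\<^sub>R h"
      have nu: "norm u = norm h / sqrt n" by (simp add: u_def)
      have nu\<delta>: "norm u < \<delta>" unfolding nu using h(1) sn by (simp add: divide_less_eq)
      have u\<Theta>: "\<theta>\<^sub>0 + u \<in> \<Theta>" by (rule \<delta>(2)[OF nu\<delta>])
      have nv: "norm v = 1" using h0 by (simp add: v_def)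
      have uv: "u = norm u *\<^sub>R v" using h0 by (simp add: u_def v_def)
      let ?\<zeta> = "\<lambda>x. v \<bullet> trunc T x"
      let ?E = "\<integral>x. ?\<zeta> x \<partial>P (\<theta>\<^sub>0 + u)" and ?F = "\<integral>x. ?\<zeta> x \<partial>M\<^sub>0"
      have "\<bar>?E - ?F - (\<integral>x. ?\<zeta> x * (u \<bullet> s x) \<partial>M\<^sub>0)\<bar> \<le> T * (\<eta> * norm u)"
        by (rule \<delta>(3)[OF nu\<delta> vm[of v]]) (use tb[OF nv] in blast)
      moreover have "(\<integral>x. ?\<zeta> x * (u \<bullet> s x) \<partial>M\<^sub>0) = norm u * (\<integral>x. (?\<zeta> x)\<^sup>2 \<partial>M\<^sub>0)"
      proof -
        have "?\<zeta> x * (u \<bullet> s x) = norm u * (?\<zeta> x)\<^sup>2" for x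
          by (subst uv) (simp add: trunc_def power2_eq_square)
        then show ?thesis by simp
      qed
      moreover have "norm u * (l / 2) \<le> norm u * (\<integral>x. (?\<zeta> x)\<^sup>2 \<partial>M\<^sub>0)"
        by (intro mult_left_mono T(2) nv) auto
      moreover have "T * (\<eta> * norm u) = norm u * l / 4" using T(1) by (simp add: \<eta>_def)
      moreover have "\<bar>e - f - x\<bar> \<le> t \<Longrightarrow> x = w \<Longrightarrow> a * (b / 2) \<le> w \<Longrightarrow> t = a * b / 4 \<Longrightarrow> f + a * (b / 4) \<le> e"
        for e f x t w a b :: real unfolding times_divide_eq_right by linarith
      ultimately have shift: "?F + norm u * (l / 4) \<le> ?E" by blast
      have sub: "{x\<in>space (N n). norm (\<Phi> T n x) \<le> c * C}
        \<subseteq> {x\<in>space (Pn n (\<theta>\<^sub>0 + u)). (\<Sum>i<n. ?\<zeta> (x i)) \<le> real n * ?E - real n * (c * norm u)}"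
      proof safe
        fix x assume x: "x \<in> space (N n)" "norm (\<Phi> T n x) \<le> c * C"
        show "x \<in> space (Pn n (\<theta>\<^sub>0 + u))" using x(1) space_sample_law[OF sets_P[OF u\<Theta>]] by simp
        have "v \<bullet> \<Phi> T n x \<le> norm (\<Phi> T n x)" using norm_cauchy_schwarz[of v "\<Phi> T n x"] nv by simp
        also have "\<dots> \<le> c * norm h" using x(2) h(2) c by (meson mult_left_mono less_imp_le order_trans)
        finally have "(\<Sum>i<n. ?\<zeta> (x i)) - real n * ?F \<le> c * norm h * sqrt n"
          using sn(1) by (simp add: inner_\<Phi> pos_divide_le_eq)
        also have "c * norm h * sqrt n = real n * (c * norm u)"
          using sn by (simp add: nu field_simps)
        finally have 1: "(\<Sum>i<n. ?\<zeta> (x i)) \<le> real n * ?F + real n * (c * norm u)" by simp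
        have "real n * (?F + norm u * (l / 4)) \<le> real n * ?E" using shift by (rule mult_left_mono) simp
        moreover have "real n * (norm u * (l / 4)) = 2 * (real n * (c * norm u))" by (simp add: c_def)
        ultimately show "(\<Sum>i<n. ?\<zeta> (x i)) \<le> real n * ?E - real n * (c * norm u)"
          using 1 unfolding distrib_left by linarith
      qed
      interpret Pn: prob_space "Pn n (\<theta>\<^sub>0 + u)" by (rule prob_space_sample_law[OF prob_P[OF u\<Theta>]])
      have \<zeta>P: "?\<zeta> \<in> borel_measurable (P (\<theta>\<^sub>0 + u))" using sets_P[OF u\<Theta>] vm by (simp cong: measurable_cong_sets)
      have "measure (Pn n (\<theta>\<^sub>0 + u)) {x\<in>space (N n). norm (\<Phi> T n x) \<le> c * C}
        \<le> \<P>(x in Pn n (\<theta>\<^sub>0 + u). (\<Sum>i<n. ?\<zeta> (x i)) \<le> real n * ?E - real n * (c * norm u))"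
      proof (rule Pn.finite_measure_mono[OF sub])
        have [measurable]: "(\<lambda>x. \<Sum>i<n. ?\<zeta> (x i)) \<in> borel_measurable (Pn n (\<theta>\<^sub>0 + u))"
          by (intro borel_measurable_sum measurable_compose[OF measurable_sample_law_component \<zeta>P]) auto
        show "{x\<in>space (Pn n (\<theta>\<^sub>0 + u)). (\<Sum>i<n. ?\<zeta> (x i)) \<le> real n * ?E - real n * (c * norm u)} \<in> Pn.events"
          by measurable
      qed
      also have "\<dots> \<le> exp (- real n * (c * norm u)\<^sup>2 / (2 * T\<^sup>2))"
        using tb[OF nv] T(1) n c by (intro hoeffding_sample_law[OF prob_P[OF u\<Theta>] \<zeta>P]) auto
      also have "\<dots> = exp (- (c\<^sup>2 / (2 * T\<^sup>2)) * (norm h)\<^sup>2)"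
        using n by (simp add: nu power_mult_distrib power_divide)
      also have "\<dots> \<le> exp (- c' * (norm h)\<^sup>2)" using mult_right_mono[OF c'(2), of "(norm h)\<^sup>2"] by simp
      finally show ?thesis unfolding u_def .
    qed
    show "measure (P0 n) {x\<in>space (N n). c * C < norm (\<Phi> T n x)} \<le> 2 * DIM(real^'d) * exp (- c' * C\<^sup>2)"
    proof -
      interpret Pn: prob_space "P0 n" by (rule prob_space_sample_law[OF M0.prob_space_axioms])
      have sps: "space (N n) = space (P0 n)" by (rule space_sample_law) simp
      define e where "e = c * C / (D * sqrt n)"
      have e: "e \<ge> 0" using c C D sn by (simp add: e_def)
      let ?A = "\<lambda>v. {x\<in>space (P0 n). (\<Sum>i<n. v \<bullet> trunc T (x i)) \<le> real n * (\<integral>y. v \<bullet> trunc T y \<partial>M\<^sub>0) - real n * e}"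
      have \<zeta>P: "(\<lambda>x. v \<bullet> trunc T x) \<in> borel_measurable M\<^sub>0" for v by simp
      have A: "?A v \<in> Pn.events" for v
      proof -
        have [measurable]: "(\<lambda>x. \<Sum>i<n. v \<bullet> trunc T (x i)) \<in> borel_measurable (P0 n)"
          by (intro borel_measurable_sum measurable_compose[OF measurable_sample_law_component \<zeta>P]) auto
        show ?thesis by measurable
      qed
      have mA: "measure (P0 n) (?A v) \<le> exp (- c' * C\<^sup>2)" if nv: "norm v = 1" for v
      proof -
        have "measure (P0 n) (?A v) \<le> exp (- real n * e\<^sup>2 / (2 * T\<^sup>2))"
          using tb[OF nv] T(1) n e by (intro hoeffding_sample_law[OF M0.prob_space_axioms \<zeta>P]) auto
        also have "- real n * e\<^sup>2 / (2 * T\<^sup>2) = - c' * C\<^sup>2"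
          using n by (simp add: e_def c'_def power_mult_distrib power_divide)
        finally show ?thesis .
      qed
      have sub: "{x\<in>space (N n). c * C < norm (\<Phi> T n x)} \<subseteq> (\<Union>b\<in>Basis. ?A b \<union> ?A (- b))"
      proof safe
        fix x assume x: "x \<in> space (N n)" "c * C < norm (\<Phi> T n x)"
        have "\<exists>b\<in>Basis. c * C / D < \<bar>\<Phi> T n x \<bullet> b\<bar>"
        proof (rule ccontr)
          assume "\<not> (\<exists>b\<in>Basis. c * C / D < \<bar>\<Phi> T n x \<bullet> b\<bar>)"
          then have "(\<Sum>b\<in>Basis. \<bar>\<Phi> T n x \<bullet> b\<bar>) \<le> (\<Sum>b\<in>(Basis :: (real^'d) set). c * C / D)"
            by (intro sum_mono) (auto simp: not_less)
          also have "\<dots> = c * C" using D by (simp add: D_def)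
          finally show False using x(2) norm_le_l1[of "\<Phi> T n x"] by linarith
        qed
        then obtain b where b: "b \<in> Basis" "c * C / D < \<bar>\<Phi> T n x \<bullet> b\<bar>" by blast
        have "real n * e = c * C / D * (real n / sqrt n)" by (simp add: e_def)
        then have ne: "real n * e = c * C / D * sqrt n" by (simp only: real_div_sqrt[OF of_nat_0_le_iff])
        have key: "x \<in> ?A v" if "c * C / D < - (v \<bullet> \<Phi> T n x)" for v
        proof -
          have "c * C / D * sqrt n < - (v \<bullet> \<Phi> T n x) * sqrt n" using that sn(1) by (rule mult_strict_right_mono)
          also have "- (v \<bullet> \<Phi> T n x) * sqrt n = real n * (\<integral>y. v \<bullet> trunc T y \<partial>M\<^sub>0) - (\<Sum>i<n. v \<bullet> trunc T (x i))"
            unfolding inner_\<Phi> using sn(1) by (simp add: field_simps)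
          finally show ?thesis using x(1) sps ne by simp
        qed
        show "x \<in> (\<Union>b\<in>Basis. ?A b \<union> ?A (- b))"
        proof (cases "\<Phi> T n x \<bullet> b \<ge> 0")
          case True
          then have "x \<in> ?A (- b)" using b(2) by (intro key) (simp add: inner_commute)
          then show ?thesis using b(1) by blast
        next
          case False
          then have "x \<in> ?A b" using b(2) by (intro key) (simp add: inner_commute)
          then show ?thesis using b(1) by blast
        qed
      qed
      have "measure (P0 n) {x\<in>space (N n). c * C < norm (\<Phi> T n x)}
        \<le> measure (P0 n) (\<Union>b\<in>Basis. ?A b \<union> ?A (- b))"
        by (intro Pn.finite_measure_mono[OF sub] sets.finite_UN sets.Un A) auto
      also have "\<dots> \<le> (\<Sum>b\<in>Basis. measure (P0 n) (?A b \<union> ?A (- b)))"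
        by (intro measure_UNION_le sets.Un A) auto
      also have "\<dots> \<le> (\<Sum>b\<in>(Basis :: (real^'d) set). exp (- c' * C\<^sup>2) + exp (- c' * C\<^sup>2))"
      proof (rule sum_mono)
        fix b :: "real^'d" assume "b \<in> Basis"
        then have "norm b = 1" "norm (- b) = 1" by auto
        then have "measure (P0 n) (?A b) + measure (P0 n) (?A (- b)) \<le> exp (- c' * C\<^sup>2) + exp (- c' * C\<^sup>2)"
          by (intro add_mono mA)
        then show "measure (P0 n) (?A b \<union> ?A (- b)) \<le> exp (- c' * C\<^sup>2) + exp (- c' * C\<^sup>2)"
          using measure_Un_le[OF A[of b] A[of "- b"]] by linarith
      qed
      also have "\<dots> = 2 * DIM(real^'d) * exp (- c' * C\<^sup>2)" by simp
      finally show ?thesis .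
    qed
  qed
qed

text \<open>A single sample size \<open>m\<close> at which both errors are below 1/4 is enough: the
  average of \<open>\<phi> m\<close> over blocks is compared with 1/2, at distance at least 1/4 from
  its mean on either side, and Hoeffding's inequality gives the exponential rate. Uniformity over
  the far parameters is inherited from the supremum at that one \<open>m\<close>. \<open>A n\<close>
  is the event that the null is accepted.\<close>

lemma global_test:
  fixes \<phi> :: "nat \<Rightarrow> (nat \<Rightarrow> 'x) \<Rightarrow> real"
  assumes \<phi>: "\<And>n. \<phi> n \<in> borel_measurable (N n)"
      "\<And>n x. x \<in> space (N n) \<Longrightarrow> 0 \<le> \<phi> n x \<and> \<phi> n x \<le> 1"
    and type1: "(\<lambda>n. \<integral>\<^sup>+x. ennreal (\<phi> n x) \<partial>P0 n) \<longlonglongrightarrow> 0"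
    and type2: "(\<lambda>n. SUP \<theta>\<in>{\<theta> \<in> \<Theta>. norm (\<theta> - \<theta>\<^sub>0) \<ge> \<epsilon>}. \<integral>\<^sup>+x. ennreal (1 - \<phi> n x) \<partial>Pn n \<theta>) \<longlonglongrightarrow> 0"
  obtains A :: "nat \<Rightarrow> (nat \<Rightarrow> 'x) set" and c where "c > 0" "\<And>n. A n \<in> sets (N n)"
    "(\<lambda>n. measure (P0 n) (space (N n) - A n)) \<longlonglongrightarrow> 0"
    "\<forall>\<^sub>F n in sequentially. \<forall>\<theta>\<in>\<Theta>. norm (\<theta> - \<theta>\<^sub>0) \<ge> \<epsilon> \<longrightarrow> measure (Pn n \<theta>) (A n) \<le> exp (- c * real n)"
proof -
  have "\<forall>\<^sub>F n in sequentially. (\<integral>\<^sup>+x. ennreal (\<phi> n x) \<partial>P0 n) < ennreal (1/4)"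
    by (rule order_tendstoD(2)[OF type1]) simp
  moreover have "\<forall>\<^sub>F n in sequentially. (SUP \<theta>\<in>{\<theta> \<in> \<Theta>. norm (\<theta> - \<theta>\<^sub>0) \<ge> \<epsilon>}. \<integral>\<^sup>+x. ennreal (1 - \<phi> n x) \<partial>Pn n \<theta>) < ennreal (1/4)"
    by (rule order_tendstoD(2)[OF type2]) simp
  ultimately have "\<forall>\<^sub>F m in sequentially. (\<integral>\<^sup>+x. ennreal (\<phi> m x) \<partial>sample_law m M\<^sub>0) < ennreal (1/4) \<and>
     (SUP \<theta>\<in>{\<theta> \<in> \<Theta>. norm (\<theta> - \<theta>\<^sub>0) \<ge> \<epsilon>}. \<integral>\<^sup>+x. ennreal (1 - \<phi> m x) \<partial>sample_law m (P \<theta>)) < ennreal (1/4) \<and> 0 < m"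
    using eventually_gt_at_top[of 0] by eventually_elim auto
  then obtain m :: nat where m: "(\<integral>\<^sup>+x. ennreal (\<phi> m x) \<partial>sample_law m M\<^sub>0) < ennreal (1/4)"
     "(SUP \<theta>\<in>{\<theta> \<in> \<Theta>. norm (\<theta> - \<theta>\<^sub>0) \<ge> \<epsilon>}. \<integral>\<^sup>+x. ennreal (1 - \<phi> m x) \<partial>sample_law m (P \<theta>)) < ennreal (1/4)" "0 < m"
    by (auto simp: eventually_sequentially)
  define S where "S n x = (\<Sum>j<n div m. \<phi> m (\<lambda>i\<in>{..<m}. x (j * m + i)))" for n and x :: "nat \<Rightarrow> 'x"
  define A where "A n = {x\<in>space (N n). S n x \<le> real (n div m) / 2}" for n
  have km: "n div m * m \<le> n" for n by simp
  have S_meas: "S n \<in> borel_measurable (N n)" for n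
    unfolding S_def by (intro borel_measurable_sum measurable_compose[OF block_measurable[OF km] \<phi>(1)]) auto
  have A: "A n \<in> sets (N n)" for n
    unfolding A_def using S_meas[of n] by measurable
  have bd: "sets (Pn n \<theta>) = sets (N n)" "space (Pn n \<theta>) = space (N n)"
     "prob_space (Pn n \<theta>)" if "\<theta> \<in> \<Theta>" for \<theta> n
    using sets_sample_law[OF sets_P[OF that]] space_sample_law[OF sets_P[OF that]] prob_space_sample_law[OF prob_P[OF that]] by blast+
  have \<phi>P: "\<phi> m \<in> borel_measurable (sample_law m (P \<theta>))" if "\<theta> \<in> \<Theta>" for \<theta>
    using \<phi>(1) bd(1)[OF that] by (simp cong: measurable_cong_sets)
  have \<phi>b: "0 \<le> \<phi> m x \<and> \<phi> m x \<le> 1" if "\<theta> \<in> \<Theta>" "x \<in> space (sample_law m (P \<theta>))" for \<theta> x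
    using \<phi>(2) bd(2)[OF that(1)] that(2) by simp
  have \<phi>i: "integrable (sample_law m (P \<theta>)) (\<phi> m)" if "\<theta> \<in> \<Theta>" for \<theta>
  proof -
    interpret prob_space "sample_law m (P \<theta>)" by (rule bd(3)[OF that])
    show ?thesis using \<phi>b[OF that] \<phi>P[OF that] by (intro integrable_const_bound[of _ 1]) auto
  qed
  define k where "k n = n div m" for n
  have main0: "measure (P0 n) (space (N n) - A n) \<le> exp (- real (k n) / 8)" for n
  proof (cases "k n = 0")
    case True
    interpret prob_space "P0 n" by (rule bd(3)[OF \<theta>0_in])
    show ?thesis using True by simp
  next
    case False
    let ?E = "\<integral>y. \<phi> m y \<partial>sample_law m M\<^sub>0"
    have "ennreal ?E = (\<integral>\<^sup>+x. ennreal (\<phi> m x) \<partial>sample_law m M\<^sub>0)"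
      using \<phi>b[OF \<theta>0_in] by (intro nn_integral_eq_integral[symmetric] \<phi>i[OF \<theta>0_in] AE_I2) auto
    with m(1) have lt: "ennreal ?E < ennreal (1/4)" by simp
    have E: "?E \<le> 1/4"
    proof (rule ccontr)
      assume "\<not> ?E \<le> 1/4"
      then have "ennreal (1/4) \<le> ennreal ?E" by (intro ennreal_leI) linarith
      with lt show False by (meson leD)
    qed
    interpret prob_space "P0 n" by (rule bd(3)[OF \<theta>0_in])
    have Sm: "S n \<in> borel_measurable (P0 n)" using S_meas bd(1)[OF \<theta>0_in] by (simp cong: measurable_cong_sets)
    have "measure (P0 n) (space (N n) - A n) \<le> \<P>(x in P0 n. S n x \<ge> real (k n) * ?E + real (k n) / 4)"
    proof (rule finite_measure_mono)
      show "space (N n) - A n \<subseteq> {x\<in>space (P0 n). S n x \<ge> real (k n) * ?E + real (k n) / 4}"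
      proof safe
        fix x assume x: "x \<in> space (N n)" "x \<notin> A n"
        show "x \<in> space (P0 n)" using x(1) bd(2)[OF \<theta>0_in] by simp
        have "real (k n) * ?E \<le> real (k n) * (1/4)" by (rule mult_left_mono[OF E]) simp
        then show "real (k n) * ?E + real (k n) / 4 \<le> S n x" using x unfolding A_def k_def by simp
      qed
      show "{x\<in>space (P0 n). S n x \<ge> real (k n) * ?E + real (k n) / 4} \<in> events" using Sm by measurable
    qed
    also have "\<dots> \<le> exp (- 2 * (real (k n) / 4)\<^sup>2 / (real (k n) * (1 - 0)\<^sup>2))"
      unfolding S_def k_def using \<phi>b[OF \<theta>0_in] m(3) False
      by (intro block_hoeffding(2)[OF prob_P[OF \<theta>0_in] \<phi>P[OF \<theta>0_in]]) (auto simp: k_def)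
    also have "- 2 * (real (k n) / 4)\<^sup>2 / (real (k n) * (1 - 0)\<^sup>2) = - real (k n) / 8"
      using False by (simp add: power2_eq_square)
    finally show ?thesis .
  qed
  have main1: "measure (Pn n \<theta>) (A n) \<le> exp (- real (k n) / 8)" if \<theta>: "\<theta> \<in> \<Theta>" "norm (\<theta> - \<theta>\<^sub>0) \<ge> \<epsilon>" for n \<theta>
  proof (cases "k n = 0")
    case True
    interpret prob_space "Pn n \<theta>" by (rule bd(3)[OF \<theta>(1)])
    show ?thesis using True by simp
  next
    case False
    let ?E = "\<integral>y. \<phi> m y \<partial>sample_law m (P \<theta>)"
    interpret m: prob_space "sample_law m (P \<theta>)" by (rule bd(3)[OF \<theta>(1)])
    have "ennreal (1 - ?E) = ennreal (\<integral>y. 1 - \<phi> m y \<partial>sample_law m (P \<theta>))"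
      using \<phi>i[OF \<theta>(1)] m.prob_space by simp
    also have "\<dots> = (\<integral>\<^sup>+x. ennreal (1 - \<phi> m x) \<partial>sample_law m (P \<theta>))"
      using \<phi>b[OF \<theta>(1)] \<phi>i[OF \<theta>(1)] by (intro nn_integral_eq_integral[symmetric] AE_I2) auto
    also have "\<dots> \<le> (SUP \<theta>\<in>{\<theta> \<in> \<Theta>. norm (\<theta> - \<theta>\<^sub>0) \<ge> \<epsilon>}. \<integral>\<^sup>+x. ennreal (1 - \<phi> m x) \<partial>sample_law m (P \<theta>))"
      using \<theta> by (intro SUP_upper) auto
    also note m(2)
    finally have lt: "ennreal (1 - ?E) < ennreal (1/4)" .
    have E: "?E \<ge> 3/4"
    proof (rule ccontr)
      assume "\<not> ?E \<ge> 3/4"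
      then have "ennreal (1/4) \<le> ennreal (1 - ?E)" by (intro ennreal_leI) linarith
      with lt show False by (meson leD)
    qed
    interpret prob_space "Pn n \<theta>" by (rule bd(3)[OF \<theta>(1)])
    have Sm: "S n \<in> borel_measurable (Pn n \<theta>)" using S_meas bd(1)[OF \<theta>(1)] by (simp cong: measurable_cong_sets)
    have "measure (Pn n \<theta>) (A n) \<le> \<P>(x in Pn n \<theta>. S n x \<le> real (k n) * ?E - real (k n) / 4)"
    proof (rule finite_measure_mono)
      show "A n \<subseteq> {x\<in>space (Pn n \<theta>). S n x \<le> real (k n) * ?E - real (k n) / 4}"
      proof
        fix x assume x: "x \<in> A n"
        have "real (k n) * (3/4) \<le> real (k n) * ?E" by (rule mult_left_mono[OF E]) simp
        then show "x \<in> {x\<in>space (Pn n \<theta>). S n x \<le> real (k n) * ?E - real (k n) / 4}"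
          using x bd(2)[OF \<theta>(1)] unfolding A_def k_def by simp
      qed
      show "{x\<in>space (Pn n \<theta>). S n x \<le> real (k n) * ?E - real (k n) / 4} \<in> events" using Sm by measurable
    qed
    also have "\<dots> \<le> exp (- 2 * (real (k n) / 4)\<^sup>2 / (real (k n) * (1 - 0)\<^sup>2))"
      unfolding S_def k_def using \<phi>b[OF \<theta>(1)] m(3) False
      by (intro block_hoeffding(1)[OF prob_P[OF \<theta>(1)] \<phi>P[OF \<theta>(1)]]) (auto simp: k_def)
    also have "- 2 * (real (k n) / 4)\<^sup>2 / (real (k n) * (1 - 0)\<^sup>2) = - real (k n) / 8"
      using False by (simp add: power2_eq_square)
    finally show ?thesis .
  qed
  \<comment> \<open>The incomplete last block is shorter than \<open>m\<close>, hence at most half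
    of the observations are lost. Combined with the rate \<open>k n / 8\<close> this gives the
    constant \<open>1 / (16 * real m)\<close> below.\<close>
  have kn: "real n / (2 * real m) \<le> real (k n)" if "n \<ge> m" for n
  proof -
    have "n = k n * m + n mod m" by (simp add: k_def)
    also have "\<dots> \<le> k n * m + k n * m"
    proof -
      have "1 \<le> k n" using that m(3) by (simp add: k_def div_greater_zero_iff Suc_leI)
      then have "m \<le> k n * m" by simp
      moreover have "n mod m < m" using m(3) by simp
      ultimately show ?thesis by linarith
    qed
    finally have "real n \<le> real (k n * m + k n * m)" by (rule of_nat_mono)
    then show ?thesis using m(3) by (simp add: pos_divide_le_eq mult_ac)
  qed
  define c where "c = 1 / (16 * real m)"
  have c: "c > 0" using m(3) by (simp add: c_def)
  have ek: "exp (- real (k n) / 8) \<le> exp (- c * real n)" if "n \<ge> m" for n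
    using kn[OF that] m(3) by (simp add: c_def field_simps)
  show ?thesis
  proof (rule that[OF c A])
    have lim: "(\<lambda>n. exp (- c * real n)) \<longlonglongrightarrow> 0" using c by real_asymp
    show "(\<lambda>n. measure (P0 n) (space (N n) - A n)) \<longlonglongrightarrow> 0"
    proof (rule tendsto_sandwich[OF _ _ tendsto_const lim])
      show "\<forall>\<^sub>F n in sequentially. measure (P0 n) (space (N n) - A n) \<le> exp (- c * real n)"
      proof (rule eventually_sequentiallyI[of m])
        fix n assume "m \<le> n"
        from order_trans[OF main0 ek[OF this]]
        show "measure (P0 n) (space (N n) - A n) \<le> exp (- c * real n)" .
      qed
    qed simp
    show "\<forall>\<^sub>F n in sequentially. \<forall>\<theta>\<in>\<Theta>. norm (\<theta> - \<theta>\<^sub>0) \<ge> \<epsilon> \<longrightarrow> measure (Pn n \<theta>) (A n) \<le> exp (- c * real n)"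
    proof (rule eventually_sequentiallyI[of m], intro ballI impI)
      fix n \<theta> assume "m \<le> n" "\<theta> \<in> \<Theta>" "norm (\<theta> - \<theta>\<^sub>0) \<ge> \<epsilon>"
      from order_trans[OF main1[OF this(2,3)] ek[OF this(1)]]
      show "measure (Pn n \<theta>) (A n) \<le> exp (- c * real n)" .
    qed
  qed
qed

end

section \<open>Gaussian integrals\<close>

text \<open>Exponential moments make \<open>f z\<close>, the expectation of
  \<open>exp (z * W)\<close>, an everywhere convergent power series. It agrees with
  \<open>exp (z\<^sup>2 * \<sigma> / 2)\<close> at real arguments, hence at \<open>\<i>\<close> by
  the identity theorem. So Gaussian Fourier transforms in several dimensions follow from completing
  a square.\<close>

lemma char_of_gaussian_mgf:
  fixes W :: "'a \<Rightarrow> real"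
  assumes N: "prob_space N" and W [measurable]: "W \<in> borel_measurable N"
    and int: "\<And>\<tau>. integrable N (\<lambda>x. exp (\<tau> * W x))"
    and mgf: "\<And>\<tau>. (\<integral>x. exp (\<tau> * W x) \<partial>N) = exp (\<tau>\<^sup>2 * \<sigma> / 2)"
  shows "(\<integral>x. exp (\<i> * of_real (W x)) \<partial>N) = exp (- of_real \<sigma> / 2)"
proof -
  define f where "f z = (\<integral>x. exp (z * complex_of_real (W x)) \<partial>N)" for z
  have int_abs: "integrable N (\<lambda>x. exp (r * \<bar>W x\<bar>))" if "r \<ge> 0" for r
  proof (rule Bochner_Integration.integrable_bound)
    show "integrable N (\<lambda>x. exp (r * W x) + exp ((- r) * W x))"
      by (intro Bochner_Integration.integrable_add int)
    show "AE x in N. norm (exp (r * \<bar>W x\<bar>)) \<le> norm (exp (r * W x) + exp ((- r) * W x))"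
    proof (rule AE_I2)
      fix x show "norm (exp (r * \<bar>W x\<bar>)) \<le> norm (exp (r * W x) + exp ((- r) * W x))"
        by (cases "W x \<ge> 0") auto
    qed
  qed measurable
  have pow_int: "integrable N (\<lambda>x. complex_of_real (W x) ^ k)" for k
  proof (rule Bochner_Integration.integrable_bound)
    show "integrable N (\<lambda>x. fact k * exp (1 * \<bar>W x\<bar>))" using int_abs[of 1] by simp
    show "AE x in N. norm (complex_of_real (W x) ^ k) \<le> norm (fact k * exp (1 * \<bar>W x\<bar>))"
    proof (rule AE_I2)
      fix x
      have "\<bar>W x\<bar> ^ k / fact k \<le> exp \<bar>W x\<bar>"
      proof -
        have "(\<Sum>i\<in>{k}. \<bar>W x\<bar> ^ i /\<^sub>R fact i) \<le> (\<Sum>i. \<bar>W x\<bar> ^ i /\<^sub>R fact i)"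
          using summable_exp_generic[of "\<bar>W x\<bar>"] by (intro sum_le_suminf) auto
        then show ?thesis unfolding exp_def by (simp add: divide_inverse mult.commute)
      qed
      then have "\<bar>W x\<bar> ^ k \<le> fact k * exp \<bar>W x\<bar>" by (simp add: divide_le_eq mult.commute)
      then show "norm (complex_of_real (W x) ^ k) \<le> norm (fact k * exp (1 * \<bar>W x\<bar>))"
        by (simp add: norm_power abs_mult)
    qed
  qed measurable
  define a where "a k = (\<integral>x. complex_of_real (W x) ^ k \<partial>N) / fact k" for k
  have sums: "(\<lambda>k. a k * (z - 0) ^ k) sums f z" for z
    unfolding sums_def f_def
  proof -
    have "(\<lambda>m. \<integral>x. (\<Sum>k<m. (z * complex_of_real (W x)) ^ k / fact k) \<partial>N) \<longlonglongrightarrow> (\<integral>x. exp (z * complex_of_real (W x)) \<partial>N)"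
    proof (rule integral_dominated_convergence[where w = "\<lambda>x. exp (norm z * \<bar>W x\<bar>)"])
      show "integrable N (\<lambda>x. exp (norm z * \<bar>W x\<bar>))" by (rule int_abs) simp
      show "AE x in N. (\<lambda>m. \<Sum>k<m. (z * complex_of_real (W x)) ^ k / fact k) \<longlonglongrightarrow> exp (z * complex_of_real (W x))"
      proof (rule AE_I2)
        fix x
        show "(\<lambda>m. \<Sum>k<m. (z * complex_of_real (W x)) ^ k / fact k) \<longlonglongrightarrow> exp (z * complex_of_real (W x))"
          using exp_converges[of "z * complex_of_real (W x)"] unfolding sums_def
          by (simp add: scaleR_conv_of_real divide_inverse mult.commute)
      qed
      show "AE x in N. norm (\<Sum>k<m. (z * complex_of_real (W x)) ^ k / fact k) \<le> exp (norm z * \<bar>W x\<bar>)" for m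
      proof (rule AE_I2)
        fix x
        let ?r = "norm z * \<bar>W x\<bar>"
        have "norm (\<Sum>k<m. (z * complex_of_real (W x)) ^ k / fact k) \<le> (\<Sum>k<m. norm ((z * complex_of_real (W x)) ^ k / fact k))"
          by (rule norm_sum)
        also have "\<dots> = (\<Sum>k<m. ?r ^ k /\<^sub>R fact k)"
          by (intro sum.cong refl) (simp add: norm_divide norm_power norm_mult divide_inverse norm_inverse mult.commute)
        also have "\<dots> \<le> (\<Sum>k. ?r ^ k /\<^sub>R fact k)"
          using summable_exp_generic[of ?r] by (intro sum_le_suminf) auto
        also have "\<dots> = exp ?r" unfolding exp_def ..
        finally show "norm (\<Sum>k<m. (z * complex_of_real (W x)) ^ k / fact k) \<le> exp ?r" .
      qed
    qed measurable
    moreover have "(\<integral>x. (\<Sum>k<m. (z * complex_of_real (W x)) ^ k / fact k) \<partial>N) = (\<Sum>k<m. a k * (z - 0) ^ k)" for m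
    proof -
      have "(\<integral>x. (\<Sum>k<m. (z * complex_of_real (W x)) ^ k / fact k) \<partial>N) = (\<integral>x. (\<Sum>k<m. (z ^ k / fact k) * complex_of_real (W x) ^ k) \<partial>N)"
        by (intro Bochner_Integration.integral_cong refl sum.cong) (simp add: power_mult_distrib)
      also have "\<dots> = (\<Sum>k<m. \<integral>x. (z ^ k / fact k) * complex_of_real (W x) ^ k \<partial>N)"
        by (intro Bochner_Integration.integral_sum integrable_mult_right pow_int)
      also have "\<dots> = (\<Sum>k<m. a k * (z - 0) ^ k)"
        unfolding a_def by (intro sum.cong refl) (simp add: mult.commute)
      finally show ?thesis .
    qed
    ultimately show "(\<lambda>n. \<Sum>k<n. a k * (z - 0) ^ k) \<longlonglongrightarrow> (\<integral>x. exp (z * complex_of_real (W x)) \<partial>N)" by simp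
  qed
  \<comment> \<open>The radius 2 only serves to have \<open>\<i>\<close> and the real segment near 0
    in one connected open set.\<close>
  have hol: "f holomorphic_on ball 0 2"
    by (rule power_series_holomorphic[where a = a]) (rule sums)
  define g where "g z = f z - exp (z\<^sup>2 * of_real \<sigma> / 2)" for z
  have holg: "g holomorphic_on ball 0 2" unfolding g_def by (intro holomorphic_intros hol) auto
  have "g \<i> = 0"
  proof (rule analytic_continuation[OF holg, of "complex_of_real ` {0<..<1}" 0])
    show "complex_of_real ` {0<..<1} \<subseteq> ball 0 2" by auto
    show "0 islimpt complex_of_real ` {0<..<1}"
      unfolding islimpt_approachable
    proof (intro allI impI)
      fix e :: real assume e: "e > 0"
      show "\<exists>x'\<in>complex_of_real ` {0<..<1}. x' \<noteq> 0 \<and> dist x' 0 < e"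
        by (rule bexI[of _ "complex_of_real (min (e/2) (1/2))"]) (use e in auto)
    qed
    fix z assume "z \<in> complex_of_real ` {0<..<1}"
    then obtain \<tau> where z: "z = of_real \<tau>" by auto
    have "f z = complex_of_real (\<integral>x. exp (\<tau> * W x) \<partial>N)"
      unfolding f_def z integral_complex_of_real[symmetric] by (simp add: exp_of_real[symmetric])
    then show "g z = 0" unfolding g_def mgf z by (simp add: exp_of_real[symmetric])
  qed auto
  then show ?thesis by (simp add: g_def f_def)
qed

lemma lborel_affine_nn_integral:
  fixes f :: "'a::euclidean_space \<Rightarrow> ennreal"
  assumes [measurable]: "f \<in> borel_measurable borel" and "c \<noteq> 0"
  shows "(\<integral>\<^sup>+x. f x \<partial>lborel) = ennreal (\<bar>c\<bar> ^ DIM('a)) * (\<integral>\<^sup>+x. f (t + c *\<^sub>R x) \<partial>lborel)"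
  by (subst lborel_affine[OF assms(2), of t])
     (simp add: nn_integral_density nn_integral_distr nn_integral_cmult)

lemma lborel_affine_integral:
  fixes f :: "'a::euclidean_space \<Rightarrow> 'b::{banach,second_countable_topology}"
  assumes [measurable]: "f \<in> borel_measurable borel" and "c \<noteq> 0"
  shows "(\<integral>x. f x \<partial>lborel) = (\<bar>c\<bar> ^ DIM('a)) *\<^sub>R (\<integral>x. f (t + c *\<^sub>R x) \<partial>lborel)"
  by (subst lborel_affine[OF assms(2), of t]) (simp add: integral_density integral_distr)

lemma integrable_scaleR_right_iff:
  fixes f :: "'a \<Rightarrow> 'b::{banach,second_countable_topology}"
  assumes "c \<noteq> 0"
  shows "integrable M (\<lambda>x. c *\<^sub>R f x) \<longleftrightarrow> integrable M f"
proof
  assume "integrable M (\<lambda>x. c *\<^sub>R f x)"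
  then have "integrable M (\<lambda>x. (1 / c) *\<^sub>R (c *\<^sub>R f x))" by (rule integrable_scaleR_right)
  moreover have "(1 / c) *\<^sub>R (c *\<^sub>R f x) = f x" for x using assms by simp
  ultimately show "integrable M f" by (simp only:)
qed simp

lemma lborel_affine_integrable:
  fixes f :: "'a::euclidean_space \<Rightarrow> 'b::{banach,second_countable_topology}"
  assumes [measurable]: "f \<in> borel_measurable borel" and "c \<noteq> 0"
  shows "integrable lborel f \<longleftrightarrow> integrable lborel (\<lambda>x. f (t + c *\<^sub>R x))"
  using assms(2) by (subst lborel_affine[OF assms(2), of t])
    (simp add: integrable_density integrable_distr_eq integrable_scaleR_right_iff)

lemma matrix_inv_inverse:
  fixes A :: "real^'d^'d"
  assumes "invertible A"
  shows "A ** matrix_inv A = mat 1" "matrix_inv A ** A = mat 1"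
proof -
  have "A ** matrix_inv A = mat 1 \<and> matrix_inv A ** A = mat 1"
    using assms unfolding invertible_def matrix_inv_def by (rule someI_ex)
  then show "A ** matrix_inv A = mat 1" "matrix_inv A ** A = mat 1" by auto
qed

lemma matrix_inv_matrix_inv:
  fixes A :: "real^'d^'d"
  assumes "invertible A" shows "matrix_inv (matrix_inv A) = A"
proof -
  let ?B = "matrix_inv A"
  have inv: "invertible ?B" unfolding invertible_def using matrix_inv_inverse[OF assms] by blast
  have "matrix_inv ?B = (A ** ?B) ** matrix_inv ?B" by (simp add: matrix_inv_inverse[OF assms])
  also have "\<dots> = A ** (?B ** matrix_inv ?B)" by (simp add: matrix_mul_assoc)
  also have "\<dots> = A" by (simp add: matrix_inv_inverse[OF inv])
  finally show ?thesis .
qed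

text \<open>
  Assuming the total mass to be one replaces the computation of the Gaussian integral by a determinant.
\<close>

locale gaussian =
  fixes A :: "real^'d^'d" and l :: real
  assumes A_sym: "transpose A = A" and A_inv: "invertible A"
    and l: "l > 0" "\<And>u. l * (norm u)\<^sup>2 \<le> u \<bullet> (A *v u)"
    and normal: "prob_space (mv_normal 0 (matrix_inv A))"
begin

abbreviation "B \<equiv> matrix_inv A"

definition G :: "real^'d \<Rightarrow> real" where "G x = exp (- (x \<bullet> (A *v x)) / 2)"

definition c\<^sub>G :: real where "c\<^sub>G = sqrt ((2 * pi) ^ CARD('d) * det B)"

lemma A_B [simp]: "A *v (B *v u) = u" and B_A [simp]: "B *v (A *v u) = u"
  by (simp_all add: matrix_vector_mul_assoc matrix_inv_inverse[OF A_inv])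

lemma A_adjoint: "x \<bullet> (A *v y) = (A *v x) \<bullet> y"
proof -
  have "x \<bullet> (A *v y) = (x v* A) \<bullet> y" by (rule dot_lmul_matrix[symmetric])
  also have "x v* A = transpose A *v x" by simp
  finally show ?thesis by (simp add: A_sym)
qed

lemma continuous_mult_vec [continuous_intros]: "continuous_on S f \<Longrightarrow> continuous_on S (\<lambda>x. (M :: real^'d^'d) *v f x)"
  by (rule continuous_on_compose2[OF linear_continuous_on[of "(*v) M" UNIV]]) auto

lemma G_measurable [measurable]: "G \<in> borel_measurable borel"
  unfolding G_def by (intro borel_measurable_continuous_onI continuous_intros) auto

lemma G_pos [simp]: "G x > 0" "G x \<ge> 0" by (simp_all add: G_def)

lemma mv_normal_eq: "mv_normal y B = density lborel (\<lambda>x. ennreal (G (x - y) / c\<^sub>G))"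
  unfolding mv_normal_def matrix_inv_matrix_inv[OF A_inv] G_def c\<^sub>G_def ..

text \<open>No determinant is evaluated. Were \<open>c\<^sub>G\<close> not positive, the density
  would be 0 everywhere, since \<open>ennreal\<close> clips negative values and division by 0 gives
  0; this contradicts total mass one. Mass one then also identifies \<open>c\<^sub>G\<close> as the
  integral of \<open>G\<close>.\<close>

lemma c_pos: "c\<^sub>G > 0" and G_integrable: "integrable lborel G" and G_integral: "integral\<^sup>L lborel G = c\<^sub>G"
proof -
  have 1: "(\<integral>\<^sup>+x. ennreal (G x / c\<^sub>G) \<partial>lborel) = 1"
    using prob_space.emeasure_space_1[OF normal] unfolding mv_normal_eq
    by (simp add: emeasure_density mv_normal_eq)
  show c: "c\<^sub>G > 0"
  proof (rule ccontr)
    assume "\<not> c\<^sub>G > 0"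
    then have "ennreal (G x / c\<^sub>G) = 0" for x by (intro ennreal_neg divide_nonneg_nonpos) auto
    then show False using 1 by simp
  qed
  have 2: "integrable lborel (\<lambda>x. G x / c\<^sub>G) \<and> (\<integral>x. G x / c\<^sub>G \<partial>lborel) = 1"
    using 1 c by (subst nn_integral_eq_integrable[symmetric]) (auto simp: less_imp_le)
  then have "integrable lborel (\<lambda>x. c\<^sub>G * (G x / c\<^sub>G))" by (intro integrable_mult_right) auto
  then show "integrable lborel G" using c by simp
  show "integral\<^sup>L lborel G = c\<^sub>G" using 2 c by simp
qed

text \<open>Boundedness of \<open>A\<close> makes one radial Gaussian smaller than \<open>G\<close>;
  a dilation then reaches every rate \<open>a\<close>.\<close>

lemma gauss_integrable:
  assumes "a > 0" shows "integrable lborel (\<lambda>x::real^'d. exp (- a * (norm x)\<^sup>2))"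
proof -
  obtain K where K: "\<And>x. norm (A *v x) \<le> norm x * K" "K > 0"
    using bounded_linear.pos_bounded[OF linear_linear[THEN iffD2, OF matrix_vector_mul_linear[of A]]] by blast
  have "integrable lborel (\<lambda>x::real^'d. exp (- (K / 2) * (norm x)\<^sup>2))"
  proof (rule Bochner_Integration.integrable_bound[OF G_integrable])
    show "AE x::real^'d in lborel. norm (exp (- (K / 2) * (norm x)\<^sup>2)) \<le> norm (G x)"
    proof (rule AE_I2)
      fix x :: "real^'d"
      have "x \<bullet> (A *v x) \<le> norm x * norm (A *v x)" by (rule norm_cauchy_schwarz)
      also have "\<dots> \<le> norm x * (norm x * K)" by (intro mult_left_mono K) auto
      finally show "norm (exp (- (K / 2) * (norm x)\<^sup>2)) \<le> norm (G x)"
        by (simp add: G_def power2_eq_square mult_ac)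
    qed
  qed measurable
  moreover obtain b where b: "b \<noteq> 0" "a * b\<^sup>2 = K / 2"
    using K(2) assms by (intro that[of "sqrt (K / (2 * a))"]) auto
  moreover have "exp (- a * (norm (0 + b *\<^sub>R x))\<^sup>2) = exp (- (K / 2) * (norm x)\<^sup>2)" for x :: "real^'d"
    unfolding b(2)[symmetric] by (simp add: power_mult_distrib)
  ultimately have "integrable lborel (\<lambda>x::real^'d. exp (- a * (norm (0 + b *\<^sub>R x))\<^sup>2))" by (simp only:)
  then show ?thesis by (subst lborel_affine_integrable[OF _ b(1), where t = 0]) auto
qed

text \<open>A power below 2 is absorbed by the quadratic: \<open>R\<close> solves
  \<open>R powr q = e * R\<^sup>2\<close>, and beyond \<open>R\<close> the term
  \<open>r powr q\<close> is at most \<open>e * r\<^sup>2\<close>. The subquadratic and the linear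
  term each use up a quarter of the rate \<open>a\<close>, which leaves \<open>a / 2\<close>. This
  is where the exponent bound 2 of the growth condition on the loss enters.\<close>

lemma subgauss_integrable:
  fixes a k c q :: real
  assumes a: "a > 0" and c: "c \<ge> 0" and q: "0 < q" "q < 2" and k: "k \<ge> 0"
  shows "integrable lborel (\<lambda>x::real^'d. exp (c * norm x powr q + k * norm x - a * (norm x)\<^sup>2))"
proof -
  define e where "e = a / (4 * (c + 1))"
  have e: "e > 0" "c * e \<le> a / 4" using a c by (auto simp: e_def field_simps)
  define R where "R = (1 / e) powr (1 / (2 - q))"
  have R: "R > 0" using e by (simp add: R_def)
  have pw: "r powr q \<le> R powr q + e * r\<^sup>2" if r: "r \<ge> 0" for r
  proof (cases "r \<le> R")
    case True
    then have "r powr q \<le> R powr q" using r q by (intro powr_mono2) auto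
    then show ?thesis using e by (smt (verit) mult_nonneg_nonneg zero_le_power2)
  next
    case False
    then have r0: "r > 0" using R by linarith
    have "1 / e = R powr (2 - q)" using e q by (simp add: R_def powr_powr)
    also have "\<dots> \<le> r powr (2 - q)" using False R q by (intro powr_mono2) auto
    finally have "1 \<le> e * r powr (2 - q)" using e(1) by (simp add: field_simps)
    then have "r powr q \<le> (e * r powr (2 - q)) * r powr q" using mult_right_mono[of 1 _ "r powr q"] by simp
    also have "\<dots> = e * r powr 2" by (simp add: powr_add[symmetric])
    also have "\<dots> = e * r\<^sup>2" using r0 by simp
    finally show ?thesis by (smt (verit) powr_ge_zero)
  qed
  have lin: "k * r \<le> k\<^sup>2 / a + a / 4 * r\<^sup>2" for r
  proof -
    have "0 \<le> (k / sqrt a - sqrt a / 2 * r)\<^sup>2" by simp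
    also have "\<dots> = k\<^sup>2 / a - k * r + a / 4 * r\<^sup>2"
      using a by (simp add: power2_diff power_divide power_mult_distrib)
    finally show ?thesis by simp
  qed
  show ?thesis
  proof (rule Bochner_Integration.integrable_bound)
    show "integrable lborel (\<lambda>x::real^'d. exp (c * R powr q + k\<^sup>2 / a) * exp (- (a / 2) * (norm x)\<^sup>2))"
      using a by (intro integrable_mult_right gauss_integrable) simp
    show "AE x::real^'d in lborel. norm (exp (c * norm x powr q + k * norm x - a * (norm x)\<^sup>2)) \<le> norm (exp (c * R powr q + k\<^sup>2 / a) * exp (- (a / 2) * (norm x)\<^sup>2))"
    proof (rule AE_I2)
      fix x :: "real^'d"
      have "c * norm x powr q \<le> c * (R powr q + e * (norm x)\<^sup>2)" by (intro mult_left_mono pw c) auto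
      also have "\<dots> \<le> c * R powr q + a / 4 * (norm x)\<^sup>2"
        using mult_right_mono[OF e(2), of "(norm x)\<^sup>2"] by (simp add: algebra_simps)
      finally have "c * norm x powr q + k * norm x - a * (norm x)\<^sup>2 \<le> c * R powr q + k\<^sup>2 / a + - (a / 2) * (norm x)\<^sup>2"
        using lin[of "norm x"] by (simp add: algebra_simps)
      then show "norm (exp (c * norm x powr q + k * norm x - a * (norm x)\<^sup>2)) \<le> norm (exp (c * R powr q + k\<^sup>2 / a) * exp (- (a / 2) * (norm x)\<^sup>2))"
        by (simp add: exp_add[symmetric])
    qed
  qed measurable
qed

lemma complete_square: "exp (u \<bullet> x) * G x = exp ((u \<bullet> (B *v u)) / 2) * G (x - B *v u)"
proof -
  have "(x - B *v u) \<bullet> (A *v (x - B *v u)) = x \<bullet> (A *v x) - 2 * (u \<bullet> x) + u \<bullet> (B *v u)"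
    using A_adjoint[of "B *v u" x]
    by (simp add: matrix_vector_mult_diff_distrib inner_diff_left inner_diff_right inner_commute)
  then show ?thesis by (simp add: G_def exp_add[symmetric] field_simps)
qed

lemma translate_integral:
  fixes f :: "real^'d \<Rightarrow> 'b::{banach,second_countable_topology}"
  assumes "f \<in> borel_measurable borel"
  shows "(\<integral>x. f (x - y) \<partial>lborel) = (\<integral>x. f x \<partial>lborel)" "integrable lborel (\<lambda>x. f (x - y)) \<longleftrightarrow> integrable lborel f"
  using lborel_affine_integral[OF assms, of 1 "- y"] lborel_affine_integrable[OF assms, of 1 "- y"] by simp_all

lemma G_mgf: "integrable lborel (\<lambda>x. exp (u \<bullet> x) * G x)" "(\<integral>x. exp (u \<bullet> x) * G x \<partial>lborel) = exp ((u \<bullet> (B *v u)) / 2) * c\<^sub>G"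
  unfolding complete_square using translate_integral[OF G_measurable, of "B *v u"] G_integrable G_integral by auto

abbreviation "N0 \<equiv> mv_normal 0 B"

lemma normal_integral:
  fixes f :: "real^'d \<Rightarrow> 'b::{banach,second_countable_topology}"
  assumes [measurable]: "f \<in> borel_measurable borel"
  shows "(\<integral>x. f x \<partial>mv_normal y B) = (1 / c\<^sub>G) *\<^sub>R (\<integral>x. G (x - y) *\<^sub>R f x \<partial>lborel)"
    "integrable (mv_normal y B) f \<longleftrightarrow> integrable lborel (\<lambda>x. G (x - y) *\<^sub>R f x)"
proof -
  have [measurable]: "(\<lambda>x. G (x - y)) \<in> borel_measurable borel" by measurable
  show "(\<integral>x. f x \<partial>mv_normal y B) = (1 / c\<^sub>G) *\<^sub>R (\<integral>x. G (x - y) *\<^sub>R f x \<partial>lborel)"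
    unfolding mv_normal_eq using c_pos
    by (subst integral_density) (auto simp: divide_inverse mult.commute simp flip: scaleR_scaleR)
  have "integrable (mv_normal y B) f \<longleftrightarrow> integrable lborel (\<lambda>x. (1 / c\<^sub>G) *\<^sub>R (G (x - y) *\<^sub>R f x))"
    unfolding mv_normal_eq using c_pos by (subst integrable_density) (auto simp: divide_inverse mult.commute)
  also have "\<dots> \<longleftrightarrow> integrable lborel (\<lambda>x. G (x - y) *\<^sub>R f x)"
    using c_pos by (intro integrable_scaleR_right_iff) simp
  finally show "integrable (mv_normal y B) f \<longleftrightarrow> integrable lborel (\<lambda>x. G (x - y) *\<^sub>R f x)" .
qed

lemma sets_normal [measurable_cong, simp]: "sets (mv_normal y B) = sets borel"
  by (simp add: mv_normal_eq)

lemma char_normal: "(\<integral>x. exp (\<i> * of_real (u \<bullet> x)) \<partial>N0) = exp (- of_real (u \<bullet> (B *v u)) / 2)"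
proof (rule char_of_gaussian_mgf[OF normal])
  show "(\<lambda>x. u \<bullet> x) \<in> borel_measurable N0" by (simp cong: measurable_cong_sets)
  fix \<tau> :: real
  have eq: "exp (\<tau> * (u \<bullet> x)) = exp ((\<tau> *\<^sub>R u) \<bullet> x)" for x by simp
  show "integrable N0 (\<lambda>x. exp (\<tau> * (u \<bullet> x)))"
    unfolding eq using G_mgf(1)[of "\<tau> *\<^sub>R u"] by (subst normal_integral(2)) (auto simp: mult.commute)
  show "(\<integral>x. exp (\<tau> * (u \<bullet> x)) \<partial>N0) = exp (\<tau>\<^sup>2 * (u \<bullet> (B *v u)) / 2)"
    unfolding eq using G_mgf(2)[of "\<tau> *\<^sub>R u"] c_pos
    by (subst normal_integral(1)) (auto simp: mult.commute power2_eq_square matrix_vector_mult_scaleR mult.left_commute)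
qed

lemma char_G: "(\<integral>x. G x *\<^sub>R exp (\<i> * of_real (u \<bullet> x)) \<partial>lborel) = c\<^sub>G *\<^sub>R exp (- of_real (u \<bullet> (B *v u)) / 2)"
  using char_normal[of u] c_pos unfolding normal_integral(1)[where f = "\<lambda>x. exp (\<i> * complex_of_real (u \<bullet> x))", simplified]
  by (auto simp: field_simps scaleR_conv_of_real)

end

section \<open>Weak convergence from characteristic functions\<close>

context gaussian
begin

text \<open>The characteristic function of \<open>N0\<close>, used as an unnormalized smoothing
  kernel on the space of values of the random vectors.\<close>

definition K :: "real^'d \<Rightarrow> real" where "K z = exp (- (z \<bullet> (B *v z)) / 2)"

definition \<kappa> :: real where "\<kappa> = integral\<^sup>L lborel K"

lemma K_continuous: "continuous_on UNIV K"
  unfolding K_def by (intro continuous_intros) auto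

lemma K_measurable [measurable]: "K \<in> borel_measurable borel"
  by (intro borel_measurable_continuous_onI K_continuous)

lemma K_pos: "K z > 0" by (simp add: K_def)

lemma B_nonneg: "0 \<le> z \<bullet> (B *v z)"
proof -
  have "z \<bullet> (B *v z) = (B *v z) \<bullet> (A *v (B *v z))" by (simp add: inner_commute)
  also have "\<dots> \<ge> l * (norm (B *v z))\<^sup>2" by (rule l(2))
  finally show ?thesis using l(1) by (smt (verit) mult_nonneg_nonneg zero_le_power2)
qed

lemma K_le_1: "K z \<le> 1" using B_nonneg[of z] by (simp add: K_def)

lemma K_abs [simp]: "\<bar>K z\<bar> = K z" using K_pos[of z] by simp

lemma K_integrable: "integrable lborel K"
proof -
  obtain C where C: "\<And>x. norm (A *v x) \<le> norm x * C" "C > 0"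
    using bounded_linear.pos_bounded[OF linear_linear[THEN iffD2, OF matrix_vector_mul_linear[of A]]] by blast
  have "l / (2 * C\<^sup>2) > 0" using l C by simp
  from gauss_integrable[OF this] show ?thesis
  proof (rule Bochner_Integration.integrable_bound)
    show "AE z in lborel. norm (K z) \<le> norm (exp (- (l / (2 * C\<^sup>2)) * (norm z)\<^sup>2))"
    proof (rule AE_I2)
      fix z :: "real^'d"
      have "norm z \<le> norm (B *v z) * C" using C(1)[of "B *v z"] by simp
      then have "(norm z)\<^sup>2 \<le> (norm (B *v z) * C)\<^sup>2" by (intro power_mono) auto
      then have "l * (norm z)\<^sup>2 \<le> C\<^sup>2 * (l * (norm (B *v z))\<^sup>2)"
        using l(1) by (simp add: power_mult_distrib mult_ac)
      also have "\<dots> \<le> C\<^sup>2 * ((B *v z) \<bullet> (A *v (B *v z)))" by (intro mult_left_mono l(2)) auto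
      finally have "l * (norm z)\<^sup>2 \<le> C\<^sup>2 * (z \<bullet> (B *v z))" by (simp add: inner_commute)
      then have "l / C\<^sup>2 * (norm z)\<^sup>2 \<le> z \<bullet> (B *v z)" using C(2) by (simp add: field_simps)
      then show "norm (K z) \<le> norm (exp (- (l / (2 * C\<^sup>2)) * (norm z)\<^sup>2))" by (simp add: K_def)
    qed
  qed measurable
qed

lemma \<kappa>_pos: "\<kappa> > 0"
proof -
  have "\<kappa> \<ge> 0" unfolding \<kappa>_def using K_pos by (intro integral_nonneg_AE AE_I2 less_imp_le)
  moreover have "\<kappa> \<noteq> 0"
  proof
    assume "\<kappa> = 0"
    then have "AE z in lborel. K z = 0"
      unfolding \<kappa>_def using integral_nonneg_eq_0_iff_AE[OF K_integrable] K_pos by (auto simp: less_imp_le)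
    then have "AE z::real^'d in lborel. False" using K_pos by (auto elim!: eventually_mono simp: less_le)
    then have "(UNIV :: (real^'d) set) \<in> null_sets lborel" by (subst (asm) AE_iff_null) auto
    then show False by (auto simp: null_sets_def)
  qed
  ultimately show ?thesis by simp
qed

text \<open>
  Levy's theorem in several dimensions by Gaussian smoothing: the Gaussian kernel \<open>K\<close> is itself a mixture of characters.
\<close>

lemma char_smoothing:
  assumes M: "prob_space M" and X [measurable]: "X \<in> borel_measurable M"
  shows "complex_of_real (\<integral>x. K (\<sigma> *\<^sub>R (X x - y)) \<partial>M)
    = (1 / c\<^sub>G) *\<^sub>R (\<integral>u. G u *\<^sub>R (exp (- \<i> * of_real (\<sigma> * (u \<bullet> y))) * (\<integral>x. exp (\<i> * of_real ((\<sigma> *\<^sub>R u) \<bullet> X x)) \<partial>M)) \<partial>lborel)"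
proof -
  interpret M: prob_space M by fact
  interpret pair_sigma_finite M "lborel :: (real^'d) measure" ..
  let ?F = "\<lambda>x u. G u *\<^sub>R exp (\<i> * complex_of_real ((\<sigma> *\<^sub>R (X x - y)) \<bullet> u))"
  have Fm [measurable]: "case_prod ?F \<in> borel_measurable (M \<Otimes>\<^sub>M lborel)"
    by measurable
  have int: "integrable (M \<Otimes>\<^sub>M lborel) (case_prod ?F)"
  proof (rule Fubini_integrable[OF Fm])
    have "(\<integral>u. norm (?F x u) \<partial>lborel) = c\<^sub>G" for x using G_integral by simp
    then show "integrable M (\<lambda>x. \<integral>u. norm (case_prod ?F (x, u)) \<partial>lborel)" by simp
    have "integrable lborel (?F x)" for x
      by (rule Bochner_Integration.integrable_bound[OF G_integrable]) auto
    then show "AE x in M. integrable lborel (\<lambda>u. case_prod ?F (x, u))" by simp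
  qed
  have "complex_of_real (\<integral>x. K (\<sigma> *\<^sub>R (X x - y)) \<partial>M) = (\<integral>x. complex_of_real (K (\<sigma> *\<^sub>R (X x - y))) \<partial>M)"
    by simp
  also have "\<dots> = (\<integral>x. (1 / c\<^sub>G) *\<^sub>R (\<integral>u. ?F x u \<partial>lborel) \<partial>M)"
  proof (intro Bochner_Integration.integral_cong refl)
    fix x
    show "complex_of_real (K (\<sigma> *\<^sub>R (X x - y))) = (1 / c\<^sub>G) *\<^sub>R (\<integral>u. ?F x u \<partial>lborel)"
      using c_pos unfolding char_G K_def by (simp add: exp_of_real[symmetric])
  qed
  also have "\<dots> = (1 / c\<^sub>G) *\<^sub>R (\<integral>x. (\<integral>u. ?F x u \<partial>lborel) \<partial>M)" by simp
  also have "(\<integral>x. (\<integral>u. ?F x u \<partial>lborel) \<partial>M) = (\<integral>u. (\<integral>x. ?F x u \<partial>M) \<partial>lborel)"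
    by (rule Fubini_integral[OF int, symmetric])
  also have "\<dots> = (\<integral>u. G u *\<^sub>R (exp (- \<i> * of_real (\<sigma> * (u \<bullet> y))) * (\<integral>x. exp (\<i> * of_real ((\<sigma> *\<^sub>R u) \<bullet> X x)) \<partial>M)) \<partial>lborel)"
  proof (intro Bochner_Integration.integral_cong refl)
    fix u
    have "?F x u = G u *\<^sub>R (exp (- \<i> * of_real (\<sigma> * (u \<bullet> y))) * exp (\<i> * of_real ((\<sigma> *\<^sub>R u) \<bullet> X x)))" for x
      by (simp add: exp_add[symmetric] inner_diff_left inner_commute algebra_simps)
    then have "(\<integral>x. ?F x u \<partial>M) = (\<integral>x. G u *\<^sub>R (exp (- \<i> * of_real (\<sigma> * (u \<bullet> y))) * exp (\<i> * of_real ((\<sigma> *\<^sub>R u) \<bullet> X x))) \<partial>M)"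
      by (intro Bochner_Integration.integral_cong refl)
    also have "\<dots> = G u *\<^sub>R (exp (- \<i> * of_real (\<sigma> * (u \<bullet> y))) * (\<integral>x. exp (\<i> * of_real ((\<sigma> *\<^sub>R u) \<bullet> X x)) \<partial>M))"
      by (simp only: integral_scaleR_right integral_mult_right_zero)
    finally show "(\<integral>x. ?F x u \<partial>M) = G u *\<^sub>R (exp (- \<i> * of_real (\<sigma> * (u \<bullet> y))) * (\<integral>x. exp (\<i> * of_real ((\<sigma> *\<^sub>R u) \<bullet> X x)) \<partial>M))" .
  qed
  finally show ?thesis .
qed

lemma smoothing_substitution:
  fixes g :: "real^'d \<Rightarrow> real"
  assumes [measurable]: "g \<in> borel_measurable borel" and \<sigma>: "\<sigma> > 0"
  shows "(\<integral>z. g (x - (1 / \<sigma>) *\<^sub>R z) * K z \<partial>lborel) = \<sigma> ^ DIM(real^'d) * (\<integral>y. g y * K (\<sigma> *\<^sub>R (x - y)) \<partial>lborel)"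
proof -
  have m: "(\<lambda>z. g (x - (1 / \<sigma>) *\<^sub>R z) * K z) \<in> borel_measurable borel" by measurable
  have "x - (1 / \<sigma>) *\<^sub>R (\<sigma> *\<^sub>R x + (- \<sigma>) *\<^sub>R y) = y" for y using \<sigma> by (simp add: scaleR_diff_right)
  moreover have "\<sigma> *\<^sub>R x + (- \<sigma>) *\<^sub>R y = \<sigma> *\<^sub>R (x - y)" for y by (simp add: scaleR_diff_right)
  ultimately show ?thesis
    using lborel_affine_integral[OF m, of "- \<sigma>" "\<sigma> *\<^sub>R x"] \<sigma> by simp
qed

text \<open>Uniformity in \<open>x\<close> is obtained by contradiction: along a sequence of
  violating points, uniform continuity gives pointwise convergence of the integrands, and dominated
  convergence with majorant \<open>2 * C * K z\<close> applies.\<close>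

lemma smoothing_approx:
  fixes g :: "real^'d \<Rightarrow> real"
  assumes uc: "uniformly_continuous_on UNIV g" and C: "\<And>x. \<bar>g x\<bar> \<le> C" and e: "e > 0"
  obtains \<sigma> where "\<sigma> > 0" "\<And>x. \<bar>(\<integral>z. g (x - (1 / \<sigma>) *\<^sub>R z) * K z \<partial>lborel) - g x * \<kappa>\<bar> \<le> e"
proof -
  have [measurable]: "g \<in> borel_measurable borel"
    by (intro borel_measurable_continuous_onI uniformly_continuous_imp_continuous uc)
  have gi: "integrable lborel (\<lambda>z. g (f z) * K z)" if [measurable]: "f \<in> borel_measurable borel" for f
  proof (rule Bochner_Integration.integrable_bound[where f = "\<lambda>z. C * K z"])
    show "integrable lborel (\<lambda>z. C * K z)" using K_integrable by simp
    show "AE z in lborel. norm (g (f z) * K z) \<le> norm (C * K z)"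
      using order_trans[OF C abs_ge_self] by (auto simp: abs_mult K_pos less_imp_le intro!: mult_right_mono)
  qed measurable
  have "\<exists>n::nat. \<forall>x. \<bar>(\<integral>z. g (x - (1 / (real n + 1)) *\<^sub>R z) * K z \<partial>lborel) - g x * \<kappa>\<bar> \<le> e"
  proof (rule ccontr)
    assume "\<not> ?thesis"
    then have "\<forall>n. \<exists>x. \<not> \<bar>(\<integral>z. g (x - (1 / (real n + 1)) *\<^sub>R z) * K z \<partial>lborel) - g x * \<kappa>\<bar> \<le> e" by blast
    then obtain x where x: "\<And>n. \<not> \<bar>(\<integral>z. g (x n - (1 / (real n + 1)) *\<^sub>R z) * K z \<partial>lborel) - g (x n) * \<kappa>\<bar> \<le> e"
      by metis
    let ?d = "\<lambda>n z. (g (x n - (1 / (real n + 1)) *\<^sub>R z) - g (x n)) * K z"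
    have "(\<lambda>n. \<integral>z. ?d n z \<partial>lborel) \<longlonglongrightarrow> (\<integral>z. 0 \<partial>(lborel :: (real^'d) measure))"
    proof (rule integral_dominated_convergence[where w = "\<lambda>z. 2 * C * K z"])
      show "integrable lborel (\<lambda>z. 2 * C * K z)" using K_integrable by simp
      show "AE z in lborel. norm (?d n z) \<le> 2 * C * K z" for n
      proof (rule AE_I2)
        fix z
        have "\<bar>g (x n - (1 / (real n + 1)) *\<^sub>R z) - g (x n)\<bar> \<le> 2 * C"
          using C[of "x n - (1 / (real n + 1)) *\<^sub>R z"] C[of "x n"] by linarith
        then show "norm (?d n z) \<le> 2 * C * K z"
          unfolding real_norm_def abs_mult K_abs by (rule mult_right_mono) (simp add: K_pos less_imp_le)
      qed
      show "AE z in lborel. (\<lambda>n. ?d n z) \<longlonglongrightarrow> 0"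
      proof (rule AE_I2)
        fix z :: "real^'d"
        have "(\<lambda>n. g (x n - (1 / (real n + 1)) *\<^sub>R z) - g (x n)) \<longlonglongrightarrow> 0"
        proof (rule LIMSEQ_I)
          fix r :: real assume "r > 0"
          then obtain d where d: "d > 0" "\<And>x x'. dist x' x < d \<Longrightarrow> dist (g x') (g x) < r"
            using uc unfolding uniformly_continuous_on_def by (metis UNIV_I)
          have "(\<lambda>n. 1 / (real n + 1) * norm z) \<longlonglongrightarrow> 0" by real_asymp
          then have "\<forall>\<^sub>F n in sequentially. 1 / (real n + 1) * norm z < d" by (rule order_tendstoD(2)) (rule d(1))
          then have "\<forall>\<^sub>F n in sequentially. norm (g (x n - (1 / (real n + 1)) *\<^sub>R z) - g (x n) - 0) < r"
          proof eventually_elim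
            case (elim n)
            then have "dist (x n - (1 / (real n + 1)) *\<^sub>R z) (x n) < d" by (simp add: dist_norm)
            from d(2)[OF this] show ?case by (simp add: dist_norm)
          qed
          then show "\<exists>no. \<forall>n\<ge>no. norm (g (x n - (1 / (real n + 1)) *\<^sub>R z) - g (x n) - 0) < r"
            by (simp add: eventually_sequentially)
        qed
        from tendsto_mult_right[OF this, of "K z"] show "(\<lambda>n. ?d n z) \<longlonglongrightarrow> 0" by simp
      qed
    qed measurable
    moreover have "(\<integral>z. ?d n z \<partial>lborel) = (\<integral>z. g (x n - (1 / (real n + 1)) *\<^sub>R z) * K z \<partial>lborel) - g (x n) * \<kappa>" for n
    proof -
      have "(\<integral>z. ?d n z \<partial>lborel) = (\<integral>z. g (x n - (1 / (real n + 1)) *\<^sub>R z) * K z - g (x n) * K z \<partial>lborel)"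
        by (simp add: left_diff_distrib)
      also have "\<dots> = (\<integral>z. g (x n - (1 / (real n + 1)) *\<^sub>R z) * K z \<partial>lborel) - (\<integral>z. g (x n) * K z \<partial>lborel)"
        by (rule Bochner_Integration.integral_diff) (auto intro!: gi integrable_mult_right K_integrable)
      finally show ?thesis by (simp add: \<kappa>_def)
    qed
    ultimately have lim0: "(\<lambda>n. (\<integral>z. g (x n - (1 / (real n + 1)) *\<^sub>R z) * K z \<partial>lborel) - g (x n) * \<kappa>) \<longlonglongrightarrow> 0" by simp
    obtain n where "norm ((\<integral>z. g (x n - (1 / (real n + 1)) *\<^sub>R z) * K z \<partial>lborel) - g (x n) * \<kappa> - 0) < e"
      using LIMSEQ_D[OF lim0 e] by blast
    then show False using x[of n] by simp
  qed
  then obtain n :: nat where "\<And>x. \<bar>(\<integral>z. g (x - (1 / (real n + 1)) *\<^sub>R z) * K z \<partial>lborel) - g x * \<kappa>\<bar> \<le> e" by blast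
  then show ?thesis by (intro that[of "real n + 1"]) auto
qed

text \<open>Fubini moves the expectation onto the kernel, so the law of \<open>X\<close> enters only
  through expectations of \<open>K\<close>, which \<open>char_smoothing\<close> expresses by
  characteristic functions.\<close>

lemma expectation_smoothing:
  fixes g :: "real^'d \<Rightarrow> real"
  assumes M: "prob_space M" and X [measurable]: "X \<in> borel_measurable M"
    and g [measurable]: "g \<in> borel_measurable borel" and gi: "integrable lborel g" and \<sigma>: "\<sigma> > 0"
  shows "(\<integral>x. (\<integral>z. g (X x - (1 / \<sigma>) *\<^sub>R z) * K z \<partial>lborel) \<partial>M) = \<sigma> ^ DIM(real^'d) * (\<integral>y. g y * (\<integral>x. K (\<sigma> *\<^sub>R (X x - y)) \<partial>M) \<partial>lborel)"
proof -
  interpret M: prob_space M by fact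
  interpret pair_sigma_finite M "lborel :: (real^'d) measure" ..
  let ?F = "\<lambda>x y. g y * K (\<sigma> *\<^sub>R (X x - y))"
  have Fm [measurable]: "case_prod ?F \<in> borel_measurable (M \<Otimes>\<^sub>M lborel)" by measurable
  have bd: "norm (?F x y) \<le> norm (g y)" for x y
    using mult_left_mono[OF K_le_1, of "\<bar>g y\<bar>"] by (simp add: abs_mult)
  have ib: "integrable lborel (?F x)" if "x \<in> space M" for x
    by (rule Bochner_Integration.integrable_bound[OF gi]) (use bd in auto)
  have int: "integrable (M \<Otimes>\<^sub>M lborel) (case_prod ?F)"
  proof (rule Fubini_integrable[OF Fm])
    show "integrable M (\<lambda>x. \<integral>y. norm (case_prod ?F (x, y)) \<partial>lborel)"
    proof (rule M.integrable_const_bound[of _ "\<integral>y. norm (g y) \<partial>lborel"])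
      have "(\<integral>y. norm (?F x y) \<partial>lborel) \<le> (\<integral>y. norm (g y) \<partial>lborel)" if "x \<in> space M" for x
        by (intro integral_mono integrable_norm ib gi bd that)
      moreover have "0 \<le> (\<integral>y. norm (?F x y) \<partial>lborel)" for x by (intro integral_nonneg_AE) auto
      ultimately show "AE x in M. norm (\<integral>y. norm (case_prod ?F (x, y)) \<partial>lborel) \<le> (\<integral>y. norm (g y) \<partial>lborel)"
        by (intro AE_I2) (simp add: abs_of_nonneg)
    qed measurable
    show "AE x in M. integrable lborel (\<lambda>y. case_prod ?F (x, y))" using ib by (intro AE_I2) auto
  qed
  have "(\<integral>x. (\<integral>z. g (X x - (1 / \<sigma>) *\<^sub>R z) * K z \<partial>lborel) \<partial>M) = (\<integral>x. \<sigma> ^ DIM(real^'d) * (\<integral>y. ?F x y \<partial>lborel) \<partial>M)"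
    by (simp only: smoothing_substitution[OF g \<sigma>])
  also have "\<dots> = \<sigma> ^ DIM(real^'d) * (\<integral>x. (\<integral>y. ?F x y \<partial>lborel) \<partial>M)" by simp
  also have "(\<integral>x. (\<integral>y. ?F x y \<partial>lborel) \<partial>M) = (\<integral>y. (\<integral>x. ?F x y \<partial>M) \<partial>lborel)"
    by (rule Fubini_integral[OF int, symmetric])
  finally show ?thesis by simp
qed

context
  fixes M :: "nat \<Rightarrow> 'a measure" and X :: "nat \<Rightarrow> 'a \<Rightarrow> real^'d" and N :: "(real^'d) measure"
  assumes M: "\<And>n. prob_space (M n)" and X: "\<And>n. X n \<in> borel_measurable (M n)"
    and N: "prob_space N" "sets N = sets borel"
    and char: "\<And>v. (\<lambda>n. \<integral>x. exp (\<i> * of_real (v \<bullet> X n x)) \<partial>M n) \<longlonglongrightarrow> (\<integral>x. exp (\<i> * of_real (v \<bullet> x)) \<partial>N)"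
begin

lemma idN: "(\<lambda>x. x) \<in> borel_measurable N" using N(2) by (simp cong: measurable_cong_sets)

lemma smoothed_convergence: "(\<lambda>n. \<integral>x. K (\<sigma> *\<^sub>R (X n x - y)) \<partial>M n) \<longlonglongrightarrow> (\<integral>x. K (\<sigma> *\<^sub>R (x - y)) \<partial>N)"
proof -
  have char_bd: "norm (\<integral>x. exp (\<i> * complex_of_real (v \<bullet> X n x)) \<partial>M n) \<le> 1" for v n
  proof -
    interpret prob_space "M n" by (rule M)
    have "norm (\<integral>x. exp (\<i> * complex_of_real (v \<bullet> X n x)) \<partial>M n) \<le> (\<integral>x. norm (exp (\<i> * complex_of_real (v \<bullet> X n x))) \<partial>M n)"
      by (rule integral_norm_bound)
    then show ?thesis using prob_space by simp
  qed
  have char_meas: "(\<lambda>u. \<integral>x. exp (\<i> * complex_of_real ((\<sigma> *\<^sub>R u) \<bullet> X n x)) \<partial>M n) \<in> borel_measurable lborel" for n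
  proof -
    interpret prob_space "M n" by (rule M)
    note X[of n, measurable]
    show ?thesis by (rule borel_measurable_lebesgue_integral) measurable
  qed
  let ?I = "\<lambda>n u. G u *\<^sub>R (exp (- \<i> * of_real (\<sigma> * (u \<bullet> y))) * (\<integral>x. exp (\<i> * of_real ((\<sigma> *\<^sub>R u) \<bullet> X n x)) \<partial>M n))"
  let ?J = "\<lambda>u. G u *\<^sub>R (exp (- \<i> * of_real (\<sigma> * (u \<bullet> y))) * (\<integral>x. exp (\<i> * of_real ((\<sigma> *\<^sub>R u) \<bullet> x)) \<partial>N))"
  have Im: "?I n \<in> borel_measurable lborel" for n using char_meas[of n] by measurable
  have IJ: "(\<lambda>n. ?I n u) \<longlonglongrightarrow> ?J u" for u by (intro tendsto_intros char)
  have "(\<lambda>n. \<integral>u. ?I n u \<partial>lborel) \<longlonglongrightarrow> (\<integral>u. ?J u \<partial>lborel)"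
  proof (rule integral_dominated_convergence[OF _ Im G_integrable])
    show "?J \<in> borel_measurable lborel" by (rule borel_measurable_LIMSEQ_metric[OF Im IJ])
    show "AE u in lborel. (\<lambda>n. ?I n u) \<longlonglongrightarrow> ?J u" using IJ by (intro AE_I2)
    show "AE u in lborel. norm (?I n u) \<le> G u" for n
    proof (rule AE_I2)
      fix u
      have "norm (?I n u) = G u * norm (\<integral>x. exp (\<i> * complex_of_real ((\<sigma> *\<^sub>R u) \<bullet> X n x)) \<partial>M n)"
        by (simp add: norm_mult)
      also have "\<dots> \<le> G u * 1" by (intro mult_left_mono char_bd) simp
      finally show "norm (?I n u) \<le> G u" by simp
    qed
  qed
  then have "(\<lambda>n. (1 / c\<^sub>G) *\<^sub>R (\<integral>u. ?I n u \<partial>lborel)) \<longlonglongrightarrow> (1 / c\<^sub>G) *\<^sub>R (\<integral>u. ?J u \<partial>lborel)"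
    by (intro tendsto_intros)
  then have "(\<lambda>n. complex_of_real (\<integral>x. K (\<sigma> *\<^sub>R (X n x - y)) \<partial>M n)) \<longlonglongrightarrow> complex_of_real (\<integral>x. K (\<sigma> *\<^sub>R (x - y)) \<partial>N)"
    unfolding char_smoothing[OF M X] char_smoothing[OF N(1) idN] .
  then show ?thesis by (rule tendsto_of_real_iff[THEN iffD1])
qed

text \<open>Such a \<open>g\<close> is bounded, integrable and uniformly continuous. Its smoothed
  version at a fixed scale has convergent expectations, and the smoothing error is uniform in the
  law, hence in \<open>n\<close>.\<close>

lemma compact_support_convergence:
  fixes g :: "real^'d \<Rightarrow> real"
  assumes g: "continuous_on UNIV g" and R: "\<And>x. norm x > R \<Longrightarrow> g x = 0"
  shows "(\<lambda>n. \<integral>x. g (X n x) \<partial>M n) \<longlonglongrightarrow> (\<integral>x. g x \<partial>N)"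
proof -
  have gm [measurable]: "g \<in> borel_measurable borel" by (intro borel_measurable_continuous_onI g)
  have "compact (g ` cball 0 (max R 0))" by (intro compact_continuous_image continuous_on_subset[OF g]) auto
  then have "bounded (g ` cball 0 (max R 0))" by (rule compact_imp_bounded)
  then obtain C where "\<forall>y\<in>g ` cball 0 (max R 0). norm y \<le> C" by (auto simp: bounded_iff)
  then have C: "\<bar>g x\<bar> \<le> C" if "x \<in> cball 0 (max R 0)" for x using that by auto
  have C0: "C \<ge> 0" using C[of 0] by (simp add: order_trans[OF abs_ge_zero])
  have gC: "\<bar>g x\<bar> \<le> C" for x
  proof (cases "norm x > R")
    case True then show ?thesis using R C0 by simp
  next
    case False then show ?thesis using C[of x] by simp
  qed
  have uc: "uniformly_continuous_on UNIV g"
    unfolding uniformly_continuous_on_def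
  proof (intro allI impI)
    fix e :: real assume e: "e > 0"
    have "uniformly_continuous_on (cball 0 (R + 2)) g"
      by (intro compact_uniformly_continuous continuous_on_subset[OF g]) auto
    then obtain d where d: "d > 0" "\<And>x x'. x \<in> cball 0 (R + 2) \<Longrightarrow> x' \<in> cball 0 (R + 2) \<Longrightarrow> dist x' x < d \<Longrightarrow> dist (g x') (g x) < e"
      unfolding uniformly_continuous_on_def using e by metis
    show "\<exists>d>0. \<forall>x\<in>UNIV. \<forall>x'\<in>UNIV. dist x' x < d \<longrightarrow> dist (g x') (g x) < e"
    proof (intro exI[of _ "min d 1"] conjI ballI impI)
      show "min d 1 > 0" using d(1) by simp
      fix x x' :: "real^'d" assume dx: "dist x' x < min d 1"
      show "dist (g x') (g x) < e"
      proof (cases "x \<in> cball 0 (R + 2) \<and> x' \<in> cball 0 (R + 2)")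
        case True then show ?thesis using d(2)[of x x'] dx by simp
      next
        case False
        have "norm x \<le> norm x' + dist x' x" "norm x' \<le> norm x + dist x' x"
          using norm_triangle_ineq2[of x x'] norm_triangle_ineq2[of x' x] by (simp_all add: dist_norm norm_minus_commute)
        then have "norm x > R" "norm x' > R" using False dx by auto
        then show ?thesis using R e by simp
      qed
    qed
  qed
  have gi: "integrable lborel g"
  proof -
    have "integrable lborel (\<lambda>x. indicator (cball 0 R) x *\<^sub>R g x)"
      by (rule integrableI_bounded_set_indicator[where B = C]) (use gC emeasure_bounded_finite[of "cball (0::real^'d) R"] in auto)
    moreover have "indicator (cball 0 R) x *\<^sub>R g x = g x" for x using R[of x] by (auto simp: indicator_def not_le)
    ultimately show ?thesis by (simp only:)
  qed
  have lim\<sigma>: "(\<lambda>n. \<integral>x. (\<integral>z. g (X n x - (1 / \<sigma>) *\<^sub>R z) * K z \<partial>lborel) \<partial>M n) \<longlonglongrightarrow> (\<integral>x. (\<integral>z. g (x - (1 / \<sigma>) *\<^sub>R z) * K z \<partial>lborel) \<partial>N)"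
    if \<sigma>: "\<sigma> > 0" for \<sigma>
    unfolding expectation_smoothing[OF M X gm gi \<sigma>] expectation_smoothing[OF N(1) idN gm gi \<sigma>]
  proof (intro tendsto_mult_left integral_dominated_convergence[where w = "\<lambda>y. \<bar>g y\<bar>"])
    have Km: "(\<lambda>y. \<integral>x. K (\<sigma> *\<^sub>R (X n x - y)) \<partial>M n) \<in> borel_measurable lborel" for n
    proof -
      interpret prob_space "M n" by (rule M)
      note X[of n, measurable]
      show ?thesis by (rule borel_measurable_lebesgue_integral) measurable
    qed
    show "(\<lambda>y. g y * (\<integral>x. K (\<sigma> *\<^sub>R (X n x - y)) \<partial>M n)) \<in> borel_measurable lborel" for n
      using Km[of n] by measurable
    show "(\<lambda>y. g y * (\<integral>x. K (\<sigma> *\<^sub>R (x - y)) \<partial>N)) \<in> borel_measurable lborel"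
      using borel_measurable_LIMSEQ_metric[OF Km smoothed_convergence] by measurable
    show "integrable lborel (\<lambda>y. \<bar>g y\<bar>)" using gi by simp
    show "AE y in lborel. (\<lambda>n. g y * (\<integral>x. K (\<sigma> *\<^sub>R (X n x - y)) \<partial>M n)) \<longlonglongrightarrow> g y * (\<integral>x. K (\<sigma> *\<^sub>R (x - y)) \<partial>N)"
      by (intro AE_I2 tendsto_mult_left smoothed_convergence)
    show "AE y in lborel. norm (g y * (\<integral>x. K (\<sigma> *\<^sub>R (X n x - y)) \<partial>M n)) \<le> \<bar>g y\<bar>" for n
    proof (rule AE_I2)
      fix y
      interpret prob_space "M n" by (rule M)
      have "(\<integral>x. K (\<sigma> *\<^sub>R (X n x - y)) \<partial>M n) \<le> 1"
        using X[of n] K_le_1 by (intro integral_le_const integrable_const_bound[of _ 1]) auto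
      moreover have "0 \<le> (\<integral>x. K (\<sigma> *\<^sub>R (X n x - y)) \<partial>M n)" using K_pos by (intro integral_nonneg_AE AE_I2 less_imp_le)
      ultimately show "norm (g y * (\<integral>x. K (\<sigma> *\<^sub>R (X n x - y)) \<partial>M n)) \<le> \<bar>g y\<bar>"
        using mult_left_mono[of "\<integral>x. K (\<sigma> *\<^sub>R (X n x - y)) \<partial>M n" 1 "\<bar>g y\<bar>"] by (simp add: abs_mult)
    qed
  qed
  show ?thesis
  proof (rule LIMSEQ_I)
    fix r :: real assume r: "r > 0"
    \<comment> \<open>Two smoothing errors and one convergence error add up to less than
      \<open>4 * e\<close>; the factor \<open>\<kappa>\<close> compensates that \<open>K\<close>
      does not have integral one.\<close>
    define e where "e = r * \<kappa> / 4"
    have e: "e > 0" using r \<kappa>_pos by (simp add: e_def)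
    obtain \<sigma> where \<sigma>: "\<sigma> > 0" "\<And>x. \<bar>(\<integral>z. g (x - (1 / \<sigma>) *\<^sub>R z) * K z \<partial>lborel) - g x * \<kappa>\<bar> \<le> e"
      using smoothing_approx[OF uc gC e] by metis
    let ?S = "\<lambda>x. \<integral>z. g (x - (1 / \<sigma>) *\<^sub>R z) * K z \<partial>lborel"
    have Sm [measurable]: "?S \<in> borel_measurable borel"
      by (rule lborel.borel_measurable_lebesgue_integral) measurable
    have key: "\<bar>(\<integral>x. ?S (X' x) \<partial>M') - (\<integral>x. g (X' x) \<partial>M') * \<kappa>\<bar> \<le> e"
      if M': "prob_space M'" and X' [measurable]: "X' \<in> borel_measurable M'" for M' :: "'b measure" and X'
    proof -
      interpret prob_space M' by (rule M')
      have ig: "integrable M' (\<lambda>x. g (X' x))" by (rule integrable_const_bound[of _ C]) (use gC in auto)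
      have "\<bar>?S x\<bar> \<le> e + C * \<kappa>" for x
      proof -
        have "\<bar>g x * \<kappa>\<bar> \<le> C * \<kappa>" using gC[of x] \<kappa>_pos by (simp add: abs_mult mult_right_mono)
        then show ?thesis using \<sigma>(2)[of x] by linarith
      qed
      then have iS: "integrable M' (\<lambda>x. ?S (X' x))" by (intro integrable_const_bound[of _ "e + C * \<kappa>"]) auto
      have "(\<integral>x. ?S (X' x) \<partial>M') - (\<integral>x. g (X' x) \<partial>M') * \<kappa> = (\<integral>x. ?S (X' x) - g (X' x) * \<kappa> \<partial>M')"
        using ig iS by simp
      also have "\<bar>\<dots>\<bar> \<le> (\<integral>x. \<bar>?S (X' x) - g (X' x) * \<kappa>\<bar> \<partial>M')" by (rule integral_abs_bound)
      also have "\<dots> \<le> e" using ig iS \<sigma>(2) by (intro integral_le_const) auto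
      finally show ?thesis .
    qed
    have "\<forall>\<^sub>F n in sequentially. \<bar>(\<integral>x. ?S (X n x) \<partial>M n) - (\<integral>x. ?S x \<partial>N)\<bar> < e"
      using lim\<sigma>[OF \<sigma>(1)] e by (auto simp: tendsto_iff dist_real_def)
    then have "\<forall>\<^sub>F n in sequentially. norm ((\<integral>x. g (X n x) \<partial>M n) - (\<integral>x. g x \<partial>N)) < r"
    proof eventually_elim
      case (elim n)
      have "\<bar>(\<integral>x. g (X n x) \<partial>M n) * \<kappa> - (\<integral>x. g x \<partial>N) * \<kappa>\<bar> < 4 * e"
        using elim key[OF M X, of n] key[OF N(1) idN] e by linarith
      then have "\<bar>(\<integral>x. g (X n x) \<partial>M n) - (\<integral>x. g x \<partial>N)\<bar> * \<kappa> < r * \<kappa>"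
        using \<kappa>_pos by (simp add: e_def abs_mult left_diff_distrib[symmetric])
      then show ?case using \<kappa>_pos by simp
    qed
    then show "\<exists>no. \<forall>n\<ge>no. norm ((\<integral>x. g (X n x) \<partial>M n) - (\<integral>x. g x \<partial>N)) < r"
      by (simp add: eventually_sequentially)
  qed
qed

text \<open>A continuous cutoff reduces bounded \<open>g\<close> to compact support. Tightness is
  assumed and not derived from the characteristic functions, because in the application it follows
  at once from exponential moments.\<close>

lemma weak_convergence:
  fixes g :: "real^'d \<Rightarrow> real"
  assumes g: "continuous_on UNIV g" and C: "\<And>x. \<bar>g x\<bar> \<le> C"
    and tight: "\<And>e. e > 0 \<Longrightarrow> \<exists>k. \<forall>\<^sub>F n in sequentially. \<P>(x in M n. norm (X n x) > k) \<le> e"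
  shows "(\<lambda>n. \<integral>x. g (X n x) \<partial>M n) \<longlonglongrightarrow> (\<integral>x. g x \<partial>N)"
proof (rule LIMSEQ_I)
  fix r :: real assume r: "r > 0"
  then have r3: "r / 3 > 0" by simp
  interpret N: prob_space N by (rule N)
  have gm [measurable]: "g \<in> borel_measurable borel" by (intro borel_measurable_continuous_onI g)
  have C0: "C \<ge> 0" using C[of 0] by linarith
  define q where "q R x = max 0 (min 1 (R + 1 - norm x))" for R :: real and x :: "real^'d"
  have q: "0 \<le> q R x" "q R x \<le> 1" "norm x \<le> R \<Longrightarrow> q R x = 1" "norm x > R + 1 \<Longrightarrow> q R x = 0" for R x
    by (auto simp: q_def)
  have qc: "continuous_on UNIV (q R)" for R unfolding q_def by (intro continuous_intros)
  have [measurable]: "q R \<in> borel_measurable borel" for R by (intro borel_measurable_continuous_onI qc)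
  have gq: "\<bar>g x * q R x\<bar> \<le> C" for x R
    using mult_mono[OF C[of x] q(2)[of R x] C0 q(1)] q(1)[of R x] by (simp add: abs_mult)
  obtain k where k: "\<forall>\<^sub>F n in sequentially. \<P>(x in M n. norm (X n x) > k) \<le> r / (3 * (C + 1))"
    using tight[of "r / (3 * (C + 1))"] r C0 by auto
  have "(\<lambda>n. \<integral>x. g x * q (real n) x \<partial>N) \<longlonglongrightarrow> (\<integral>x. g x \<partial>N)"
  proof (rule integral_dominated_convergence[where w = "\<lambda>_. C"])
    show "AE x in N. (\<lambda>n. g x * q (real n) x) \<longlonglongrightarrow> g x"
    proof (rule AE_I2)
      fix x :: "real^'d"
      have "\<forall>\<^sub>F n in sequentially. norm x \<le> real n"
        by (rule eventually_sequentiallyI[of "nat \<lceil>norm x\<rceil>"]) linarith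
      then have "\<forall>\<^sub>F n in sequentially. g x = g x * q (real n) x" by eventually_elim (simp add: q(3))
      then show "(\<lambda>n. g x * q (real n) x) \<longlonglongrightarrow> g x" by (rule Lim_transform_eventually[OF tendsto_const])
    qed
  qed (use gq N(2) in \<open>auto cong: measurable_cong_sets\<close>)
  then have "\<forall>\<^sub>F n in sequentially. \<bar>(\<integral>x. g x * q (real n) x \<partial>N) - (\<integral>x. g x \<partial>N)\<bar> < r / 3 \<and> k \<le> real n"
  proof -
    assume lim: "(\<lambda>n. \<integral>x. g x * q (real n) x \<partial>N) \<longlonglongrightarrow> (\<integral>x. g x \<partial>N)"
    have "\<forall>\<^sub>F n in sequentially. \<bar>(\<integral>x. g x * q (real n) x \<partial>N) - (\<integral>x. g x \<partial>N)\<bar> < r / 3"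
      using tendstoD[OF lim r3] unfolding dist_real_def .
    moreover have "\<forall>\<^sub>F n in sequentially. k \<le> real n"
      by (rule eventually_sequentiallyI[of "nat \<lceil>k\<rceil>"]) linarith
    ultimately show ?thesis by eventually_elim auto
  qed
  then obtain R where R: "\<bar>(\<integral>x. g x * q R x \<partial>N) - (\<integral>x. g x \<partial>N)\<bar> < r / 3" "k \<le> R"
    by (auto simp: eventually_sequentially)
  have lim: "(\<lambda>n. \<integral>x. g (X n x) * q R (X n x) \<partial>M n) \<longlonglongrightarrow> (\<integral>x. g x * q R x \<partial>N)"
    by (rule compact_support_convergence[where R = "R + 1"]) (auto intro!: continuous_intros g qc simp: q(4))
  have "\<forall>\<^sub>F n in sequentially. \<bar>(\<integral>x. g (X n x) * q R (X n x) \<partial>M n) - (\<integral>x. g x * q R x \<partial>N)\<bar> < r / 3"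
    using tendstoD[OF lim r3] unfolding dist_real_def .
  with k have "\<forall>\<^sub>F n in sequentially. norm ((\<integral>x. g (X n x) \<partial>M n) - (\<integral>x. g x \<partial>N)) < r"
  proof eventually_elim
    case (elim n)
    interpret prob_space "M n" by (rule M)
    note X[of n, measurable]
    let ?E = "{x\<in>space (M n). norm (X n x) > k}"
    have i1: "integrable (M n) (\<lambda>x. g (X n x))" by (rule integrable_const_bound[of _ C]) (use C in auto)
    have i2: "integrable (M n) (\<lambda>x. g (X n x) * q R (X n x))" by (rule integrable_const_bound[of _ C]) (use gq in auto)
    have "\<bar>(\<integral>x. g (X n x) \<partial>M n) - (\<integral>x. g (X n x) * q R (X n x) \<partial>M n)\<bar> = \<bar>\<integral>x. g (X n x) - g (X n x) * q R (X n x) \<partial>M n\<bar>"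
      using i1 i2 by simp
    also have "\<dots> \<le> (\<integral>x. \<bar>g (X n x) - g (X n x) * q R (X n x)\<bar> \<partial>M n)" by (rule integral_abs_bound)
    also have "\<dots> \<le> (\<integral>x. C * indicator ?E x \<partial>M n)"
    proof (rule integral_mono)
      show "integrable (M n) (\<lambda>x. \<bar>g (X n x) - g (X n x) * q R (X n x)\<bar>)" using i1 i2 by simp
      show "integrable (M n) (\<lambda>x. C * indicator ?E x)"
        by (intro integrable_mult_right integrable_real_indicator) (auto simp: less_top[symmetric])
      fix x assume x: "x \<in> space (M n)"
      show "\<bar>g (X n x) - g (X n x) * q R (X n x)\<bar> \<le> C * indicator ?E x"
      proof (cases "norm (X n x) > k")
        case True
        have "g (X n x) - g (X n x) * q R (X n x) = g (X n x) * (1 - q R (X n x))" by (simp add: algebra_simps)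
        then have "\<bar>g (X n x) - g (X n x) * q R (X n x)\<bar> = \<bar>g (X n x)\<bar> * (1 - q R (X n x))"
          using q(2)[of R "X n x"] by (simp add: abs_mult)
        also have "\<dots> \<le> C * 1" using q(1)[of R "X n x"] q(2)[of R "X n x"] C0 by (intro mult_mono C) auto
        finally show ?thesis using True x by simp
      next
        case False
        then have "q R (X n x) = 1" using R(2) by (intro q(3)) simp
        then show ?thesis using C0 by simp
      qed
    qed
    also have "\<dots> = C * measure (M n) ?E" by simp
    also have "\<dots> \<le> C * (r / (3 * (C + 1)))" using elim(1) C0 by (rule mult_left_mono)
    also have "\<dots> \<le> r / 3"
    proof -
      have "C * (r / (3 * (C + 1))) = (C / (C + 1)) * (r / 3)" by simp
      also have "\<dots> \<le> 1 * (r / 3)" using C0 r by (intro mult_right_mono) auto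
      finally show ?thesis by simp
    qed
    finally have "\<bar>(\<integral>x. g (X n x) \<partial>M n) - (\<integral>x. g (X n x) * q R (X n x) \<partial>M n)\<bar> \<le> r / 3" .
    then show ?case using elim(2) R(1) unfolding real_norm_def by linarith
  qed
  then show "\<exists>no. \<forall>n\<ge>no. norm ((\<integral>x. g (X n x) \<partial>M n) - (\<integral>x. g x \<partial>N)) < r"
    by (simp add: eventually_sequentially)
qed

end

end

section \<open>The posterior in local coordinates\<close>

locale bvm_model = dqm_model \<mu> \<Theta> \<theta>\<^sub>0 P s
  for \<mu> :: "'x measure" and \<Theta> :: "(real^'d) set" and \<theta>\<^sub>0 P s +
  fixes prior :: "(real^'d) measure" and \<pi> :: "real^'d \<Rightarrow> real"
    and Q :: "nat \<Rightarrow> (nat \<Rightarrow> 'x) \<Rightarrow> (real^'d) measure" and \<epsilon>\<^sub>0 :: real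
  assumes FI_invertible: "invertible FI"
    and model: "P \<in> restrict_space borel \<Theta> \<rightarrow>\<^sub>M prob_algebra \<mu>"
    and prior_space: "prior \<in> space (prob_algebra (restrict_space borel \<Theta>))"
    and posterior: "\<And>n. is_posterior prior P n (Q n)"
    and marginal: "\<And>n. absolutely_continuous (marginal_law prior P n) (P0 n)"
    and \<pi>_measurable [measurable]: "\<pi> \<in> borel_measurable borel" and \<pi>_nonneg: "\<And>\<theta>. 0 \<le> \<pi> \<theta>"
    and prior_density: "distr prior borel (\<lambda>\<theta>. \<theta>) = density lborel (\<lambda>\<theta>. ennreal (\<pi> \<theta>))"
    and \<pi>_cont: "isCont \<pi> \<theta>\<^sub>0" and \<pi>_pos: "\<pi> \<theta>\<^sub>0 > 0"
    and \<epsilon>0_pos: "\<epsilon>\<^sub>0 > 0" and ball_\<Theta>: "ball \<theta>\<^sub>0 \<epsilon>\<^sub>0 \<subseteq> \<Theta>"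
    and \<pi>_le: "\<And>\<theta>. \<theta> \<in> ball \<theta>\<^sub>0 \<epsilon>\<^sub>0 \<Longrightarrow> \<pi> \<theta> \<le> 2 * \<pi> \<theta>\<^sub>0"
begin

abbreviation "\<B> \<equiv> ball \<theta>\<^sub>0 \<epsilon>\<^sub>0"

definition p0 :: "nat \<Rightarrow> (nat \<Rightarrow> 'x) \<Rightarrow> real" where "p0 n x = (\<Prod>i<n. dens \<theta>\<^sub>0 (x i))"

definition loc :: "nat \<Rightarrow> real^'d \<Rightarrow> real^'d" where "loc n h = \<theta>\<^sub>0 + (1 / sqrt n) *\<^sub>R h"

lemma sets_prior: "sets prior = sets (restrict_space borel \<Theta>)" and prob_prior: "prob_space prior"
  using prior_space by (auto simp: space_prob_algebra)

lemma id_measurable_prior: "(\<lambda>\<theta>. \<theta>) \<in> prior \<rightarrow>\<^sub>M borel"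
  unfolding measurable_cong_sets[OF sets_prior refl] by (rule measurable_restrict_space1) simp

lemma space_prior [simp]: "space prior = \<Theta>"
  using sets_eq_imp_space_eq[OF sets_prior] by (simp add: space_restrict_space)

sublocale prior: prob_space prior by (rule prob_prior)

sublocale N: sigma_finite_measure "N n" for n by (rule sigma_finite_sample_law[OF sigma_finite_\<mu>])

sublocale P0: prob_space "P0 n" for n by (rule prob_space_sample_law[OF M0.prob_space_axioms])

lemma sets_P0 [measurable_cong, simp]: "sets (P0 n) = sets (N n)" by (rule sets_sample_law) simp

lemma space_P0 [simp]: "space (P0 n) = space (N n)" by (rule space_sample_law) simp

lemma kernel: "(\<lambda>\<theta>. Pn n \<theta>) \<in> prior \<rightarrow>\<^sub>M prob_algebra (N n)"
  using measurable_sample_law[OF model, of n] unfolding measurable_cong_sets[OF sets_prior refl] .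

lemma dens_prod_measurable [measurable]: "(\<lambda>x. \<Prod>i<n. dens \<theta> (x i)) \<in> borel_measurable (N n)"
  by (intro borel_measurable_prod measurable_compose[OF measurable_sample_law_component dens_measurable]) auto

lemma p0_measurable [measurable]: "p0 n \<in> borel_measurable (N n)"
  unfolding p0_def by measurable

lemma p0_nonneg [simp]: "0 \<le> p0 n x" by (simp add: p0_def prod_nonneg)

lemma sample_law_eq_density:
  assumes "\<theta> \<in> \<Theta>"
  shows "Pn n \<theta> = density (N n) (\<lambda>x. ennreal (\<Prod>i<n. dens \<theta> (x i)))"
proof -
  have "prob_space (density \<mu> (\<lambda>x. ennreal (dens \<theta> x)))"
    using prob_P[OF assms] P_eq_density[OF assms] by simp
  then have "Pn n \<theta> = density (N n) (\<lambda>x. \<Prod>i<n. ennreal (dens \<theta> (x i)))"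
    unfolding P_eq_density[OF assms] by (intro sample_law_density[OF sigma_finite_\<mu>]) auto
  then show ?thesis by (simp add: prod_ennreal)
qed

lemma P0_density: "P0 n = density (N n) (\<lambda>x. ennreal (p0 n x))"
  unfolding p0_def by (rule sample_law_eq_density[OF \<theta>0_in])

lemma sample_law_ac: "\<theta> \<in> \<Theta> \<Longrightarrow> absolutely_continuous (N n) (Pn n \<theta>)"
  unfolding sample_law_eq_density by (rule absolutely_continuousI_density) measurable

text \<open>
  The densities of the model are only measurable in the observation. A jointly measurable density \<open>q\<close> is
  obtained as a Radon-Nikodym derivative of the joint law of parameter and sample, at the price that \<open>q n \<theta>\<close>
  is a density of \<open>Pn n \<theta>\<close> only after integration over \<open>\<theta>\<close>.
\<close>

definition is_joint_density :: "nat \<Rightarrow> (real^'d \<Rightarrow> (nat \<Rightarrow> 'x) \<Rightarrow> real) \<Rightarrow> bool" where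
  "is_joint_density n q \<longleftrightarrow> case_prod q \<in> borel_measurable (prior \<Otimes>\<^sub>M N n) \<and> (\<forall>\<theta> x. 0 \<le> q \<theta> x) \<and>
    (\<forall>G. case_prod G \<in> borel_measurable (prior \<Otimes>\<^sub>M N n) \<longrightarrow>
       (\<integral>\<^sup>+\<theta>. \<integral>\<^sup>+x. G \<theta> x * ennreal (q \<theta> x) \<partial>N n \<partial>prior) = (\<integral>\<^sup>+\<theta>. \<integral>\<^sup>+x. G \<theta> x \<partial>Pn n \<theta> \<partial>prior))"

definition q :: "nat \<Rightarrow> real^'d \<Rightarrow> (nat \<Rightarrow> 'x) \<Rightarrow> real" where "q n = (SOME q. is_joint_density n q)"

lemma q_joint_density: "is_joint_density n (q n)"
  unfolding q_def
proof (rule someI_ex[of "is_joint_density n"])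
  show "\<exists>q. is_joint_density n q"
  proof (rule kernel_density[OF prob_prior N.sigma_finite_measure_axioms kernel[of n]])
    show "absolutely_continuous (N n) (Pn n \<theta>)" if "\<theta> \<in> space prior" for \<theta>
      using sample_law_ac that by simp
    fix q' :: "real^'d \<Rightarrow> (nat \<Rightarrow> 'x) \<Rightarrow> real"
    assume "case_prod q' \<in> borel_measurable (prior \<Otimes>\<^sub>M N n)" "\<And>\<theta> x. 0 \<le> q' \<theta> x"
      "\<And>G. case_prod G \<in> borel_measurable (prior \<Otimes>\<^sub>M N n) \<Longrightarrow>
       (\<integral>\<^sup>+\<theta>. \<integral>\<^sup>+x. G \<theta> x * ennreal (q' \<theta> x) \<partial>N n \<partial>prior) = (\<integral>\<^sup>+\<theta>. \<integral>\<^sup>+x. G \<theta> x \<partial>Pn n \<theta> \<partial>prior)"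
    then have "is_joint_density n q'" unfolding is_joint_density_def by blast
    then show "\<exists>q. is_joint_density n q" by blast
  qed
qed

lemma q_measurable [measurable]: "case_prod (q n) \<in> borel_measurable (prior \<Otimes>\<^sub>M N n)"
  and q_nonneg [simp]: "0 \<le> q n \<theta> x"
  and q_integral: "\<And>G. case_prod G \<in> borel_measurable (prior \<Otimes>\<^sub>M N n) \<Longrightarrow>
       (\<integral>\<^sup>+\<theta>. \<integral>\<^sup>+x. G \<theta> x * ennreal (q n \<theta> x) \<partial>N n \<partial>prior) = (\<integral>\<^sup>+\<theta>. \<integral>\<^sup>+x. G \<theta> x \<partial>Pn n \<theta> \<partial>prior)"
  using q_joint_density[of n] unfolding is_joint_density_def by blast+

definition m :: "nat \<Rightarrow> (nat \<Rightarrow> 'x) \<Rightarrow> ennreal" where "m n x = (\<integral>\<^sup>+\<theta>. ennreal (q n \<theta> x) \<partial>prior)"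

lemma posterior_density:
  "AE x in P0 n. 0 < m n x \<and> m n x < \<infinity> \<and> sets (Q n x) = sets prior \<and> prob_space (Q n x) \<and>
    (\<forall>F\<in>borel_measurable prior. m n x * (\<integral>\<^sup>+\<theta>. F \<theta> \<partial>Q n x) = (\<integral>\<^sup>+\<theta>. F \<theta> * ennreal (q n \<theta> x) \<partial>prior))"
proof -
  obtain \<C> where \<C>: "countable \<C>" "Int_stable \<C>" "\<C> \<subseteq> Pow \<Theta>" "\<Theta> \<in> \<C>"
    "sets (restrict_space borel \<Theta>) = sigma_sets \<Theta> \<C>"
    using restrict_borel_generator[of \<Theta>] by metis
  have marg: "marginal_law prior P n = prior \<bind> (\<lambda>\<theta>. Pn n \<theta>)"
    by (simp add: marginal_law_def)
  note post = posterior[of n, unfolded is_posterior_def marg]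
  show ?thesis unfolding m_def
    by (rule bayes_formula[OF prob_prior N.sigma_finite_measure_axioms kernel q_measurable q_integral])
       (simp_all only: post[THEN conjunct1] post[THEN conjunct2, rule_format] \<C> sets_prior space_prior sets_P0 marginal[of n, unfolded marg])
qed

lemma p0_pos: "AE x in P0 n. 0 < p0 n x"
  unfolding P0_density by (subst AE_density) (auto simp: less_le)

section \<open>Prior and joint density in local coordinates\<close>

lemma loc_measurable [measurable]: "loc n \<in> borel_measurable borel"
  unfolding loc_def by measurable

lemma eventually_radius: "\<forall>\<^sub>F n in sequentially. C < \<epsilon>\<^sub>0 * sqrt (real n)"
proof -
  have "filterlim (\<lambda>n. \<epsilon>\<^sub>0 * sqrt (real n)) at_top sequentially" using \<epsilon>0_pos by real_asymp
  then show ?thesis unfolding filterlim_at_top_dense by blast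
qed

lemma loc_in_ball: "0 < n \<Longrightarrow> loc n h \<in> \<B> \<longleftrightarrow> norm h < \<epsilon>\<^sub>0 * sqrt n"
  by (simp add: loc_def dist_norm divide_less_eq)

text \<open>Dividing by \<open>\<pi> \<theta>\<^sub>0\<close> makes
  \<open>lik n h x * p0 n x\<close> the approximation without any further constant. The restriction
  to \<open>\<B>\<close> keeps \<open>loc n h\<close> inside \<open>\<Theta>\<close>, outside of
  which \<open>q\<close> carries no information.\<close>

definition u :: "nat \<Rightarrow> real^'d \<Rightarrow> (nat \<Rightarrow> 'x) \<Rightarrow> real" where
  "u n h x = (if loc n h \<in> \<B> then \<pi> (loc n h) * q n (loc n h) x / \<pi> \<theta>\<^sub>0 else 0)"

lemma u_nonneg [simp]: "0 \<le> u n h x"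
  unfolding u_def using \<pi>_nonneg \<pi>_pos by auto

text \<open>The prior lives on the trace sigma-algebra of \<open>\<Theta>\<close>, which is not
  assumed to be a Borel set. Functions measurable for it become Borel functions on the whole space
  only after being cut off to the open ball inside \<open>\<Theta>\<close>.\<close>

lemma measurable_on_ball:
  assumes "F \<in> borel_measurable prior"
  shows "(\<lambda>\<theta>. F \<theta> * indicator \<B> \<theta> :: ennreal) \<in> borel_measurable borel"
proof -
  have "F \<in> borel_measurable (restrict_space borel \<Theta>)" using assms unfolding measurable_cong_sets[OF sets_prior refl] .
  then have "F \<in> borel_measurable (restrict_space borel \<B>)" using ball_\<Theta> by (rule measurable_restrict_mono)
  then show ?thesis by (subst (asm) borel_measurable_restrict_space_iff_ennreal) auto
qed

lemma u_measurable [measurable]: "case_prod (u n) \<in> borel_measurable (borel \<Otimes>\<^sub>M N n)"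
proof -
  let ?S = "{z \<in> space (borel \<Otimes>\<^sub>M N n). loc n (fst z) \<in> \<B>}"
  have S: "?S \<in> sets (borel \<Otimes>\<^sub>M N n)"
  proof -
    have "?S = (\<lambda>z. loc n (fst z)) -` \<B> \<inter> space (borel \<Otimes>\<^sub>M N n)" by auto
    also have "\<dots> \<in> sets (borel \<Otimes>\<^sub>M N n)" by (rule measurable_sets[of _ _ borel]) auto
    finally show ?thesis .
  qed
  have 1: "(\<lambda>z. loc n (fst z)) \<in> restrict_space (borel \<Otimes>\<^sub>M N n) ?S \<rightarrow>\<^sub>M prior"
    unfolding measurable_cong_sets[OF refl sets_prior]
    by (rule measurable_restrict_space2) (use ball_\<Theta> in \<open>auto simp: space_restrict_space intro!: measurable_restrict_space1\<close>)
  have 2: "(\<lambda>z. (loc n (fst z), snd z)) \<in> restrict_space (borel \<Otimes>\<^sub>M N n) ?S \<rightarrow>\<^sub>M prior \<Otimes>\<^sub>M N n"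
    by (intro measurable_Pair 1 measurable_restrict_space1) auto
  have 3: "(\<lambda>z. \<pi> (loc n (fst z)) * q n (loc n (fst z)) (snd z) / \<pi> \<theta>\<^sub>0) \<in> borel_measurable (restrict_space (borel \<Otimes>\<^sub>M N n) ?S)"
  proof (intro borel_measurable_divide borel_measurable_times borel_measurable_const)
    show "(\<lambda>z. \<pi> (loc n (fst z))) \<in> borel_measurable (restrict_space (borel \<Otimes>\<^sub>M N n) ?S)"
      by (rule measurable_restrict_space1) measurable
    show "(\<lambda>z. q n (loc n (fst z)) (snd z)) \<in> borel_measurable (restrict_space (borel \<Otimes>\<^sub>M N n) ?S)"
      using measurable_compose[OF 2 q_measurable] by simp
  qed
  have "(\<lambda>z. indicator ?S z *\<^sub>R (\<pi> (loc n (fst z)) * q n (loc n (fst z)) (snd z) / \<pi> \<theta>\<^sub>0)) \<in> borel_measurable (borel \<Otimes>\<^sub>M N n)"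
    using 3 S by (subst (asm) borel_measurable_restrict_space_iff) auto
  then show ?thesis
    by (rule measurable_cong[THEN iffD1, rotated]) (auto simp: u_def split: split_indicator)
qed

text \<open>Substitution \<open>\<theta> = loc n h\<close> in the Lebesgue density of the prior;
  \<open>sqrt n ^ CARD('d)\<close> cancels the Jacobian.\<close>

lemma near_integral:
  assumes n: "0 < n" and F: "F \<in> borel_measurable prior"
  shows "ennreal (sqrt n ^ CARD('d) / \<pi> \<theta>\<^sub>0) * (\<integral>\<^sup>+\<theta>. F \<theta> * indicator \<B> \<theta> \<partial>prior)
    = (\<integral>\<^sup>+h. F (loc n h) * (indicator \<B> (loc n h) * ennreal (\<pi> (loc n h) / \<pi> \<theta>\<^sub>0)) \<partial>lborel)"
proof -
  let ?f = "\<lambda>\<theta>. F \<theta> * indicator \<B> \<theta> :: ennreal"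
  have f [measurable]: "?f \<in> borel_measurable borel" by (rule measurable_on_ball[OF F])
  have idm: "(\<lambda>\<theta>. \<theta>) \<in> prior \<rightarrow>\<^sub>M borel"
    unfolding measurable_cong_sets[OF sets_prior refl] by (rule measurable_restrict_space1) simp
  have sn: "sqrt n > 0" using n by simp
  have "(\<integral>\<^sup>+\<theta>. ?f \<theta> \<partial>prior) = (\<integral>\<^sup>+\<theta>. ?f \<theta> \<partial>distr prior borel (\<lambda>\<theta>. \<theta>))"
    by (rule nn_integral_distr[OF idm, symmetric]) measurable
  also have "\<dots> = (\<integral>\<^sup>+\<theta>. ennreal (\<pi> \<theta>) * ?f \<theta> \<partial>lborel)"
    unfolding prior_density by (rule nn_integral_density) measurable
  also have "\<dots> = ennreal (\<bar>1 / sqrt n\<bar> ^ DIM(real^'d)) * (\<integral>\<^sup>+h. ennreal (\<pi> (\<theta>\<^sub>0 + (1 / sqrt n) *\<^sub>R h)) * ?f (\<theta>\<^sub>0 + (1 / sqrt n) *\<^sub>R h) \<partial>lborel)"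
    by (rule lborel_affine_nn_integral) (use sn in auto)
  finally have "ennreal (sqrt n ^ CARD('d) / \<pi> \<theta>\<^sub>0) * (\<integral>\<^sup>+\<theta>. ?f \<theta> \<partial>prior)
     = (ennreal (sqrt n ^ CARD('d) / \<pi> \<theta>\<^sub>0) * ennreal (\<bar>1 / sqrt n\<bar> ^ DIM(real^'d))) * (\<integral>\<^sup>+h. ennreal (\<pi> (loc n h)) * ?f (loc n h) \<partial>lborel)"
    by (simp only: mult.assoc loc_def)
  also have "ennreal (sqrt n ^ CARD('d) / \<pi> \<theta>\<^sub>0) * ennreal (\<bar>1 / sqrt n\<bar> ^ DIM(real^'d)) = ennreal (1 / \<pi> \<theta>\<^sub>0)"
    using sn \<pi>_pos by (subst ennreal_mult[symmetric]) (auto simp: power_divide)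
  also have "ennreal (1 / \<pi> \<theta>\<^sub>0) * (\<integral>\<^sup>+h. ennreal (\<pi> (loc n h)) * ?f (loc n h) \<partial>lborel) = (\<integral>\<^sup>+h. ennreal (1 / \<pi> \<theta>\<^sub>0) * (ennreal (\<pi> (loc n h)) * ?f (loc n h)) \<partial>lborel)"
    by (rule nn_integral_cmult[symmetric]) measurable
  also have "\<dots> = (\<integral>\<^sup>+h. F (loc n h) * (indicator \<B> (loc n h) * ennreal (\<pi> (loc n h) / \<pi> \<theta>\<^sub>0)) \<partial>lborel)"
  proof (rule nn_integral_cong)
    fix h
    have "ennreal (\<pi> (loc n h) / \<pi> \<theta>\<^sub>0) = ennreal (1 / \<pi> \<theta>\<^sub>0) * ennreal (\<pi> (loc n h))"
      using \<pi>_nonneg \<pi>_pos by (subst ennreal_mult[symmetric]) auto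
    then show "ennreal (1 / \<pi> \<theta>\<^sub>0) * (ennreal (\<pi> (loc n h)) * ?f (loc n h)) = F (loc n h) * (indicator \<B> (loc n h) * ennreal (\<pi> (loc n h) / \<pi> \<theta>\<^sub>0))"
      by (simp add: mult_ac)
  qed
  finally show ?thesis .
qed

lemma q_section_measurable: "x \<in> space (N n) \<Longrightarrow> (\<lambda>\<theta>. ennreal (q n \<theta> x)) \<in> borel_measurable prior"
  by measurable

lemma near_integral_q:
  assumes n: "0 < n" and F: "F \<in> borel_measurable prior" and x: "x \<in> space (N n)"
  shows "ennreal (sqrt n ^ CARD('d) / \<pi> \<theta>\<^sub>0) * (\<integral>\<^sup>+\<theta>. F \<theta> * ennreal (q n \<theta> x) * indicator \<B> \<theta> \<partial>prior)
    = (\<integral>\<^sup>+h. F (loc n h) * ennreal (u n h x) \<partial>lborel)"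
proof -
  have "(\<lambda>\<theta>. F \<theta> * ennreal (q n \<theta> x)) \<in> borel_measurable prior"
    by (rule borel_measurable_times_ennreal[OF F q_section_measurable[OF x]])
  from near_integral[OF n this] show ?thesis
  proof (rule trans, intro nn_integral_cong)
    fix h
    have "ennreal (q n (loc n h) x) * ennreal (\<pi> (loc n h) / \<pi> \<theta>\<^sub>0) = ennreal (\<pi> (loc n h) * q n (loc n h) x / \<pi> \<theta>\<^sub>0)"
      using \<pi>_nonneg \<pi>_pos by (subst ennreal_mult[symmetric]) (auto simp: mult_ac)
    then show "F (loc n h) * ennreal (q n (loc n h) x) * (indicator \<B> (loc n h) * ennreal (\<pi> (loc n h) / \<pi> \<theta>\<^sub>0)) = F (loc n h) * ennreal (u n h x)"
      by (cases "loc n h \<in> \<B>") (auto simp: u_def mult_ac)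
  qed
qed

text \<open>The integrated property of \<open>q\<close>, transported to local coordinates. It brings
  in the actual laws \<open>Pn n (loc n h)\<close>, to which test errors and the density
  approximation apply for every single \<open>h\<close>.\<close>

lemma joint_integral:
  assumes n: "0 < n" and G [measurable]: "case_prod G \<in> borel_measurable (borel \<Otimes>\<^sub>M N n)"
  shows "(\<integral>\<^sup>+x. \<integral>\<^sup>+h. G h x * ennreal (u n h x) \<partial>lborel \<partial>N n)
    = (\<integral>\<^sup>+h. (\<integral>\<^sup>+x. G h x \<partial>Pn n (loc n h)) * (indicator \<B> (loc n h) * ennreal (\<pi> (loc n h) / \<pi> \<theta>\<^sub>0)) \<partial>lborel)"
    "(\<lambda>h. (\<integral>\<^sup>+x. G h x \<partial>Pn n (loc n h)) * indicator \<B> (loc n h)) \<in> borel_measurable borel"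
proof -
  interpret pair_sigma_finite prior "N n" ..
  let ?K = "ennreal (sqrt n ^ CARD('d) / \<pi> \<theta>\<^sub>0)"
  let ?h = "\<lambda>\<theta>. sqrt n *\<^sub>R (\<theta> - \<theta>\<^sub>0)"
  let ?i = "indicator \<B> :: _ \<Rightarrow> ennreal"
  have hl: "?h (loc n h) = h" for h using n by (simp add: loc_def)
  have idm [measurable]: "(\<lambda>\<theta>. \<theta>) \<in> prior \<rightarrow>\<^sub>M borel"
    unfolding measurable_cong_sets[OF sets_prior refl] by (rule measurable_restrict_space1) simp
  have hm [measurable]: "?h \<in> prior \<rightarrow>\<^sub>M borel" using measurable_compose[OF idm, of ?h borel] by simp
  have im [measurable]: "?i \<in> borel_measurable prior" by (rule measurable_compose[OF idm borel_measurable_indicator]) simp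
  have Gm [measurable]: "(\<lambda>(\<theta>, x). G (?h \<theta>) x) \<in> borel_measurable (prior \<Otimes>\<^sub>M N n)"
  proof -
    have "(\<lambda>z. (?h (fst z), snd z)) \<in> prior \<Otimes>\<^sub>M N n \<rightarrow>\<^sub>M borel \<Otimes>\<^sub>M N n" by measurable
    from measurable_compose[OF this G] show ?thesis by (simp add: case_prod_beta)
  qed
  have Gx: "(\<lambda>\<theta>. G (?h \<theta>) x) \<in> borel_measurable prior" if "x \<in> space (N n)" for x
    using that by measurable
  have GK: "(\<lambda>\<theta>. \<integral>\<^sup>+x. G (?h \<theta>) x \<partial>Pn n \<theta>) \<in> borel_measurable prior"
    by (rule nn_integral_measurable_subprob_algebra2[OF _ measurable_prob_algebraD[OF kernel]]) measurable
  have "(\<integral>\<^sup>+x. \<integral>\<^sup>+h. G h x * ennreal (u n h x) \<partial>lborel \<partial>N n)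
    = (\<integral>\<^sup>+x. ?K * (\<integral>\<^sup>+\<theta>. G (?h \<theta>) x * ennreal (q n \<theta> x) * ?i \<theta> \<partial>prior) \<partial>N n)"
    by (intro nn_integral_cong, subst near_integral_q[OF n Gx]) (auto simp: hl)
  also have "\<dots> = ?K * (\<integral>\<^sup>+x. (\<integral>\<^sup>+\<theta>. G (?h \<theta>) x * ennreal (q n \<theta> x) * ?i \<theta> \<partial>prior) \<partial>N n)"
    by (rule nn_integral_cmult) measurable
  also have "(\<integral>\<^sup>+x. (\<integral>\<^sup>+\<theta>. G (?h \<theta>) x * ennreal (q n \<theta> x) * ?i \<theta> \<partial>prior) \<partial>N n)
     = (\<integral>\<^sup>+\<theta>. (\<integral>\<^sup>+x. G (?h \<theta>) x * ennreal (q n \<theta> x) * ?i \<theta> \<partial>N n) \<partial>prior)"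
    by (rule Fubini') measurable
  also have "\<dots> = (\<integral>\<^sup>+\<theta>. (\<integral>\<^sup>+x. (G (?h \<theta>) x * ?i \<theta>) * ennreal (q n \<theta> x) \<partial>N n) \<partial>prior)"
    by (simp only: mult_ac)
  also have "\<dots> = (\<integral>\<^sup>+\<theta>. (\<integral>\<^sup>+x. G (?h \<theta>) x * ?i \<theta> \<partial>Pn n \<theta>) \<partial>prior)"
    by (rule q_integral) measurable
  also have "\<dots> = (\<integral>\<^sup>+\<theta>. (\<integral>\<^sup>+x. G (?h \<theta>) x \<partial>Pn n \<theta>) * ?i \<theta> \<partial>prior)"
  proof (rule nn_integral_cong)
    fix \<theta> assume "\<theta> \<in> space prior"
    then have "sets (Pn n \<theta>) = sets (N n)" by (intro sets_sample_law sets_P) simp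
    moreover have "(\<lambda>x. G (?h \<theta>) x) \<in> borel_measurable (N n)" by measurable
    ultimately have "(\<lambda>x. G (?h \<theta>) x) \<in> borel_measurable (Pn n \<theta>)" by (simp cong: measurable_cong_sets)
    then show "(\<integral>\<^sup>+x. G (?h \<theta>) x * ?i \<theta> \<partial>Pn n \<theta>) = (\<integral>\<^sup>+x. G (?h \<theta>) x \<partial>Pn n \<theta>) * ?i \<theta>"
      by (rule nn_integral_multc)
  qed
  also have "?K * \<dots> = (\<integral>\<^sup>+h. (\<integral>\<^sup>+x. G (?h (loc n h)) x \<partial>Pn n (loc n h)) * (?i (loc n h) * ennreal (\<pi> (loc n h) / \<pi> \<theta>\<^sub>0)) \<partial>lborel)"
    by (rule near_integral[OF n GK])
  finally show "(\<integral>\<^sup>+x. \<integral>\<^sup>+h. G h x * ennreal (u n h x) \<partial>lborel \<partial>N n)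
    = (\<integral>\<^sup>+h. (\<integral>\<^sup>+x. G h x \<partial>Pn n (loc n h)) * (?i (loc n h) * ennreal (\<pi> (loc n h) / \<pi> \<theta>\<^sub>0)) \<partial>lborel)"
    by (simp only: hl)
  have "(\<lambda>h. (\<integral>\<^sup>+x. G (?h (loc n h)) x \<partial>Pn n (loc n h)) * ?i (loc n h)) \<in> borel_measurable borel"
    by (rule measurable_compose[OF loc_measurable measurable_on_ball[OF GK]])
  then show "(\<lambda>h. (\<integral>\<^sup>+x. G h x \<partial>Pn n (loc n h)) * indicator \<B> (loc n h)) \<in> borel_measurable borel"
    by (simp only: hl)
qed

lemma Del_measurable [measurable]: "Del n \<in> borel_measurable (N n)"
  unfolding Del_def
  by (intro borel_measurable_scaleR borel_measurable_const borel_measurable_sum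
      measurable_compose[OF measurable_sample_law_component \<psi>_measurable]) auto

lemma Del_P0: "Del n \<in> borel_measurable (P0 n)"
  using Del_measurable[of n] by (simp add: measurable_cong_sets[OF sets_P0 refl])

lemma FI_measurable [measurable]: "(\<lambda>h. h \<bullet> (FI *v h)) \<in> borel_measurable borel"
  by (intro borel_measurable_continuous_onI continuous_intros linear_continuous_on linear_linear[THEN iffD2]) auto

lemma lik_measurable [measurable]: "case_prod (lik n) \<in> borel_measurable (borel \<Otimes>\<^sub>M N n)"
proof -
  have [measurable]: "(\<lambda>z. fst z \<bullet> (FI *v fst z)) \<in> borel_measurable (borel \<Otimes>\<^sub>M N n)"
    by (rule measurable_compose[OF measurable_fst FI_measurable])
  have [measurable]: "(\<lambda>z. Del n (snd z)) \<in> borel_measurable (borel \<Otimes>\<^sub>M N n)"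
    by (rule measurable_compose[OF measurable_snd Del_measurable])
  show ?thesis unfolding lik_def case_prod_beta by measurable
qed

lemma lik_pos [simp]: "0 < lik n h x" "0 \<le> lik n h x" by (simp_all add: lik_def)

text \<open>The number \<open>a\<close> is the marginal density relative to \<open>p0\<close>,
  rescaled by the same factor as the local integral, and it is itself the case \<open>F = 1\<close>.
  Inside \<open>\<B>\<close> the integral is local and Lebesgue; outside it remains an integral over
  the prior, since there only integrability with respect to the prior is available.\<close>

lemma posterior_representation:
  assumes n: "0 < n"
  shows "AE x in P0 n. x \<in> space (N n) \<and> 0 < p0 n x \<and> sets (Q n x) = sets prior \<and> prob_space (Q n x) \<and>
    (\<exists>a. 0 < a \<and> a < \<infinity> \<and> (\<forall>F\<in>borel_measurable prior. a * (\<integral>\<^sup>+\<theta>. F \<theta> \<partial>Q n x) =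
      (\<integral>\<^sup>+h. F (loc n h) * ennreal (u n h x / p0 n x) \<partial>lborel)
      + ennreal (sqrt n ^ CARD('d) / \<pi> \<theta>\<^sub>0) * (\<integral>\<^sup>+\<theta>. F \<theta> * ennreal (q n \<theta> x / p0 n x) * indicator (- \<B>) \<theta> \<partial>prior)))"
  using posterior_density p0_pos AE_space
proof eventually_elim
  case (elim x)
  then have x: "x \<in> space (N n)" by simp
  let ?K = "ennreal (sqrt n ^ CARD('d) / \<pi> \<theta>\<^sub>0)"
  let ?p = "ennreal (1 / p0 n x)"
  define a where "a = ?K * ?p * m n x"
  have K: "0 < ?K" "?K < \<infinity>" using n \<pi>_pos by auto
  have p: "0 < ?p" "?p < \<infinity>" using elim by auto
  have a: "0 < a" "a < \<infinity>" unfolding a_def using K p elim(1) by (auto simp: ennreal_zero_less_mult_iff ennreal_mult_less_top)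
  have div: "ennreal (r / p0 n x) = ennreal r * ?p" if "r \<ge> 0" for r
    using that elim(2) by (subst ennreal_mult[symmetric]) auto
  have idm [measurable]: "(\<lambda>\<theta>. \<theta>) \<in> prior \<rightarrow>\<^sub>M borel"
    unfolding measurable_cong_sets[OF sets_prior refl] by (rule measurable_restrict_space1) simp
  have "a * (\<integral>\<^sup>+\<theta>. F \<theta> \<partial>Q n x) = (\<integral>\<^sup>+h. F (loc n h) * ennreal (u n h x / p0 n x) \<partial>lborel)
      + ?K * (\<integral>\<^sup>+\<theta>. F \<theta> * ennreal (q n \<theta> x / p0 n x) * indicator (- \<B>) \<theta> \<partial>prior)"
    if F [measurable]: "F \<in> borel_measurable prior" for F
  proof -
    note qm [measurable] = q_section_measurable[OF x]
    have [measurable]: "(\<lambda>\<theta>. indicator B \<theta> :: ennreal) \<in> borel_measurable prior" if "B \<in> sets borel" for B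
      by (rule measurable_compose[OF idm borel_measurable_indicator[OF that]])
    have um: "(\<lambda>h. u n h x) \<in> borel_measurable borel" using x by measurable
    have Fu: "(\<lambda>h. F (loc n h) * ennreal (u n h x)) \<in> borel_measurable lborel"
    proof -
      have "(\<lambda>h. F (loc n h) * indicator \<B> (loc n h)) \<in> borel_measurable borel"
        by (rule measurable_compose[OF loc_measurable measurable_on_ball[OF F]])
      then have "(\<lambda>h. F (loc n h) * indicator \<B> (loc n h) * ennreal (u n h x)) \<in> borel_measurable borel"
        using um by measurable
      moreover have "F (loc n h) * indicator \<B> (loc n h) * ennreal (u n h x) = F (loc n h) * ennreal (u n h x)" for h
        by (cases "loc n h \<in> \<B>") (auto simp: u_def)
      ultimately show ?thesis by simp
    qed
    have "a * (\<integral>\<^sup>+\<theta>. F \<theta> \<partial>Q n x) = ?K * ?p * (\<integral>\<^sup>+\<theta>. F \<theta> * ennreal (q n \<theta> x) \<partial>prior)"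
      using elim(1) F by (simp add: a_def mult.assoc)
    also have "(\<integral>\<^sup>+\<theta>. F \<theta> * ennreal (q n \<theta> x) \<partial>prior) = (\<integral>\<^sup>+\<theta>. F \<theta> * ennreal (q n \<theta> x) * indicator \<B> \<theta>
        + F \<theta> * ennreal (q n \<theta> x) * indicator (- \<B>) \<theta> \<partial>prior)"
      by (intro nn_integral_cong) (auto split: split_indicator)
    also have "\<dots> = (\<integral>\<^sup>+\<theta>. F \<theta> * ennreal (q n \<theta> x) * indicator \<B> \<theta> \<partial>prior)
        + (\<integral>\<^sup>+\<theta>. F \<theta> * ennreal (q n \<theta> x) * indicator (- \<B>) \<theta> \<partial>prior)"
      by (rule nn_integral_add) measurable
    also have "?K * ?p * \<dots> = ?p * (?K * (\<integral>\<^sup>+\<theta>. F \<theta> * ennreal (q n \<theta> x) * indicator \<B> \<theta> \<partial>prior))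
        + ?K * ((\<integral>\<^sup>+\<theta>. F \<theta> * ennreal (q n \<theta> x) * indicator (- \<B>) \<theta> \<partial>prior) * ?p)"
      by (simp add: distrib_left mult_ac)
    also have "?K * (\<integral>\<^sup>+\<theta>. F \<theta> * ennreal (q n \<theta> x) * indicator \<B> \<theta> \<partial>prior) = (\<integral>\<^sup>+h. F (loc n h) * ennreal (u n h x) \<partial>lborel)"
      by (rule near_integral_q[OF n F x])
    also have "?p * (\<integral>\<^sup>+h. F (loc n h) * ennreal (u n h x) \<partial>lborel) = (\<integral>\<^sup>+h. F (loc n h) * ennreal (u n h x) * ?p \<partial>lborel)"
      using nn_integral_multc[OF Fu, of ?p] by (simp add: mult.commute)
    also have "\<dots> = (\<integral>\<^sup>+h. F (loc n h) * ennreal (u n h x / p0 n x) \<partial>lborel)"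
      by (simp only: div[OF u_nonneg] mult.assoc)
    also have "(\<integral>\<^sup>+\<theta>. F \<theta> * ennreal (q n \<theta> x) * indicator (- \<B>) \<theta> \<partial>prior) * ?p
       = (\<integral>\<^sup>+\<theta>. F \<theta> * ennreal (q n \<theta> x) * indicator (- \<B>) \<theta> * ?p \<partial>prior)"
      by (rule nn_integral_multc[symmetric]) measurable
    also have "\<dots> = (\<integral>\<^sup>+\<theta>. F \<theta> * ennreal (q n \<theta> x / p0 n x) * indicator (- \<B>) \<theta> \<partial>prior)"
      by (simp only: div[OF q_nonneg] mult_ac)
    finally show ?thesis .
  qed
  then show ?case using x elim a by blast
qed

end

section \<open>Total variation approximation on balls of the local parameter\<close>

lemma markov_measure:
  fixes f :: "'a \<Rightarrow> ennreal"
  assumes M: "finite_measure M" and f [measurable]: "f \<in> borel_measurable M"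
    and le: "(\<integral>\<^sup>+x. f x \<partial>M) \<le> ennreal r" and r: "0 \<le> r" and e: "e > 0"
  shows "\<P>(x in M. ennreal e < f x) \<le> r / e"
proof -
  interpret finite_measure M by fact
  let ?S = "{x\<in>space M. ennreal e < f x}"
  have "ennreal e * emeasure M ?S = (\<integral>\<^sup>+x. ennreal e * indicator ?S x \<partial>M)"
    by (subst nn_integral_cmult) auto
  also have "\<dots> \<le> (\<integral>\<^sup>+x. f x \<partial>M)"
    by (intro nn_integral_mono) (auto split: split_indicator intro: less_imp_le)
  also have "\<dots> \<le> ennreal r" by fact
  finally have "ennreal (e * measure M ?S) \<le> ennreal r"
    using e by (simp add: emeasure_eq_measure ennreal_mult)
  then have "e * measure M ?S \<le> r" using r by (simp add: ennreal_le_iff)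
  then show ?thesis using e by (simp add: pos_le_divide_eq mult.commute)
qed

lemma tail_integral_tendsto_0:
  fixes f :: "'a::euclidean_space \<Rightarrow> real"
  assumes f: "integrable lborel f" "\<And>x. 0 \<le> f x" and e: "e > 0"
  obtains R where "R > 0" "\<And>C. C \<ge> R \<Longrightarrow> (\<integral>x. f x * indicator (- cball 0 C) x \<partial>lborel) \<le> e"
proof -
  have fm [measurable]: "f \<in> borel_measurable borel" using borel_measurable_integrable[OF f(1)] by simp
  have fi: "integrable lborel (\<lambda>x. f x * indicator (- cball 0 C) x)" for C
    by (intro integrable_mult_indicator f(1) integrable_real_mult_indicator) auto
  have "(\<lambda>k. \<integral>x. f x * indicator (- cball 0 (real k)) x \<partial>lborel) \<longlonglongrightarrow> (\<integral>x. 0 \<partial>(lborel :: 'a measure))"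
  proof (rule integral_dominated_convergence[where w = f])
    show "AE x in lborel. (\<lambda>k. f x * indicator (- cball 0 (real k)) x) \<longlonglongrightarrow> 0"
    proof (rule AE_I2)
      fix x :: 'a
      have "\<forall>\<^sub>F k in sequentially. norm x \<le> real k"
        by (rule eventually_sequentiallyI[of "nat \<lceil>norm x\<rceil>"]) linarith
      then have "\<forall>\<^sub>F k in sequentially. 0 = f x * indicator (- cball 0 (real k)) x"
        by eventually_elim simp
      then show "(\<lambda>k. f x * indicator (- cball 0 (real k)) x) \<longlonglongrightarrow> 0"
        by (rule Lim_transform_eventually[OF tendsto_const])
    qed
    show "AE x in lborel. norm (f x * indicator (- cball 0 (real k)) x) \<le> f x" for k
      using f(2) by (auto split: split_indicator)
  qed (use f(1) in auto)
  then have "\<forall>\<^sub>F k in sequentially. (\<integral>x. f x * indicator (- cball 0 (real k)) x \<partial>lborel) < e \<and> 0 < k"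
    using e by (intro eventually_conj order_tendstoD(2)[where y = 0] eventually_gt_at_top) auto
  then obtain k :: nat where k: "(\<integral>x. f x * indicator (- cball 0 (real k)) x \<partial>lborel) < e" "0 < k"
    by (auto simp: eventually_sequentially)
  show ?thesis
  proof (rule that[of "real k"])
    fix C assume C: "real k \<le> C"
    have "(\<integral>x. f x * indicator (- cball 0 C) x \<partial>lborel) \<le> (\<integral>x. f x * indicator (- cball 0 (real k)) x \<partial>lborel)"
      using C f(2) by (intro integral_mono fi) (auto split: split_indicator)
    then show "(\<integral>x. f x * indicator (- cball 0 C) x \<partial>lborel) \<le> e" using k(1) by linarith
  qed (use k in auto)
qed

lemma pred_fst_cball [measurable]:
  "Measurable.pred (borel \<Otimes>\<^sub>M M) (\<lambda>x. fst x \<in> cball (a::'a::real_normed_vector) C)"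
proof -
  have "cball a C \<in> sets borel" by simp
  then have "Measurable.pred borel (\<lambda>x. x \<in> cball a C)" unfolding pred_def by (simp del: mem_cball)
  from measurable_compose[OF measurable_fst this] show ?thesis .
qed

context bvm_model
begin

lemma nn_integral_P0: "f \<in> borel_measurable (N n) \<Longrightarrow> (\<integral>\<^sup>+x. f x \<partial>P0 n) = (\<integral>\<^sup>+x. ennreal (p0 n x) * f x \<partial>N n)"
  unfolding P0_density by (rule nn_integral_density) auto

text \<open>Equality may fail where \<open>p0\<close> vanishes: there the quotient is 0 by
  convention, so the product with \<open>p0\<close> is 0 and not \<open>g\<close>. The inequality is
  all that Markov bounds require.\<close>

lemma change_of_measure:
  fixes F :: "'c \<Rightarrow> (nat \<Rightarrow> 'x) \<Rightarrow> ennreal" and g :: "'c \<Rightarrow> (nat \<Rightarrow> 'x) \<Rightarrow> real"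
  assumes M: "sigma_finite_measure M"
    and F [measurable]: "case_prod F \<in> borel_measurable (M \<Otimes>\<^sub>M N n)" and g [measurable]: "case_prod g \<in> borel_measurable (M \<Otimes>\<^sub>M N n)"
    and g0: "\<And>h x. 0 \<le> g h x"
  shows "(\<integral>\<^sup>+x. \<integral>\<^sup>+h. F h x * ennreal (g h x / p0 n x) \<partial>M \<partial>P0 n) \<le> (\<integral>\<^sup>+x. \<integral>\<^sup>+h. F h x * ennreal (g h x) \<partial>M \<partial>N n)" (is "?l \<le> ?r")
    "(\<lambda>x. \<integral>\<^sup>+h. F h x * ennreal (g h x / p0 n x) \<partial>M) \<in> borel_measurable (N n)"
proof -
  interpret M: sigma_finite_measure M by fact
  have [measurable]: "(\<lambda>z. F (snd z) (fst z)) \<in> borel_measurable (N n \<Otimes>\<^sub>M M)"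
    using measurable_compose[OF measurable_pair_swap'[of "N n" M] F] by (simp add: case_prod_beta)
  have [measurable]: "(\<lambda>z. g (snd z) (fst z)) \<in> borel_measurable (N n \<Otimes>\<^sub>M M)"
    using measurable_compose[OF measurable_pair_swap'[of "N n" M] g] by (simp add: case_prod_beta)
  show m1: "(\<lambda>x. \<integral>\<^sup>+h. F h x * ennreal (g h x / p0 n x) \<partial>M) \<in> borel_measurable (N n)"
    by (rule M.borel_measurable_nn_integral) (simp add: case_prod_beta)
  have "?l = (\<integral>\<^sup>+x. ennreal (p0 n x) * (\<integral>\<^sup>+h. F h x * ennreal (g h x / p0 n x) \<partial>M) \<partial>N n)"
    by (rule nn_integral_P0[OF m1])
  also have "\<dots> \<le> (\<integral>\<^sup>+x. \<integral>\<^sup>+h. F h x * ennreal (g h x) \<partial>M \<partial>N n)"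
  proof (rule nn_integral_mono)
    fix x assume x: "x \<in> space (N n)"
    have [measurable]: "(\<lambda>h. F h x) \<in> borel_measurable M" "(\<lambda>h. g h x) \<in> borel_measurable M" using x by measurable
    have "ennreal (p0 n x) * (\<integral>\<^sup>+h. F h x * ennreal (g h x / p0 n x) \<partial>M) = (\<integral>\<^sup>+h. ennreal (p0 n x) * (F h x * ennreal (g h x / p0 n x)) \<partial>M)"
      by (rule nn_integral_cmult[symmetric]) measurable
    also have "\<dots> \<le> (\<integral>\<^sup>+h. F h x * ennreal (g h x) \<partial>M)"
    proof (rule nn_integral_mono)
      fix h
      have "ennreal (p0 n x) * ennreal (g h x / p0 n x) \<le> ennreal (g h x)"
        using g0[of h x] by (subst ennreal_mult[symmetric]) (auto intro!: ennreal_leI)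
      from mult_left_mono[OF this, of "F h x"]
      show "ennreal (p0 n x) * (F h x * ennreal (g h x / p0 n x)) \<le> F h x * ennreal (g h x)"
        by (simp add: mult_ac)
    qed
    finally show "ennreal (p0 n x) * (\<integral>\<^sup>+h. F h x * ennreal (g h x / p0 n x) \<partial>M) \<le> (\<integral>\<^sup>+h. F h x * ennreal (g h x) \<partial>M)" .
  qed
  finally show "?l \<le> ?r" .
qed

lemma lik_integral_le:
  assumes "norm h \<le> C" "bnd C n \<le> 1" "n > 0"
  shows "(\<integral>\<^sup>+x. ennreal (lik n h x * p0 n x) \<partial>N n) \<le> ennreal (exp (C\<^sup>2 * V))"
proof -
  have [measurable]: "(\<lambda>x. lik n h x) \<in> borel_measurable (N n)" by measurable
  have "(\<integral>\<^sup>+x. ennreal (lik n h x * p0 n x) \<partial>N n) = (\<integral>\<^sup>+x. ennreal (lik n h x) \<partial>P0 n)"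
    by (subst nn_integral_P0) (auto simp: ennreal_mult mult.commute intro!: nn_integral_cong)
  also have "\<dots> \<le> (\<integral>\<^sup>+x. ennreal (exp (h \<bullet> Del n x)) \<partial>P0 n)"
    using fisher_nonneg[of h] by (intro nn_integral_mono ennreal_leI) (simp add: lik_def)
  also have "\<dots> = ennreal (\<integral>x. exp (h \<bullet> Del n x) \<partial>P0 n)"
    by (rule nn_integral_eq_integral[OF lik_mean(1)[OF assms]]) simp
  also have "\<dots> \<le> ennreal (exp (C\<^sup>2 * V))" by (rule ennreal_leI[OF lik_mean(2)[OF assms]])
  finally show ?thesis .
qed

lemma lan_difference:
  assumes "loc n h \<in> \<Theta>" "D \<in> sets (N n)" "n > 0" "bnd (norm h) n \<le> 1"
  shows "\<bar>measure (Pn n (loc n h)) D - (\<integral>x. indicator D x * (lik n h x * p0 n x) \<partial>N n)\<bar>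
    \<le> (\<integral>x. \<bar>(\<Prod>i<n. dens (\<theta>\<^sub>0 + (1 / sqrt n) *\<^sub>R h) (x i)) - (\<Prod>i<n. dens \<theta>\<^sub>0 (x i)) * lik n h x\<bar> \<partial>N n)" (is "?l \<le> ?r")
    "integrable (N n) (\<lambda>x. lik n h x * p0 n x)"
proof -
  let ?f = "\<lambda>x. \<Prod>i<n. dens (loc n h) (x i)"
  interpret S: prob_space "Pn n (loc n h)" by (rule prob_space_sample_law[OF prob_P[OF assms(1)]])
  have [measurable]: "(\<lambda>x. lik n h x) \<in> borel_measurable (N n)" by measurable
  note D [measurable] = assms(2)
  have f0: "0 \<le> ?f x" for x by (simp add: prod_nonneg)
  have "(\<integral>\<^sup>+x. ennreal (?f x) \<partial>N n) = 1"
    using S.emeasure_space_1 unfolding sample_law_eq_density[OF assms(1)] by (simp add: emeasure_density cong: nn_integral_cong)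
  then have fi: "integrable (N n) ?f" using f0 by (intro integrableI_nonneg) auto
  show li: "integrable (N n) (\<lambda>x. lik n h x * p0 n x)"
  proof (rule integrableI_nonneg)
    show "(\<integral>\<^sup>+x. ennreal (lik n h x * p0 n x) \<partial>N n) < \<infinity>"
      using lik_integral_le[OF order_refl assms(4,3)] by (rule le_less_trans) simp
  qed auto
  have "measure (Pn n (loc n h)) D = (\<integral>x. indicator D x * ?f x \<partial>N n)"
  proof -
    have "measure (Pn n (loc n h)) D = (\<integral>x. indicator D x \<partial>Pn n (loc n h))"
      using sets_sample_law[OF sets_P[OF assms(1)], of n] sets.sets_into_space[OF D] by (simp add: Int_absorb2 sample_law_eq_density[OF assms(1)])
    also have "\<dots> = (\<integral>x. ?f x *\<^sub>R indicator D x \<partial>N n)"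
      unfolding sample_law_eq_density[OF assms(1)] using f0 by (intro integral_density) auto
    finally show ?thesis by (simp add: mult.commute)
  qed
  then have "?l
     = \<bar>\<integral>x. indicator D x * ?f x - indicator D x * (lik n h x * p0 n x) \<partial>N n\<bar>"
    using fi li by (subst Bochner_Integration.integral_diff) (auto intro: integrable_mult_indicator[where 'b = real, simplified])
  also have "\<dots> \<le> (\<integral>x. \<bar>indicator D x * ?f x - indicator D x * (lik n h x * p0 n x)\<bar> \<partial>N n)" by (rule integral_abs_bound)
  also have "\<dots> \<le> (\<integral>x. \<bar>?f x - lik n h x * p0 n x\<bar> \<partial>N n)"
    using fi li by (intro integral_mono) (auto intro!: integrable_abs Bochner_Integration.integrable_diff integrable_mult_indicator[where 'b = real, simplified] split: split_indicator)
  also have "\<dots> = ?r"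
    by (simp add: loc_def p0_def mult.commute)
  finally show "?l \<le> ?r" .
qed

text \<open>
  Since \<open>u n h\<close> is a density only after integration over \<open>h\<close>, the distance to the Gaussian shift is first
  compared on measurable sets \<open>D n\<close>, whose sections have a well-defined probability for every \<open>h\<close>.
\<close>

lemma local_difference_sets:
  fixes C :: real and D :: "nat \<Rightarrow> ((real^'d) \<times> (nat \<Rightarrow> 'x)) set"
  assumes D: "\<And>n. D n \<in> sets (borel \<Otimes>\<^sub>M N n)"
  defines "\<alpha> \<equiv> \<lambda>n. \<integral>\<^sup>+x. \<integral>\<^sup>+h. indicator (cball 0 C) h * indicator (D n) (h, x) * ennreal (u n h x) \<partial>lborel \<partial>N n"
    and "\<beta> \<equiv> \<lambda>n. \<integral>\<^sup>+x. \<integral>\<^sup>+h. indicator (cball 0 C) h * indicator (D n) (h, x) * ennreal (lik n h x * p0 n x) \<partial>lborel \<partial>N n"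
  shows "\<forall>\<^sub>F n in sequentially. \<alpha> n < \<infinity> \<and> \<beta> n < \<infinity>" "(\<lambda>n. enn2real (\<alpha> n) - enn2real (\<beta> n)) \<longlonglongrightarrow> 0"
proof -
  let ?I = "cball (0::real^'d) C"
  let ?L = "\<lambda>n h. \<integral>x. \<bar>(\<Prod>i<n. dens (\<theta>\<^sub>0 + (1 / sqrt n) *\<^sub>R h) (x i)) - (\<Prod>i<n. dens \<theta>\<^sub>0 (x i)) * lik n h x\<bar> \<partial>N n"
  let ?S = "\<lambda>n h. {x \<in> space (N n). (h, x) \<in> D n}"
  \<comment> \<open>\<open>A\<close> and \<open>Bb\<close> are the inner integrals of
    \<open>\<alpha>\<close> and \<open>\<beta>\<close> after the order of integration is exchanged;
    their difference is controlled for each fixed \<open>h\<close> by \<open>lan_L1\<close> and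
    continuity of the prior density.\<close>
  define A where "A n h = indicator ?I h * (measure (Pn n (loc n h)) (?S n h) * (\<pi> (loc n h) / \<pi> \<theta>\<^sub>0))" for n h
  define Bb where "Bb n h = indicator ?I h * (\<integral>x. indicator (?S n h) x * (lik n h x * p0 n x) \<partial>N n)" for n h
  have "\<forall>\<^sub>F n in sequentially. C < \<epsilon>\<^sub>0 * sqrt n" by (rule eventually_radius)
  moreover have "\<forall>\<^sub>F n in sequentially. bnd C n < 1" by (rule order_tendstoD(2)[OF bnd_tendsto(1)]) simp
  ultimately have "\<forall>\<^sub>F n in sequentially. C < \<epsilon>\<^sub>0 * sqrt n \<and> bnd C n \<le> 1 \<and> 0 < n"
    using eventually_gt_at_top[of 0] by eventually_elim auto
  \<comment> \<open>From \<open>n0\<close> on, the ball of radius \<open>C\<close> is mapped into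
    \<open>\<B>\<close> and the increments in \<open>lik\<close> are at most one, so all bounds
    below hold simultaneously on that ball.\<close>
  then obtain n0 where n0: "\<And>n. n \<ge> n0 \<Longrightarrow> C < \<epsilon>\<^sub>0 * sqrt n \<and> bnd C n \<le> 1 \<and> 0 < n"
    by (auto simp: eventually_sequentially)
  have S: "?S n h \<in> sets (N n)" for n h
  proof -
    have "?S n h = Pair h -` D n" using sets.sets_into_space[OF D[of n]] by (auto simp: space_pair_measure)
    then show ?thesis using sets_Pair1[OF D[of n], of h] by simp
  qed
  have locI: "loc n h \<in> \<B>" "loc n h \<in> \<Theta>" "bnd (norm h) n \<le> 1" if "h \<in> ?I" "n \<ge> n0" for n h
  proof -
    show l: "loc n h \<in> \<B>" using loc_in_ball[of n h] n0[OF that(2)] that(1) by auto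
    then show "loc n h \<in> \<Theta>" using ball_\<Theta> by auto
    have "bnd (norm h) n \<le> bnd C n" unfolding bnd_def using that(1) by (intro divide_right_mono mult_right_mono) auto
    then show "bnd (norm h) n \<le> 1" using n0[OF that(2)] by linarith
  qed
  have pile: "0 \<le> \<pi> (loc n h) / \<pi> \<theta>\<^sub>0" "\<pi> (loc n h) / \<pi> \<theta>\<^sub>0 \<le> 2" if "h \<in> ?I" "n \<ge> n0" for n h
    using \<pi>_le[OF locI(1)[OF that]] \<pi>_nonneg[of "loc n h"] \<pi>_pos by (auto simp: pos_divide_le_eq)
  have \<alpha>_eq: "\<alpha> n = (\<integral>\<^sup>+h. ennreal (A n h) \<partial>lborel)" and A_meas: "A n \<in> borel_measurable borel" if n: "n \<ge> n0" for n
  proof -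
    have [measurable]: "(\<lambda>z. indicator (D n) z :: ennreal) \<in> borel_measurable (borel \<Otimes>\<^sub>M N n)" using D[of n] by simp
    let ?G = "\<lambda>h x. indicator ?I h * indicator (D n) (h, x) :: ennreal"
    have G: "case_prod ?G \<in> borel_measurable (borel \<Otimes>\<^sub>M N n)" unfolding case_prod_beta prod.collapse
      by (intro borel_measurable_times_ennreal borel_measurable_indicator D) measurable
    note J = joint_integral[OF _ G]
    have n1: "0 < n" using n0[OF n] by simp
    have KG: "(\<integral>\<^sup>+x. ?G h x \<partial>Pn n (loc n h)) = indicator ?I h * ennreal (measure (Pn n (loc n h)) (?S n h))" if "h \<in> ?I" for h
    proof -
      note lt = locI(2)[OF that n]
      interpret S: prob_space "Pn n (loc n h)" by (rule prob_space_sample_law[OF prob_P[OF lt]])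
      note st = sets_sample_law[OF sets_P[OF lt], of n] space_sample_law[OF sets_P[OF lt], of n]
      have "(\<integral>\<^sup>+x. ?G h x \<partial>Pn n (loc n h)) = (\<integral>\<^sup>+x. indicator ?I h * indicator (?S n h) x \<partial>Pn n (loc n h))"
        by (intro nn_integral_cong) (auto simp: st split: split_indicator)
      also have "\<dots> = indicator ?I h * emeasure (Pn n (loc n h)) (?S n h)"
        using S[of n h] st by (subst nn_integral_cmult_indicator) auto
      finally show ?thesis by (simp add: S.emeasure_eq_measure)
    qed
    have K0: "(\<integral>\<^sup>+x. ?G h x \<partial>Pn n (loc n h)) = 0" if "h \<notin> ?I" for h using that by simp
    have eqA: "(\<integral>\<^sup>+x. ?G h x \<partial>Pn n (loc n h)) * (indicator \<B> (loc n h) * ennreal (\<pi> (loc n h) / \<pi> \<theta>\<^sub>0)) = ennreal (A n h)" for h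
    proof (cases "h \<in> ?I")
      case True
      then show ?thesis using KG[OF True] locI(1)[OF True n] pile(1)[OF True n] by (simp add: A_def ennreal_mult[symmetric])
    next
      case False then show ?thesis using K0 by (simp add: A_def)
    qed
    show "\<alpha> n = (\<integral>\<^sup>+h. ennreal (A n h) \<partial>lborel)"
      unfolding \<alpha>_def J(1)[OF n1] by (simp only: eqA)
    have "(\<lambda>h. (\<integral>\<^sup>+x. ?G h x \<partial>Pn n (loc n h)) * indicator \<B> (loc n h) * ennreal (\<pi> (loc n h) / \<pi> \<theta>\<^sub>0)) \<in> borel_measurable borel"
      by (intro borel_measurable_times_ennreal J(2)[OF n1]) measurable
    then have "(\<lambda>h. ennreal (A n h)) \<in> borel_measurable borel" by (simp only: mult.assoc eqA)
    then have "(\<lambda>h. enn2real (ennreal (A n h))) \<in> borel_measurable borel" by measurable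
    moreover have "enn2real (ennreal (A n h)) = A n h" for h
      unfolding A_def using mult_nonneg_nonneg[OF measure_nonneg pile(1)[OF _ n, of h]]
      by (intro enn2real_ennreal) (auto split: split_indicator)
    ultimately show "A n \<in> borel_measurable borel" by simp
  qed
  have Sm: "(\<lambda>z. indicator (?S n (fst z)) (snd z) :: real) \<in> borel_measurable (borel \<Otimes>\<^sub>M N n)" for n
  proof -
    have "(\<lambda>z. indicator (D n) z :: real) \<in> borel_measurable (borel \<Otimes>\<^sub>M N n)" using D[of n] by simp
    then show ?thesis
      by (rule measurable_cong[THEN iffD1, rotated]) (auto simp: space_pair_measure split: split_indicator)
  qed
  have likm: "(\<lambda>z. lik n (fst z) (snd z) * p0 n (snd z)) \<in> borel_measurable (borel \<Otimes>\<^sub>M N n)" for n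
    by measurable
  have B_meas: "Bb n \<in> borel_measurable borel" for n
  proof -
    have "(\<lambda>h. \<integral>x. indicator (?S n h) x * (lik n h x * p0 n x) \<partial>N n) \<in> borel_measurable borel"
      by (rule N.borel_measurable_lebesgue_integral) (use borel_measurable_times[OF Sm likm] in \<open>simp add: case_prod_beta\<close>)
    then show ?thesis unfolding Bb_def by (intro borel_measurable_times borel_measurable_indicator) auto
  qed
  have lik_int: "integrable (N n) (\<lambda>x. lik n h x * p0 n x)" and lik_le: "(\<integral>x. lik n h x * p0 n x \<partial>N n) \<le> exp (C\<^sup>2 * V)" if "h \<in> ?I" "n \<ge> n0" for n h
  proof -
    have hC: "norm h \<le> C" using that(1) by simp
    have n: "bnd C n \<le> 1" "0 < n" using n0[OF that(2)] by auto
    show i: "integrable (N n) (\<lambda>x. lik n h x * p0 n x)"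
      by (rule lan_difference(2)[OF locI(2)[OF that] sets.top n(2) locI(3)[OF that]])
    have "ennreal (\<integral>x. lik n h x * p0 n x \<partial>N n) = (\<integral>\<^sup>+x. ennreal (lik n h x * p0 n x) \<partial>N n)"
      by (rule nn_integral_eq_integral[OF i, symmetric]) auto
    also have "\<dots> \<le> ennreal (exp (C\<^sup>2 * V))" by (rule lik_integral_le[OF hC n])
    finally show "(\<integral>x. lik n h x * p0 n x \<partial>N n) \<le> exp (C\<^sup>2 * V)" by (simp add: ennreal_le_iff)
  qed
  have ind_int: "integrable (N n) (\<lambda>x. indicator (?S n h) x * (lik n h x * p0 n x))" if "h \<in> ?I" "n \<ge> n0" for n h
    using integrable_mult_indicator[OF S lik_int[OF that], of h] by simp
  have B_nonneg: "0 \<le> Bb n h" for n h unfolding Bb_def by (intro mult_nonneg_nonneg integral_nonneg_AE AE_I2) auto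
  have B_le: "Bb n h \<le> exp (C\<^sup>2 * V) * indicator ?I h" if n: "n \<ge> n0" for n h
  proof (cases "h \<in> ?I")
    case True
    have "(\<integral>x. indicator (?S n h) x * (lik n h x * p0 n x) \<partial>N n) \<le> (\<integral>x. lik n h x * p0 n x \<partial>N n)"
      by (intro integral_mono ind_int lik_int True n) (auto split: split_indicator)
    then show ?thesis using lik_le[OF True n] True by (simp add: Bb_def)
  qed (simp add: Bb_def)
  have \<beta>_eq: "\<beta> n = (\<integral>\<^sup>+h. ennreal (Bb n h) \<partial>lborel)" if n: "n \<ge> n0" for n
  proof -
    interpret pair_sigma_finite "lborel :: (real^'d) measure" "N n" ..
    have m: "(\<lambda>(h, x). indicator ?I h * indicator (D n) (h, x) * ennreal (lik n h x * p0 n x)) \<in> borel_measurable (lborel \<Otimes>\<^sub>M N n)"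
    proof -
      have "(\<lambda>z. indicator (D n) z :: ennreal) \<in> borel_measurable (lborel \<Otimes>\<^sub>M N n)" using D[of n] by simp
      moreover have "(\<lambda>z. ennreal (lik n (fst z) (snd z) * p0 n (snd z))) \<in> borel_measurable (lborel \<Otimes>\<^sub>M N n)" by measurable
      moreover have "(\<lambda>z. indicator ?I (fst z) :: ennreal) \<in> borel_measurable (lborel \<Otimes>\<^sub>M N n)" by measurable
      ultimately show ?thesis unfolding case_prod_beta by (simp add: borel_measurable_times_ennreal)
    qed
    have "\<beta> n = (\<integral>\<^sup>+h. \<integral>\<^sup>+x. indicator ?I h * indicator (D n) (h, x) * ennreal (lik n h x * p0 n x) \<partial>N n \<partial>lborel)"
      unfolding \<beta>_def using Fubini'[OF m] by simp
    also have "\<dots> = (\<integral>\<^sup>+h. ennreal (Bb n h) \<partial>lborel)"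
    proof (rule nn_integral_cong)
      fix h
      show "(\<integral>\<^sup>+x. indicator ?I h * indicator (D n) (h, x) * ennreal (lik n h x * p0 n x) \<partial>N n) = ennreal (Bb n h)"
      proof (cases "h \<in> ?I")
        case True
        have "(\<integral>\<^sup>+x. indicator ?I h * indicator (D n) (h, x) * ennreal (lik n h x * p0 n x) \<partial>N n) = (\<integral>\<^sup>+x. ennreal (indicator (?S n h) x * (lik n h x * p0 n x)) \<partial>N n)"
          using True by (intro nn_integral_cong) (auto split: split_indicator)
        also have "\<dots> = ennreal (Bb n h)"
          unfolding Bb_def using True by (subst nn_integral_eq_integral[OF ind_int[OF True n]]) auto
        finally show ?thesis .
      qed (simp add: Bb_def)
    qed
    finally show ?thesis .
  qed
  have A_nonneg: "0 \<le> A n h" if "n \<ge> n0" for n h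
    unfolding A_def using mult_nonneg_nonneg[OF measure_nonneg pile(1)[OF _ that, of h]] by (auto split: split_indicator)
  have A_le: "A n h \<le> 2 * indicator ?I h" if n: "n \<ge> n0" for n h
  proof (cases "h \<in> ?I")
    case True
    interpret S: prob_space "Pn n (loc n h)" by (rule prob_space_sample_law[OF prob_P[OF locI(2)[OF True n]]])
    have "measure (Pn n (loc n h)) (?S n h) * (\<pi> (loc n h) / \<pi> \<theta>\<^sub>0) \<le> 1 * 2"
      by (intro mult_mono pile(2)[OF True n] pile(1)[OF True n]) auto
    then show ?thesis using True by (simp add: A_def)
  qed (simp add: A_def)
  have Iint: "integrable lborel (\<lambda>h. c * indicator ?I h :: real)" for c
    using emeasure_bounded_finite[of ?I] by (intro integrable_mult_right integrable_real_indicator) auto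
  have A_int: "integrable lborel (A n)" if n: "n \<ge> n0" for n
    by (rule Bochner_Integration.integrable_bound[OF Iint[of 2]]) (use A_meas[OF n] A_le[OF n] A_nonneg[OF n] in auto)
  have B_int: "integrable lborel (Bb n)" if n: "n \<ge> n0" for n
    by (rule Bochner_Integration.integrable_bound[OF Iint[of "exp (C\<^sup>2 * V)"]]) (use B_meas[of n] B_le[OF n] B_nonneg in auto)
  have \<alpha>2: "\<alpha> n = ennreal (\<integral>h. A n h \<partial>lborel)" if n: "n \<ge> n0" for n
    unfolding \<alpha>_eq[OF n] by (rule nn_integral_eq_integral[OF A_int[OF n]]) (use A_nonneg[OF n] in auto)
  have \<beta>2: "\<beta> n = ennreal (\<integral>h. Bb n h \<partial>lborel)" if n: "n \<ge> n0" for n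
    unfolding \<beta>_eq[OF n] by (rule nn_integral_eq_integral[OF B_int[OF n]]) (use B_nonneg in auto)
  show "\<forall>\<^sub>F n in sequentially. \<alpha> n < \<infinity> \<and> \<beta> n < \<infinity>"
    by (rule eventually_sequentiallyI[of n0]) (simp add: \<alpha>2 \<beta>2)
  have pt: "(\<lambda>n. A n h - Bb n h) \<longlonglongrightarrow> 0" for h
  proof (cases "h \<in> ?I")
    case False then show ?thesis by (simp add: A_def Bb_def)
  next
    case True
    have "(\<lambda>n. \<theta>\<^sub>0 + (1 / sqrt (real n)) *\<^sub>R h) \<longlonglongrightarrow> \<theta>\<^sub>0 + 0 *\<^sub>R h"
      by (intro tendsto_intros) real_asymp
    then have "(\<lambda>n. loc n h) \<longlonglongrightarrow> \<theta>\<^sub>0" by (simp add: loc_def)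
    then have "(\<lambda>n. \<pi> (loc n h)) \<longlonglongrightarrow> \<pi> \<theta>\<^sub>0" by (rule isCont_tendsto_compose[OF \<pi>_cont])
    then have "(\<lambda>n. \<pi> (loc n h) / \<pi> \<theta>\<^sub>0) \<longlonglongrightarrow> \<pi> \<theta>\<^sub>0 / \<pi> \<theta>\<^sub>0" using \<pi>_pos by (intro tendsto_intros) auto
    then have pl: "(\<lambda>n. \<pi> (loc n h) / \<pi> \<theta>\<^sub>0) \<longlonglongrightarrow> 1" using \<pi>_pos by simp
    have "(\<lambda>n. ?L n h + \<bar>\<pi> (loc n h) / \<pi> \<theta>\<^sub>0 - 1\<bar>) \<longlonglongrightarrow> 0 + \<bar>1 - 1\<bar>"
      by (intro tendsto_intros lan_L1 pl)
    then have lim0: "(\<lambda>n. ?L n h + \<bar>\<pi> (loc n h) / \<pi> \<theta>\<^sub>0 - 1\<bar>) \<longlonglongrightarrow> 0" by simp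
    show ?thesis
    proof (rule Lim_null_comparison[OF eventually_sequentiallyI[of n0] lim0])
      fix n assume n: "n0 \<le> n"
      have n1: "0 < n" using n0[OF n] by simp
      interpret S: prob_space "Pn n (loc n h)" by (rule prob_space_sample_law[OF prob_P[OF locI(2)[OF True n]]])
      let ?k = "measure (Pn n (loc n h)) (?S n h)" and ?r = "\<pi> (loc n h) / \<pi> \<theta>\<^sub>0"
      let ?b = "\<integral>x. indicator (?S n h) x * (lik n h x * p0 n x) \<partial>N n"
      have d: "\<bar>?k - ?b\<bar> \<le> ?L n h" by (rule lan_difference(1)[OF locI(2)[OF True n] S n1 locI(3)[OF True n]])
      have "\<bar>k * r - b\<bar> \<le> e + \<bar>r - 1\<bar>" if "\<bar>k - b\<bar> \<le> e" "0 \<le> k" "k \<le> 1" for k r b e :: real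
      proof -
        have 1: "\<bar>k * (r - 1)\<bar> \<le> \<bar>r - 1\<bar>" unfolding abs_mult using that mult_right_mono[of "\<bar>k\<bar>" 1 "\<bar>r - 1\<bar>"] by simp
        have 2: "k * r - b = (k - b) + k * (r - 1)" by (simp add: right_diff_distrib)
        show ?thesis unfolding 2 by (rule order_trans[OF abs_triangle_ineq add_mono[OF that(1) 1]])
      qed
      from this[OF d measure_nonneg S.prob_le_1] have "\<bar>?k * ?r - ?b\<bar> \<le> ?L n h + \<bar>?r - 1\<bar>" .
      then show "norm (A n h - Bb n h) \<le> ?L n h + \<bar>?r - 1\<bar>" using True by (simp add: A_def Bb_def)
    qed
  qed
  \<comment> \<open>The index is shifted because measurability and domination are available only
    from \<open>n0\<close> on.\<close>
  have "(\<lambda>n. \<integral>h. A (n + n0) h - Bb (n + n0) h \<partial>lborel) \<longlonglongrightarrow> (\<integral>h. 0 \<partial>(lborel :: (real^'d) measure))"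
  proof (rule integral_dominated_convergence[where w = "\<lambda>h. (2 + exp (C\<^sup>2 * V)) * indicator ?I h"])
    show "AE h in lborel. (\<lambda>n. A (n + n0) h - Bb (n + n0) h) \<longlonglongrightarrow> 0"
      by (intro AE_I2 LIMSEQ_ignore_initial_segment pt)
    show "AE h in lborel. norm (A (n + n0) h - Bb (n + n0) h) \<le> (2 + exp (C\<^sup>2 * V)) * indicator ?I h" for n
    proof (rule AE_I2)
      fix h
      have nn: "n0 \<le> n + n0" by simp
      show "norm (A (n + n0) h - Bb (n + n0) h) \<le> (2 + exp (C\<^sup>2 * V)) * indicator ?I h"
        using A_le[OF nn, of h] A_nonneg[OF nn, of h] B_le[OF nn, of h] B_nonneg[of "n + n0" h]
        by (simp add: distrib_right)
    qed
    show "(\<lambda>h. A (n + n0) h - Bb (n + n0) h) \<in> borel_measurable lborel" for n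
      using A_meas[of "n + n0"] B_meas[of "n + n0"] by simp
  qed (use Iint in auto)
  moreover have "(\<integral>h. A (n + n0) h - Bb (n + n0) h \<partial>lborel) = enn2real (\<alpha> (n + n0)) - enn2real (\<beta> (n + n0))" for n
  proof -
    have nn: "n0 \<le> n + n0" by simp
    have "0 \<le> (\<integral>h. A (n + n0) h \<partial>lborel)" "0 \<le> (\<integral>h. Bb (n + n0) h \<partial>lborel)"
      using A_nonneg[OF nn] B_nonneg by (auto intro: integral_nonneg_AE)
    then show ?thesis using A_int[OF nn] B_int[OF nn] by (simp add: \<alpha>2[OF nn] \<beta>2[OF nn])
  qed
  ultimately have "(\<lambda>n. enn2real (\<alpha> (n + n0)) - enn2real (\<beta> (n + n0))) \<longlonglongrightarrow> 0" by simp
  then show "(\<lambda>n. enn2real (\<alpha> n) - enn2real (\<beta> n)) \<longlonglongrightarrow> 0" by (rule LIMSEQ_offset)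
qed

text \<open>On the set \<open>D n\<close> where \<open>u\<close> exceeds the Gaussian approximation,
  and on its complement, the difference has a constant sign. The integral of its absolute value is
  therefore a combination of the signed differences treated in
  \<open>local_difference_sets\<close>.\<close>

lemma local_total_variation:
  "(\<lambda>n. \<integral>\<^sup>+x. \<integral>\<^sup>+h. indicator (cball 0 C) h * ennreal \<bar>u n h x - lik n h x * p0 n x\<bar> \<partial>lborel \<partial>N n) \<longlonglongrightarrow> 0"
proof -
  let ?I = "cball (0::real^'d) C"
  let ?b = "\<lambda>n h x. lik n h x * p0 n x"
  define D where "D n = {z \<in> space (borel \<Otimes>\<^sub>M N n). ?b n (fst z) (snd z) < u n (fst z) (snd z)}" for n
  have um: "(\<lambda>z. u n (fst z) (snd z)) \<in> borel_measurable (borel \<Otimes>\<^sub>M N n)" for n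
    using u_measurable[of n] by (simp add: case_prod_beta)
  have bm: "(\<lambda>z. ?b n (fst z) (snd z)) \<in> borel_measurable (borel \<Otimes>\<^sub>M N n)" for n by measurable
  have D: "D n \<in> sets (borel \<Otimes>\<^sub>M N n)" for n
    unfolding D_def using um[of n] bm[of n] by (rule borel_measurable_less[rotated])
  define D' where "D' n = space (borel \<Otimes>\<^sub>M N n) - D n" for n
  have D': "D' n \<in> sets (borel \<Otimes>\<^sub>M N n)" for n unfolding D'_def using D by simp
  define \<alpha> where "\<alpha> D n = (\<integral>\<^sup>+x. \<integral>\<^sup>+h. indicator ?I h * indicator (D n) (h, x) * ennreal (u n h x) \<partial>lborel \<partial>N n)" for D :: "nat \<Rightarrow> ((real^'d) \<times> (nat \<Rightarrow> 'x)) set" and n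
  define \<beta> where "\<beta> D n = (\<integral>\<^sup>+x. \<integral>\<^sup>+h. indicator ?I h * indicator (D n) (h, x) * ennreal (?b n h x) \<partial>lborel \<partial>N n)" for D :: "nat \<Rightarrow> ((real^'d) \<times> (nat \<Rightarrow> 'x)) set" and n
  note L = local_difference_sets[OF D, of C, folded \<alpha>_def \<beta>_def]
  note L' = local_difference_sets[OF D', of C, folded \<alpha>_def \<beta>_def]
  have meas: "(\<lambda>x. \<integral>\<^sup>+h. indicator ?I h * indicator E (h, x) * ennreal (f h x) \<partial>lborel) \<in> borel_measurable (N n)"
    "\<And>x. x \<in> space (N n) \<Longrightarrow> (\<lambda>h. indicator ?I h * indicator E (h, x) * ennreal (f h x)) \<in> borel_measurable lborel"
    if E: "E \<in> sets (borel \<Otimes>\<^sub>M N n)" and f: "(\<lambda>z. f (fst z) (snd z)) \<in> borel_measurable (borel \<Otimes>\<^sub>M N n)" for E f n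
  proof -
    have m: "(\<lambda>z. indicator ?I (fst z) * indicator E z * ennreal (f (fst z) (snd z))) \<in> borel_measurable (borel \<Otimes>\<^sub>M N n)"
    proof (intro borel_measurable_times_ennreal)
      show "(\<lambda>z. ennreal (f (fst z) (snd z))) \<in> borel_measurable (borel \<Otimes>\<^sub>M N n)" using f by measurable
      show "(\<lambda>z. indicator ?I (fst z) :: ennreal) \<in> borel_measurable (borel \<Otimes>\<^sub>M N n)" by measurable
    qed (use E in auto)
    have "(\<lambda>z. (snd z, fst z)) \<in> N n \<Otimes>\<^sub>M lborel \<rightarrow>\<^sub>M borel \<Otimes>\<^sub>M N n" by measurable
    from measurable_compose[OF this m]
    show "(\<lambda>x. \<integral>\<^sup>+h. indicator ?I h * indicator E (h, x) * ennreal (f h x) \<partial>lborel) \<in> borel_measurable (N n)"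
      by (intro lborel.borel_measurable_nn_integral) (simp add: case_prod_beta)
    show "(\<lambda>h. indicator ?I h * indicator E (h, x) * ennreal (f h x)) \<in> borel_measurable lborel" if x: "x \<in> space (N n)" for x
    proof -
      have "(\<lambda>h. (h, x)) \<in> lborel \<rightarrow>\<^sub>M borel \<Otimes>\<^sub>M N n" using x by measurable
      from measurable_compose[OF this m] show ?thesis by simp
    qed
  qed
  let ?T = "\<lambda>E n. \<integral>\<^sup>+x. \<integral>\<^sup>+h. indicator ?I h * indicator (E n) (h, x) * ennreal \<bar>u n h x - ?b n h x\<bar> \<partial>lborel \<partial>N n"
  have dm: "(\<lambda>z. \<bar>u n (fst z) (snd z) - ?b n (fst z) (snd z)\<bar>) \<in> borel_measurable (borel \<Otimes>\<^sub>M N n)" for n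
    using um[of n] bm[of n] by measurable
  have split: "(\<integral>\<^sup>+x. \<integral>\<^sup>+h. indicator ?I h * ennreal \<bar>u n h x - ?b n h x\<bar> \<partial>lborel \<partial>N n) = ?T D n + ?T D' n" for n
  proof -
    have "?T D n + ?T D' n = (\<integral>\<^sup>+x. (\<integral>\<^sup>+h. indicator ?I h * indicator (D n) (h, x) * ennreal \<bar>u n h x - ?b n h x\<bar> \<partial>lborel)
        + (\<integral>\<^sup>+h. indicator ?I h * indicator (D' n) (h, x) * ennreal \<bar>u n h x - ?b n h x\<bar> \<partial>lborel) \<partial>N n)"
      by (rule nn_integral_add[symmetric]) (rule meas(1)[OF D dm] meas(1)[OF D' dm])+
    also have "\<dots> = (\<integral>\<^sup>+x. \<integral>\<^sup>+h. indicator ?I h * ennreal \<bar>u n h x - ?b n h x\<bar> \<partial>lborel \<partial>N n)"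
    proof (rule nn_integral_cong)
      fix x assume x: "x \<in> space (N n)"
      have "(\<integral>\<^sup>+h. indicator ?I h * indicator (D n) (h, x) * ennreal \<bar>u n h x - ?b n h x\<bar> \<partial>lborel)
        + (\<integral>\<^sup>+h. indicator ?I h * indicator (D' n) (h, x) * ennreal \<bar>u n h x - ?b n h x\<bar> \<partial>lborel)
        = (\<integral>\<^sup>+h. indicator ?I h * indicator (D n) (h, x) * ennreal \<bar>u n h x - ?b n h x\<bar>
          + indicator ?I h * indicator (D' n) (h, x) * ennreal \<bar>u n h x - ?b n h x\<bar> \<partial>lborel)"
        by (rule nn_integral_add[symmetric]) (rule meas(2)[OF D dm x] meas(2)[OF D' dm x])+
      also have "\<dots> = (\<integral>\<^sup>+h. indicator ?I h * ennreal \<bar>u n h x - ?b n h x\<bar> \<partial>lborel)"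
        using x by (intro nn_integral_cong) (auto simp: D'_def space_pair_measure split: split_indicator)
      finally show "(\<integral>\<^sup>+h. indicator ?I h * indicator (D n) (h, x) * ennreal \<bar>u n h x - ?b n h x\<bar> \<partial>lborel)
        + (\<integral>\<^sup>+h. indicator ?I h * indicator (D' n) (h, x) * ennreal \<bar>u n h x - ?b n h x\<bar> \<partial>lborel) = \<dots>" .
    qed
    finally show ?thesis ..
  qed
  have add: "(\<integral>\<^sup>+x. \<integral>\<^sup>+h. indicator ?I h * indicator E (h, x) * ennreal (f h x) \<partial>lborel \<partial>N n)
      = (\<integral>\<^sup>+x. \<integral>\<^sup>+h. indicator ?I h * indicator E (h, x) * ennreal (g h x) \<partial>lborel \<partial>N n)
      + (\<integral>\<^sup>+x. \<integral>\<^sup>+h. indicator ?I h * indicator E (h, x) * ennreal \<bar>u n h x - ?b n h x\<bar> \<partial>lborel \<partial>N n)"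
    if E: "E \<in> sets (borel \<Otimes>\<^sub>M N n)" and f: "(\<lambda>z. f (fst z) (snd z)) \<in> borel_measurable (borel \<Otimes>\<^sub>M N n)"
      and g: "(\<lambda>z. g (fst z) (snd z)) \<in> borel_measurable (borel \<Otimes>\<^sub>M N n)" "\<And>h x. 0 \<le> g h x"
      and fg: "\<And>h x. (h, x) \<in> E \<Longrightarrow> f h x = g h x + \<bar>u n h x - ?b n h x\<bar>" for E f g n
  proof -
    have "(\<integral>\<^sup>+x. \<integral>\<^sup>+h. indicator ?I h * indicator E (h, x) * ennreal (f h x) \<partial>lborel \<partial>N n)
       = (\<integral>\<^sup>+x. (\<integral>\<^sup>+h. indicator ?I h * indicator E (h, x) * ennreal (g h x) \<partial>lborel)
          + (\<integral>\<^sup>+h. indicator ?I h * indicator E (h, x) * ennreal \<bar>u n h x - ?b n h x\<bar> \<partial>lborel) \<partial>N n)"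
    proof (rule nn_integral_cong)
      fix x assume x: "x \<in> space (N n)"
      have "(\<integral>\<^sup>+h. indicator ?I h * indicator E (h, x) * ennreal (f h x) \<partial>lborel)
        = (\<integral>\<^sup>+h. indicator ?I h * indicator E (h, x) * ennreal (g h x) + indicator ?I h * indicator E (h, x) * ennreal \<bar>u n h x - ?b n h x\<bar> \<partial>lborel)"
        using fg g(2) by (intro nn_integral_cong) (auto simp: ennreal_plus[symmetric] simp del: ennreal_plus split: split_indicator)
      also have "\<dots> = (\<integral>\<^sup>+h. indicator ?I h * indicator E (h, x) * ennreal (g h x) \<partial>lborel)
          + (\<integral>\<^sup>+h. indicator ?I h * indicator E (h, x) * ennreal \<bar>u n h x - ?b n h x\<bar> \<partial>lborel)"
        by (rule nn_integral_add) (rule meas(2)[OF E g(1) x] meas(2)[OF E dm x])+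
      finally show "(\<integral>\<^sup>+h. indicator ?I h * indicator E (h, x) * ennreal (f h x) \<partial>lborel) = \<dots>" .
    qed
    also have "\<dots> = (\<integral>\<^sup>+x. \<integral>\<^sup>+h. indicator ?I h * indicator E (h, x) * ennreal (g h x) \<partial>lborel \<partial>N n)
      + (\<integral>\<^sup>+x. \<integral>\<^sup>+h. indicator ?I h * indicator E (h, x) * ennreal \<bar>u n h x - ?b n h x\<bar> \<partial>lborel \<partial>N n)"
      by (rule nn_integral_add) (rule meas(1)[OF E g(1)] meas(1)[OF E dm])+
    finally show ?thesis .
  qed
  have T1: "\<alpha> D n = \<beta> D n + ?T D n" for n
    unfolding \<alpha>_def \<beta>_def by (rule add[OF D um bm]) (auto simp: D_def)
  have T2: "\<beta> D' n = \<alpha> D' n + ?T D' n" for n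
    unfolding \<alpha>_def \<beta>_def by (rule add[OF D' bm um]) (auto simp: D'_def D_def not_less)
  have key: "t < top" "enn2real X = enn2real Y + enn2real t"
    if "X < \<infinity>" "Y < \<infinity>" "X = Y + t" for X Y t :: ennreal
    using that by (auto simp: less_top enn2real_plus)
  have fin: "\<forall>\<^sub>F n in sequentially. ?T D n + ?T D' n = ennreal ((enn2real (\<alpha> D n) - enn2real (\<beta> D n)) - (enn2real (\<alpha> D' n) - enn2real (\<beta> D' n)))"
    using L(1) L'(1)
  proof eventually_elim
    case (elim n)
    note k1 = key[OF conjunct1[OF elim(1)] conjunct2[OF elim(1)] T1]
      and k2 = key[OF conjunct2[OF elim(2)] conjunct1[OF elim(2)] T2]
    have "?T D n + ?T D' n = ennreal (enn2real (?T D n) + enn2real (?T D' n))"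
      by (subst ennreal_plus) (simp_all only: enn2real_nonneg ennreal_enn2real k1(1) k2(1))
    also have "enn2real (?T D n) + enn2real (?T D' n) = (enn2real (\<alpha> D n) - enn2real (\<beta> D n)) - (enn2real (\<alpha> D' n) - enn2real (\<beta> D' n))"
      using k1(2) k2(2) by linarith
    finally show ?case .
  qed
  have "(\<lambda>n. ennreal ((enn2real (\<alpha> D n) - enn2real (\<beta> D n)) - (enn2real (\<alpha> D' n) - enn2real (\<beta> D' n)))) \<longlonglongrightarrow> ennreal (0 - 0)"
    by (intro tendsto_ennrealI tendsto_diff L(2) L'(2))
  then show ?thesis unfolding split
    by (subst tendsto_cong[OF fin]) simp
qed

end

lemma measure_exceed_split:
  fixes f :: "'a \<Rightarrow> ennreal"
  assumes M: "finite_measure M" and A [measurable]: "A \<in> sets M" and f [measurable]: "f \<in> borel_measurable M"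
  shows "\<P>(x in M. e < f x) \<le> measure M (space M - A) + \<P>(x in M. e < indicator A x * f x)"
proof -
  interpret finite_measure M by fact
  have "{x\<in>space M. e < f x} \<subseteq> (space M - A) \<union> {x\<in>space M. e < indicator A x * f x}" by auto
  then have "\<P>(x in M. e < f x) \<le> measure M ((space M - A) \<union> {x\<in>space M. e < indicator A x * f x})"
    by (rule finite_measure_mono) measurable
  also have "\<dots> \<le> measure M (space M - A) + \<P>(x in M. e < indicator A x * f x)"
    by (rule measure_Un_le) measurable
  finally show ?thesis .
qed

lemma markov_tendsto_0:
  fixes f :: "nat \<Rightarrow> 'a \<Rightarrow> ennreal"
  assumes M: "\<And>n. finite_measure (M n)" and f: "\<And>n. f n \<in> borel_measurable (M n)"
    and lim: "(\<lambda>n. \<integral>\<^sup>+x. f n x \<partial>M n) \<longlonglongrightarrow> 0" and e: "e > 0"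
  shows "(\<lambda>n. \<P>(x in M n. ennreal e < f n x)) \<longlonglongrightarrow> 0"
proof -
  have fin: "\<forall>\<^sub>F n in sequentially. (\<integral>\<^sup>+x. f n x \<partial>M n) < \<infinity>" by (rule order_tendstoD(2)[OF lim]) simp
  have "(\<lambda>n. enn2real (\<integral>\<^sup>+x. f n x \<partial>M n)) \<longlonglongrightarrow> 0"
    using tendsto_enn2real[of "\<lambda>n. \<integral>\<^sup>+x. f n x \<partial>M n" 0 sequentially] lim by simp
  then have lim0: "(\<lambda>n. enn2real (\<integral>\<^sup>+x. f n x \<partial>M n) / e) \<longlonglongrightarrow> 0" using tendsto_divide[OF _ tendsto_const[of e]] e by fastforce
  have "\<forall>\<^sub>F n in sequentially. \<P>(x in M n. ennreal e < f n x) \<le> enn2real (\<integral>\<^sup>+x. f n x \<partial>M n) / e"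
    using fin by eventually_elim (intro markov_measure M f e, auto simp: less_top)
  then show ?thesis
    by (intro tendsto_sandwich[OF _ _ tendsto_const lim0]) auto
qed

section \<open>Posterior mass outside of large balls\<close>

text \<open>Collects the conclusions of \<open>local_test\<close> and \<open>global_test\<close> at
  one common radius, so that \<open>\<B>\<close> is covered by the local bounds and its complement
  by the global ones without a gap.\<close>

locale bvm_test = bvm_model \<mu> \<Theta> \<theta>\<^sub>0 P s prior \<pi> Q \<epsilon>\<^sub>0 + g: gaussian FI l
  for \<mu> :: "'x measure" and \<Theta> :: "(real^'d) set" and \<theta>\<^sub>0 P s prior \<pi> Q \<epsilon>\<^sub>0 and l :: real +
  fixes T c\<^sub>t d\<^sub>t :: real and A :: "nat \<Rightarrow> (nat \<Rightarrow> 'x) set" and c\<^sub>a p :: real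
  assumes T_pos: "T > 0" and ct_pos: "c\<^sub>t > 0" and dt_pos: "d\<^sub>t > 0"
    and local1: "\<And>n h C. 0 < n \<Longrightarrow> norm h < \<epsilon>\<^sub>0 * sqrt n \<Longrightarrow> 0 < C \<Longrightarrow> C \<le> norm h \<Longrightarrow>
      measure (Pn n (\<theta>\<^sub>0 + (1 / sqrt n) *\<^sub>R h)) {x\<in>space (N n). norm (\<Phi> T n x) \<le> c\<^sub>t * C} \<le> exp (- d\<^sub>t * (norm h)\<^sup>2)"
    and local2: "\<And>n C. 0 < n \<Longrightarrow> 0 < C \<Longrightarrow>
      measure (P0 n) {x\<in>space (N n). c\<^sub>t * C < norm (\<Phi> T n x)} \<le> 2 * DIM(real^'d) * exp (- d\<^sub>t * C\<^sup>2)"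
    and ca_pos: "c\<^sub>a > 0" and A_sets: "\<And>n. A n \<in> sets (N n)"
    and A_type1: "(\<lambda>n. measure (P0 n) (space (N n) - A n)) \<longlonglongrightarrow> 0"
    and A_type2: "\<forall>\<^sub>F n in sequentially. \<forall>\<theta>\<in>\<Theta>. norm (\<theta> - \<theta>\<^sub>0) \<ge> \<epsilon>\<^sub>0 \<longrightarrow> measure (Pn n \<theta>) (A n) \<le> exp (- c\<^sub>a * real n)"
    and p_pos: "p > 0"
begin

definition Dev :: "nat \<Rightarrow> real \<Rightarrow> (nat \<Rightarrow> 'x) \<Rightarrow> ennreal" where
  "Dev n C x = (\<integral>\<^sup>+h. indicator (cball 0 C) h * ennreal (\<bar>u n h x - lik n h x * p0 n x\<bar> / p0 n x) \<partial>lborel)"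

text \<open>The weight dominates, up to a constant, both the rescaled loss for \<open>t\<close> in a
  bounded set and the constant 1, so one quantity serves numerator and normalizer. Since
  \<open>u\<close> vanishes outside the neighbourhood, only parameters in \<open>\<B>\<close>
  contribute.\<close>

definition Mid :: "nat \<Rightarrow> real \<Rightarrow> (nat \<Rightarrow> 'x) \<Rightarrow> ennreal" where
  "Mid n C x = (\<integral>\<^sup>+h. ennreal ((1 + norm h) powr p * indicator (- cball 0 C) h) * ennreal (u n h x / p0 n x) \<partial>lborel)"

text \<open>The factor \<open>real n powr (p / 2)\<close> is the rescaling of the loss, the next one
  the normalization from \<open>posterior_representation\<close>; both are polynomial in
  \<open>n\<close> and will be beaten by the exponential test error.\<close>

definition Far :: "nat \<Rightarrow> (real^'d \<Rightarrow> ennreal) \<Rightarrow> (nat \<Rightarrow> 'x) \<Rightarrow> ennreal" where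
  "Far n U x = ennreal (real n powr (p / 2)) * (ennreal (sqrt n ^ CARD('d) / \<pi> \<theta>\<^sub>0) *
     (\<integral>\<^sup>+\<theta>. U \<theta> * ennreal (q n \<theta> x / p0 n x) * indicator (- \<B>) \<theta> \<partial>prior))"

lemma lborel_sf: "sigma_finite_measure (lborel :: (real^'d) measure)"
  by (rule sigma_finite_lborel)

lemma Dev_meas: "Dev n C \<in> borel_measurable (P0 n)" and
  Dev_small: "\<And>e. e > 0 \<Longrightarrow> (\<lambda>n. \<P>(x in P0 n. ennreal e < Dev n C x)) \<longlonglongrightarrow> 0"
proof -
  have I: "case_prod (\<lambda>h x. indicator (cball 0 C) h :: ennreal) \<in> borel_measurable (lborel \<Otimes>\<^sub>M N n)" for n
    by measurable
  have um: "(\<lambda>z. u n (fst z) (snd z)) \<in> borel_measurable (lborel \<Otimes>\<^sub>M N n)" for n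
    using u_measurable[of n] by (simp add: case_prod_beta)
  have bm: "(\<lambda>z. lik n (fst z) (snd z) * p0 n (snd z)) \<in> borel_measurable (lborel \<Otimes>\<^sub>M N n)" for n by measurable
  have g: "case_prod (\<lambda>h x. \<bar>u n h x - lik n h x * p0 n x\<bar>) \<in> borel_measurable (lborel \<Otimes>\<^sub>M N n)" for n
    unfolding case_prod_beta using um[of n] bm[of n] by measurable
  note cm = change_of_measure[OF lborel_sf I g abs_ge_zero]
  show Dm: "Dev n C \<in> borel_measurable (P0 n)" for n
    using cm(2)[of n] unfolding Dev_def by (simp cong: measurable_cong_sets)
  fix e :: real assume e: "e > 0"
  have "(\<lambda>n. \<integral>\<^sup>+x. Dev n C x \<partial>P0 n) \<longlonglongrightarrow> 0"
    by (rule tendsto_sandwich[OF _ _ tendsto_const local_total_variation[of C]])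
       (use cm(1) in \<open>auto simp: Dev_def\<close>)
  then show "(\<lambda>n. \<P>(x in P0 n. ennreal e < Dev n C x)) \<longlonglongrightarrow> 0"
    by (intro markov_tendsto_0 Dm e P0.finite_measure_axioms)
qed

text \<open>The polynomial weight is at most \<open>exp (p * norm h)\<close>, which reduces the
  claim to a linear exponent.\<close>

lemma poly_gauss_integrable:
  assumes "a > 0"
  shows "integrable lborel (\<lambda>h::real^'d. (1 + norm h) powr p * exp (- a * (norm h)\<^sup>2))"
proof (rule Bochner_Integration.integrable_bound)
  show "integrable lborel (\<lambda>h::real^'d. exp (0 * norm h powr 1 + p * norm h - a * (norm h)\<^sup>2))"
    using g.subgauss_integrable[of a 0 1 p] assms p_pos by simp
  show "AE h::real^'d in lborel. norm ((1 + norm h) powr p * exp (- a * (norm h)\<^sup>2)) \<le> norm (exp (0 * norm h powr 1 + p * norm h - a * (norm h)\<^sup>2))"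
  proof (rule AE_I2)
    fix h :: "real^'d"
    have "(1 + norm h) powr p \<le> exp (norm h) powr p"
      using p_pos exp_ge_add_one_self[of "norm h"] by (intro powr_mono2) auto
    also have "\<dots> = exp (p * norm h)" by (simp add: powr_def)
    finally have "(1 + norm h) powr p * exp (- a * (norm h)\<^sup>2) \<le> exp (p * norm h) * exp (- a * (norm h)\<^sup>2)"
      by (rule mult_right_mono) simp
    then show "norm ((1 + norm h) powr p * exp (- a * (norm h)\<^sup>2)) \<le> norm (exp (0 * norm h powr 1 + p * norm h - a * (norm h)\<^sup>2))"
      by (simp add: exp_add[symmetric])
  qed
qed measurable

text \<open>On the event \<open>?E\<close> that the local test of radius \<open>C\<close> accepts,
  the expectation of \<open>Mid\<close> is at most the tail beyond \<open>C\<close> of the integral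
  of \<open>?f\<close>, by \<open>joint_integral\<close> and the exponential test error. The
  complement of \<open>?E\<close> has probability exponentially small in \<open>C\<^sup>2\<close>.
  Neither bound involves \<open>n\<close>, so one radius works for all sample sizes.\<close>

lemma Mid_meas: "Mid n C \<in> borel_measurable (P0 n)" and
  Mid_small: "\<And>e. e > 0 \<Longrightarrow> \<exists>R>0. \<forall>C\<ge>R. \<forall>n>0. \<P>(x in P0 n. ennreal e < Mid n C x) \<le> e"
proof -
  have um: "case_prod (u n) \<in> borel_measurable (lborel \<Otimes>\<^sub>M N n)" for n
    using u_measurable[of n] by simp
  have W: "case_prod (\<lambda>h x. ennreal ((1 + norm h) powr p * indicator (- cball 0 C) h)) \<in> borel_measurable (lborel \<Otimes>\<^sub>M N n)" for n C
    by measurable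
  show Mm: "Mid n C \<in> borel_measurable (P0 n)" for n C
    using change_of_measure(2)[OF lborel_sf W um u_nonneg] unfolding Mid_def by (simp cong: measurable_cong_sets)
  fix e :: real assume e: "e > 0"
  let ?f = "\<lambda>h::real^'d. 2 * ((1 + norm h) powr p * exp (- d\<^sub>t * (norm h)\<^sup>2))"
  have fi: "integrable lborel ?f" using poly_gauss_integrable[OF dt_pos] by simp
  \<comment> \<open>Markov's inequality divides by \<open>e\<close> and leaves \<open>e / 2\<close>;
    the other half is reserved for the complement of \<open>?E\<close>.\<close>
  obtain R1 where R1: "R1 > 0" "\<And>C. C \<ge> R1 \<Longrightarrow> (\<integral>h. ?f h * indicator (- cball 0 C) h \<partial>lborel) \<le> e * e / 2"
    using tail_integral_tendsto_0[OF fi, of "e * e / 2"] e by auto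
  let ?b = "\<lambda>C. 2 * DIM(real^'d) * exp (- d\<^sub>t * C\<^sup>2)"
  have "(?b \<longlongrightarrow> 0) at_top" using dt_pos by real_asymp
  then have "\<forall>\<^sub>F C in at_top. ?b C < e / 2" using e by (intro order_tendstoD(2)) auto
  then obtain R2 where R2: "\<And>C. C \<ge> R2 \<Longrightarrow> ?b C < e / 2" by (auto simp: eventually_at_top_linorder)
  show "\<exists>R>0. \<forall>C\<ge>R. \<forall>n>0. \<P>(x in P0 n. ennreal e < Mid n C x) \<le> e"
  proof (intro exI[of _ "max R1 R2"] conjI allI impI)
    show "max R1 R2 > 0" using R1 by simp
    fix C :: real and n :: nat assume C: "max R1 R2 \<le> C" and n: "n > 0"
    have C0: "C > 0" using C R1 by simp
    let ?E = "{x\<in>space (N n). norm (\<Phi> T n x) \<le> c\<^sub>t * C}"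
    note Pm [measurable] = \<Phi>_measurable[of T n]
    have E [measurable]: "?E \<in> sets (N n)" by measurable
    have compl: "measure (P0 n) (space (P0 n) - ?E) \<le> e / 2"
    proof -
      have "space (P0 n) - ?E = {x\<in>space (N n). c\<^sub>t * C < norm (\<Phi> T n x)}" by auto
      then show ?thesis using local2[OF n C0] R2[of C] C by simp
    qed
    let ?G = "\<lambda>h x. ennreal ((1 + norm h) powr p * indicator (- cball 0 C) h) * indicator ?E x"
    have G: "case_prod ?G \<in> borel_measurable (lborel \<Otimes>\<^sub>M N n)" by measurable
    have G': "case_prod ?G \<in> borel_measurable (borel \<Otimes>\<^sub>M N n)" by measurable
    have "(\<integral>\<^sup>+x. indicator ?E x * Mid n C x \<partial>P0 n) = (\<integral>\<^sup>+x. \<integral>\<^sup>+h. ?G h x * ennreal (u n h x / p0 n x) \<partial>lborel \<partial>P0 n)"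
    proof (rule nn_integral_cong)
      fix x assume "x \<in> space (P0 n)"
      then have x: "x \<in> space (N n)" by simp
      have [measurable]: "(\<lambda>h. u n h x) \<in> borel_measurable lborel" using u_measurable[of n] x by simp
      show "indicator ?E x * Mid n C x = (\<integral>\<^sup>+h. ?G h x * ennreal (u n h x / p0 n x) \<partial>lborel)"
        unfolding Mid_def by (subst nn_integral_cmult[symmetric]) (auto simp: mult_ac)
    qed
    also have "\<dots> \<le> (\<integral>\<^sup>+x. \<integral>\<^sup>+h. ?G h x * ennreal (u n h x) \<partial>lborel \<partial>N n)"
      by (rule change_of_measure(1)[OF lborel_sf G um u_nonneg])
    also have "\<dots> = (\<integral>\<^sup>+h. (\<integral>\<^sup>+x. ?G h x \<partial>Pn n (loc n h)) * (indicator \<B> (loc n h) * ennreal (\<pi> (loc n h) / \<pi> \<theta>\<^sub>0)) \<partial>lborel)"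
      by (rule joint_integral(1)[OF n G'])
    also have "\<dots> \<le> (\<integral>\<^sup>+h. ennreal (?f h * indicator (- cball 0 C) h) \<partial>lborel)"
    proof (rule nn_integral_mono)
      fix h :: "real^'d"
      show "(\<integral>\<^sup>+x. ?G h x \<partial>Pn n (loc n h)) * (indicator \<B> (loc n h) * ennreal (\<pi> (loc n h) / \<pi> \<theta>\<^sub>0)) \<le> ennreal (?f h * indicator (- cball 0 C) h)"
      proof (cases "loc n h \<in> \<B> \<and> h \<notin> cball 0 C")
        case False then show ?thesis by auto
      next
        case True
        have lt: "loc n h \<in> \<Theta>" using True ball_\<Theta> by auto
        interpret S: prob_space "Pn n (loc n h)" by (rule prob_space_sample_law[OF prob_P[OF lt]])
        have ES: "?E \<in> sets (Pn n (loc n h))" using E sets_sample_law[OF sets_P[OF lt], of n] by simp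
        have "(\<integral>\<^sup>+x. ?G h x \<partial>Pn n (loc n h)) = ennreal ((1 + norm h) powr p) * ennreal (measure (Pn n (loc n h)) ?E)"
          using True ES by (subst nn_integral_cmult_indicator) (auto simp: S.emeasure_eq_measure)
        also have "\<dots> \<le> ennreal ((1 + norm h) powr p) * ennreal (exp (- d\<^sub>t * (norm h)\<^sup>2))"
          using True loc_in_ball[OF n, of h] local1[OF n _ C0, of h]
          by (intro mult_left_mono ennreal_leI) (auto simp: loc_def)
        finally have "(\<integral>\<^sup>+x. ?G h x \<partial>Pn n (loc n h)) * ennreal (\<pi> (loc n h) / \<pi> \<theta>\<^sub>0)
          \<le> (ennreal ((1 + norm h) powr p) * ennreal (exp (- d\<^sub>t * (norm h)\<^sup>2))) * ennreal 2"
          using \<pi>_le[of "loc n h"] True \<pi>_pos by (intro mult_mono ennreal_leI) (auto simp: pos_divide_le_eq)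
        also have "\<dots> = ennreal (?f h)"
          by (simp add: ennreal_mult[symmetric] mult_ac del: ennreal_numeral)
        finally show ?thesis using True by simp
      qed
    qed
    also have "\<dots> = ennreal (\<integral>h. ?f h * indicator (- cball 0 C) h \<partial>lborel)"
    proof (rule nn_integral_eq_integral)
      show "integrable lborel (\<lambda>h. ?f h * indicator (- cball 0 C) h)"
        using integrable_mult_indicator[OF _ fi, of "- cball 0 C"] by (simp add: mult_ac)
    qed auto
    also have "\<dots> \<le> ennreal (e * e / 2)" using R1(2)[of C] C by (intro ennreal_leI) simp
    finally have "\<P>(x in P0 n. ennreal e < indicator ?E x * Mid n C x) \<le> (e * e / 2) / e"
      using e Mm[of n C] by (intro markov_measure[OF P0.finite_measure_axioms]) auto
    also have "\<dots> = e / 2" using e by simp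
    finally show "\<P>(x in P0 n. ennreal e < Mid n C x) \<le> e"
      using measure_exceed_split[OF P0.finite_measure_axioms _ Mm, of ?E n "ennreal e" C] compl E by simp
  qed
qed

text \<open>On \<open>A n\<close> the expectation of \<open>Far\<close> is at most a power of
  \<open>n\<close> times \<open>exp (- c\<^sub>a * real n)\<close> times the prior mean of
  \<open>U\<close>; thus prior integrability of the majorant is enough, whatever its growth.\<close>

lemma Far_meas: "U \<in> borel_measurable prior \<Longrightarrow> Far n U \<in> borel_measurable (P0 n)" and
  Far_small: "\<And>e. U \<in> borel_measurable prior \<Longrightarrow> (\<integral>\<^sup>+\<theta>. U \<theta> \<partial>prior) < \<infinity> \<Longrightarrow> e > 0 \<Longrightarrow>
    (\<lambda>n. \<P>(x in P0 n. ennreal e < Far n U x)) \<longlonglongrightarrow> 0"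
proof -
  assume U [measurable]: "U \<in> borel_measurable prior"
  let ?K = "\<lambda>n. ennreal (real n powr (p / 2)) * ennreal (sqrt n ^ CARD('d) / \<pi> \<theta>\<^sub>0)"
  let ?i = "indicator (- \<B>) :: _ \<Rightarrow> ennreal"
  have idm: "(\<lambda>\<theta>. \<theta>) \<in> prior \<rightarrow>\<^sub>M borel"
    unfolding measurable_cong_sets[OF sets_prior refl] by (rule measurable_restrict_space1) simp
  have im [measurable]: "?i \<in> borel_measurable prior"
    by (rule measurable_compose[OF idm borel_measurable_indicator]) simp
  have F: "case_prod (\<lambda>\<theta> x. U \<theta> * ?i \<theta>) \<in> borel_measurable (prior \<Otimes>\<^sub>M N n)" for n by measurable
  have eq: "Far n U x = ?K n * (\<integral>\<^sup>+\<theta>. (U \<theta> * ?i \<theta>) * ennreal (q n \<theta> x / p0 n x) \<partial>prior)" for n x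
    unfolding Far_def by (simp add: mult_ac)
  show Fm: "Far n U \<in> borel_measurable (P0 n)" for n
    using change_of_measure(2)[OF prior.sigma_finite_measure_axioms F q_measurable q_nonneg, of n]
    unfolding eq[abs_def] by (simp cong: measurable_cong_sets)
  assume Ufin: "(\<integral>\<^sup>+\<theta>. U \<theta> \<partial>prior) < \<infinity>"
  fix e :: real assume e: "e > 0"
  define UU where "UU = enn2real (\<integral>\<^sup>+\<theta>. U \<theta> \<partial>prior)"
  have UU: "(\<integral>\<^sup>+\<theta>. U \<theta> \<partial>prior) = ennreal UU" "0 \<le> UU" using Ufin by (auto simp: UU_def less_top)
  let ?r = "\<lambda>n. real n powr (p / 2) * (sqrt n ^ CARD('d) / \<pi> \<theta>\<^sub>0) * (exp (- c\<^sub>a * real n) * UU)"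
  have le: "\<forall>\<^sub>F n in sequentially. (\<integral>\<^sup>+x. indicator (A n) x * Far n U x \<partial>P0 n) \<le> ennreal (?r n)"
    using A_type2
  proof eventually_elim
    case (elim n)
    note An [measurable] = A_sets[of n]
    let ?F = "\<lambda>\<theta> x. (U \<theta> * ?i \<theta>) * indicator (A n) x"
    have F': "case_prod ?F \<in> borel_measurable (prior \<Otimes>\<^sub>M N n)" by measurable
    note cm = change_of_measure[OF prior.sigma_finite_measure_axioms F' q_measurable q_nonneg]
    have "(\<integral>\<^sup>+x. indicator (A n) x * Far n U x \<partial>P0 n) = (\<integral>\<^sup>+x. ?K n * (\<integral>\<^sup>+\<theta>. ?F \<theta> x * ennreal (q n \<theta> x / p0 n x) \<partial>prior) \<partial>P0 n)"
      unfolding eq by (intro nn_integral_cong) (auto split: split_indicator)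
    also have "\<dots> = ?K n * (\<integral>\<^sup>+x. (\<integral>\<^sup>+\<theta>. ?F \<theta> x * ennreal (q n \<theta> x / p0 n x) \<partial>prior) \<partial>P0 n)"
      using cm(2) by (intro nn_integral_cmult) (simp cong: measurable_cong_sets)
    also have "\<dots> \<le> ?K n * (\<integral>\<^sup>+x. \<integral>\<^sup>+\<theta>. ?F \<theta> x * ennreal (q n \<theta> x) \<partial>prior \<partial>N n)"
      by (intro mult_left_mono cm(1)) simp
    also have "(\<integral>\<^sup>+x. \<integral>\<^sup>+\<theta>. ?F \<theta> x * ennreal (q n \<theta> x) \<partial>prior \<partial>N n) = (\<integral>\<^sup>+\<theta>. \<integral>\<^sup>+x. ?F \<theta> x * ennreal (q n \<theta> x) \<partial>N n \<partial>prior)"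
    proof -
      interpret pair_sigma_finite prior "N n" ..
      show ?thesis by (rule Fubini') measurable
    qed
    also have "\<dots> = (\<integral>\<^sup>+\<theta>. \<integral>\<^sup>+x. ?F \<theta> x \<partial>Pn n \<theta> \<partial>prior)" by (rule q_integral[OF F'])
    also have "\<dots> \<le> (\<integral>\<^sup>+\<theta>. ennreal (exp (- c\<^sub>a * real n)) * U \<theta> \<partial>prior)"
    proof (rule nn_integral_mono)
      fix \<theta> assume "\<theta> \<in> space prior"
      then have \<theta>: "\<theta> \<in> \<Theta>" by simp
      interpret S: prob_space "Pn n \<theta>" by (rule prob_space_sample_law[OF prob_P[OF \<theta>]])
      have AS: "A n \<in> sets (Pn n \<theta>)" using An sets_sample_law[OF sets_P[OF \<theta>], of n] by simp
      show "(\<integral>\<^sup>+x. ?F \<theta> x \<partial>Pn n \<theta>) \<le> ennreal (exp (- c\<^sub>a * real n)) * U \<theta>"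
      proof (cases "\<theta> \<in> \<B>")
        case False
        then have "norm (\<theta> - \<theta>\<^sub>0) \<ge> \<epsilon>\<^sub>0" by (simp add: dist_norm norm_minus_commute)
        then have "measure (Pn n \<theta>) (A n) \<le> exp (- c\<^sub>a * real n)" using elim \<theta> by blast
        then have "U \<theta> * emeasure (Pn n \<theta>) (A n) \<le> U \<theta> * ennreal (exp (- c\<^sub>a * real n))"
          by (intro mult_left_mono) (auto simp: S.emeasure_eq_measure intro!: ennreal_leI)
        then show ?thesis using AS False by (subst nn_integral_cmult_indicator) (auto simp: mult.commute)
      qed simp
    qed
    also have "\<dots> = ennreal (exp (- c\<^sub>a * real n)) * ennreal UU"
      using UU(1) by (subst nn_integral_cmult) auto
    also have "?K n * (ennreal (exp (- c\<^sub>a * real n)) * ennreal UU) = ennreal (?r n)"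
      using UU(2) \<pi>_pos by (simp add: ennreal_mult[symmetric])
    finally show ?case by (simp add: mult_left_mono)
  qed
  have rlim: "?r \<longlonglongrightarrow> 0"
  proof -
    have "(\<lambda>n. (UU / \<pi> \<theta>\<^sub>0) * (real n powr (p / 2 + CARD('d) / 2) * exp (- c\<^sub>a * real n))) \<longlonglongrightarrow> (UU / \<pi> \<theta>\<^sub>0) * 0"
      using ca_pos by (intro tendsto_mult_left) real_asymp
    moreover have "\<forall>\<^sub>F n in sequentially. (UU / \<pi> \<theta>\<^sub>0) * (real n powr (p / 2 + CARD('d) / 2) * exp (- c\<^sub>a * real n)) = ?r n"
      using eventually_gt_at_top[of 0]
    proof eventually_elim
      case (elim n)
      have "sqrt n ^ CARD('d) = real n powr (CARD('d) / 2)"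
        using elim by (simp add: powr_half_sqrt[symmetric] powr_power)
      then show ?case by (simp add: powr_add mult_ac)
    qed
    ultimately show ?thesis by (auto intro: Lim_transform_eventually)
  qed
  have "(\<lambda>n. ennreal (?r n)) \<longlonglongrightarrow> ennreal 0" using rlim by (rule tendsto_ennrealI)
  then have rlim': "(\<lambda>n. ennreal (?r n)) \<longlonglongrightarrow> 0" by simp
  have AF: "(\<lambda>x. indicator (A n) x * Far n U x) \<in> borel_measurable (P0 n)" for n
    using A_sets[of n] Fm[of n] by (intro borel_measurable_times_ennreal borel_measurable_indicator) auto
  have "(\<lambda>n. \<integral>\<^sup>+x. indicator (A n) x * Far n U x \<partial>P0 n) \<longlonglongrightarrow> 0"
    by (rule tendsto_sandwich[OF _ le tendsto_const rlim']) simp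
  then have m0: "(\<lambda>n. \<P>(x in P0 n. ennreal e < indicator (A n) x * Far n U x)) \<longlonglongrightarrow> 0"
    by (intro markov_tendsto_0 AF e P0.finite_measure_axioms)
  have sum0: "(\<lambda>n. measure (P0 n) (space (P0 n) - A n) + \<P>(x in P0 n. ennreal e < indicator (A n) x * Far n U x)) \<longlonglongrightarrow> 0"
    using tendsto_add[OF A_type1 m0] by simp
  show "(\<lambda>n. \<P>(x in P0 n. ennreal e < Far n U x)) \<longlonglongrightarrow> 0"
  proof (rule tendsto_sandwich[OF _ _ tendsto_const sum0])
    show "\<forall>\<^sub>F n in sequentially. \<P>(x in P0 n. ennreal e < Far n U x)
       \<le> measure (P0 n) (space (P0 n) - A n) + \<P>(x in P0 n. ennreal e < indicator (A n) x * Far n U x)"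
      using A_sets by (intro always_eventually allI measure_exceed_split P0.finite_measure_axioms Fm) auto
  qed simp
qed

text \<open>A large norm forces some coordinate to be large in absolute value; exponential moments
  of \<open>Del\<close> along the signed basis vectors, bounded uniformly in \<open>n\<close> by
  \<open>lik_mean\<close> with radius 1, make this unlikely.\<close>

lemma Del_tight:
  assumes e: "e > 0"
  obtains k where "k > 0" "\<forall>\<^sub>F n in sequentially. \<P>(x in P0 n. norm (Del n x) > k) \<le> e"
proof -
  let ?D = "real DIM(real^'d)"
  have D: "?D > 0" by simp
  have "((\<lambda>k. 2 * ?D * exp V * exp (- k / ?D)) \<longlongrightarrow> 0) at_top"
  proof -
    have "((\<lambda>k. exp (- k / d)) \<longlongrightarrow> 0) at_top" if "d > 0" for d :: real using that by real_asymp
    from tendsto_mult_left[OF this[OF D], of "2 * ?D * exp V"] show ?thesis by simp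
  qed
  then have "\<forall>\<^sub>F k in at_top. 2 * ?D * exp V * exp (- k / ?D) < e" using e by (intro order_tendstoD(2)) auto
  then have "\<forall>\<^sub>F k in at_top. 2 * ?D * exp V * exp (- k / ?D) < e \<and> k > 0" using eventually_gt_at_top[of 0] by eventually_elim auto
  then obtain k where k: "2 * ?D * exp V * exp (- k / ?D) < e" "k > 0" by (auto simp: eventually_at_top_linorder)
  have "\<forall>\<^sub>F n in sequentially. bnd 1 n < 1" by (rule order_tendstoD(2)[OF bnd_tendsto(1)]) simp
  then have "\<forall>\<^sub>F n in sequentially. \<P>(x in P0 n. norm (Del n x) > k) \<le> e"
    using eventually_gt_at_top[of 0]
  proof eventually_elim
    case (elim n)
    let ?W = "\<lambda>x. \<Sum>b\<in>(Basis :: (real^'d) set). exp (b \<bullet> Del n x) + exp ((- b) \<bullet> Del n x)"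
    have b1: "norm b \<le> 1" "norm (- b) \<le> 1" if "b \<in> Basis" for b :: "real^'d" using that by auto
    have lm: "integrable (P0 n) (\<lambda>x. exp (v \<bullet> Del n x))" "(\<integral>x. exp (v \<bullet> Del n x) \<partial>P0 n) \<le> exp V" if "norm v \<le> 1" for v
      using lik_mean[OF that _ elim(2)] elim(1) by auto
    have Wi: "integrable (P0 n) ?W"
      by (intro Bochner_Integration.integrable_sum Bochner_Integration.integrable_add lm b1)
    have "(\<integral>x. ?W x \<partial>P0 n) = (\<Sum>b\<in>(Basis :: (real^'d) set). (\<integral>x. exp (b \<bullet> Del n x) + exp ((- b) \<bullet> Del n x) \<partial>P0 n))"
      by (intro Bochner_Integration.integral_sum Bochner_Integration.integrable_add lm b1)
    also have "\<dots> = (\<Sum>b\<in>(Basis :: (real^'d) set). (\<integral>x. exp (b \<bullet> Del n x) \<partial>P0 n) + (\<integral>x. exp ((- b) \<bullet> Del n x) \<partial>P0 n))"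
      by (intro sum.cong refl Bochner_Integration.integral_add lm b1)
    also have "\<dots> \<le> (\<Sum>b\<in>(Basis :: (real^'d) set). exp V + exp V)"
      by (intro sum_mono add_mono lm b1)
    finally have EW: "(\<integral>x. ?W x \<partial>P0 n) \<le> 2 * ?D * exp V" by simp
    have W0: "0 \<le> ?W x" for x by (intro sum_nonneg) auto
    have Wm: "?W \<in> borel_measurable (P0 n)" using Wi by auto
    have sub: "{x\<in>space (P0 n). norm (Del n x) > k} \<subseteq> {x\<in>space (P0 n). ?W x \<ge> exp (k / ?D)}"
    proof safe
      fix x assume x: "x \<in> space (P0 n)" "norm (Del n x) > k"
      have "\<exists>b\<in>Basis. k / ?D < \<bar>Del n x \<bullet> b\<bar>"
      proof (rule ccontr)
        assume "\<not> (\<exists>b\<in>Basis. k / ?D < \<bar>Del n x \<bullet> b\<bar>)"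
        then have "(\<Sum>b\<in>Basis. \<bar>Del n x \<bullet> b\<bar>) \<le> (\<Sum>b\<in>(Basis :: (real^'d) set). k / ?D)"
          by (intro sum_mono) (auto simp: not_less)
        then show False using x(2) norm_le_l1[of "Del n x"] by simp
      qed
      then obtain b where b: "b \<in> Basis" "k / ?D < \<bar>Del n x \<bullet> b\<bar>" by blast
      have "exp (k / ?D) \<le> exp \<bar>b \<bullet> Del n x\<bar>" using b(2) by (simp add: inner_commute)
      also have "\<dots> \<le> exp (b \<bullet> Del n x) + exp ((- b) \<bullet> Del n x)" by (cases "b \<bullet> Del n x \<ge> 0") auto
      also have "\<dots> \<le> ?W x" using b(1) by (intro member_le_sum) auto
      finally show "exp (k / ?D) \<le> ?W x" .
    qed
    have "\<P>(x in P0 n. norm (Del n x) > k) \<le> \<P>(x in P0 n. ?W x \<ge> exp (k / ?D))"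
      using Wm by (intro P0.finite_measure_mono[OF sub]) measurable
    also have "\<dots> \<le> (\<integral>x. ?W x \<partial>P0 n) / exp (k / ?D)"
      using W0
      by (intro integral_Markov_inequality_measure[OF Wi, where A = "{}"]) auto
    also have "\<dots> \<le> 2 * ?D * exp V / exp (k / ?D)" using EW by (intro divide_right_mono) auto
    also have "\<dots> = 2 * ?D * exp V * exp (- k / ?D)" by (simp add: exp_minus divide_inverse)
    also have "\<dots> \<le> e" using k by simp
    finally show ?case .
  qed
  with k(2) show ?thesis by (rule that)
qed

end

section \<open>Posterior risk\<close>

text \<open>Here \<open>a\<close> and \<open>y1\<close> are normalizers, \<open>z\<close> and
  \<open>y\<close> the quotients. Comparing \<open>a * z\<close> with \<open>y1 * y\<close> and
  \<open>a\<close> with \<open>y1\<close> suffices, as \<open>a * (z - y)\<close> equals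
  \<open>(a * z - y1 * y) + (y1 - a) * y\<close> and \<open>a\<close> is at least
  \<open>c / 2\<close>.\<close>

lemma ratio_approx:
  fixes a z y y1 :: real
  assumes "\<bar>a * z - y1 * y\<bar> \<le> \<eta>" "\<bar>a - y1\<bar> \<le> \<eta>" "c \<le> y1" "\<eta> \<le> c / 2" "c > 0" "0 \<le> y" "y \<le> M"
  shows "\<bar>z - y\<bar> \<le> 2 * \<eta> * (1 + M) / c"
proof -
  have a: "c / 2 \<le> a" using assms by linarith
  have eq: "a * (z - y) = (a * z - y1 * y) + (y1 - a) * y" by (simp add: algebra_simps)
  have "\<bar>(y1 - a) * y\<bar> \<le> \<eta> * M"
    unfolding abs_mult using assms by (intro mult_mono) auto
  then have "\<bar>a * (z - y)\<bar> \<le> \<eta> + \<eta> * M"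
    unfolding eq by (intro order_trans[OF abs_triangle_ineq] add_mono assms(1))
  moreover have "\<bar>a * (z - y)\<bar> = a * \<bar>z - y\<bar>" unfolding abs_mult using a assms(5) by simp
  ultimately have "a * \<bar>z - y\<bar> \<le> \<eta> * (1 + M)" by (simp add: distrib_left)
  moreover have "c / 2 * \<bar>z - y\<bar> \<le> a * \<bar>z - y\<bar>" using a by (intro mult_right_mono) auto
  ultimately have "c / 2 * \<bar>z - y\<bar> \<le> \<eta> * (1 + M)" by linarith
  then show ?thesis using assms(5) by (simp add: field_simps)
qed

lemma ennreal_near:
  assumes "X \<le> ennreal y + ennreal \<eta>" "ennreal y \<le> X + ennreal \<eta>" "0 \<le> y" "0 \<le> \<eta>"
  shows "X < \<infinity>" "\<bar>enn2real X - y\<bar> \<le> \<eta>"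
proof -
  have "ennreal y + ennreal \<eta> < \<infinity>" by simp
  with assms(1) show X: "X < \<infinity>" by (rule le_less_trans)
  then obtain r where r: "X = ennreal r" "0 \<le> r" by (cases X) auto
  then show "\<bar>enn2real X - y\<bar> \<le> \<eta>"
    using assms by (auto simp: ennreal_plus[symmetric] ennreal_le_iff abs_le_iff simp del: ennreal_plus)
qed

context bvm_test
begin

lemma lik_le:
  assumes "norm (Del n x) \<le> k"
  shows "lik n h x \<le> exp (k * norm h - (l / 2) * (norm h)\<^sup>2)"
proof -
  have "h \<bullet> Del n x \<le> norm h * norm (Del n x)" by (rule norm_cauchy_schwarz)
  also have "\<dots> \<le> norm h * k" using assms by (intro mult_left_mono) auto
  finally have "h \<bullet> Del n x \<le> k * norm h" by (simp add: mult.commute)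
  moreover have "l * (norm h)\<^sup>2 \<le> h \<bullet> (FI *v h)" by (rule g.l(2))
  ultimately show ?thesis unfolding lik_def by (intro exp_mono) (simp add: field_simps)
qed

text \<open>A statement about one fixed sample, applied once with the rescaled loss and its limit
  and once with the constant 1 for both. On the ball of radius \<open>C\<close> the error is
  \<open>g * (w - v) + (g - g0) * v\<close>, which produces the terms with \<open>Dev\<close> and
  \<open>\<kappa>\<close>; outside, the two integrands are bounded separately by \<open>Mid\<close>
  and \<open>\<tau>\<close>. Two one-sided inequalities replace an absolute difference because the
  values may be infinite.\<close>

lemma risk_approx:
  fixes g g0 :: "real^'d \<Rightarrow> real"
  assumes x: "x \<in> space (N n)" "0 < p0 n x" and n: "0 < n"
    and gm: "(\<lambda>h. if loc n h \<in> \<B> then g (loc n h) else 0) \<in> borel_measurable borel"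
    and g0m [measurable]: "g0 \<in> borel_measurable borel"
    and g_nonneg: "\<And>h. loc n h \<in> \<B> \<Longrightarrow> 0 \<le> g (loc n h)" and g0_nonneg: "\<And>h. 0 \<le> g0 h"
    and g_le: "\<And>h. loc n h \<in> \<B> \<Longrightarrow> g (loc n h) \<le> D * (1 + norm h) powr p"
    and D: "0 \<le> D" and C: "0 \<le> C" "C < \<epsilon>\<^sub>0 * sqrt n" and k: "norm (Del n x) \<le> k"
    and \<kappa>: "(\<integral>\<^sup>+h. indicator (cball 0 C) h * ennreal \<bar>g (loc n h) - g0 h\<bar> \<partial>lborel) \<le> \<kappa>"
    and \<tau>: "(\<integral>\<^sup>+h. indicator (- cball 0 C) h * ennreal (g0 h * lik n h x) \<partial>lborel) \<le> \<tau>"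
  defines "X \<equiv> \<integral>\<^sup>+h. ennreal (g (loc n h)) * ennreal (u n h x / p0 n x) \<partial>lborel"
    and "Y \<equiv> \<integral>\<^sup>+h. ennreal (g0 h * lik n h x) \<partial>lborel"
    and "E \<equiv> ennreal D * Mid n C x + ennreal (D * (1 + C) powr p) * Dev n C x + (ennreal (exp (k * C)) * \<kappa> + \<tau>)"
  shows "X \<le> Y + E" "Y \<le> X + E"
proof -
  define gl where "gl h = (if loc n h \<in> \<B> then g (loc n h) else 0)" for h
  have glm [measurable]: "gl \<in> borel_measurable borel" using gm by (simp add: gl_def[abs_def])
  have um [measurable]: "(\<lambda>h. u n h x) \<in> borel_measurable borel"
    using measurable_compose[OF measurable_Pair2'[OF x(1)] u_measurable[of n]] x by simp
  have lm [measurable]: "(\<lambda>h. lik n h x) \<in> borel_measurable borel"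
    using measurable_compose[OF measurable_Pair2'[OF x(1)] lik_measurable[of n]] x by simp
  let ?w = "\<lambda>h. u n h x / p0 n x" and ?v = "\<lambda>h. lik n h x" and ?d = "\<lambda>h. \<bar>u n h x - lik n h x * p0 n x\<bar> / p0 n x"
  let ?i = "\<lambda>h. indicator (cball 0 C) h :: ennreal" and ?j = "\<lambda>h. indicator (- cball 0 C) h :: ennreal"
  define f1 where "f1 h = ennreal (gl h) * ennreal (?w h)" for h
  define f2 where "f2 h = ennreal (g0 h * ?v h)" for h
  define e1 where "e1 h = ennreal D * (ennreal ((1 + norm h) powr p * indicator (- cball 0 C) h) * ennreal (?w h))" for h :: "real^'d"
  define e2 where "e2 h = ennreal (D * (1 + C) powr p) * (?i h * ennreal (?d h))" for h
  define e3 where "e3 h = ennreal (exp (k * C)) * (?i h * ennreal \<bar>gl h - g0 h\<bar>)" for h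
  define e4 where "e4 h = ?j h * ennreal (g0 h * ?v h)" for h
  have im [measurable]: "?i \<in> borel_measurable borel" "?j \<in> borel_measurable borel"
    "(\<lambda>h. indicator (- cball 0 C) h :: real) \<in> borel_measurable borel" by (auto intro!: borel_measurable_indicator)
  have meas [measurable]: "f1 \<in> borel_measurable borel" "f2 \<in> borel_measurable borel" "e1 \<in> borel_measurable borel"
    "e2 \<in> borel_measurable borel" "e3 \<in> borel_measurable borel" "e4 \<in> borel_measurable borel"
    unfolding f1_def[abs_def] f2_def[abs_def] e1_def[abs_def] e2_def[abs_def] e3_def[abs_def] e4_def[abs_def] by measurable
  have in_ball: "loc n h \<in> \<B>" if "norm h \<le> C" for h using loc_in_ball[OF n, of h] C that by auto
  have u0: "u n h x = 0" if "loc n h \<notin> \<B>" for h using that by (simp only: u_def if_False)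
  have X: "X = (\<integral>\<^sup>+h. f1 h \<partial>lborel)"
    unfolding X_def f1_def by (intro nn_integral_cong) (auto simp: gl_def u0)
  have Y: "Y = (\<integral>\<^sup>+h. f2 h \<partial>lborel)" unfolding Y_def f2_def ..
  have gl: "0 \<le> gl h" "gl h \<le> D * (1 + norm h) powr p" for h
    using g_nonneg[of h] g_le[of h] D by (auto simp: gl_def)
  have w: "0 \<le> ?w h" "0 \<le> ?d h" "?d h = \<bar>?w h - ?v h\<bar>" for h
  proof -
    show "0 \<le> ?w h" "0 \<le> ?d h" by simp_all
    have "?w h - ?v h = (u n h x - lik n h x * p0 n x) / p0 n x" using x(2) by (simp add: field_simps)
    then show "?d h = \<bar>?w h - ?v h\<bar>" using x(2) by (simp add: abs_divide)
  qed
  let ?S = "\<lambda>h. (e1 h + e2 h) + (e3 h + e4 h)"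
  have pt: "f1 h \<le> f2 h + ?S h \<and> f2 h \<le> f1 h + ?S h" for h
  proof (cases "norm h \<le> C")
    case True
    have eq: "gl h * ?w h - g0 h * ?v h = gl h * (?w h - ?v h) + (gl h - g0 h) * ?v h" by (simp add: algebra_simps)
    have "?v h \<le> exp (k * norm h - (l / 2) * (norm h)\<^sup>2)" by (rule lik_le[OF k])
    also have "\<dots> \<le> exp (k * C)"
    proof -
      have "0 \<le> k" using k norm_ge_zero order_trans by blast
      then have "k * norm h \<le> k * C" using True by (intro mult_left_mono)
      moreover have "0 \<le> (l / 2) * (norm h)\<^sup>2" using g.l(1) by simp
      ultimately show ?thesis by simp
    qed
    finally have v: "?v h \<le> exp (k * C)" .
    have "gl h \<le> D * (1 + C) powr p"
      using gl(2)[of h] D True p_pos by (elim order_trans) (intro mult_left_mono powr_mono2, auto)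
    then have "\<bar>gl h * (?w h - ?v h)\<bar> \<le> D * (1 + C) powr p * ?d h"
      unfolding abs_mult w(3) using gl(1)[of h] by (intro mult_right_mono) auto
    moreover have "\<bar>(gl h - g0 h) * ?v h\<bar> \<le> exp (k * C) * \<bar>gl h - g0 h\<bar>"
      unfolding abs_mult using v by (subst mult.commute) (intro mult_right_mono, auto)
    ultimately have r: "\<bar>gl h * ?w h - g0 h * ?v h\<bar> \<le> D * (1 + C) powr p * ?d h + exp (k * C) * \<bar>gl h - g0 h\<bar>"
      unfolding eq by (intro order_trans[OF abs_triangle_ineq] add_mono)
    have S: "?S h = ennreal (D * (1 + C) powr p * ?d h + exp (k * C) * \<bar>gl h - g0 h\<bar>)"
      using True D by (simp add: e1_def e2_def e3_def e4_def ennreal_mult[symmetric] ennreal_plus[symmetric] del: ennreal_plus)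
    have f: "f1 h = ennreal (gl h * ?w h)" "f2 h = ennreal (g0 h * ?v h)"
      unfolding f1_def f2_def using gl(1)[of h] by (simp_all add: ennreal_mult[symmetric])
    let ?r = "D * (1 + C) powr p * ?d h + exp (k * C) * \<bar>gl h - g0 h\<bar>"
    have nn: "0 \<le> gl h * ?w h" "0 \<le> g0 h * ?v h" "0 \<le> ?r"
      using gl(1)[of h] g0_nonneg[of h] w(1,2)[of h] D by (auto intro!: add_nonneg_nonneg mult_nonneg_nonneg)
    have r': "gl h * ?w h \<le> g0 h * ?v h + ?r" "g0 h * ?v h \<le> gl h * ?w h + ?r"
      using r by (simp_all only: abs_le_iff) linarith+
    show ?thesis unfolding f S
      using ennreal_leI[OF r'(1)] ennreal_leI[OF r'(2)] nn by (simp only: ennreal_plus)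
  next
    case False
    have "f1 h \<le> e1 h"
    proof -
      have "ennreal (gl h) * ennreal (?w h) \<le> ennreal (D * (1 + norm h) powr p) * ennreal (?w h)"
        by (intro mult_right_mono ennreal_leI gl) simp
      then show ?thesis using False D by (simp add: f1_def e1_def ennreal_mult mult.assoc)
    qed
    moreover have "f2 h = e4 h" using False by (simp add: f2_def e4_def)
    moreover have "e1 h \<le> f2 h + ?S h" "e4 h \<le> f1 h + ?S h"
      by (simp_all add: add_increasing add_increasing2)
    ultimately show ?thesis by (metis order_trans)
  qed
  have S: "(\<integral>\<^sup>+h. ?S h \<partial>lborel) \<le> E"
  proof -
    have "(\<integral>\<^sup>+h. ?S h \<partial>lborel) = ((\<integral>\<^sup>+h. e1 h \<partial>lborel) + (\<integral>\<^sup>+h. e2 h \<partial>lborel)) + ((\<integral>\<^sup>+h. e3 h \<partial>lborel) + (\<integral>\<^sup>+h. e4 h \<partial>lborel))"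
      by (simp add: nn_integral_add)
    moreover have "(\<integral>\<^sup>+h. e1 h \<partial>lborel) = ennreal D * Mid n C x"
      unfolding e1_def Mid_def by (rule nn_integral_cmult) measurable
    moreover have "(\<integral>\<^sup>+h. e2 h \<partial>lborel) = ennreal (D * (1 + C) powr p) * Dev n C x"
      unfolding e2_def Dev_def by (rule nn_integral_cmult) measurable
    moreover have "(\<integral>\<^sup>+h. e3 h \<partial>lborel) = ennreal (exp (k * C)) * (\<integral>\<^sup>+h. ?i h * ennreal \<bar>gl h - g0 h\<bar> \<partial>lborel)"
      unfolding e3_def by (rule nn_integral_cmult) measurable
    moreover have "(\<integral>\<^sup>+h. ?i h * ennreal \<bar>gl h - g0 h\<bar> \<partial>lborel) = (\<integral>\<^sup>+h. ?i h * ennreal \<bar>g (loc n h) - g0 h\<bar> \<partial>lborel)"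
      using in_ball by (intro nn_integral_cong) (auto simp: gl_def split: split_indicator)
    moreover have "(\<integral>\<^sup>+h. e4 h \<partial>lborel) \<le> \<tau>" unfolding e4_def by (rule \<tau>)
    ultimately show ?thesis unfolding E_def
      using mult_left_mono[OF \<kappa>, of "ennreal (exp (k * C))"] by (simp add: add_mono)
  qed
  have "X \<le> (\<integral>\<^sup>+h. f2 h + ?S h \<partial>lborel)" unfolding X using pt by (intro nn_integral_mono) blast
  also have "\<dots> = Y + (\<integral>\<^sup>+h. ?S h \<partial>lborel)" unfolding Y by (rule nn_integral_add) measurable
  also have "\<dots> \<le> Y + E" by (intro add_left_mono S)
  finally show "X \<le> Y + E" .
  have "Y \<le> (\<integral>\<^sup>+h. f1 h + ?S h \<partial>lborel)" unfolding Y using pt by (intro nn_integral_mono) blast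
  also have "\<dots> = X + (\<integral>\<^sup>+h. ?S h \<partial>lborel)" unfolding X by (rule nn_integral_add) measurable
  also have "\<dots> \<le> X + E" by (intro add_left_mono S)
  finally show "Y \<le> X + E" .
qed

lemma lik_square:
  "lik n h x = exp ((Del n x \<bullet> (g.B *v Del n x)) / 2) * g.G (h - g.B *v Del n x)"
  "0 \<le> Del n x \<bullet> (g.B *v Del n x)"
proof -
  have "lik n h x = exp (Del n x \<bullet> h) * g.G h"
    by (simp add: lik_def g.G_def exp_add[symmetric] inner_commute)
  then show "lik n h x = exp ((Del n x \<bullet> (g.B *v Del n x)) / 2) * g.G (h - g.B *v Del n x)"
    by (simp add: g.complete_square)
  have "0 \<le> (g.B *v Del n x) \<bullet> (FI *v (g.B *v Del n x))" by (rule fisher_nonneg)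
  then show "0 \<le> Del n x \<bullet> (g.B *v Del n x)" by (simp add: inner_commute)
qed

text \<open>The tower property: the mean over the marginal law of the posterior expectation is the
  prior expectation. It is read off from \<open>q\<close>, and positivity of \<open>m\<close>
  transfers finiteness to the posterior itself.\<close>

lemma posterior_finite:
  assumes U [measurable]: "U \<in> borel_measurable prior" and fin: "(\<integral>\<^sup>+\<theta>. U \<theta> \<partial>prior) < \<infinity>"
  shows "AE x in P0 n. (\<integral>\<^sup>+\<theta>. U \<theta> \<partial>Q n x) < \<infinity>"
proof -
  interpret pair_sigma_finite prior "N n" ..
  let ?\<phi> = "\<lambda>x. \<integral>\<^sup>+\<theta>. U \<theta> * ennreal (q n \<theta> x) \<partial>prior"
  have F: "case_prod (\<lambda>\<theta> x. U \<theta>) \<in> borel_measurable (prior \<Otimes>\<^sub>M N n)" by measurable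
  have m: "(\<lambda>(x, \<theta>). U \<theta> * ennreal (q n \<theta> x)) \<in> borel_measurable (N n \<Otimes>\<^sub>M prior)"
    using measurable_compose[OF measurable_pair_swap'[of "N n" prior] q_measurable[of n]]
    by (simp add: case_prod_beta)
  have \<phi>m: "?\<phi> \<in> borel_measurable (N n)" by (rule prior.borel_measurable_nn_integral[OF m])
  have "(\<integral>\<^sup>+x. ?\<phi> x \<partial>N n) = (\<integral>\<^sup>+\<theta>. \<integral>\<^sup>+x. U \<theta> * ennreal (q n \<theta> x) \<partial>N n \<partial>prior)"
    by (rule Fubini') measurable
  also have "\<dots> = (\<integral>\<^sup>+\<theta>. \<integral>\<^sup>+x. U \<theta> \<partial>Pn n \<theta> \<partial>prior)" by (rule q_integral[OF F])
  also have "\<dots> = (\<integral>\<^sup>+\<theta>. U \<theta> \<partial>prior)"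
    by (intro nn_integral_cong)
       (simp add: prob_space.emeasure_space_1[OF prob_space_sample_law[OF prob_P]])
  finally have "(\<integral>\<^sup>+x. ?\<phi> x \<partial>N n) \<noteq> \<infinity>" using fin by simp
  then have "AE x in N n. ?\<phi> x \<noteq> \<infinity>" by (intro nn_integral_PInf_AE \<phi>m)
  then have "AE x in P0 n. ?\<phi> x \<noteq> \<infinity>"
    unfolding P0_density by (subst AE_density) auto
  then show ?thesis using posterior_density
  proof eventually_elim
    case (elim x)
    have "m n x * (\<integral>\<^sup>+\<theta>. U \<theta> \<partial>Q n x) = ?\<phi> x" using elim(2) U by blast
    then have "m n x * (\<integral>\<^sup>+\<theta>. U \<theta> \<partial>Q n x) < top" using elim(1) by (simp add: less_top)
    then show ?case using elim(2)[THEN conjunct1] by (auto simp: ennreal_mult_less_top)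
  qed
qed

end

text \<open>
  \<open>U\<close> is a measurable majorant of the supremum in assumption (ii).
\<close>

locale bvm_loss = bvm_test \<mu> \<Theta> \<theta>\<^sub>0 P s prior \<pi> Q \<epsilon>\<^sub>0 l T c\<^sub>t d\<^sub>t A c\<^sub>a p
  for \<mu> :: "'x measure" and \<Theta> :: "(real^'d) set" and \<theta>\<^sub>0 P s prior \<pi> Q \<epsilon>\<^sub>0 l T c\<^sub>t d\<^sub>t A c\<^sub>a p +
  fixes K :: "(real^'d) set" and L L\<^sub>0 :: "real^'d \<Rightarrow> real^'d \<Rightarrow> real"
    and U :: "real^'d \<Rightarrow> ennreal" and k\<^sub>K c\<^sub>1 c\<^sub>2 c\<^sub>3 q\<^sub>0 :: real
  assumes L_loss: "loss_function \<Theta> L" and L0_loss: "loss_function UNIV L\<^sub>0"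
    and K_bound: "\<And>t. t \<in> K \<Longrightarrow> norm t \<le> k\<^sub>K" and kK: "0 \<le> k\<^sub>K"
    and c1: "c\<^sub>1 > 0" and L_le: "\<And>t \<theta>. t \<in> \<B> \<Longrightarrow> \<theta> \<in> \<B> \<Longrightarrow> L t \<theta> \<le> c\<^sub>1 * norm (t - \<theta>) powr p"
    and U_measurable [measurable]: "U \<in> borel_measurable prior" and U_finite: "(\<integral>\<^sup>+\<theta>. U \<theta> \<partial>prior) < \<infinity>"
    and U_le: "\<And>t \<theta>. t \<in> \<B> \<Longrightarrow> \<theta> \<in> \<Theta> \<Longrightarrow> ennreal (L t \<theta>) \<le> U \<theta>"
    and L_lim: "\<And>h. ((\<lambda>r. SUP t\<in>K. ennreal \<bar>r powr (- p) * L (\<theta>\<^sub>0 + r *\<^sub>R t) (\<theta>\<^sub>0 + r *\<^sub>R h) - L\<^sub>0 t h\<bar>) \<longlongrightarrow> 0) (at_right 0)"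
    and c23: "c\<^sub>2 > 0" "c\<^sub>3 > 0" "0 < q\<^sub>0" "q\<^sub>0 < 2"
    and L0_le: "\<And>t h. L\<^sub>0 t h \<le> c\<^sub>2 * exp (c\<^sub>3 * norm t powr q\<^sub>0 + c\<^sub>3 * norm h powr q\<^sub>0)"
begin

section \<open>Envelopes for the losses and the limiting Gaussian risk\<close>

lemma L_nonneg: "t \<in> \<Theta> \<Longrightarrow> \<theta> \<in> \<Theta> \<Longrightarrow> 0 \<le> L t \<theta>" and L0_nonneg [simp]: "0 \<le> L\<^sub>0 t \<theta>"
  using L_loss L0_loss by (auto simp: loss_function_def)

lemma L_measurable: "t \<in> \<Theta> \<Longrightarrow> L t \<in> borel_measurable (restrict_space borel \<Theta>)"
proof -
  assume t: "t \<in> \<Theta>"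
  have "(\<lambda>(t, \<theta>). L t \<theta>) \<in> borel_measurable (restrict_space borel \<Theta> \<Otimes>\<^sub>M restrict_space borel \<Theta>)"
    using L_loss by (simp add: loss_function_def)
  from measurable_compose[OF measurable_Pair1' this, of t] t show ?thesis by (simp add: space_restrict_space)
qed

lemma L_measurable_prior: "t \<in> \<Theta> \<Longrightarrow> L t \<in> borel_measurable prior"
  unfolding measurable_cong_sets[OF sets_prior refl] by (rule L_measurable)

lemma L0_measurable [measurable]: "L\<^sub>0 t \<in> borel_measurable borel"
proof -
  have "(\<lambda>(t, \<theta>). L\<^sub>0 t \<theta>) \<in> borel_measurable (borel \<Otimes>\<^sub>M borel)"
  proof -
    have r: "sets (restrict_space borel UNIV) = sets borel" by (simp add: sets_restrict_space)
    have "(\<lambda>(t, \<theta>). L\<^sub>0 t \<theta>) \<in> borel_measurable (restrict_space borel UNIV \<Otimes>\<^sub>M restrict_space borel UNIV)"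
      using L0_loss unfolding loss_function_def by blast
    then show ?thesis unfolding measurable_cong_sets[OF sets_pair_measure_cong[OF r r] refl] .
  qed
  from measurable_compose[OF measurable_Pair1' this, of t] show ?thesis by simp
qed

text \<open>Bounds the part of the growth condition that depends on \<open>t\<close> in
  \<open>K\<close>. The maximum with 1 lets the same envelope dominate the constant loss 1, so that
  the normalizer is covered as well.\<close>

definition D\<^sub>0 :: real where "D\<^sub>0 = max 1 (c\<^sub>2 * exp (c\<^sub>3 * k\<^sub>K powr q\<^sub>0))"

definition W :: "real \<Rightarrow> real^'d \<Rightarrow> real" where
  "W k h = D\<^sub>0 * exp (c\<^sub>3 * norm h powr q\<^sub>0 + k * norm h - (l / 2) * (norm h)\<^sup>2)"

lemma D0: "D\<^sub>0 \<ge> 1" "D\<^sub>0 > 0" by (auto simp: D\<^sub>0_def)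

lemma W_nonneg [simp]: "0 \<le> W k h" using D0 by (simp add: W_def)

lemma W_integrable: "0 \<le> k \<Longrightarrow> integrable lborel (W k)"
  unfolding W_def[abs_def] using c23 g.l(1) by (intro integrable_mult_right g.subgauss_integrable) auto

lemma L0_le_D0: "t \<in> K \<Longrightarrow> L\<^sub>0 t h \<le> D\<^sub>0 * exp (c\<^sub>3 * norm h powr q\<^sub>0)"
proof -
  assume t: "t \<in> K"
  have "norm t powr q\<^sub>0 \<le> k\<^sub>K powr q\<^sub>0" using K_bound[OF t] c23 by (intro powr_mono2) auto
  then have "exp (c\<^sub>3 * norm t powr q\<^sub>0) \<le> exp (c\<^sub>3 * k\<^sub>K powr q\<^sub>0)" using c23 by simp
  then have "c\<^sub>2 * exp (c\<^sub>3 * norm t powr q\<^sub>0) \<le> D\<^sub>0" unfolding D\<^sub>0_def using c23 by (intro max.coboundedI2) simp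
  then have "c\<^sub>2 * exp (c\<^sub>3 * norm t powr q\<^sub>0) * exp (c\<^sub>3 * norm h powr q\<^sub>0) \<le> D\<^sub>0 * exp (c\<^sub>3 * norm h powr q\<^sub>0)"
    by (rule mult_right_mono) simp
  moreover have "L\<^sub>0 t h \<le> c\<^sub>2 * exp (c\<^sub>3 * norm t powr q\<^sub>0) * exp (c\<^sub>3 * norm h powr q\<^sub>0)"
    using L0_le[of t h] by (simp add: exp_add mult.assoc)
  ultimately show ?thesis by (rule order_trans[rotated])
qed

lemma one_le_D0: "1 \<le> D\<^sub>0 * exp (c\<^sub>3 * norm (h :: real^'d) powr q\<^sub>0)"
  using mult_mono[OF D0(1), of 1 "exp (c\<^sub>3 * norm h powr q\<^sub>0)"] c23 D0 by simp

lemma weight_le: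
  assumes "g0 \<le> D\<^sub>0 * exp (c\<^sub>3 * norm h powr q\<^sub>0)" "v \<le> exp (k * norm h - (l / 2) * (norm h)\<^sup>2)" "0 \<le> v"
  shows "g0 * v \<le> W k (h :: real^'d)"
proof -
  have "g0 * v \<le> (D\<^sub>0 * exp (c\<^sub>3 * norm h powr q\<^sub>0)) * exp (k * norm h - (l / 2) * (norm h)\<^sup>2)"
    using assms D0 by (intro mult_mono) auto
  then show ?thesis by (simp add: W_def exp_add[symmetric] mult.assoc algebra_simps)
qed

text \<open>Positive definiteness bounds the exponent by
  \<open>- (l / 2) * (norm (h - y))\<^sup>2\<close>; expanding the square and dropping
  \<open>(norm y)\<^sup>2\<close> leaves a bound that is uniform over
  \<open>norm y \<le> k\<close>.\<close>

lemma G_le: "norm y \<le> k \<Longrightarrow> g.G (h - y) \<le> exp (l * k * norm h - (l / 2) * (norm h)\<^sup>2)"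
proof -
  assume y: "norm y \<le> k"
  have "h \<bullet> y \<le> norm h * norm y" by (rule norm_cauchy_schwarz)
  also have "\<dots> \<le> norm h * k" using y by (intro mult_left_mono) auto
  finally have "h \<bullet> y \<le> norm h * k" .
  moreover have "(norm (h - y))\<^sup>2 = (norm h)\<^sup>2 - 2 * (h \<bullet> y) + (norm y)\<^sup>2"
    by (simp add: power2_norm_eq_inner inner_diff_left inner_diff_right inner_commute)
  moreover have "0 \<le> (norm y)\<^sup>2" by simp
  ultimately have "(norm h)\<^sup>2 - 2 * (norm h * k) \<le> (norm (h - y))\<^sup>2" by linarith
  then have "l * ((norm h)\<^sup>2 - 2 * (norm h * k)) \<le> l * (norm (h - y))\<^sup>2" using g.l(1) by simp
  also have "\<dots> \<le> (h - y) \<bullet> (FI *v (h - y))" by (rule g.l(2))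
  finally have le: "l * ((norm h)\<^sup>2 - 2 * (norm h * k)) \<le> (h - y) \<bullet> (FI *v (h - y))" .
  have "l * ((norm h)\<^sup>2 - 2 * (norm h * k)) = 2 * ((l / 2) * (norm h)\<^sup>2 - l * k * norm h)" by (simp add: algebra_simps)
  moreover have "- e / 2 \<le> b - a" if "c \<le> e" "c = 2 * (a - b)" for a b c e :: real using that by (simp add: field_simps)
  ultimately show ?thesis unfolding g.G_def using le by (intro exp_mono) blast
qed

definition Zt :: "real^'d \<Rightarrow> real^'d \<Rightarrow> real" where
  "Zt y t = (\<integral>h. L\<^sub>0 t h \<partial>mv_normal y g.B)"

lemma Zt_eq: "Zt y t = (1 / g.c\<^sub>G) * (\<integral>h. L\<^sub>0 t h * g.G (h - y) \<partial>lborel)"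
  unfolding Zt_def by (subst g.normal_integral(1)) (simp_all add: mult.commute)

lemma L0_G_le: "t \<in> K \<Longrightarrow> norm y \<le> k \<Longrightarrow> L\<^sub>0 t h * g.G (h - y) \<le> W (l * k) h"
  by (rule weight_le[OF L0_le_D0 G_le]) auto

lemma L0_G_integrable:
  assumes t: "t \<in> K" shows "integrable lborel (\<lambda>h. L\<^sub>0 t h * g.G (h - y))"
proof (rule Bochner_Integration.integrable_bound[OF W_integrable[of "l * norm y"]])
  show "AE h in lborel. norm (L\<^sub>0 t h * g.G (h - y)) \<le> norm (W (l * norm y) h)"
    using L0_G_le[OF t order_refl] by (intro AE_I2) (simp add: abs_mult)
qed (use g.l(1) in auto)

lemma Zt_bounds:
  assumes t: "t \<in> K" and y: "norm y \<le> k"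
  shows "0 \<le> Zt y t" "Zt y t \<le> (1 / g.c\<^sub>G) * (\<integral>h. W (l * k) h \<partial>lborel)"
proof -
  have "0 \<le> k" using y norm_ge_zero order_trans by blast
  then have k: "0 \<le> l * k" using g.l(1) by simp
  show "0 \<le> Zt y t" unfolding Zt_eq using g.c_pos by (intro mult_nonneg_nonneg integral_nonneg_AE) auto
  show "Zt y t \<le> (1 / g.c\<^sub>G) * (\<integral>h. W (l * k) h \<partial>lborel)"
    unfolding Zt_eq using g.c_pos L0_G_le[OF t y]
    by (intro mult_left_mono integral_mono L0_G_integrable[OF t] W_integrable[OF k]) auto
qed

definition mass :: "nat \<Rightarrow> (nat \<Rightarrow> 'x) \<Rightarrow> real" where
  "mass n x = exp ((Del n x \<bullet> (g.B *v Del n x)) / 2) * g.c\<^sub>G"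

text \<open>A lower bound free of the sample for the Gaussian normalizer: this keeps the quotient of
  numerator and normalizer stable under small errors in both.\<close>

lemma mass_ge: "g.c\<^sub>G \<le> mass n x"
  unfolding mass_def using lik_square(2)[of n x] g.c_pos by simp

lemma lik_integral: "(\<integral>\<^sup>+h. ennreal (1 * lik n h x) \<partial>lborel) = ennreal (mass n x)"
proof -
  have "integrable lborel (\<lambda>h. exp ((Del n x \<bullet> (g.B *v Del n x)) / 2) * g.G (h - g.B *v Del n x))"
    using g.G_integrable g.translate_integral(2)[OF g.G_measurable] by (intro integrable_mult_right) simp
  from nn_integral_eq_integral[OF this] show ?thesis
    using g.translate_integral(1)[OF g.G_measurable] g.G_integral by (simp add: lik_square(1) mass_def)
qed

lemma L0_lik_integral:
  assumes t: "t \<in> K"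
  shows "(\<integral>\<^sup>+h. ennreal (L\<^sub>0 t h * lik n h x) \<partial>lborel) = ennreal (mass n x * Zt (g.B *v Del n x) t)"
proof -
  let ?e = "exp ((Del n x \<bullet> (g.B *v Del n x)) / 2)"
  have eq: "L\<^sub>0 t h * lik n h x = ?e * (L\<^sub>0 t h * g.G (h - g.B *v Del n x))" for h
    by (simp add: lik_square(1))
  show ?thesis unfolding eq using g.c_pos
    by (subst nn_integral_eq_integral) (auto intro!: integrable_mult_right L0_G_integrable[OF t] simp: Zt_eq mass_def)
qed

lemma scaled_loss_le:
  assumes n: "0 < n" and ball: "loc n t \<in> \<B>" "loc n h \<in> \<B>"
  shows "real n powr (p / 2) * L (loc n t) (loc n h) \<le> c\<^sub>1 * norm (t - h) powr p"
proof -
  have "loc n t - loc n h = (1 / sqrt n) *\<^sub>R (t - h)" by (simp add: loc_def scaleR_diff_right)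
  then have "norm (loc n t - loc n h) = norm (t - h) / sqrt n" by simp
  moreover have "sqrt (real n) powr p = real n powr (p / 2)" by (simp add: powr_half_sqrt[symmetric] powr_powr)
  ultimately have eq: "real n powr (p / 2) * (c\<^sub>1 * norm (loc n t - loc n h) powr p) = c\<^sub>1 * norm (t - h) powr p"
    using n by (simp add: powr_divide)
  show ?thesis by (rule order_trans[OF mult_left_mono[OF L_le[OF ball]] eq_refl[OF eq]]) simp
qed

text \<open>
  The supremum over \<open>t \<in> K\<close> need not be measurable in \<open>h\<close>, so dominated convergence is applied along
  sequences of points that violate the bound.
\<close>

lemma loss_limit:
  assumes C: "C \<ge> 0" and e: "e > 0"
  shows "\<forall>\<^sub>F n in sequentially. \<forall>t\<in>K. (\<integral>\<^sup>+h. indicator (cball 0 C) h *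
    ennreal \<bar>real n powr (p / 2) * L (loc n t) (loc n h) - L\<^sub>0 t h\<bar> \<partial>lborel) \<le> ennreal e"
proof -
  define F where "F n t h = indicator (cball 0 C) h * \<bar>real n powr (p / 2) * L (loc n t) (loc n h) - L\<^sub>0 t h\<bar>" for n :: nat and t h
  have F: "ennreal (F n t h) = indicator (cball 0 C) h * ennreal \<bar>real n powr (p / 2) * L (loc n t) (loc n h) - L\<^sub>0 t h\<bar>" for n t h
    by (auto simp: F_def split: split_indicator)
  have "\<forall>\<^sub>F n in sequentially. max C k\<^sub>K < \<epsilon>\<^sub>0 * sqrt n" by (rule eventually_radius)
  then have "\<forall>\<^sub>F n in sequentially. max C k\<^sub>K < \<epsilon>\<^sub>0 * sqrt n \<and> 0 < n"
    using eventually_gt_at_top[of 0] by eventually_elim auto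
  then obtain n0 where n0: "\<And>n. n \<ge> n0 \<Longrightarrow> max C k\<^sub>K < \<epsilon>\<^sub>0 * sqrt (real n) \<and> 0 < n"
    unfolding eventually_sequentially by blast
  have ballI: "loc n h \<in> \<B>" if "n \<ge> n0" "norm h \<le> max C k\<^sub>K" for n h
    using loc_in_ball[of n h] n0[OF that(1)] that(2) by auto
  have lim: "(\<lambda>n. \<integral>\<^sup>+h. ennreal (F n (t n) h) \<partial>lborel) \<longlonglongrightarrow> 0" if t: "\<And>n. t n \<in> K" for t
  proof -
    \<comment> \<open>The first summand bounds the rescaled loss by assumption (i), whose power
      \<open>p\<close> matches the rescaling; the second bounds the limiting loss on the
      ball.\<close>
    let ?w = "c\<^sub>1 * (k\<^sub>K + C) powr p + D\<^sub>0 * exp (c\<^sub>3 * C powr q\<^sub>0)"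
    have m: "F n (t n) \<in> borel_measurable lborel" if n: "n \<ge> n0" for n
    proof -
      have tb: "loc n (t n) \<in> \<Theta>" using ballI[OF n, of "t n"] K_bound[OF t, of n] ball_\<Theta> by auto
      \<comment> \<open>The loss is measurable only on the trace of \<open>\<Theta>\<close>. It is
        cut off to \<open>\<B>\<close> to become Borel in \<open>h\<close>, which does not affect
        \<open>F\<close> because the ball of radius \<open>C\<close> is mapped into
        \<open>\<B>\<close>.\<close>
      have "(\<lambda>\<theta>. ennreal (L (loc n (t n)) \<theta>)) \<in> borel_measurable prior"
        using L_measurable_prior[OF tb] by measurable
      from measurable_compose[OF loc_measurable[of n] measurable_on_ball[OF this]]
      have "(\<lambda>h. enn2real (ennreal (L (loc n (t n)) (loc n h)) * indicator \<B> (loc n h))) \<in> borel_measurable borel"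
        by measurable
      then have "(\<lambda>h. indicator (cball 0 C) h * \<bar>real n powr (p / 2) * enn2real (ennreal (L (loc n (t n)) (loc n h)) * indicator \<B> (loc n h)) - L\<^sub>0 (t n) h\<bar>) \<in> borel_measurable borel"
        by (intro borel_measurable_times borel_measurable_abs borel_measurable_diff borel_measurable_const borel_measurable_indicator) auto
      also have "(\<lambda>h. indicator (cball 0 C) h * \<bar>real n powr (p / 2) * enn2real (ennreal (L (loc n (t n)) (loc n h)) * indicator \<B> (loc n h)) - L\<^sub>0 (t n) h\<bar>) = F n (t n)"
      proof
        fix h
        have "enn2real (ennreal (L (loc n (t n)) (loc n h)) * indicator \<B> (loc n h)) = L (loc n (t n)) (loc n h)" if "norm h \<le> C"
        proof -
          have hb: "loc n h \<in> \<B>" using that by (intro ballI[OF n]) simp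
          then have "0 \<le> L (loc n (t n)) (loc n h)" using ball_\<Theta> by (intro L_nonneg[OF tb]) blast
          with hb show ?thesis by simp
        qed
        then show "indicator (cball 0 C) h * \<bar>real n powr (p / 2) * enn2real (ennreal (L (loc n (t n)) (loc n h)) * indicator \<B> (loc n h)) - L\<^sub>0 (t n) h\<bar> = F n (t n) h"
          by (auto simp: F_def split: split_indicator)
      qed
      finally show ?thesis by simp
    qed
    have bound: "norm (F n (t n) h) \<le> ?w * indicator (cball 0 C) h" if n: "n \<ge> n0" for n h
    proof (cases "norm h \<le> C")
      case True
      note tb = ballI[OF n, of "t n"] and hb = ballI[OF n, of h]
      have tK: "norm (t n) \<le> k\<^sub>K" by (rule K_bound[OF t])
      have "real n powr (p / 2) * L (loc n (t n)) (loc n h) \<le> c\<^sub>1 * norm (t n - h) powr p"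
        using tb hb tK True n0[OF n] by (intro scaled_loss_le) auto
      also have "\<dots> \<le> c\<^sub>1 * (k\<^sub>K + C) powr p"
        using norm_triangle_ineq4[of "t n" h] tK True c1 p_pos by (intro mult_left_mono powr_mono2) auto
      finally have 1: "real n powr (p / 2) * L (loc n (t n)) (loc n h) \<le> c\<^sub>1 * (k\<^sub>K + C) powr p" .
      have 2: "0 \<le> real n powr (p / 2) * L (loc n (t n)) (loc n h)"
        using tb hb tK True ball_\<Theta> by (intro mult_nonneg_nonneg L_nonneg) auto
      have "norm h powr q\<^sub>0 \<le> C powr q\<^sub>0" using True c23 by (intro powr_mono2) auto
      then have "D\<^sub>0 * exp (c\<^sub>3 * norm h powr q\<^sub>0) \<le> D\<^sub>0 * exp (c\<^sub>3 * C powr q\<^sub>0)" using D0 c23 by simp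
      then have 3: "L\<^sub>0 (t n) h \<le> D\<^sub>0 * exp (c\<^sub>3 * C powr q\<^sub>0)" using L0_le_D0[OF t, of n h] by linarith
      have "\<bar>real n powr (p / 2) * L (loc n (t n)) (loc n h) - L\<^sub>0 (t n) h\<bar> \<le> ?w"
        using 1 2 3 L0_nonneg[of "t n" h] by linarith
      then show ?thesis using True by (simp add: F_def)
    qed (simp add: F_def)
    have pt: "(\<lambda>n. F n (t n) h) \<longlonglongrightarrow> 0" for h
    proof -
      let ?S = "\<lambda>r. SUP t\<in>K. ennreal \<bar>r powr (- p) * L (\<theta>\<^sub>0 + r *\<^sub>R t) (\<theta>\<^sub>0 + r *\<^sub>R h) - L\<^sub>0 t h\<bar>"
      \<comment> \<open>Assumption (iii) along \<open>r = 1 / sqrt n\<close>, for which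
        \<open>r powr (- p)\<close> is \<open>real n powr (p / 2)\<close>. Its supremum over
        \<open>K\<close> allows the point \<open>t n\<close> to vary with \<open>n\<close>.\<close>
      have "filterlim (\<lambda>n. 1 / sqrt (real n)) (at_right 0) sequentially" by real_asymp
      from filterlim_compose[OF L_lim this] have lim0: "(\<lambda>n. ?S (1 / sqrt (real n))) \<longlonglongrightarrow> 0" .
      have "\<forall>\<^sub>F n in sequentially. ennreal (F n (t n) h) \<le> ?S (1 / sqrt (real n))"
        using eventually_gt_at_top[of 0]
      proof eventually_elim
        case (elim n)
        have "(1 / sqrt (real n)) powr (- p) = real n powr (p / 2)"
          using elim by (simp add: powr_minus powr_half_sqrt[symmetric] powr_powr powr_divide field_simps)
        then have "ennreal \<bar>real n powr (p / 2) * L (loc n (t n)) (loc n h) - L\<^sub>0 (t n) h\<bar> \<le> ?S (1 / sqrt (real n))"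
          by (intro SUP_upper2[OF t[of n]]) (simp add: loc_def)
        moreover have "ennreal (F n (t n) h) \<le> ennreal \<bar>real n powr (p / 2) * L (loc n (t n)) (loc n h) - L\<^sub>0 (t n) h\<bar>"
          by (intro ennreal_leI) (auto simp: F_def split: split_indicator)
        ultimately show ?case by (rule order_trans[rotated])
      qed
      then have "(\<lambda>n. ennreal (F n (t n) h)) \<longlonglongrightarrow> 0"
        by (intro tendsto_sandwich[OF _ _ tendsto_const lim0]) auto
      then have "(\<lambda>n. enn2real (ennreal (F n (t n) h))) \<longlonglongrightarrow> 0"
        using tendsto_enn2real[of "\<lambda>n. ennreal (F n (t n) h)" 0 sequentially] by simp
      moreover have "enn2real (ennreal (F n (t n) h)) = F n (t n) h" for n by (simp add: F_def)
      ultimately show ?thesis by simp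
    qed
    have "(\<lambda>n. \<integral>\<^sup>+h. norm (0 - F (n + n0) (t (n + n0)) h) \<partial>(lborel :: (real^'d) measure)) \<longlonglongrightarrow> 0"
    proof (rule nn_integral_dominated_convergence_norm[where w = "\<lambda>h. ?w * indicator (cball 0 C) h"])
      show "AE h in lborel. norm (F (n + n0) (t (n + n0)) h) \<le> ?w * indicator (cball 0 C) h" for n
        using bound[of "n + n0"] by (intro AE_I2) auto
      show "AE h in lborel. (\<lambda>n. F (n + n0) (t (n + n0)) h) \<longlonglongrightarrow> 0"
        by (intro AE_I2 LIMSEQ_ignore_initial_segment pt)
      have "(\<integral>\<^sup>+h. ennreal (?w * indicator (cball 0 C) h) \<partial>(lborel :: (real^'d) measure)) = (\<integral>\<^sup>+h. ennreal ?w * indicator (cball 0 C) h \<partial>(lborel :: (real^'d) measure))"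
        by (intro nn_integral_cong) (auto split: split_indicator)
      also have "\<dots> = ennreal ?w * emeasure lborel (cball (0::real^'d) C)"
        by (rule nn_integral_cmult_indicator) simp
      also have "\<dots> < \<infinity>" using emeasure_bounded_finite[of "cball (0::real^'d) C"] by (simp add: ennreal_mult_less_top)
      finally show "(\<integral>\<^sup>+h. ennreal (?w * indicator (cball 0 C) h) \<partial>(lborel :: (real^'d) measure)) < \<infinity>" .
      show "(\<lambda>h. F (n + n0) (t (n + n0)) h) \<in> borel_measurable lborel" for n by (rule m) simp
      show "(\<lambda>h. ?w * indicator (cball 0 C) h) \<in> borel_measurable (lborel :: (real^'d) measure)"
        by (intro borel_measurable_times borel_measurable_indicator) auto
    qed simp
    moreover have "norm (0 - F n (t n) h) = F n (t n) h" for n h by (simp add: F_def abs_mult)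
    ultimately have "(\<lambda>n. \<integral>\<^sup>+h. ennreal (F (n + n0) (t (n + n0)) h) \<partial>lborel) \<longlonglongrightarrow> 0"
      by simp
    then show ?thesis by (rule LIMSEQ_offset)
  qed
  show ?thesis
  proof (cases "K = {}")
    case False
    then obtain t0 where t0: "t0 \<in> K" by auto
    define bad where "bad n t \<longleftrightarrow> t \<in> K \<and> \<not> (\<integral>\<^sup>+h. ennreal (F n t h) \<partial>lborel) \<le> ennreal e" for n t
    define t where "t n = (if Ex (bad n) then SOME t. bad n t else t0)" for n
    have bt: "bad n (t n)" if "Ex (bad n)" for n using that someI_ex[OF that] by (simp add: t_def)
    have tK: "t n \<in> K" for n
      using bt[of n] t0 by (cases "Ex (bad n)") (auto simp: bad_def t_def)
    have "\<forall>\<^sub>F n in sequentially. (\<integral>\<^sup>+h. ennreal (F n (t n) h) \<partial>lborel) < ennreal e"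
      using e by (intro order_tendstoD(2)[OF lim[OF tK]]) simp
    then show ?thesis unfolding F[symmetric]
    proof eventually_elim
      case (elim n)
      then have "\<not> bad n (t n)" by (auto simp: bad_def)
      then have "\<not> Ex (bad n)" using bt by blast
      then show ?case by (auto simp: bad_def)
    qed
  qed simp
qed

section \<open>The posterior risk process and its Gaussian approximation\<close>

definition Zn :: "nat \<Rightarrow> (nat \<Rightarrow> 'x) \<Rightarrow> real^'d \<Rightarrow> real" where
  "Zn n x t = (\<integral>h. real n powr (p / 2) * L ((1 / sqrt n) *\<^sub>R t + \<theta>\<^sub>0) ((1 / sqrt n) *\<^sub>R h + \<theta>\<^sub>0) \<partial>local_law n \<Theta> \<theta>\<^sub>0 (Q n x))"

lemma Zn_eq:
  assumes n: "0 < n" and Q: "sets (Q n x) = sets prior" and t: "loc n t \<in> \<Theta>"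
  shows "Zn n x t = enn2real (\<integral>\<^sup>+\<theta>. ennreal (real n powr (p / 2) * L (loc n t) \<theta>) \<partial>Q n x)"
proof -
  let ?f = "\<lambda>\<theta>. sqrt n *\<^sub>R (\<theta> - \<theta>\<^sub>0)" and ?R = "restrict_space borel (local_set n \<Theta> \<theta>\<^sub>0)"
  have sp: "space (Q n x) = \<Theta>" using sets_eq_imp_space_eq[OF Q] by simp
  have idm: "(\<lambda>\<theta>. \<theta>) \<in> Q n x \<rightarrow>\<^sub>M borel"
    unfolding measurable_cong_sets[OF Q[unfolded sets_prior] refl] by (rule measurable_restrict_space1) simp
  have "(\<lambda>\<theta>. ?f \<theta>) \<in> borel_measurable borel" by measurable
  from measurable_compose[OF idm this] have f: "?f \<in> Q n x \<rightarrow>\<^sub>M ?R"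
    by (intro measurable_restrict_space2) (auto simp: sp local_set_def)
  have loc_f: "loc n (?f \<theta>) = \<theta>" for \<theta> using n by (simp add: loc_def)
  have "loc n \<in> ?R \<rightarrow>\<^sub>M restrict_space borel \<Theta>"
    by (intro measurable_restrict_space2 measurable_restrict_space1 loc_measurable)
       (auto simp: space_restrict_space local_set_def loc_f)
  from measurable_compose[OF this L_measurable[OF t]]
  have g: "(\<lambda>h. real n powr (p / 2) * L (loc n t) (loc n h)) \<in> borel_measurable ?R" by simp
  have "Zn n x t = (\<integral>h. real n powr (p / 2) * L (loc n t) (loc n h) \<partial>distr (Q n x) ?R ?f)"
    by (simp add: Zn_def local_law_def loc_def add.commute)
  also have "\<dots> = (\<integral>\<theta>. real n powr (p / 2) * L (loc n t) \<theta> \<partial>Q n x)"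
    by (subst integral_distr[OF f g]) (simp only: loc_f)
  also have "\<dots> = enn2real (\<integral>\<^sup>+\<theta>. ennreal (real n powr (p / 2) * L (loc n t) \<theta>) \<partial>Q n x)"
  proof (rule integral_eq_nn_integral)
    show "(\<lambda>\<theta>. real n powr (p / 2) * L (loc n t) \<theta>) \<in> borel_measurable (Q n x)"
      unfolding measurable_cong_sets[OF Q refl] using L_measurable_prior[OF t] by simp
    show "AE \<theta> in Q n x. 0 \<le> real n powr (p / 2) * L (loc n t) \<theta>"
      using L_nonneg[OF t] sp by (intro AE_I2) auto
  qed
  finally show ?thesis .
qed

lemma eventually_loc_in_ball: "\<forall>\<^sub>F n in sequentially. 0 < n \<and> (\<forall>t\<in>K. loc n t \<in> \<B>)"
proof -
  have "\<forall>\<^sub>F n in sequentially. k\<^sub>K < \<epsilon>\<^sub>0 * sqrt (real n)" by (rule eventually_radius)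
  then show ?thesis using eventually_gt_at_top[of 0]
  proof eventually_elim
    case (elim n)
    then show ?case using loc_in_ball[of n] le_less_trans[OF K_bound elim(1)] by auto
  qed
qed

text \<open>The majorant \<open>U\<close> dominates the loss for all \<open>t\<close> in
  \<open>K\<close> simultaneously once \<open>loc n\<close> maps \<open>K\<close> into
  \<open>\<B>\<close>, so boundedness in \<open>t\<close> reduces to finiteness of one posterior
  expectation.\<close>

lemma Zn_in_linfty: "\<forall>\<^sub>F n in sequentially. AE x in P0 n. restrict (Zn n x) K \<in> linfty K"
  using eventually_loc_in_ball
proof eventually_elim
  case (elim n)
  have "AE x in P0 n. sets (Q n x) = sets prior" using posterior_density by eventually_elim blast
  then show ?case using posterior_finite[OF U_measurable U_finite]
  proof eventually_elim
    case (elim x)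
    let ?I = "\<integral>\<^sup>+\<theta>. U \<theta> \<partial>Q n x"
    have sp: "space (Q n x) = \<Theta>" using sets_eq_imp_space_eq[OF elim(1)] by simp
    have Um: "U \<in> borel_measurable (Q n x)" unfolding measurable_cong_sets[OF elim(1) refl] by (rule U_measurable)
    have "\<bar>Zn n x t\<bar> \<le> real n powr (p / 2) * enn2real ?I" if t: "t \<in> K" for t
    proof -
      have tb: "loc n t \<in> \<B>" using t \<open>0 < n \<and> (\<forall>t\<in>K. loc n t \<in> \<B>)\<close> by blast
      then have tT: "loc n t \<in> \<Theta>" using ball_\<Theta> by blast
      have n: "0 < n" using \<open>0 < n \<and> (\<forall>t\<in>K. loc n t \<in> \<B>)\<close> by blast
      have "(\<integral>\<^sup>+\<theta>. ennreal (real n powr (p / 2) * L (loc n t) \<theta>) \<partial>Q n x) \<le> (\<integral>\<^sup>+\<theta>. ennreal (real n powr (p / 2)) * U \<theta> \<partial>Q n x)"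
        using U_le[OF tb] L_nonneg[OF tT] by (intro nn_integral_mono) (auto simp: sp ennreal_mult intro!: mult_left_mono)
      also have "\<dots> = ennreal (real n powr (p / 2)) * ?I" by (rule nn_integral_cmult[OF Um])
      finally have "enn2real (\<integral>\<^sup>+\<theta>. ennreal (real n powr (p / 2) * L (loc n t) \<theta>) \<partial>Q n x) \<le> enn2real (ennreal (real n powr (p / 2)) * ?I)"
        using elim(2) by (intro enn2real_mono) (auto simp: ennreal_mult_less_top)
      then show ?thesis unfolding Zn_eq[OF n elim(1) tT] by (simp add: enn2real_mult)
    qed
    then show ?case by (auto simp: linfty_def bounded_iff)
  qed
qed

lemma ball_section_measurable:
  assumes g: "g \<in> borel_measurable prior" and g0: "\<And>\<theta>. \<theta> \<in> \<Theta> \<Longrightarrow> 0 \<le> g \<theta>"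
  shows "(\<lambda>h. if loc n h \<in> \<B> then g (loc n h) else (0::real)) \<in> borel_measurable borel"
proof -
  have "(\<lambda>\<theta>. ennreal (g \<theta>)) \<in> borel_measurable prior" using g by measurable
  from measurable_compose[OF loc_measurable[of n] measurable_on_ball[OF this]]
  have "(\<lambda>h. enn2real (ennreal (g (loc n h)) * indicator \<B> (loc n h))) \<in> borel_measurable borel"
    by measurable
  also have "(\<lambda>h. enn2real (ennreal (g (loc n h)) * indicator \<B> (loc n h))) = (\<lambda>h. if loc n h \<in> \<B> then g (loc n h) else 0)"
  proof
    fix h
    show "enn2real (ennreal (g (loc n h)) * indicator \<B> (loc n h)) = (if loc n h \<in> \<B> then g (loc n h) else 0)"
    proof (cases "loc n h \<in> \<B>")
      case True
      then have "0 \<le> g (loc n h)" using ball_\<Theta> by (intro g0) blast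
      with True show ?thesis by simp
    qed simp
  qed
  finally show ?thesis .
qed

lemma far_le:
  assumes x: "x \<in> space (N n)" and V: "U' \<in> borel_measurable prior"
    and F: "\<And>\<theta>. \<theta> \<in> \<Theta> \<Longrightarrow> F \<theta> \<le> ennreal (real n powr (p / 2)) * U' \<theta>"
  shows "ennreal (sqrt n ^ CARD('d) / \<pi> \<theta>\<^sub>0) * (\<integral>\<^sup>+\<theta>. F \<theta> * ennreal (q n \<theta> x / p0 n x) * indicator (- \<B>) \<theta> \<partial>prior) \<le> Far n U' x"
proof -
  let ?r = "\<lambda>\<theta>. U' \<theta> * ennreal (q n \<theta> x / p0 n x) * indicator (- \<B>) \<theta>"
  have idm: "(\<lambda>\<theta>. \<theta>) \<in> prior \<rightarrow>\<^sub>M borel"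
    unfolding measurable_cong_sets[OF sets_prior refl] by (rule measurable_restrict_space1) simp
  have im: "(indicator (- \<B>) :: _ \<Rightarrow> ennreal) \<in> borel_measurable prior"
    by (rule measurable_compose[OF idm borel_measurable_indicator]) simp
  have "(\<lambda>\<theta>. ennreal (q n \<theta> x) * ennreal (1 / p0 n x)) \<in> borel_measurable prior"
    using q_section_measurable[OF x] by (intro borel_measurable_times_ennreal) auto
  also have "(\<lambda>\<theta>. ennreal (q n \<theta> x) * ennreal (1 / p0 n x)) = (\<lambda>\<theta>. ennreal (q n \<theta> x / p0 n x))"
    by (simp add: ennreal_mult[symmetric])
  finally have rm: "?r \<in> borel_measurable prior"
    by (intro borel_measurable_times_ennreal V im)
  have "(\<integral>\<^sup>+\<theta>. F \<theta> * ennreal (q n \<theta> x / p0 n x) * indicator (- \<B>) \<theta> \<partial>prior) \<le> (\<integral>\<^sup>+\<theta>. ennreal (real n powr (p / 2)) * ?r \<theta> \<partial>prior)"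
    using F by (intro nn_integral_mono) (auto simp: mult.assoc[symmetric] intro!: mult_right_mono)
  also have "\<dots> = ennreal (real n powr (p / 2)) * (\<integral>\<^sup>+\<theta>. ?r \<theta> \<partial>prior)" by (rule nn_integral_cmult[OF rm])
  finally show ?thesis unfolding Far_def
    by (subst mult.left_commute) (rule mult_left_mono, auto)
qed

text \<open>The added 1 makes the polynomial envelope dominate the constant loss 1 besides the
  rescaled loss.\<close>

definition D\<^sub>1 :: real where "D\<^sub>1 = c\<^sub>1 * (1 + k\<^sub>K) powr p + 1"

lemma D1: "D\<^sub>1 \<ge> 1" "D\<^sub>1 > 0"
proof -
  have "0 \<le> c\<^sub>1 * (1 + k\<^sub>K) powr p" using c1 by simp
  then show "D\<^sub>1 \<ge> 1" "D\<^sub>1 > 0" by (simp_all add: D\<^sub>1_def)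
qed

lemma one_le_D1: "1 \<le> D\<^sub>1 * (1 + norm (h :: real^'d)) powr p"
proof -
  have "1 \<le> (1 + norm h) powr p" using p_pos by (intro ge_one_powr_ge_zero) auto
  from mult_mono[OF D1(1) this] D1 show ?thesis by simp
qed

lemma loss_le_D1:
  assumes "t \<in> K" shows "c\<^sub>1 * norm (t - h) powr p \<le> D\<^sub>1 * (1 + norm h) powr p"
proof -
  have "0 \<le> k\<^sub>K * norm h" using kK by simp
  then have "norm (t - h) \<le> (1 + k\<^sub>K) * (1 + norm h)"
    using norm_triangle_ineq4[of t h] K_bound[OF assms] by (simp add: algebra_simps)
  then have "norm (t - h) powr p \<le> ((1 + k\<^sub>K) * (1 + norm h)) powr p" using p_pos by (intro powr_mono2) auto
  also have "\<dots> = (1 + k\<^sub>K) powr p * (1 + norm h) powr p" using kK by (simp add: powr_mult)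
  finally have "c\<^sub>1 * norm (t - h) powr p \<le> c\<^sub>1 * ((1 + k\<^sub>K) powr p * (1 + norm h) powr p)" using c1 by simp
  also have "\<dots> \<le> D\<^sub>1 * (1 + norm h) powr p" by (simp add: D\<^sub>1_def distrib_right)
  finally show ?thesis .
qed

text \<open>The deterministic core: for one sample and one \<open>t\<close>, the representation of
  the posterior turns the risk into a quotient whose numerator and normalizer \<open>a\<close> are
  both within the same error \<open>\<eta>\<close> of their Gaussian counterparts. Using
  \<open>U \<theta> + 1\<close> in \<open>Far\<close> covers the loss and the constant 1 by a single
  error term.\<close>

lemma good_event:
  assumes n: "0 < n" and x: "x \<in> space (N n)" "0 < p0 n x" and Q: "sets (Q n x) = sets prior" "prob_space (Q n x)"
    and a: "0 < a" "a < \<infinity>" "\<And>F. F \<in> borel_measurable prior \<Longrightarrow> a * (\<integral>\<^sup>+\<theta>. F \<theta> \<partial>Q n x) =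
      (\<integral>\<^sup>+h. F (loc n h) * ennreal (u n h x / p0 n x) \<partial>lborel)
      + ennreal (sqrt n ^ CARD('d) / \<pi> \<theta>\<^sub>0) * (\<integral>\<^sup>+\<theta>. F \<theta> * ennreal (q n \<theta> x / p0 n x) * indicator (- \<B>) \<theta> \<partial>prior)"
    and C: "0 \<le> C" "C < \<epsilon>\<^sub>0 * sqrt n" and k: "norm (Del n x) \<le> k" and t: "t \<in> K" "loc n t \<in> \<B>"
    and \<kappa>: "(\<integral>\<^sup>+h. indicator (cball 0 C) h * ennreal \<bar>real n powr (p / 2) * L (loc n t) (loc n h) - L\<^sub>0 t h\<bar> \<partial>lborel) \<le> \<kappa>"
    and \<tau>: "(\<integral>\<^sup>+h. indicator (- cball 0 C) h * ennreal (W k h) \<partial>lborel) \<le> \<tau>"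
    and small: "ennreal D\<^sub>1 * Mid n C x + ennreal (D\<^sub>1 * (1 + C) powr p) * Dev n C x + (ennreal (exp (k * C)) * \<kappa> + \<tau>)
      + Far n (\<lambda>\<theta>. U \<theta> + 1) x \<le> ennreal \<eta>" (is "?E + ?F \<le> _")
    and \<eta>: "0 \<le> \<eta>" "\<eta> \<le> g.c\<^sub>G / 2" and M: "Zt (g.B *v Del n x) t \<le> M"
  shows "\<bar>Zn n x t - Zt (g.B *v Del n x) t\<bar> \<le> 2 * \<eta> * (1 + M) / g.c\<^sub>G"
proof -
  let ?b = "\<lambda>\<theta>. real n powr (p / 2) * L (loc n t) \<theta>"
  let ?y = "Zt (g.B *v Del n x) t"
  have tT: "loc n t \<in> \<Theta>" using t ball_\<Theta> by blast
  have bm: "?b \<in> borel_measurable prior" using L_measurable_prior[OF tT] by simp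
  have b0: "0 \<le> ?b \<theta>" if "\<theta> \<in> \<Theta>" for \<theta> using L_nonneg[OF tT that] by simp
  have n1: "1 \<le> real n powr (p / 2)" using n p_pos by (intro ge_one_powr_ge_zero) auto
  have y0: "0 \<le> ?y" by (rule Zt_bounds(1)[OF t(1) order_refl])
  have V: "(\<lambda>\<theta>. U \<theta> + 1) \<in> borel_measurable prior" by measurable
  have tail: "(\<integral>\<^sup>+h. indicator (- cball 0 C) h * ennreal (g0 h * lik n h x) \<partial>lborel) \<le> \<tau>"
    if "\<And>h. g0 h \<le> D\<^sub>0 * exp (c\<^sub>3 * norm h powr q\<^sub>0)" for g0
  proof (rule order_trans[OF nn_integral_mono \<tau>])
    fix h
    have "g0 h * lik n h x \<le> W k h" by (rule weight_le[OF that lik_le[OF k]]) simp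
    then show "indicator (- cball 0 C) h * ennreal (g0 h * lik n h x) \<le> indicator (- cball 0 C) h * ennreal (W k h)"
      by (intro mult_left_mono ennreal_leI) auto
  qed
  have combine: "X + f \<le> Y + ennreal \<eta>" "Y \<le> (X + f) + ennreal \<eta>"
    if "X \<le> Y + ?E" "Y \<le> X + ?E" "f \<le> ?F" for X Y f :: ennreal
  proof -
    have "X + f \<le> (Y + ?E) + ?F" by (intro add_mono that)
    also have "\<dots> \<le> Y + ennreal \<eta>" unfolding add.assoc[of Y] by (intro add_left_mono small)
    finally show "X + f \<le> Y + ennreal \<eta>" .
    have "Y \<le> X + ?E" by (rule that)
    also have "\<dots> \<le> (X + f) + (?E + ?F)"
    proof -
      have le: "c \<le> c + d" for c d :: ennreal by simp
      show ?thesis by (rule add_mono[OF le le])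
    qed
    also have "\<dots> \<le> (X + f) + ennreal \<eta>" by (intro add_left_mono small)
    finally show "Y \<le> (X + f) + ennreal \<eta>" .
  qed
  let ?I = "\<integral>\<^sup>+\<theta>. ennreal (?b \<theta>) \<partial>Q n x"
  have "a * ?I \<le> ennreal (mass n x * ?y) + ennreal \<eta>" "ennreal (mass n x * ?y) \<le> a * ?I + ennreal \<eta>"
  proof -
    have bm': "(\<lambda>\<theta>. ennreal (?b \<theta>)) \<in> borel_measurable prior" using bm by measurable
    have far: "ennreal (sqrt n ^ CARD('d) / \<pi> \<theta>\<^sub>0) * (\<integral>\<^sup>+\<theta>. ennreal (?b \<theta>) * ennreal (q n \<theta> x / p0 n x) * indicator (- \<B>) \<theta> \<partial>prior) \<le> ?F"
    proof (rule far_le[OF x(1) V])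
      fix \<theta> assume \<theta>: "\<theta> \<in> \<Theta>"
      have "ennreal (L (loc n t) \<theta>) \<le> U \<theta> + 1" using U_le[OF t(2) \<theta>] by (simp add: add_increasing2)
      then show "ennreal (?b \<theta>) \<le> ennreal (real n powr (p / 2)) * (U \<theta> + 1)"
        using L_nonneg[OF tT \<theta>] by (simp add: ennreal_mult mult_left_mono)
    qed
    have le: "?b (loc n h) \<le> D\<^sub>1 * (1 + norm h) powr p" if "loc n h \<in> \<B>" for h
      by (rule order_trans[OF scaled_loss_le[OF n t(2) that] loss_le_D1[OF t(1)]])
    have nn: "0 \<le> ?b (loc n h)" if "loc n h \<in> \<B>" for h
      using that ball_\<Theta> by (intro b0) blast
    note R = risk_approx[OF x n ball_section_measurable[OF bm b0] L0_measurable nn L0_nonneg le less_imp_le[OF D1(2)] C k \<kappa> tail[OF L0_le_D0[OF t(1)]],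
        unfolded L0_lik_integral[OF t(1)]]
    show "a * ?I \<le> ennreal (mass n x * ?y) + ennreal \<eta>" "ennreal (mass n x * ?y) \<le> a * ?I + ennreal \<eta>"
      using combine[OF R far] by (simp_all only: a(3)[OF bm'])
  qed
  from ennreal_near[OF this] have I1: "\<bar>enn2real (a * ?I) - mass n x * ?y\<bar> \<le> \<eta>"
    using mass_ge[of n x] g.c_pos y0 \<eta> by (simp add: mult_nonneg_nonneg)
  have "a \<le> ennreal (mass n x) + ennreal \<eta>" "ennreal (mass n x) \<le> a + ennreal \<eta>"
  proof -
    have one: "(\<lambda>_. 1 :: ennreal) \<in> borel_measurable prior" by simp
    have I: "a * (\<integral>\<^sup>+\<theta>. 1 \<partial>Q n x) = a" using prob_space.emeasure_space_1[OF Q(2)] by simp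
    have far: "ennreal (sqrt n ^ CARD('d) / \<pi> \<theta>\<^sub>0) * (\<integral>\<^sup>+\<theta>. 1 * ennreal (q n \<theta> x / p0 n x) * indicator (- \<B>) \<theta> \<partial>prior) \<le> ?F"
    proof (rule far_le[OF x(1) V])
      fix \<theta>
      have "1 * 1 \<le> ennreal (real n powr (p / 2)) * (U \<theta> + 1)"
        using n1 by (intro mult_mono) (auto simp: add_increasing)
      then show "1 \<le> ennreal (real n powr (p / 2)) * (U \<theta> + 1)" by simp
    qed
    \<comment> \<open>For the normalizer both losses are the constant 1, so the same
      \<open>\<kappa>\<close> is trivially admissible.\<close>
    have \<kappa>1: "(\<integral>\<^sup>+h. indicator (cball 0 C) h * ennreal \<bar>1 - 1\<bar> \<partial>(lborel :: (real^'d) measure)) \<le> \<kappa>" by simp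
    have m1: "(\<lambda>h. if loc n h \<in> \<B> then 1 else (0::real)) \<in> borel_measurable borel"
      by (rule ball_section_measurable[of "\<lambda>_. 1"]) auto
    note R = risk_approx[where g = "\<lambda>_. 1" and ?g0.0 = "\<lambda>_. 1", OF x n m1 _ _ _ one_le_D1 less_imp_le[OF D1(2)] C k \<kappa>1 tail[OF one_le_D0],
        unfolded lik_integral]
    show "a \<le> ennreal (mass n x) + ennreal \<eta>" "ennreal (mass n x) \<le> a + ennreal \<eta>"
      using combine[OF R far] a(3)[OF one] unfolding I by simp_all
  qed
  from ennreal_near[OF this] have I2: "\<bar>enn2real a - mass n x\<bar> \<le> \<eta>"
    using mass_ge[of n x] g.c_pos \<eta> by simp
  have Z: "Zn n x t = enn2real ?I" by (rule Zn_eq[OF n Q(1) tT])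
  have "\<bar>enn2real a * Zn n x t - mass n x * ?y\<bar> \<le> \<eta>" using I1 by (simp add: Z enn2real_mult)
  from ratio_approx[OF this I2 mass_ge \<eta>(2) g.c_pos y0 M] show ?thesis .
qed

lemma B_bounded: obtains \<beta> where "\<beta> > 0" "\<And>y. norm (g.B *v y) \<le> norm y * \<beta>"
  using bounded_linear.pos_bounded[OF linear_linear[THEN iffD2, OF matrix_vector_mul_linear[of g.B]]] by blast

text \<open>The order of choices matters: first the bound \<open>k\<close> for \<open>Del\<close>,
  which fixes the bound \<open>M\<close> of the Gaussian risk and hence \<open>\<eta>\<close>; then
  the radius \<open>C\<close>, which makes the Gaussian tail and \<open>Mid\<close> small; last the
  levels for \<open>Dev\<close> and for the loss error, whose coefficients grow with
  \<open>C\<close>. The bad event does not depend on \<open>t\<close>.\<close>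

lemma posterior_risk_approx:
  assumes e: "e > 0"
  obtains bad where "\<And>n. bad n \<in> sets (P0 n)" "\<forall>\<^sub>F n in sequentially. measure (P0 n) (bad n) \<le> e"
    "\<forall>\<^sub>F n in sequentially. AE x in P0 n. x \<notin> bad n \<longrightarrow> (\<forall>t\<in>K. \<bar>Zn n x t - Zt (g.B *v Del n x) t\<bar> \<le> e)"
proof -
  obtain k where k: "k > 0" "\<forall>\<^sub>F n in sequentially. \<P>(x in P0 n. norm (Del n x) > k) \<le> e / 4"
    using Del_tight[of "e / 4"] e by auto
  obtain \<beta> where \<beta>: "\<beta> > 0" "\<And>y. norm (g.B *v y) \<le> norm y * \<beta>" using B_bounded by metis
  define M where "M = (1 / g.c\<^sub>G) * (\<integral>h. W (l * (k * \<beta>)) h \<partial>lborel)"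
  have M: "Zt (g.B *v Del n x) t \<le> M" if "norm (Del n x) \<le> k" "t \<in> K" for n x t
  proof -
    have "norm (g.B *v Del n x) \<le> norm (Del n x) * \<beta>" by (rule \<beta>(2))
    also have "\<dots> \<le> k * \<beta>" using that \<beta>(1) by (intro mult_right_mono) auto
    finally show ?thesis unfolding M_def by (rule Zt_bounds(2)[OF that(2)])
  qed
  have M0: "0 \<le> M" unfolding M_def using g.c_pos by (intro mult_nonneg_nonneg integral_nonneg_AE) auto
  \<comment> \<open>The first bound keeps the normalizer away from 0, the second makes the final
    error in \<open>good_event\<close> at most \<open>e\<close>.\<close>
  define \<eta> where "\<eta> = min (g.c\<^sub>G / 2) (e * g.c\<^sub>G / (2 * (1 + M)))"
  have \<eta>: "\<eta> > 0" using e g.c_pos M0 by (simp add: \<eta>_def)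
  have \<eta>2: "\<eta> \<le> g.c\<^sub>G / 2" unfolding \<eta>_def by (rule min.cobounded1)
  have \<eta>e: "2 * \<eta> * (1 + M) / g.c\<^sub>G \<le> e"
  proof -
    have "\<eta> \<le> e * g.c\<^sub>G / (2 * (1 + M))" by (simp add: \<eta>_def)
    then show ?thesis using g.c_pos M0 by (simp add: field_simps)
  qed
  obtain R1 where R1: "R1 > 0" "\<And>C. C \<ge> R1 \<Longrightarrow> (\<integral>h. W k h * indicator (- cball 0 C) h \<partial>lborel) \<le> \<eta> / 5"
    using tail_integral_tendsto_0[OF W_integrable W_nonneg, of k "\<eta> / 5"] k(1) \<eta> by auto
  \<comment> \<open>Five error terms share \<open>\<eta>\<close>, and four events share the
    probability \<open>e\<close>. \<open>Mid_small\<close> uses one number both as level and as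
    probability, whence the minimum.\<close>
  define e1 where "e1 = min (\<eta> / (5 * D\<^sub>1)) (e / 4)"
  have e1: "e1 > 0" "e1 \<le> e / 4" "D\<^sub>1 * e1 \<le> \<eta> / 5"
  proof -
    show "e1 > 0" "e1 \<le> e / 4" using \<eta> e D1 by (auto simp: e1_def)
    have "e1 \<le> \<eta> / (5 * D\<^sub>1)" by (simp add: e1_def)
    then show "D\<^sub>1 * e1 \<le> \<eta> / 5" using D1 by (simp add: field_simps)
  qed
  obtain R2 where R2: "R2 > 0" "\<And>C n. C \<ge> R2 \<Longrightarrow> n > 0 \<Longrightarrow> \<P>(x in P0 n. ennreal e1 < Mid n C x) \<le> e1"
    using Mid_small[OF e1(1)] by blast
  define C where "C = max R1 R2"
  have C: "C > 0" "C \<ge> R1" "C \<ge> R2" using R1 R2 by (auto simp: C_def)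
  define D2 where "D2 = D\<^sub>1 * (1 + C) powr p"
  have D2: "D2 > 0" using D1 C by (simp add: D2_def)
  define e2 where "e2 = \<eta> / (5 * D2)"
  define e3 where "e3 = \<eta> / (5 * exp (k * C))"
  have e23: "e2 > 0" "e3 > 0" "D2 * e2 = \<eta> / 5" "exp (k * C) * e3 = \<eta> / 5"
    using \<eta> D2 by (auto simp: e2_def e3_def)
  let ?U = "\<lambda>\<theta>. U \<theta> + 1"
  have Um: "?U \<in> borel_measurable prior" by measurable
  have Ufin: "(\<integral>\<^sup>+\<theta>. ?U \<theta> \<partial>prior) < \<infinity>"
    using U_finite prior.emeasure_space_1 by (subst nn_integral_add) auto
  have \<tau>: "(\<integral>\<^sup>+h. indicator (- cball 0 C) h * ennreal (W k h) \<partial>lborel) \<le> ennreal (\<eta> / 5)"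
  proof -
    have Wi: "integrable lborel (\<lambda>h. W k h * indicator (- cball 0 C) h)"
      using integrable_mult_indicator[OF _ W_integrable[of k], of "- cball 0 C"] k(1) by (simp add: mult.commute)
    have "(\<integral>\<^sup>+h. indicator (- cball 0 C) h * ennreal (W k h) \<partial>lborel) = (\<integral>\<^sup>+h. ennreal (W k h * indicator (- cball 0 C) h) \<partial>lborel)"
      by (intro nn_integral_cong) (auto split: split_indicator)
    also have "\<dots> = ennreal (\<integral>h. W k h * indicator (- cball 0 C) h \<partial>lborel)"
      by (rule nn_integral_eq_integral[OF Wi]) auto
    finally show ?thesis using R1(2)[OF C(2)] by (simp add: ennreal_leI)
  qed
  let ?A1 = "\<lambda>n. {x\<in>space (P0 n). norm (Del n x) > k}" and ?A2 = "\<lambda>n. {x\<in>space (P0 n). ennreal e1 < Mid n C x}"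
    and ?A3 = "\<lambda>n. {x\<in>space (P0 n). ennreal e2 < Dev n C x}" and ?A4 = "\<lambda>n. {x\<in>space (P0 n). ennreal (\<eta> / 5) < Far n ?U x}"
  note [measurable] = Mid_meas Dev_meas Far_meas[OF Um] Del_P0
  have A: "?A1 n \<in> sets (P0 n)" "?A2 n \<in> sets (P0 n)" "?A3 n \<in> sets (P0 n)" "?A4 n \<in> sets (P0 n)" for n
    by measurable
  define bad where "bad n = (?A1 n \<union> ?A2 n) \<union> (?A3 n \<union> ?A4 n)" for n
  show ?thesis
  proof (rule that[of bad])
    show "bad n \<in> sets (P0 n)" for n unfolding bad_def by (intro sets.Un A)
    have "\<forall>\<^sub>F n in sequentially. measure (P0 n) (?A3 n) < e / 4"
      using e by (intro order_tendstoD(2)[OF Dev_small[OF e23(1)]]) auto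
    moreover have "\<forall>\<^sub>F n in sequentially. measure (P0 n) (?A4 n) < e / 4"
      using e \<eta> by (intro order_tendstoD(2)[OF Far_small[OF Um Ufin]]) auto
    ultimately show "\<forall>\<^sub>F n in sequentially. measure (P0 n) (bad n) \<le> e"
      using k(2) eventually_gt_at_top[of 0]
    proof eventually_elim
      case (elim n)
      have "measure (P0 n) (bad n) \<le> measure (P0 n) (?A1 n \<union> ?A2 n) + measure (P0 n) (?A3 n \<union> ?A4 n)"
        unfolding bad_def by (intro measure_Un_le sets.Un A)
      also have "\<dots> \<le> (measure (P0 n) (?A1 n) + measure (P0 n) (?A2 n)) + (measure (P0 n) (?A3 n) + measure (P0 n) (?A4 n))"
        by (intro add_mono measure_Un_le A)
      also have "\<dots> \<le> (e / 4 + e / 4) + (e / 4 + e / 4)"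
        using elim R2(2)[OF C(3) elim(4)] e1(2) by (intro add_mono) auto
      finally show ?case by simp
    qed
    have "\<forall>\<^sub>F n in sequentially. C < \<epsilon>\<^sub>0 * sqrt (real n)" by (rule eventually_radius)
    then show "\<forall>\<^sub>F n in sequentially. AE x in P0 n. x \<notin> bad n \<longrightarrow> (\<forall>t\<in>K. \<bar>Zn n x t - Zt (g.B *v Del n x) t\<bar> \<le> e)"
      using eventually_loc_in_ball loss_limit[OF less_imp_le[OF C(1)] e23(2)]
    proof eventually_elim
      case (elim n)
      note el = elim
      have n: "0 < n" using el(2) by blast
      from posterior_representation[OF n] AE_space show ?case
      proof eventually_elim
        case (elim x)
        note rep = elim(1) and sp = elim(2)
        obtain a where a: "0 < a" "a < \<infinity>" and a3: "\<And>F. F \<in> borel_measurable prior \<Longrightarrow> a * (\<integral>\<^sup>+\<theta>. F \<theta> \<partial>Q n x) =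
          (\<integral>\<^sup>+h. F (loc n h) * ennreal (u n h x / p0 n x) \<partial>lborel)
          + ennreal (sqrt n ^ CARD('d) / \<pi> \<theta>\<^sub>0) * (\<integral>\<^sup>+\<theta>. F \<theta> * ennreal (q n \<theta> x / p0 n x) * indicator (- \<B>) \<theta> \<partial>prior)"
          using rep by blast
        show ?case
        proof (intro impI ballI)
          fix t assume bad: "x \<notin> bad n" and t: "t \<in> K"
          have good: "norm (Del n x) \<le> k" "Mid n C x \<le> ennreal e1" "Dev n C x \<le> ennreal e2" "Far n ?U x \<le> ennreal (\<eta> / 5)"
            using bad sp unfolding bad_def by (simp_all add: not_less)
          let ?h = "\<eta> / 5"
          have "ennreal D\<^sub>1 * Mid n C x \<le> ennreal D\<^sub>1 * ennreal e1" by (intro mult_left_mono good) simp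
          also have "\<dots> \<le> ennreal ?h" using e1 D1 by (simp add: ennreal_mult[symmetric] ennreal_leI)
          finally have s1: "ennreal D\<^sub>1 * Mid n C x \<le> ennreal ?h" .
          have "ennreal D2 * Dev n C x \<le> ennreal D2 * ennreal e2" by (intro mult_left_mono good) simp
          also have "\<dots> = ennreal ?h" unfolding e23(3)[symmetric] using e23(1) D2 by (simp add: ennreal_mult)
          finally have s2: "ennreal D2 * Dev n C x \<le> ennreal ?h" .
          have s3: "ennreal (exp (k * C)) * ennreal e3 \<le> ennreal ?h" unfolding e23(4)[symmetric] using e23(2) by (simp add: ennreal_mult)
          have "ennreal D\<^sub>1 * Mid n C x + ennreal D2 * Dev n C x + (ennreal (exp (k * C)) * ennreal e3 + ennreal ?h) + Far n ?U x
            \<le> ennreal ?h + ennreal ?h + (ennreal ?h + ennreal ?h) + ennreal ?h"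
            by (intro add_mono s1 s2 s3 order_refl good)
          also have "\<dots> = ennreal \<eta>" using \<eta> by (simp add: ennreal_plus[symmetric] del: ennreal_plus)
          finally have small: "ennreal D\<^sub>1 * Mid n C x + ennreal (D\<^sub>1 * (1 + C) powr p) * Dev n C x + (ennreal (exp (k * C)) * ennreal e3 + ennreal ?h) + Far n ?U x \<le> ennreal \<eta>"
            unfolding D2_def .
          have lt: "loc n t \<in> \<B>" using el(2) t by blast
          have \<kappa>: "(\<integral>\<^sup>+h. indicator (cball 0 C) h * ennreal \<bar>real n powr (p / 2) * L (loc n t) (loc n h) - L\<^sub>0 t h\<bar> \<partial>lborel) \<le> ennreal e3"
            using el(3) t by blast
          have "\<bar>Zn n x t - Zt (g.B *v Del n x) t\<bar> \<le> 2 * \<eta> * (1 + M) / g.c\<^sub>G"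
            by (rule good_event[OF n _ _ _ _ a a3 less_imp_le[OF C(1)] el(1) good(1) t lt \<kappa> \<tau> small less_imp_le[OF \<eta>] \<eta>2 M[OF good(1) t]])
               (use rep in blast)+
          then show "\<bar>Zn n x t - Zt (g.B *v Del n x) t\<bar> \<le> e" using \<eta>e by linarith
        qed
      qed
    qed
  qed
qed

lemma Zt_in_linfty: "restrict (Zt y) K \<in> linfty K"
proof -
  have "\<bar>Zt y t\<bar> \<le> (1 / g.c\<^sub>G) * (\<integral>h. W (l * norm y) h \<partial>lborel)" if "t \<in> K" for t
    using Zt_bounds[OF that order_refl] by (simp add: abs_of_nonneg)
  then show ?thesis by (auto simp: linfty_def bounded_iff)
qed

text \<open>The envelope for the limiting loss is free of \<open>t\<close>, so the risks at two
  centres differ, for all \<open>t\<close> in \<open>K\<close> at once, by at most a weighted L1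
  distance of the two shifted Gaussian densities; that distance vanishes by dominated
  convergence.\<close>

lemma Zt_continuous:
  assumes y: "y \<longlonglongrightarrow> y0" and e: "e > 0"
  shows "\<forall>\<^sub>F n in sequentially. \<forall>t\<in>K. \<bar>Zt (y n) t - Zt y0 t\<bar> \<le> e"
proof -
  obtain k where k: "k > 0" "\<And>n. norm (y n) \<le> k"
    using convergent_imp_Bseq[OF convergentI[OF y]] unfolding Bseq_def by blast
  have k0: "norm y0 \<le> k" using k(2) by (intro tendsto_upperbound[OF tendsto_norm[OF y]]) auto
  let ?w = "\<lambda>h::real^'d. D\<^sub>0 * exp (c\<^sub>3 * norm h powr q\<^sub>0)"
  let ?f = "\<lambda>n h. ?w h * \<bar>g.G (h - y n) - g.G (h - y0)\<bar>"
  have w: "?w h * g.G (h - z) \<le> W (l * k) h" if "norm z \<le> k" for z h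
    by (rule weight_le[OF order_refl G_le[OF that]]) simp
  have bound: "norm (?f n h) \<le> 2 * W (l * k) h" for n h
  proof -
    have "\<bar>g.G (h - y n) - g.G (h - y0)\<bar> \<le> g.G (h - y n) + g.G (h - y0)"
      using g.G_pos(2)[of "h - y n"] g.G_pos(2)[of "h - y0"] by linarith
    then have "?f n h \<le> ?w h * (g.G (h - y n) + g.G (h - y0))" using D0 by (intro mult_left_mono) auto
    also have "\<dots> \<le> 2 * W (l * k) h" using w[OF k(2), of h n] w[OF k0, of h] by (simp add: distrib_left)
    finally show ?thesis using D0 by simp
  qed
  have W2: "integrable lborel (\<lambda>h. 2 * W (l * k) h)" using k(1) g.l(1) by (intro integrable_mult_right W_integrable) simp
  have Gc: "isCont g.G z" for z
    unfolding g.G_def[abs_def] by (intro continuous_intros continuous_at_imp_continuous_on g.continuous_mult_vec[THEN continuous_on_interior]) auto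
  have "(\<lambda>n. \<integral>h. ?f n h \<partial>lborel) \<longlonglongrightarrow> (\<integral>h. 0 \<partial>(lborel :: (real^'d) measure))"
  proof (rule integral_dominated_convergence[OF _ _ W2])
    show "AE h in lborel. (\<lambda>n. ?f n h) \<longlonglongrightarrow> 0"
    proof (rule AE_I2)
      fix h :: "real^'d"
      have "(\<lambda>n. h - y n) \<longlonglongrightarrow> h - y0" by (intro tendsto_intros y)
      then have "(\<lambda>n. g.G (h - y n)) \<longlonglongrightarrow> g.G (h - y0)" by (rule isCont_tendsto_compose[OF Gc])
      then have "(\<lambda>n. ?w h * \<bar>g.G (h - y n) - g.G (h - y0)\<bar>) \<longlonglongrightarrow> ?w h * \<bar>g.G (h - y0) - g.G (h - y0)\<bar>"
        by (intro tendsto_intros)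
      then show "(\<lambda>n. ?f n h) \<longlonglongrightarrow> 0" by simp
    qed
    show "AE h in lborel. norm (?f n h) \<le> 2 * W (l * k) h" for n using bound by (intro AE_I2)
  qed auto
  then have "\<forall>\<^sub>F n in sequentially. (\<integral>h. ?f n h \<partial>lborel) < g.c\<^sub>G * e"
    using e g.c_pos by (intro order_tendstoD(2)[where y = 0]) auto
  then show ?thesis
  proof eventually_elim
    case (elim n)
    have fi: "integrable lborel (?f n)"
      by (rule Bochner_Integration.integrable_bound[OF W2]) (use order_trans[OF bound abs_ge_self] in auto)
    show ?case
    proof
      fix t assume t: "t \<in> K"
      note i = L0_G_integrable[OF t]
      have eq: "Zt (y n) t - Zt y0 t = (1 / g.c\<^sub>G) * (\<integral>h. L\<^sub>0 t h * g.G (h - y n) - L\<^sub>0 t h * g.G (h - y0) \<partial>lborel)"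
        unfolding Zt_eq using i[of "y n"] i[of y0] by (simp add: right_diff_distrib diff_divide_distrib)
      have "\<bar>Zt (y n) t - Zt y0 t\<bar> \<le> (1 / g.c\<^sub>G) * (\<integral>h. \<bar>L\<^sub>0 t h * g.G (h - y n) - L\<^sub>0 t h * g.G (h - y0)\<bar> \<partial>lborel)"
        unfolding eq abs_mult using g.c_pos by (intro mult_mono integral_abs_bound) auto
      also have "\<dots> \<le> (1 / g.c\<^sub>G) * (g.c\<^sub>G * e)"
      proof (rule mult_left_mono)
        have "(\<integral>h. \<bar>L\<^sub>0 t h * g.G (h - y n) - L\<^sub>0 t h * g.G (h - y0)\<bar> \<partial>lborel) \<le> (\<integral>h. ?f n h \<partial>lborel)"
        proof (rule integral_mono[OF _ fi])
          show "integrable lborel (\<lambda>h. \<bar>L\<^sub>0 t h * g.G (h - y n) - L\<^sub>0 t h * g.G (h - y0)\<bar>)"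
            by (rule integrable_abs[OF Bochner_Integration.integrable_diff[OF i i]])
          fix h
          have eq: "L\<^sub>0 t h * g.G (h - y n) - L\<^sub>0 t h * g.G (h - y0) = L\<^sub>0 t h * (g.G (h - y n) - g.G (h - y0))"
            by (rule right_diff_distrib[symmetric])
          show "\<bar>L\<^sub>0 t h * g.G (h - y n) - L\<^sub>0 t h * g.G (h - y0)\<bar> \<le> ?f n h"
            unfolding eq abs_mult abs_of_nonneg[OF L0_nonneg] by (rule mult_right_mono[OF L0_le_D0[OF t]]) simp
        qed
        then show "(\<integral>h. \<bar>L\<^sub>0 t h * g.G (h - y n) - L\<^sub>0 t h * g.G (h - y0)\<bar> \<partial>lborel) \<le> g.c\<^sub>G * e"
          using elim by linarith
        show "0 \<le> 1 / g.c\<^sub>G" using g.c_pos by simp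
      qed
      finally show "\<bar>Zt (y n) t - Zt y0 t\<bar> \<le> e" using g.c_pos by simp
    qed
  qed
qed

end

section \<open>Convergence in distribution\<close>

text \<open>\<open>\<phi>\<close> need not be measurable. The function \<open>h\<close> plus the
  error is an admissible majorant, and every admissible majorant lies almost everywhere above
  \<open>h\<close> minus the error. The first fact makes the set under the infimum nonempty, the
  second bounds it below, so the infimum is a genuine one.\<close>

lemma outer_expectation_near:
  assumes M: "prob_space M" and h: "integrable M h" and bad: "bad \<in> sets M"
    and near: "AE x in M. \<bar>\<phi> x - h x\<bar> \<le> e + c * indicator bad x"
  shows "\<bar>outer_expectation M \<phi> - (\<integral>x. h x \<partial>M)\<bar> \<le> e + c * measure M bad"
proof -
  interpret prob_space M by fact
  let ?S = "{\<integral>x. U x \<partial>M | U. integrable M U \<and> (AE x in M. \<phi> x \<le> U x)}"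
  let ?d = "\<lambda>x. e + c * indicator bad x :: real"
  have ci: "integrable M (\<lambda>x. c * indicator bad x :: real)"
    using bad by (intro integrable_mult_right integrable_real_indicator) (auto simp: emeasure_eq_measure)
  then have di: "integrable M ?d" by (intro Bochner_Integration.integrable_add) auto
  have dI: "(\<integral>x. ?d x \<partial>M) = e + c * measure M bad"
    using ci bad sets.sets_into_space[OF bad] by (simp add: prob_space Int_absorb2)
  have mem: "(\<integral>x. h x \<partial>M) + (e + c * measure M bad) \<in> ?S"
  proof -
    have i: "(\<integral>x. h x + ?d x \<partial>M) = (\<integral>x. h x \<partial>M) + (e + c * measure M bad)"
      unfolding dI[symmetric] by (rule Bochner_Integration.integral_add[OF h di])
    moreover have "AE x in M. \<phi> x \<le> h x + ?d x" using near by eventually_elim linarith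
    moreover have "integrable M (\<lambda>x. h x + ?d x)" by (rule Bochner_Integration.integrable_add[OF h di])
    ultimately show ?thesis unfolding i[symmetric] by blast
  qed
  have lower: "(\<integral>x. h x \<partial>M) - (e + c * measure M bad) \<le> z" if "z \<in> ?S" for z
  proof -
    obtain U where U: "integrable M U" "AE x in M. \<phi> x \<le> U x" "z = (\<integral>x. U x \<partial>M)" using \<open>z \<in> ?S\<close> by blast
    have "(\<integral>x. h x - ?d x \<partial>M) \<le> (\<integral>x. U x \<partial>M)"
    proof (rule integral_mono_AE[OF Bochner_Integration.integrable_diff[OF h di] U(1)])
      show "AE x in M. h x - ?d x \<le> U x" using near U(2) by eventually_elim linarith
    qed
    then show ?thesis using Bochner_Integration.integral_diff[OF h di] by (simp add: U(3) dI)
  qed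
  have "outer_expectation M \<phi> \<le> (\<integral>x. h x \<partial>M) + (e + c * measure M bad)"
    unfolding outer_expectation_def using lower by (intro cInf_lower[OF mem]) (auto simp: bdd_below_def)
  moreover have "(\<integral>x. h x \<partial>M) - (e + c * measure M bad) \<le> outer_expectation M \<phi>"
    unfolding outer_expectation_def by (rule cInf_greatest) (use mem lower in auto)
  ultimately show ?thesis by linarith
qed

lemma linfty_continuous_at:
  assumes f: "continuous_map (linfty_topology K) euclideanreal f" and g: "g \<in> linfty K" and e: "e > 0"
  obtains d where "d > 0" "\<And>g'. g' \<in> linfty K \<Longrightarrow> (\<And>t. t \<in> K \<Longrightarrow> \<bar>g t - g' t\<bar> \<le> d) \<Longrightarrow> \<bar>f g' - f g\<bar> < e"
proof -
  interpret M: Metric_space "linfty K" "linfty_dist K" by (rule Metric_space_linfty)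
  let ?O = "{x \<in> topspace M.mtopology. f x \<in> ball (f g) e}"
  have "openin M.mtopology ?O"
    using openin_continuous_map_preimage[OF f[unfolded linfty_topology_def], of "ball (f g) e"] by simp
  moreover have "g \<in> ?O" using g e by simp
  ultimately obtain r where r: "r > 0" "M.mball g r \<subseteq> ?O" unfolding M.openin_mtopology by blast
  \<comment> \<open>Half the radius, because a non-strict pointwise bound has to place
    \<open>g'\<close> inside an open ball.\<close>
  show ?thesis
  proof (rule that[of "r / 2"])
    fix g' assume g': "g' \<in> linfty K" "\<And>t. t \<in> K \<Longrightarrow> \<bar>g t - g' t\<bar> \<le> r / 2"
    have "linfty_dist K g g' \<le> r / 2" using g'(2) r(1) by (intro linfty_dist_least) auto
    then have "g' \<in> M.mball g r" using g g'(1) r(1) by simp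
    then have "f g' \<in> ball (f g) e" using r(2) by blast
    then show "\<bar>f g' - f g\<bar> < e" by (simp add: dist_real_def abs_minus_commute)
  qed (use r in simp)
qed

context bvm_loss
begin

context
  fixes f :: "(real^'d \<Rightarrow> real) \<Rightarrow> real" and C :: real
  assumes f: "continuous_map (linfty_topology K) euclideanreal f" and C: "\<And>g. g \<in> linfty K \<Longrightarrow> \<bar>f g\<bar> \<le> C"
begin

text \<open>Composing \<open>f\<close> with the family of limiting risks gives a bounded continuous
  function on a finite-dimensional space, where measurability and weak convergence are
  unproblematic.\<close>

definition H :: "real^'d \<Rightarrow> real" where "H y = f (restrict (Zt y) K)"

lemma H_le: "\<bar>H y\<bar> \<le> C" unfolding H_def by (rule C[OF Zt_in_linfty])

lemma H_continuous: "continuous_on UNIV H"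
proof (rule continuous_on_sequentiallyI)
  fix y :: "nat \<Rightarrow> real^'d" and a assume y: "y \<longlonglongrightarrow> a"
  show "(\<lambda>n. H (y n)) \<longlonglongrightarrow> H a"
  proof (rule tendstoI)
    fix e :: real assume "e > 0"
    from linfty_continuous_at[OF f Zt_in_linfty[of a] this] obtain d where d: "d > 0"
      "\<And>g'. g' \<in> linfty K \<Longrightarrow> (\<And>t. t \<in> K \<Longrightarrow> \<bar>restrict (Zt a) K t - g' t\<bar> \<le> d) \<Longrightarrow> \<bar>f g' - f (restrict (Zt a) K)\<bar> < e"
      by metis
    show "\<forall>\<^sub>F n in sequentially. dist (H (y n)) (H a) < e"
      using Zt_continuous[OF y d(1)]
    proof eventually_elim
      case (elim n)
      have "\<bar>f (restrict (Zt (y n)) K) - f (restrict (Zt a) K)\<bar> < e"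
        using elim by (intro d(2) Zt_in_linfty) (simp add: abs_minus_commute)
      then show ?case by (simp add: H_def dist_real_def)
    qed
  qed
qed

text \<open>A general \<open>f\<close> is not uniformly continuous, and bounded sets of functions
  are not compact. What is compact is the set of centres \<open>y\<close>: a sequence of violations
  has a convergent subsequence of centres, and continuity of \<open>f\<close> at the single limiting
  risk gives a contradiction.\<close>

lemma H_uniform:
  assumes e: "e > 0"
  shows "\<exists>\<eta>>0. \<forall>y g. norm y \<le> k \<longrightarrow> g \<in> linfty K \<longrightarrow> (\<forall>t\<in>K. \<bar>g t - Zt y t\<bar> \<le> \<eta>) \<longrightarrow> \<bar>f g - H y\<bar> \<le> e"
proof (rule ccontr)
  assume not: "\<not> ?thesis"
  define bad where "bad n y g \<longleftrightarrow> norm y \<le> k \<and> g \<in> linfty K \<and> (\<forall>t\<in>K. \<bar>g t - Zt y t\<bar> \<le> inverse (real (Suc n))) \<and> e < \<bar>f g - H y\<bar>" for n y g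
  have "\<exists>y g. bad n y g" for n
  proof -
    have "inverse (real (Suc n)) > 0" by simp
    with not show ?thesis unfolding bad_def not_le[symmetric] by blast
  qed
  then obtain Y where "\<forall>n. \<exists>g. bad n (Y n) g" by metis
  then obtain G where bad: "\<And>n. bad n (Y n) (G n)" by metis
  have "\<forall>n. Y n \<in> cball 0 k" using bad by (auto simp: bad_def)
  then obtain y r where y: "strict_mono r" "(Y \<circ> r) \<longlonglongrightarrow> y"
    using compact_imp_seq_compact[OF compact_cball[of "0::real^'d" k]] unfolding seq_compact_def by blast
  have "e / 2 > 0" using e by simp
  from linfty_continuous_at[OF f Zt_in_linfty[of y] this] obtain d where d: "d > 0"
    "\<And>g'. g' \<in> linfty K \<Longrightarrow> (\<And>t. t \<in> K \<Longrightarrow> \<bar>restrict (Zt y) K t - g' t\<bar> \<le> d) \<Longrightarrow> \<bar>f g' - f (restrict (Zt y) K)\<bar> < e / 2"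
    by metis
  have "(\<lambda>n. inverse (real (Suc n))) \<longlonglongrightarrow> 0" by (rule LIMSEQ_inverse_real_of_nat)
  from LIMSEQ_subseq_LIMSEQ[OF this y(1)] have "\<forall>\<^sub>F n in sequentially. inverse (real (Suc (r n))) < d / 2"
    using d(1) by (intro order_tendstoD(2)[where y = 0]) (auto simp: o_def)
  moreover have "\<forall>\<^sub>F n in sequentially. \<forall>t\<in>K. \<bar>Zt ((Y \<circ> r) n) t - Zt y t\<bar> \<le> d / 2"
    using d(1) by (intro Zt_continuous y(2)) simp
  ultimately have "\<forall>\<^sub>F n in sequentially. False"
  proof eventually_elim
    case (elim n)
    have b: "bad (r n) (Y (r n)) (G (r n))" by (rule bad)
    have 1: "\<bar>f (G (r n)) - f (restrict (Zt y) K)\<bar> < e / 2"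
    proof (rule d(2))
      show "G (r n) \<in> linfty K" using b by (simp add: bad_def)
      fix t assume t: "t \<in> K"
      have "\<bar>G (r n) t - Zt (Y (r n)) t\<bar> \<le> inverse (real (Suc (r n)))" using b t unfolding bad_def by blast
      moreover have "\<bar>Zt (Y (r n)) t - Zt y t\<bar> \<le> d / 2" using elim(2) t by simp
      moreover have "restrict (Zt y) K t = Zt y t" using t by simp
      ultimately show "\<bar>restrict (Zt y) K t - G (r n) t\<bar> \<le> d" using elim(1) by linarith
    qed
    have 2: "\<bar>f (restrict (Zt (Y (r n))) K) - f (restrict (Zt y) K)\<bar> < e / 2"
    proof (rule d(2)[OF Zt_in_linfty])
      fix t assume t: "t \<in> K"
      have "\<bar>Zt (Y (r n)) t - Zt y t\<bar> \<le> d / 2" using elim(2) t by simp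
      moreover have "restrict (Zt y) K t = Zt y t" "restrict (Zt (Y (r n))) K t = Zt (Y (r n)) t" using t by simp_all
      ultimately show "\<bar>restrict (Zt y) K t - restrict (Zt (Y (r n))) K t\<bar> \<le> d" using d(1) by linarith
    qed
    have "e < \<bar>f (G (r n)) - f (restrict (Zt (Y (r n))) K)\<bar>" using b by (simp add: bad_def H_def)
    then show False using 1 2 by linarith
  qed
  then show False by simp
qed

lemma B_symmetric: "v \<bullet> (g.B *v z) = (g.B *v v) \<bullet> z"
  using g.A_adjoint[of "g.B *v v" "g.B *v z"] by simp

lemma BDel_measurable: "(\<lambda>x. g.B *v Del n x) \<in> borel_measurable (P0 n)"
proof -
  have "(\<lambda>z. g.B *v z) \<in> borel_measurable borel"
    by (intro borel_measurable_continuous_onI g.continuous_mult_vec continuous_on_id)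
  then show ?thesis by (rule measurable_compose[OF Del_P0])
qed

lemma BDel_tight:
  assumes "e > 0" shows "\<exists>k. \<forall>\<^sub>F n in sequentially. \<P>(x in P0 n. norm (g.B *v Del n x) > k) \<le> e"
proof -
  obtain k where k: "k > 0" "\<forall>\<^sub>F n in sequentially. \<P>(x in P0 n. norm (Del n x) > k) \<le> e"
    by (rule Del_tight[OF assms])
  obtain \<beta> where \<beta>: "\<beta> > 0" "\<And>y. norm (g.B *v y) \<le> norm y * \<beta>" using B_bounded by metis
  note [measurable] = Del_P0
  have "\<forall>\<^sub>F n in sequentially. \<P>(x in P0 n. norm (g.B *v Del n x) > k * \<beta>) \<le> e"
    using k(2)
  proof eventually_elim
    case (elim n)
    have "{x\<in>space (P0 n). norm (g.B *v Del n x) > k * \<beta>} \<subseteq> {x\<in>space (P0 n). norm (Del n x) > k}"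
    proof safe
      fix x assume "k * \<beta> < norm (g.B *v Del n x)"
      also have "\<dots> \<le> norm (Del n x) * \<beta>" by (rule \<beta>(2))
      finally show "k < norm (Del n x)" using \<beta>(1) by simp
    qed
    then have "\<P>(x in P0 n. norm (g.B *v Del n x) > k * \<beta>) \<le> \<P>(x in P0 n. norm (Del n x) > k)"
      by (rule P0.finite_measure_mono) measurable
    then show ?case using elim by linarith
  qed
  then show ?thesis by blast
qed

text \<open>By symmetry of the inverse information, \<open>v \<bullet> (g.B *v Del n x)\<close> is
  \<open>(g.B *v v) \<bullet> Del n x\<close>, and the information form at \<open>g.B *v v\<close>
  equals \<open>v \<bullet> (g.B *v v)\<close>, the variance of the limiting normal law in direction
  \<open>v\<close>.\<close>

lemma H_limit: "(\<lambda>n. \<integral>x. H (g.B *v Del n x) \<partial>P0 n) \<longlonglongrightarrow> (\<integral>y. H y \<partial>g.N0)"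
proof (rule g.weak_convergence[OF P0.prob_space_axioms BDel_measurable g.normal g.sets_normal _ H_continuous H_le BDel_tight])
  fix v :: "real^'d"
  have "(\<lambda>n. \<integral>x. exp (\<i> * of_real (v \<bullet> (g.B *v Del n x))) \<partial>P0 n) \<longlonglongrightarrow> exp (- of_real ((g.B *v v) \<bullet> (FI *v (g.B *v v))) / 2)"
    unfolding B_symmetric by (rule char_Del)
  then show "(\<lambda>n. \<integral>x. exp (\<i> * of_real (v \<bullet> (g.B *v Del n x))) \<partial>P0 n) \<longlonglongrightarrow> (\<integral>x. exp (\<i> * of_real (v \<bullet> x)) \<partial>g.N0)"
    unfolding g.char_normal by (simp add: inner_commute)
qed

lemma outer_limit:
  "(\<lambda>n. outer_expectation (P0 n) (\<lambda>x. f (restrict (Zn n x) K))) \<longlonglongrightarrow> (\<integral>y. H y \<partial>g.N0)"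
proof (rule LIMSEQ_I)
  fix e :: real assume e: "e > 0"
  have C0: "0 \<le> C" using H_le[of 0] by linarith
  \<comment> \<open>The budget is \<open>e / 4\<close> for the modulus of \<open>f\<close>,
    \<open>e / 4\<close> for the exceptional events and \<open>e / 2\<close> for the weak limit. The
    summand 1 next to \<open>C\<close> avoids division by zero.\<close>
  define e1 where "e1 = e / 4"
  define e2 where "e2 = e / (16 * (C + 1))"
  have e12: "e1 > 0" "e2 > 0" using e C0 by (auto simp: e1_def e2_def)
  have e2': "2 * C * (2 * e2) \<le> e / 4" using e C0 by (simp add: e2_def field_simps)
  obtain k where k: "\<forall>\<^sub>F n in sequentially. \<P>(x in P0 n. norm (g.B *v Del n x) > k) \<le> e2"
    using BDel_tight[OF e12(2)] by blast
  obtain \<eta> where \<eta>: "\<eta> > 0" "\<And>y g. norm y \<le> k \<Longrightarrow> g \<in> linfty K \<Longrightarrow> (\<forall>t\<in>K. \<bar>g t - Zt y t\<bar> \<le> \<eta>) \<Longrightarrow> \<bar>f g - H y\<bar> \<le> e1"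
    using H_uniform[OF e12(1), of k] by blast
  \<comment> \<open>\<open>posterior_risk_approx\<close> uses one number for accuracy and
    probability, so it has to meet both demands.\<close>
  have "min \<eta> e2 > 0" using \<eta> e12 by simp
  from posterior_risk_approx[OF this] obtain bad where bad: "\<And>n. bad n \<in> sets (P0 n)"
    "\<forall>\<^sub>F n in sequentially. measure (P0 n) (bad n) \<le> min \<eta> e2"
    "\<forall>\<^sub>F n in sequentially. AE x in P0 n. x \<notin> bad n \<longrightarrow> (\<forall>t\<in>K. \<bar>Zn n x t - Zt (g.B *v Del n x) t\<bar> \<le> min \<eta> e2)"
    by blast
  let ?T = "\<lambda>n. {x\<in>space (P0 n). norm (g.B *v Del n x) > k}"
  have T: "?T n \<in> sets (P0 n)" for n using BDel_measurable[of n] by measurable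
  have "\<forall>\<^sub>F n in sequentially. \<bar>(\<integral>x. H (g.B *v Del n x) \<partial>P0 n) - (\<integral>y. H y \<partial>g.N0)\<bar> < e / 2"
    using tendstoD[OF H_limit, of "e / 2"] e by (simp add: dist_real_def)
  then have "\<forall>\<^sub>F n in sequentially. norm (outer_expectation (P0 n) (\<lambda>x. f (restrict (Zn n x) K)) - (\<integral>y. H y \<partial>g.N0)) < e"
    using k bad(2,3) Zn_in_linfty
  proof eventually_elim
    case (elim n)
    let ?bad = "bad n \<union> ?T n"
    have "AE x in P0 n. \<bar>f (restrict (Zn n x) K) - H (g.B *v Del n x)\<bar> \<le> e1 + 2 * C * indicator ?bad x"
      using elim(4,5) AE_space
    proof eventually_elim
      case (elim x)
      show ?case
      proof (cases "x \<in> ?bad")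
        case True
        have "\<bar>f (restrict (Zn n x) K)\<bar> \<le> C" using elim(2) by (rule C)
        then have "\<bar>f (restrict (Zn n x) K) - H (g.B *v Del n x)\<bar> \<le> 2 * C"
          using H_le[of "g.B *v Del n x"] by linarith
        then show ?thesis using True e12(1) by simp
      next
        case False
        then have "\<bar>f (restrict (Zn n x) K) - H (g.B *v Del n x)\<bar> \<le> e1"
          using elim by (intro \<eta>(2)) (auto simp: not_less)
        then show ?thesis using False by simp
      qed
    qed
    moreover have Hi: "integrable (P0 n) (\<lambda>x. H (g.B *v Del n x))"
    proof (rule P0.integrable_const_bound[where B = C])
      show "(\<lambda>x. H (g.B *v Del n x)) \<in> borel_measurable (P0 n)"
        by (rule measurable_compose[OF BDel_measurable borel_measurable_continuous_onI[OF H_continuous]])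
    qed (use H_le in auto)
    ultimately have "\<bar>outer_expectation (P0 n) (\<lambda>x. f (restrict (Zn n x) K)) - (\<integral>x. H (g.B *v Del n x) \<partial>P0 n)\<bar> \<le> e1 + 2 * C * measure (P0 n) ?bad"
      using bad(1)[of n] T[of n] by (intro outer_expectation_near P0.prob_space_axioms) auto
    moreover have "2 * C * measure (P0 n) ?bad \<le> 2 * C * (2 * e2)"
    proof (rule mult_left_mono)
      have "measure (P0 n) ?bad \<le> measure (P0 n) (bad n) + measure (P0 n) (?T n)" by (intro measure_Un_le bad(1) T)
      then show "measure (P0 n) ?bad \<le> 2 * e2" using elim(2,3) by simp
    qed (use C0 in simp)
    ultimately show ?case using elim(1) e2' unfolding e1_def real_norm_def by linarith
  qed
  then show "\<exists>no. \<forall>n\<ge>no. norm (outer_expectation (P0 n) (\<lambda>x. f (restrict (Zn n x) K)) - (\<integral>y. H y \<partial>g.N0)) < e"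
    by (simp add: eventually_sequentially)
qed

end

lemma posterior_risk_converges:
  fixes \<Omega> :: "'w measure" and Y :: "'w \<Rightarrow> real^'d"
  assumes Y: "Y \<in> borel_measurable \<Omega>" "distr \<Omega> borel Y = g.N0"
  shows "converges_in_distribution_linfty K P0 Zn \<Omega> (\<lambda>\<omega>. Zt (Y \<omega>))"
  unfolding converges_in_distribution_linfty_def
proof (intro conjI ballI allI impI)
  show "\<forall>\<^sub>F n in sequentially. AE x in P0 n. restrict (Zn n x) K \<in> linfty K" by (rule Zn_in_linfty)
  show "restrict (Zt (Y \<omega>)) K \<in> linfty K" for \<omega> by (rule Zt_in_linfty)
  fix f assume f: "continuous_map (linfty_topology K) euclideanreal f \<and> bounded (f ` linfty K)"
  then obtain C where C: "\<And>g. g \<in> linfty K \<Longrightarrow> \<bar>f g\<bar> \<le> C" by (auto simp: bounded_iff)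
  note H = H_continuous[OF f[THEN conjunct1] C] outer_limit[OF f[THEN conjunct1] C]
  have Hm: "H f \<in> borel_measurable borel" by (rule borel_measurable_continuous_onI[OF H(1)])
  have eq: "(\<lambda>\<omega>. f (restrict (Zt (Y \<omega>)) K)) = (\<lambda>\<omega>. H f (Y \<omega>))" by (simp add: H_def[OF f[THEN conjunct1] C])
  show "(\<lambda>\<omega>. f (restrict (Zt (Y \<omega>)) K)) \<in> borel_measurable \<Omega>"
    unfolding eq by (rule measurable_compose[OF Y(1) Hm])
  have "(\<integral>y. H f y \<partial>g.N0) = (\<integral>\<omega>. H f (Y \<omega>) \<partial>\<Omega>)"
    unfolding Y(2)[symmetric] by (rule integral_distr[OF Y(1) Hm])
  then show "(\<lambda>n. outer_expectation (P0 n) (\<lambda>x. f (restrict (Zn n x) K))) \<longlonglongrightarrow> (\<integral>\<omega>. f (restrict (Zt (Y \<omega>)) K) \<partial>\<Omega>)"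
    using H(2) unfolding eq by simp
qed

end

section \<open>Assembly: choice of radii, tests and majorants\<close>

theorem proposition3:
  fixes \<Theta> :: "(real^'d) set" and \<theta>\<^sub>0 :: "real^'d"
    and \<mu> :: "'x measure" and P :: "real^'d \<Rightarrow> 'x measure"
    and prior :: "(real^'d) measure" and \<pi> :: "real^'d \<Rightarrow> real"
    and Q :: "nat \<Rightarrow> (nat \<Rightarrow> 'x) \<Rightarrow> (real^'d) measure"
    and score :: "'x \<Rightarrow> real^'d"
    and K :: "(real^'d) set" and p :: real
    and L L\<^sub>0 :: "real^'d \<Rightarrow> real^'d \<Rightarrow> real"
    and \<Omega> :: "'w measure" and Y :: "'w \<Rightarrow> real^'d"
  defines "B \<equiv> \<lambda>\<delta>. {\<theta> \<in> \<Theta>. norm (\<theta> - \<theta>\<^sub>0) \<le> \<delta>}"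
    and "I \<equiv> fisher_information (P \<theta>\<^sub>0) score"
  defines "Z\<^sub>n \<equiv> \<lambda>n x t. \<integral>h. real n powr (p / 2)
              * L ((1 / sqrt n) *\<^sub>R t + \<theta>\<^sub>0) ((1 / sqrt n) *\<^sub>R h + \<theta>\<^sub>0) \<partial>local_law n \<Theta> \<theta>\<^sub>0 (Q n x)"
    and "Z \<equiv> \<lambda>\<omega> t. \<integral>h. L\<^sub>0 t h \<partial>mv_normal (Y \<omega>) (matrix_inv I)"
  assumes dominating: "sigma_finite_measure \<mu>"
    and model: "P \<in> restrict_space borel \<Theta> \<rightarrow>\<^sub>M prob_algebra \<mu>"
    and dominated: "\<And>\<theta>. \<theta> \<in> \<Theta> \<Longrightarrow> absolutely_continuous \<mu> (P \<theta>)"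
    and prior_space: "prior \<in> space (prob_algebra (restrict_space borel \<Theta>))"
    and true_parameter: "\<theta>\<^sub>0 \<in> interior \<Theta>"
    and posterior: "\<And>n. is_posterior prior P n (Q n)"
    and marginal: "\<And>n. absolutely_continuous (marginal_law prior P n) (sample_law n (P \<theta>\<^sub>0))"
    and a_dqm: "differentiable_in_quadratic_mean \<mu> P \<theta>\<^sub>0 score"
    and a_fisher: "invertible I"
    and b: "\<And>\<epsilon>. \<epsilon> > 0 \<Longrightarrow>
          \<exists>\<phi> :: nat \<Rightarrow> (nat \<Rightarrow> 'x) \<Rightarrow> real.
            (\<forall>n. \<phi> n \<in> borel_measurable (sample_law n \<mu>)
               \<and> (\<forall>x\<in>space (sample_law n \<mu>). 0 \<le> \<phi> n x \<and> \<phi> n x \<le> 1)) \<and>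
            (\<lambda>n. \<integral>\<^sup>+x. ennreal (\<phi> n x) \<partial>sample_law n (P \<theta>\<^sub>0)) \<longlonglongrightarrow> 0 \<and>
            (\<lambda>n. SUP \<theta>\<in>{\<theta> \<in> \<Theta>. norm (\<theta> - \<theta>\<^sub>0) \<ge> \<epsilon>}.
               \<integral>\<^sup>+x. ennreal (1 - \<phi> n x) \<partial>sample_law n (P \<theta>)) \<longlonglongrightarrow> 0"
    and c_density: "\<pi> \<in> borel_measurable borel" "\<And>\<theta>. 0 \<le> \<pi> \<theta>"
          "distr prior borel (\<lambda>\<theta>. \<theta>) = density lborel (\<lambda>\<theta>. ennreal (\<pi> \<theta>))"
    and c_continuous: "\<exists>U. open U \<and> \<theta>\<^sub>0 \<in> U \<and> continuous_on U \<pi>"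
    and c_positive: "\<pi> \<theta>\<^sub>0 > 0"
    and K: "compact K" and p: "p > 0"
    and loss: "loss_function \<Theta> L" "loss_function UNIV L\<^sub>0"
    and loss_integrable: "\<And>t. t \<in> \<Theta> \<Longrightarrow> (\<integral>\<^sup>+\<theta>. ennreal (L t \<theta>) \<partial>prior) < \<infinity>"
    and i: "\<exists>\<epsilon>>0. \<exists>c\<^sub>1>0. \<forall>t\<in>B \<epsilon>. \<forall>\<theta>\<in>B \<epsilon>. L t \<theta> \<le> c\<^sub>1 * norm (t - \<theta>) powr p"
    and ii: "\<exists>\<delta>>0. outer_nn_integral prior (\<lambda>\<theta>. SUP t\<in>B \<delta>. ennreal (L t \<theta>)) < \<infinity>"
    and iii: "\<And>h. ((\<lambda>r. SUP t\<in>K. ennreal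
             \<bar>r powr (- p) * L (\<theta>\<^sub>0 + r *\<^sub>R t) (\<theta>\<^sub>0 + r *\<^sub>R h) - L\<^sub>0 t h\<bar>) \<longlongrightarrow> 0) (at_right 0)"
    and iv: "\<exists>c\<^sub>2>0. \<exists>c\<^sub>3>0. \<exists>c\<^sub>4>0. c\<^sub>4 < 2 \<and> (\<exists>\<delta>>0.
          (\<forall>t\<in>B \<delta>. \<forall>\<theta>\<in>\<Theta>.
             L t \<theta> \<le> c\<^sub>2 * exp (c\<^sub>3 * norm t powr c\<^sub>4 + c\<^sub>3 * norm \<theta> powr c\<^sub>4)) \<and>
          (\<forall>t h. L\<^sub>0 t h \<le> c\<^sub>2 * exp (c\<^sub>3 * norm t powr c\<^sub>4 + c\<^sub>3 * norm h powr c\<^sub>4)))"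
    and Y: "prob_space \<Omega>" "Y \<in> borel_measurable \<Omega>"
          "distr \<Omega> borel Y = mv_normal 0 (matrix_inv I)"
  shows "converges_in_distribution_linfty K (\<lambda>n. sample_law n (P \<theta>\<^sub>0)) Z\<^sub>n \<Omega> Z"
proof -
  note FI_inv = a_fisher[unfolded I_def]
  have P_in: "P \<theta> \<in> space (prob_algebra \<mu>)" if "\<theta> \<in> \<Theta>" for \<theta>
    using measurable_space[OF model, of \<theta>] that by (simp add: space_restrict_space)
  interpret D: dqm_model \<mu> \<Theta> \<theta>\<^sub>0 P score
    by (rule dqm_model.intro[OF dominating P_in dominated true_parameter a_dqm])
  obtain l where l: "l > 0" "\<And>u. l * (norm u)\<^sup>2 \<le> u \<bullet> (fisher_information (P \<theta>\<^sub>0) score *v u)"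
    by (rule D.fisher_pos_def[OF FI_inv]) (rule that)
  obtain T c\<^sub>t d\<^sub>t \<delta> where loc: "T > 0" "c\<^sub>t > 0" "d\<^sub>t > 0" "\<delta> > 0" "ball \<theta>\<^sub>0 \<delta> \<subseteq> \<Theta>"
    "\<And>n h C. 0 < n \<Longrightarrow> norm h < \<delta> * sqrt n \<Longrightarrow> 0 < C \<Longrightarrow> C \<le> norm h \<Longrightarrow>
      measure (sample_law n (P (\<theta>\<^sub>0 + (1 / sqrt n) *\<^sub>R h))) {x\<in>space (sample_law n \<mu>). norm (D.\<Phi> T n x) \<le> c\<^sub>t * C} \<le> exp (- d\<^sub>t * (norm h)\<^sup>2)"
    "\<And>n C. 0 < n \<Longrightarrow> 0 < C \<Longrightarrow>
      measure (sample_law n (P \<theta>\<^sub>0)) {x\<in>space (sample_law n \<mu>). c\<^sub>t * C < norm (D.\<Phi> T n x)} \<le> 2 * DIM(real^'d) * exp (- d\<^sub>t * C\<^sup>2)"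
    by (rule D.local_test[OF FI_inv]) (rule that)
  obtain S where S: "open S" "\<theta>\<^sub>0 \<in> S" "continuous_on S \<pi>" using c_continuous by blast
  then have \<pi>_cont: "isCont \<pi> \<theta>\<^sub>0" by (simp add: continuous_on_eq_continuous_at)
  \<comment> \<open>Continuity and positivity at the true parameter bound the prior density nearby
    by twice its value there; the factor 2 reappears in the majorants for the local
    integrals.\<close>
  have "\<forall>\<^sub>F \<theta> in at \<theta>\<^sub>0. \<pi> \<theta> < 2 * \<pi> \<theta>\<^sub>0"
    using \<pi>_cont c_positive by (intro order_tendstoD(2)[of \<pi> "\<pi> \<theta>\<^sub>0"]) (auto simp: isCont_def)
  then obtain r where r: "r > 0" "\<And>\<theta>. \<theta> \<noteq> \<theta>\<^sub>0 \<Longrightarrow> dist \<theta> \<theta>\<^sub>0 < r \<Longrightarrow> \<pi> \<theta> < 2 * \<pi> \<theta>\<^sub>0"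
    unfolding eventually_at by blast
  obtain \<epsilon> c\<^sub>1 where L_le: "\<epsilon> > 0" "c\<^sub>1 > 0" "\<And>t \<theta>. t \<in> B \<epsilon> \<Longrightarrow> \<theta> \<in> B \<epsilon> \<Longrightarrow> L t \<theta> \<le> c\<^sub>1 * norm (t - \<theta>) powr p"
    using i by blast
  obtain \<delta>' where \<delta>': "\<delta>' > 0" "outer_nn_integral prior (\<lambda>\<theta>. SUP t\<in>B \<delta>'. ennreal (L t \<theta>)) < \<infinity>" using ii by blast
  \<comment> \<open>An infimum below infinity is witnessed by some measurable majorant with finite
    integral.\<close>
  then obtain U where U: "U \<in> borel_measurable prior" "\<And>\<theta>. \<theta> \<in> space prior \<Longrightarrow> (SUP t\<in>B \<delta>'. ennreal (L t \<theta>)) \<le> U \<theta>"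
    "(\<integral>\<^sup>+\<theta>. U \<theta> \<partial>prior) < \<infinity>"
    unfolding outer_nn_integral_def INF_less_iff by blast
  obtain c\<^sub>2 c\<^sub>3 c\<^sub>4 where L0_le: "c\<^sub>2 > 0" "c\<^sub>3 > 0" "0 < c\<^sub>4" "c\<^sub>4 < 2"
    "\<And>t h. L\<^sub>0 t h \<le> c\<^sub>2 * exp (c\<^sub>3 * norm t powr c\<^sub>4 + c\<^sub>3 * norm h powr c\<^sub>4)"
    using iv by blast
  obtain k\<^sub>K where "\<forall>t\<in>K. norm t \<le> k\<^sub>K" using compact_imp_bounded[OF K] unfolding bounded_iff by blast
  \<comment> \<open>For empty \<open>K\<close> the bound \<open>k\<^sub>K\<close> could be negative,
    whereas a nonnegative one is required later.\<close>
  then have kK: "\<And>t. t \<in> K \<Longrightarrow> norm t \<le> max 0 k\<^sub>K" by fastforce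
  \<comment> \<open>The four radii belong to the local test, the bound on the prior density, and
    assumptions (i) and (ii).\<close>
  define \<epsilon>\<^sub>0 where "\<epsilon>\<^sub>0 = min (min \<delta> r) (min \<epsilon> \<delta>')"
  have \<epsilon>0: "\<epsilon>\<^sub>0 > 0" "\<epsilon>\<^sub>0 \<le> \<delta>" "\<epsilon>\<^sub>0 \<le> r" "\<epsilon>\<^sub>0 \<le> \<epsilon>" "\<epsilon>\<^sub>0 \<le> \<delta>'"
    using loc(4) r(1) L_le(1) \<delta>'(1) by (auto simp: \<epsilon>\<^sub>0_def)
  have ball: "ball \<theta>\<^sub>0 \<epsilon>\<^sub>0 \<subseteq> \<Theta>" using loc(5) \<epsilon>0(2) by (meson subset_ball subset_trans)
  have ballB: "\<theta> \<in> B e" if "\<theta> \<in> ball \<theta>\<^sub>0 \<epsilon>\<^sub>0" "\<epsilon>\<^sub>0 \<le> e" for \<theta> e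
    using that ball by (auto simp: B_def dist_norm norm_minus_commute)
  have sp: "space prior = \<Theta>"
    using prior_space sets_eq_imp_space_eq[of prior "restrict_space borel \<Theta>"] by (simp add: space_prob_algebra space_restrict_space)
  \<comment> \<open>The consistent tests are requested only now, at the radius up to which the local
    test is already known to work.\<close>
  obtain \<phi> :: "nat \<Rightarrow> (nat \<Rightarrow> 'x) \<Rightarrow> real" where \<phi>:
    "\<forall>n. \<phi> n \<in> borel_measurable (sample_law n \<mu>) \<and> (\<forall>x\<in>space (sample_law n \<mu>). 0 \<le> \<phi> n x \<and> \<phi> n x \<le> 1)"
    "(\<lambda>n. \<integral>\<^sup>+x. ennreal (\<phi> n x) \<partial>sample_law n (P \<theta>\<^sub>0)) \<longlonglongrightarrow> 0"
    "(\<lambda>n. SUP \<theta>\<in>{\<theta> \<in> \<Theta>. norm (\<theta> - \<theta>\<^sub>0) \<ge> \<epsilon>\<^sub>0}. \<integral>\<^sup>+x. ennreal (1 - \<phi> n x) \<partial>sample_law n (P \<theta>)) \<longlonglongrightarrow> 0"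
    using b[OF \<epsilon>0(1)] by blast
  have \<phi>1: "\<And>n. \<phi> n \<in> borel_measurable (sample_law n \<mu>)" "\<And>n x. x \<in> space (sample_law n \<mu>) \<Longrightarrow> 0 \<le> \<phi> n x \<and> \<phi> n x \<le> 1"
    using \<phi>(1) by blast+
  obtain A :: "nat \<Rightarrow> (nat \<Rightarrow> 'x) set" and c\<^sub>a where A: "c\<^sub>a > 0" "\<And>n. A n \<in> sets (sample_law n \<mu>)"
    "(\<lambda>n. measure (sample_law n (P \<theta>\<^sub>0)) (space (sample_law n \<mu>) - A n)) \<longlonglongrightarrow> 0"
    "\<forall>\<^sub>F n in sequentially. \<forall>\<theta>\<in>\<Theta>. norm (\<theta> - \<theta>\<^sub>0) \<ge> \<epsilon>\<^sub>0 \<longrightarrow> measure (sample_law n (P \<theta>)) (A n) \<le> exp (- c\<^sub>a * real n)"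
    by (rule D.global_test[OF \<phi>1(1) _ \<phi>(2,3)], rule \<phi>1(2), assumption, rule that)
  \<comment> \<open>The law of \<open>Y\<close> is a probability measure, which supplies the total
    mass one of the Gaussian required by the locale \<open>gaussian\<close>.\<close>
  interpret normal: prob_space "mv_normal 0 (matrix_inv (fisher_information (P \<theta>\<^sub>0) score))"
    using prob_space.prob_space_distr[OF Y(1,2)] unfolding Y(3) I_def .
  interpret X: bvm_loss \<mu> \<Theta> \<theta>\<^sub>0 P score prior \<pi> Q \<epsilon>\<^sub>0 l T c\<^sub>t d\<^sub>t A c\<^sub>a p K L L\<^sub>0 U "max 0 k\<^sub>K" c\<^sub>1 c\<^sub>2 c\<^sub>3 c\<^sub>4
  proof unfold_locales
    show "invertible (fisher_information (P \<theta>\<^sub>0) score)" by (rule FI_inv)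
    show "\<pi> \<theta> \<le> 2 * \<pi> \<theta>\<^sub>0" if "\<theta> \<in> ball \<theta>\<^sub>0 \<epsilon>\<^sub>0" for \<theta>
    proof (cases "\<theta> = \<theta>\<^sub>0")
      case False
      have "dist \<theta> \<theta>\<^sub>0 < r" using that \<epsilon>0(3) by (simp add: dist_commute)
      from r(2)[OF False this] show ?thesis by simp
    qed (use c_positive in simp)
    show "L t \<theta> \<le> c\<^sub>1 * norm (t - \<theta>) powr p" if "t \<in> ball \<theta>\<^sub>0 \<epsilon>\<^sub>0" "\<theta> \<in> ball \<theta>\<^sub>0 \<epsilon>\<^sub>0" for t \<theta>
      by (rule L_le(3)[OF ballB[OF that(1) \<epsilon>0(4)] ballB[OF that(2) \<epsilon>0(4)]])
    show "ennreal (L t \<theta>) \<le> U \<theta>" if "t \<in> ball \<theta>\<^sub>0 \<epsilon>\<^sub>0" "\<theta> \<in> \<Theta>" for t \<theta>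
    proof (rule order_trans[OF SUP_upper[OF ballB[OF that(1) \<epsilon>0(5)]]])
      show "(SUP t\<in>B \<delta>'. ennreal (L t \<theta>)) \<le> U \<theta>" using U(2) that(2) sp by blast
    qed
    show "measure (sample_law n (P (\<theta>\<^sub>0 + (1 / sqrt n) *\<^sub>R h))) {x\<in>space (sample_law n \<mu>). norm (D.\<Phi> T n x) \<le> c\<^sub>t * C} \<le> exp (- d\<^sub>t * (norm h)\<^sup>2)"
      if "0 < n" "norm h < \<epsilon>\<^sub>0 * sqrt n" "0 < C" "C \<le> norm h" for n h C
    proof (rule loc(6)[OF that(1) _ that(3,4)])
      have "\<epsilon>\<^sub>0 * sqrt n \<le> \<delta> * sqrt n" using \<epsilon>0(2) by (intro mult_right_mono) auto
      then show "norm h < \<delta> * sqrt n" using that(2) by linarith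
    qed
  qed (fact D.fisher_symmetric l model prior_space posterior marginal c_density \<pi>_cont c_positive \<epsilon>0(1) ball
      loc(1-3) loc(7) A p loss kK L_le(2) U(1,3) iii L0_le | simp)+
  have Zn: "X.Zn = Z\<^sub>n" by (intro ext) (simp add: X.Zn_def Z\<^sub>n_def)
  have Z: "(\<lambda>\<omega>. X.Zt (Y \<omega>)) = Z" by (intro ext) (simp add: X.Zt_def Z_def I_def)
  show ?thesis using X.posterior_risk_converges[OF Y(2) Y(3)[unfolded I_def]] unfolding Zn Z .
qed

end
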